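(* The correspondence $(L,\mathcal I)\mapsto \wedge V$, which assigns to a complete enriched Lie algebra its quadratic model, is a contravariant isomorphism from the category of complete enriched Lie algebras to the category $\mathcal C'$ of quadratic Sullivan algebras.
   Context: All vector spaces are graded, over $\mathbb Q$; $(-)^\vee$ is the graded dual and $s$ the suspension, $(sL)_k=L_{k-1}$. An enriched Lie algebra is a graded Lie algebra $L=L_{\ge 0}$ with a family $\mathcal I=\{I_\alpha\}$ of ideals such that: (i) each $L_\alpha:=L/I_\alpha$ is finite dimensional and nilpotent; (ii) for all $\alpha,\beta$ there is $\gamma$ with $I_\gamma\subset I_\alpha\cap I_\beta$; (iii) $\bigcap_\alpha I_\alpha=0$. It is complete if $L\to\varprojlim_\alpha L/I_\alpha$ is an isomorphism. A morphism $(E,\mathcal J)\to(F,\mathcal I)$ is a degree $0$ Lie algebra homomorphism $\varphi$ such that for each $I_\alpha\in\mathcal I$ there is $J_\beta\in\mathcal J$ with $J_\beta\subset\varphi^{-1}(I_\alpha)$. Two families $\mathcal I,\mathcal I'$ on $L$ are equivalent if the identity of $L$ is a morphism in both directions; the objects of the category of complete enriched Lie algebras are pairs consisting of $L$ and an equivalence class of such families (with $L$ complete). A quadratic Sullivan algebra is a commutative differential graded algebra (cdga) $(\wedge V,d)$, free as a graded commutative algebra on $V=V^{\ge1}$, with $d:V\to\wedge^2V$ and $V=\bigcup_{n\ge0}V_n$, where $V_0=V\cap\ker d$ and $V_{n+1}=V\cap d^{-1}(\wedge^2V_n)$. The category $\mathcal C'$ has the quadratic Sullivan algebras as objects, and as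 morphisms $\wedge V\to\wedge W$ the cdga morphisms mapping $V$ into $W$. Quadratic model: for a complete enriched Lie algebra $(L,\mathcal I)$ set $V_\alpha=(sL_\alpha)^\vee$ and let $\wedge V_\alpha=C^*(L_\alpha)$ be the Cartan–Chevalley–Eilenberg cochain algebra, dual to the coalgebra $C_*(L_\alpha)=\wedge sL_\alpha$ with differential determined by $\partial(sx\wedge sy)=(-1)^{\deg x+1}s[x,y]$. The quadratic model of $L$ is $\wedge V:=\varinjlim_\alpha\wedge V_\alpha$, so that $V=\varinjlim_\alpha V_\alpha$ and $V^\vee=sL$. A morphism $\psi:E\to L$ of complete enriched Lie algebras is sent to the unique morphism $\varphi:\wedge V_L\to\wedge V_E$ of quadratic models with $\varphi(V_L)\subset V_E$ whose restriction $V_L\to V_E$ has dual $\psi$ (under the identifications $V_E^\vee=sE$, $V_L^\vee=sL$). *)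

theory Defs
  imports Complex_Main "HOL-Library.FuncSet" "HOL-Library.Function_Algebras"
begin

section \<open>Rational vector spaces\<close>

class rat_vector = ab_group_add +
  fixes scaleQ :: "rat \<Rightarrow> 'a \<Rightarrow> 'a"  (infixr \<open>*\<^sub>Q\<close> 75)
  assumes scaleQ_add_right: "a *\<^sub>Q (x + y) = a *\<^sub>Q x + a *\<^sub>Q y"
    and scaleQ_add_left: "(a + b) *\<^sub>Q x = a *\<^sub>Q x + b *\<^sub>Q x"
    and scaleQ_scaleQ: "a *\<^sub>Q (b *\<^sub>Q x) = (a * b) *\<^sub>Q x"
    and scaleQ_one: "1 *\<^sub>Q x = x"

global_interpretation ratvec: vector_space "scaleQ :: rat \<Rightarrow> 'a \<Rightarrow> 'a::rat_vector"
  by standard (simp_all add: scaleQ_add_right scaleQ_add_left scaleQ_scaleQ scaleQ_one)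

instantiation rat :: rat_vector
begin
definition scaleQ_rat :: "rat \<Rightarrow> rat \<Rightarrow> rat" where "scaleQ_rat a x = a * x"
instance by standard (simp_all add: scaleQ_rat_def algebra_simps)
end

instantiation "fun" :: (type, rat_vector) rat_vector
begin
definition scaleQ_fun :: "rat \<Rightarrow> ('a \<Rightarrow> 'b) \<Rightarrow> 'a \<Rightarrow> 'b" where "scaleQ_fun a f = (\<lambda>x. a *\<^sub>Q f x)"
instance
  by standard (simp_all add: scaleQ_fun_def plus_fun_def fun_eq_iff
      scaleQ_add_right scaleQ_add_left scaleQ_scaleQ scaleQ_one)
end

text \<open>A graded vector space \<open>V\<close> is a family \<open>(V k)\<close> of subspaces of an ambient rational vector
  space, indexed by the degree; the members for different degrees are unrelated (they need not be
  independent), so that all operations carry the degrees of their arguments.\<close>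

type_synonym 'a graded = "nat \<Rightarrow> 'a set"

definition graded_space :: "'a::rat_vector graded \<Rightarrow> bool" where
  "graded_space V \<longleftrightarrow> (\<forall>k. ratvec.subspace (V k))"

definition linear_map_on :: "'a::rat_vector set \<Rightarrow> ('a \<Rightarrow> 'b::rat_vector) \<Rightarrow> bool" where
  "linear_map_on S f \<longleftrightarrow>
     (\<forall>x\<in>S. \<forall>y\<in>S. f (x + y) = f x + f y) \<and> (\<forall>c. \<forall>x\<in>S. f (c *\<^sub>Q x) = c *\<^sub>Q f x)"

definition bilinear_map_on ::
  "'a::rat_vector set \<Rightarrow> 'b::rat_vector set \<Rightarrow> ('a \<Rightarrow> 'b \<Rightarrow> 'c::rat_vector) \<Rightarrow> bool" where
  "bilinear_map_on S T f \<longleftrightarrow>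
     (\<forall>x\<in>S. linear_map_on T (f x)) \<and> (\<forall>y\<in>T. linear_map_on S (\<lambda>x. f x y))"

text \<open>The dual of a subspace; functionals are extended by \<open>0\<close> outside it, so that they form a
  subspace of the function type.\<close>

definition dual_space :: "'a::rat_vector set \<Rightarrow> ('a \<Rightarrow> rat) set" where
  "dual_space S = {f. linear_map_on S f \<and> (\<forall>x. x \<notin> S \<longrightarrow> f x = 0)}"

text \<open>Words of homogeneous elements, each recorded with its degree.\<close>

type_synonym 'a word = "(nat \<times> 'a) list"

definition words :: "'a graded \<Rightarrow> 'a word set" where
  "words V = {ws. \<forall>(k, x)\<in>set ws. x \<in> V k}"


section \<open>Complete enriched Lie algebras\<close>

record 'a glie =
  lcomp :: "'a graded"
  lbr :: "nat \<Rightarrow> nat \<Rightarrow> 'a \<Rightarrow> 'a \<Rightarrow> 'a"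

definition graded_lie :: "'a::rat_vector glie \<Rightarrow> bool" where
  "graded_lie L \<longleftrightarrow>
     graded_space (lcomp L) \<and>
     (\<forall>i j. \<forall>x\<in>lcomp L i. \<forall>y\<in>lcomp L j. lbr L i j x y \<in> lcomp L (i + j)) \<and>
     (\<forall>i j. bilinear_map_on (lcomp L i) (lcomp L j) (lbr L i j)) \<and>
     (\<forall>i j. \<forall>x\<in>lcomp L i. \<forall>y\<in>lcomp L j.
        lbr L i j x y = - ((-1) ^ (i * j) *\<^sub>Q lbr L j i y x)) \<and>
     (\<forall>i j k. \<forall>x\<in>lcomp L i. \<forall>y\<in>lcomp L j. \<forall>z\<in>lcomp L k.
        lbr L i (j + k) x (lbr L j k y z) =
          lbr L (i + j) k (lbr L i j x y) z
          + (-1) ^ (i * j) *\<^sub>Q lbr L j (i + k) y (lbr L i k x z))"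

definition graded_ideal :: "'a::rat_vector glie \<Rightarrow> 'a graded \<Rightarrow> bool" where
  "graded_ideal L I \<longleftrightarrow>
     graded_space I \<and> (\<forall>k. I k \<subseteq> lcomp L k) \<and>
     (\<forall>i j. \<forall>x\<in>lcomp L i. \<forall>y\<in>I j. lbr L i j x y \<in> I (i + j))"

text \<open>Properties of \<open>L / I\<close> are stated on representatives in \<open>L\<close>: the total dimension of \<open>L / I\<close>
  is finite, and the lower central series of \<open>L / I\<close>, which is the image of that of \<open>L\<close>,
  reaches \<open>0\<close>.\<close>

definition finite_dim_quotient :: "'a::rat_vector glie \<Rightarrow> 'a graded \<Rightarrow> bool" where
  "finite_dim_quotient L I \<longleftrightarrow>
     (\<exists>N. \<forall>k>N. lcomp L k \<subseteq> I k) \<and>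
     (\<forall>k. \<exists>B. finite B \<and> B \<subseteq> lcomp L k \<and> lcomp L k \<subseteq> ratvec.span (B \<union> I k))"

primrec lower_central :: "'a::rat_vector glie \<Rightarrow> nat \<Rightarrow> 'a graded" where
  "lower_central L 0 = lcomp L"
| "lower_central L (Suc n) =
     (\<lambda>k. ratvec.span {lbr L i j x y | i j x y. i + j = k \<and> x \<in> lcomp L i \<and> y \<in> lower_central L n j})"

definition nilpotent_quotient :: "'a::rat_vector glie \<Rightarrow> 'a graded \<Rightarrow> bool" where
  "nilpotent_quotient L I \<longleftrightarrow> (\<exists>n. \<forall>k. lower_central L n k \<subseteq> I k)"

text \<open>A family of ideals is given as a set of ideals. It is required to be nonempty, as
  directed systems are.\<close>

definition enriched_lie :: "'a::rat_vector glie \<Rightarrow> 'a graded set \<Rightarrow> bool" where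
  "enriched_lie L \<I> \<longleftrightarrow>
     graded_lie L \<and> \<I> \<noteq> {} \<and>
     (\<forall>I\<in>\<I>. graded_ideal L I \<and> finite_dim_quotient L I \<and> nilpotent_quotient L I) \<and>
     (\<forall>I\<in>\<I>. \<forall>J\<in>\<I>. \<exists>K\<in>\<I>. \<forall>k. K k \<subseteq> I k \<inter> J k) \<and>
     (\<forall>k. (\<Inter>I\<in>\<I>. I k) = {0})"

text \<open>Completeness: every compatible family of classes \<open>x I + I k\<close> in \<open>lcomp L k / I k\<close> comes from
  exactly one element of \<open>lcomp L k\<close> (bijectivity of the map to the inverse limit, in each degree).
  The order \<open>J \<le> I\<close> on families of sets is degreewise inclusion.\<close>

definition complete_enriched_lie :: "'a::rat_vector glie \<Rightarrow> 'a graded set \<Rightarrow> bool" where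
  "complete_enriched_lie L \<I> \<longleftrightarrow>
     enriched_lie L \<I> \<and>
     (\<forall>k. \<forall>x. (\<forall>I\<in>\<I>. x I \<in> lcomp L k) \<and> (\<forall>I\<in>\<I>. \<forall>J\<in>\<I>. J \<le> I \<longrightarrow> x J - x I \<in> I k)
        \<longrightarrow> (\<exists>!y. y \<in> lcomp L k \<and> (\<forall>I\<in>\<I>. y - x I \<in> I k)))"

definition lie_hom ::
  "'a::rat_vector glie \<Rightarrow> 'a graded set \<Rightarrow> 'b::rat_vector glie \<Rightarrow> 'b graded set \<Rightarrow> (nat \<Rightarrow> 'a \<Rightarrow> 'b) set"
  where
  "lie_hom E \<J> F \<I> = {\<psi>.
     (\<forall>k. \<psi> k \<in> lcomp E k \<rightarrow>\<^sub>E lcomp F k) \<and>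
     (\<forall>k. linear_map_on (lcomp E k) (\<psi> k)) \<and>
     (\<forall>i j. \<forall>x\<in>lcomp E i. \<forall>y\<in>lcomp E j. \<psi> (i + j) (lbr E i j x y) = lbr F i j (\<psi> i x) (\<psi> j y)) \<and>
     (\<forall>I\<in>\<I>. \<exists>J\<in>\<J>. \<forall>k. J k \<subseteq> {x \<in> lcomp E k. \<psi> k x \<in> I k})}"

text \<open>Identities and composites of families of maps, normalised outside the domain as in \<open>\<rightarrow>\<^sub>E\<close>.\<close>

definition graded_id :: "'a graded \<Rightarrow> nat \<Rightarrow> 'a \<Rightarrow> 'a" where
  "graded_id V = (\<lambda>k. restrict id (V k))"

definition graded_comp :: "'a graded \<Rightarrow> (nat \<Rightarrow> 'b \<Rightarrow> 'c) \<Rightarrow> (nat \<Rightarrow> 'a \<Rightarrow> 'b) \<Rightarrow> nat \<Rightarrow> 'a \<Rightarrow> 'c" where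
  "graded_comp V g f = (\<lambda>k. compose (V k) (g k) (f k))"

definition equiv_families :: "'a::rat_vector glie \<Rightarrow> 'a graded set \<Rightarrow> 'a graded set \<Rightarrow> bool" where
  "equiv_families L \<I> \<I>' \<longleftrightarrow>
     graded_id (lcomp L) \<in> lie_hom L \<I> L \<I>' \<and> graded_id (lcomp L) \<in> lie_hom L \<I>' L \<I>"

text \<open>Equality of objects of the category: the same graded Lie algebra (bracket compared only
  where it is meaningful) with equivalent families.\<close>

definition same_enriched ::
  "'a::rat_vector glie \<Rightarrow> 'a graded set \<Rightarrow> 'a glie \<Rightarrow> 'a graded set \<Rightarrow> bool" where
  "same_enriched L \<I> L' \<I>' \<longleftrightarrow>
     lcomp L = lcomp L' \<and>
     (\<forall>i j. \<forall>x\<in>lcomp L i. \<forall>y\<in>lcomp L j. lbr L i j x y = lbr L' i j x y) \<and>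
     equiv_families L \<I> \<I>'"


section \<open>Quadratic Sullivan algebras\<close>

text \<open>A commutative differential graded algebra together with a graded subspace of generators.\<close>

record 'v gcdga =
  acomp :: "'v graded"
  amul :: "nat \<Rightarrow> nat \<Rightarrow> 'v \<Rightarrow> 'v \<Rightarrow> 'v"
  aone :: 'v
  adif :: "nat \<Rightarrow> 'v \<Rightarrow> 'v"
  gens :: "'v graded"

definition cdga :: "'v::rat_vector gcdga \<Rightarrow> bool" where
  "cdga A \<longleftrightarrow>
     graded_space (acomp A) \<and>
     (\<forall>i j. \<forall>x\<in>acomp A i. \<forall>y\<in>acomp A j. amul A i j x y \<in> acomp A (i + j)) \<and>
     (\<forall>i j. bilinear_map_on (acomp A i) (acomp A j) (amul A i j)) \<and>
     aone A \<in> acomp A 0 \<and>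
     (\<forall>i. \<forall>x\<in>acomp A i. amul A 0 i (aone A) x = x \<and> amul A i 0 x (aone A) = x) \<and>
     (\<forall>i j k. \<forall>x\<in>acomp A i. \<forall>y\<in>acomp A j. \<forall>z\<in>acomp A k.
        amul A (i + j) k (amul A i j x y) z = amul A i (j + k) x (amul A j k y z)) \<and>
     (\<forall>i j. \<forall>x\<in>acomp A i. \<forall>y\<in>acomp A j. amul A i j x y = (-1) ^ (i * j) *\<^sub>Q amul A j i y x) \<and>
     (\<forall>i. \<forall>x\<in>acomp A i. adif A i x \<in> acomp A (Suc i)) \<and>
     (\<forall>i. linear_map_on (acomp A i) (adif A i)) \<and>
     (\<forall>i. \<forall>x\<in>acomp A i. adif A (Suc i) (adif A i x) = 0) \<and>
     (\<forall>i j. \<forall>x\<in>acomp A i. \<forall>y\<in>acomp A j.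
        adif A (i + j) (amul A i j x y) =
          amul A (Suc i) j (adif A i x) y + (-1) ^ i *\<^sub>Q amul A i (Suc j) x (adif A j y))"

definition wdeg :: "'v word \<Rightarrow> nat" where
  "wdeg ws = sum_list (map fst ws)"

fun wprod :: "'v gcdga \<Rightarrow> 'v word \<Rightarrow> 'v" where
  "wprod A [] = aone A"
| "wprod A ((k, x) # ws) = amul A k (wdeg ws) x (wprod A ws)"

text \<open>Formal linear combinations of words are functions \<open>'v word \<Rightarrow> rat\<close>; the span of \<open>single ws\<close>
  over all \<open>ws \<in> words V\<close> is the space of finite ones. \<open>free_relations V\<close> spans the ideal of
  relations that hold between words in every graded commutative algebra containing \<open>V\<close>:
  multilinearity and graded commutativity. Modulo multilinearity the words form the tensor algebra
  \<open>T V\<close>.\<close>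

definition single :: "'v word \<Rightarrow> 'v word \<Rightarrow> rat" where
  "single ws = (\<lambda>us. if us = ws then 1 else 0)"

definition free_relations :: "'v::rat_vector graded \<Rightarrow> ('v word \<Rightarrow> rat) set" where
  "free_relations V =
     {single (us @ (k, x + c *\<^sub>Q y) # ws) - single (us @ (k, x) # ws) - c *\<^sub>Q single (us @ (k, y) # ws)
        | us ws k x y c. us \<in> words V \<and> ws \<in> words V \<and> x \<in> V k \<and> y \<in> V k} \<union>
     {single (us @ (i, x) # (j, y) # ws) - (-1) ^ (i * j) *\<^sub>Q single (us @ (j, y) # (i, x) # ws)
        | us ws i j x y. us \<in> words V \<and> ws \<in> words V \<and> x \<in> V i \<and> y \<in> V j}"

text \<open>\<open>A\<close> is free as a graded commutative algebra on \<open>V = gens A\<close>, that is, the canonical map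
  \<open>\<And>V = T V / (x \<otimes> y - (-1)\<^sup>i\<^sup>j y \<otimes> x) \<rightarrow> A\<close> is an isomorphism: it is onto in every
  degree, and a combination of words is mapped to \<open>0\<close> (in every degree) only if it is a consequence
  of the relations.\<close>

definition free_on_gens :: "'v::rat_vector gcdga \<Rightarrow> bool" where
  "free_on_gens A \<longleftrightarrow>
     graded_space (gens A) \<and> (\<forall>k. gens A k \<subseteq> acomp A k) \<and>
     (\<forall>n. acomp A n = ratvec.span (wprod A ` {ws \<in> words (gens A). wdeg ws = n})) \<and>
     (\<forall>p \<in> ratvec.span (single ` words (gens A)).
        (\<forall>n. (\<Sum>ws | p ws \<noteq> 0 \<and> wdeg ws = n. p ws *\<^sub>Q wprod A ws) = 0)
          \<longrightarrow> p \<in> ratvec.span (free_relations (gens A)))"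

text \<open>\<open>wedge2 A U\<close> is \<open>\<And>\<^sup>2U\<close> for a graded subspace \<open>U\<close> of the generators.\<close>

definition wedge2 :: "'v::rat_vector gcdga \<Rightarrow> 'v graded \<Rightarrow> 'v graded" where
  "wedge2 A U = (\<lambda>n. ratvec.span {amul A i j x y | i j x y. i + j = n \<and> x \<in> U i \<and> y \<in> U j})"

primrec sullivan_filtration :: "'v::rat_vector gcdga \<Rightarrow> nat \<Rightarrow> 'v graded" where
  "sullivan_filtration A 0 = (\<lambda>k. {v \<in> gens A k. adif A k v = 0})"
| "sullivan_filtration A (Suc n) =
     (\<lambda>k. {v \<in> gens A k. adif A k v \<in> wedge2 A (sullivan_filtration A n) (Suc k)})"

definition quadratic_sullivan :: "'v::rat_vector gcdga \<Rightarrow> bool" where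
  "quadratic_sullivan A \<longleftrightarrow>
     cdga A \<and> free_on_gens A \<and> gens A 0 = {0} \<and>
     (\<forall>k. \<forall>v\<in>gens A k. adif A k v \<in> wedge2 A (gens A) (Suc k)) \<and>
     (\<forall>k. gens A k = (\<Union>n. sullivan_filtration A n k))"

definition sullivan_hom ::
  "'v::rat_vector gcdga \<Rightarrow> 'w::rat_vector gcdga \<Rightarrow> (nat \<Rightarrow> 'v \<Rightarrow> 'w) set" where
  "sullivan_hom A B = {\<phi>.
     (\<forall>k. \<phi> k \<in> acomp A k \<rightarrow>\<^sub>E acomp B k) \<and>
     (\<forall>k. linear_map_on (acomp A k) (\<phi> k)) \<and>
     \<phi> 0 (aone A) = aone B \<and>
     (\<forall>i j. \<forall>x\<in>acomp A i. \<forall>y\<in>acomp A j. \<phi> (i + j) (amul A i j x y) = amul B i j (\<phi> i x) (\<phi> j y)) \<and>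
     (\<forall>k. \<forall>x\<in>acomp A k. \<phi> (Suc k) (adif A k x) = adif B k (\<phi> k x)) \<and>
     (\<forall>k. \<forall>v\<in>gens A k. \<phi> k v \<in> gens B k)}"

definition sullivan_iso ::
  "'v::rat_vector gcdga \<Rightarrow> 'w::rat_vector gcdga \<Rightarrow> (nat \<Rightarrow> 'v \<Rightarrow> 'w) set" where
  "sullivan_iso A B = {\<phi> \<in> sullivan_hom A B. \<exists>\<chi>\<in>sullivan_hom B A.
     graded_comp (acomp A) \<chi> \<phi> = graded_id (acomp A) \<and>
     graded_comp (acomp B) \<phi> \<chi> = graded_id (acomp B)}"


section \<open>The quadratic model\<close>

text \<open>A word \<open>[(k\<^sub>1, x\<^sub>1), \<dots>, (k\<^sub>p, x\<^sub>p)]\<close> in \<open>L\<close> stands for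
  \<open>sx\<^sub>1 \<and> \<dots> \<and> sx\<^sub>p \<in> \<And>sL\<close>, where \<open>sx\<close> has degree \<open>deg x + 1\<close>. A list of pairs
  (coefficient, word) is a linear combination.\<close>

definition sdeg :: "'a word \<Rightarrow> nat" where
  "sdeg ws = sum_list (map (\<lambda>p. Suc (fst p)) ws)"

text \<open>The coproduct of \<open>\<And>sL\<close>: the algebra morphism for which every \<open>sx\<close> is primitive, so that
  \<open>\<Delta>(sx \<and> c) = (sx \<otimes> 1 + 1 \<otimes> sx) \<Delta>(c)\<close>.\<close>

fun coprod :: "'a word \<Rightarrow> (rat \<times> 'a word \<times> 'a word) list" where
  "coprod [] = [(1, [], [])]"
| "coprod ((k, x) # ws) = concat (map (\<lambda>(c, us, vs).
     [(c, (k, x) # us, vs), (c * (-1) ^ (Suc k * sdeg us), us, (k, x) # vs)]) (coprod ws))"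

text \<open>The differential of \<open>C\<^sub>*(L)\<close> is the coderivation \<open>\<partial>\<close> of \<open>\<And>sL\<close> determined by
  \<open>\<partial>(sx \<and> sy) = (-1)\<^bsup>deg x + 1\<^esup> s[x,y]\<close> and \<open>\<partial>(sx) = 0\<close>. The terms of
  \<open>\<partial>(sx \<and> c)\<close> either bracket \<open>x\<close> with one factor of \<open>c\<close> (\<open>bracket_into\<close>) or come from
  \<open>(-1)\<^bsup>deg sx\<^esup> sx \<and> \<partial>c\<close>. In \<open>bracket_into\<close>, skipping a factor \<open>sy\<close> costs the sign of
  interchanging \<open>sx\<close> and \<open>sy\<close> and that of moving \<open>\<partial>\<close> past \<open>sy\<close>.\<close>

fun bracket_into :: "'a glie \<Rightarrow> nat \<Rightarrow> 'a \<Rightarrow> 'a word \<Rightarrow> (rat \<times> 'a word) list" where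
  "bracket_into L k x [] = []"
| "bracket_into L k x ((l, y) # ws) =
     ((-1) ^ Suc k, (k + l, lbr L k l x y) # ws) #
     map (\<lambda>(c, us). (c * (-1) ^ (Suc k * Suc l + Suc l), (l, y) # us)) (bracket_into L k x ws)"

fun boundary :: "'a glie \<Rightarrow> 'a word \<Rightarrow> (rat \<times> 'a word) list" where
  "boundary L [] = []"
| "boundary L ((k, x) # ws) =
     bracket_into L k x ws @ map (\<lambda>(c, us). (c * (-1) ^ Suc k, (k, x) # us)) (boundary L ws)"

text \<open>\<open>cochains L n\<close> is the dual of \<open>(\<And>sL)\<^sub>n\<close>: functions on words (extended by \<open>0\<close>) that are
  multilinear and graded symmetric, thus functionals on the quotient \<open>\<And>sL\<close> of \<open>T(sL)\<close>.
  \<open>quotient_cochains L I n\<close> consists of those that factor through \<open>\<And>s(L / I)\<close>, which is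
  \<open>C\<^sup>n(L / I)\<close> embedded by pullback along the surjection \<open>L \<rightarrow> L / I\<close>.\<close>

definition cochains :: "'a::rat_vector glie \<Rightarrow> nat \<Rightarrow> ('a word \<Rightarrow> rat) set" where
  "cochains L n = {f.
     (\<forall>ws. ws \<notin> words (lcomp L) \<or> sdeg ws \<noteq> n \<longrightarrow> f ws = 0) \<and>
     (\<forall>us\<in>words (lcomp L). \<forall>ws\<in>words (lcomp L). \<forall>k.
        linear_map_on (lcomp L k) (\<lambda>x. f (us @ (k, x) # ws))) \<and>
     (\<forall>us\<in>words (lcomp L). \<forall>ws\<in>words (lcomp L). \<forall>i j. \<forall>x\<in>lcomp L i. \<forall>y\<in>lcomp L j.
        f (us @ (i, x) # (j, y) # ws) = (-1) ^ (Suc i * Suc j) * f (us @ (j, y) # (i, x) # ws))}"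

definition quotient_cochains ::
  "'a::rat_vector glie \<Rightarrow> 'a graded \<Rightarrow> nat \<Rightarrow> ('a word \<Rightarrow> rat) set" where
  "quotient_cochains L I n =
     {f \<in> cochains L n. \<forall>ws. (\<exists>(k, x)\<in>set ws. x \<in> I k) \<longrightarrow> f ws = 0}"

text \<open>Product and differential are the transposes of \<open>\<Delta>\<close> and \<open>\<partial>\<close>, with the pairing
  \<open>\<langle>f \<otimes> g, a \<otimes> b\<rangle> = \<langle>f, a\<rangle>\<langle>g, b\<rangle>\<close> without sign.\<close>

definition cochain_mul :: "('a word \<Rightarrow> rat) \<Rightarrow> ('a word \<Rightarrow> rat) \<Rightarrow> 'a word \<Rightarrow> rat" where
  "cochain_mul f g = (\<lambda>ws. \<Sum>(c, us, vs)\<leftarrow>coprod ws. c * f us * g vs)"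

definition cochain_dif :: "'a glie \<Rightarrow> ('a word \<Rightarrow> rat) \<Rightarrow> 'a word \<Rightarrow> rat" where
  "cochain_dif L f =
     (\<lambda>ws. if ws \<in> words (lcomp L) then \<Sum>(c, us)\<leftarrow>boundary L ws. c * f us else 0)"

text \<open>The direct limit of the \<open>C\<^sup>*(L / I)\<close>, \<open>I \<in> \<I>\<close>, is a union since the pullbacks are
  inclusions of subspaces of the cochains of \<open>L\<close>. The generators \<open>(s(L / I))\<^sup>\<or>\<close> are the cochains
  supported on words of length \<open>1\<close>.\<close>

definition quadratic_model ::
  "'a::rat_vector glie \<Rightarrow> 'a graded set \<Rightarrow> ('a word \<Rightarrow> rat) gcdga" where
  "quadratic_model L \<I> = \<lparr>
     acomp = (\<lambda>n. \<Union>I\<in>\<I>. quotient_cochains L I n),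
     amul = (\<lambda>i j. cochain_mul),
     aone = single [],
     adif = (\<lambda>n. cochain_dif L),
     gens = (\<lambda>n. {f \<in> \<Union>I\<in>\<I>. quotient_cochains L I n. \<forall>ws. length ws \<noteq> 1 \<longrightarrow> f ws = 0})\<rparr>"

text \<open>The identification \<open>sL = V\<^sup>\<or>\<close>: \<open>sx\<close>, \<open>x\<close> of degree \<open>k\<close>, as a functional on the generators
  of degree \<open>k + 1\<close>.\<close>

definition suspension_eval ::
  "'a::rat_vector glie \<Rightarrow> 'a graded set \<Rightarrow> nat \<Rightarrow> 'a \<Rightarrow> ('a word \<Rightarrow> rat) \<Rightarrow> rat" where
  "suspension_eval L \<I> k x =
     (\<lambda>v. if v \<in> gens (quadratic_model L \<I>) (Suc k) then v [(k, x)] else 0)"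

text \<open>\<open>\<phi>\<close> restricts to a map of generators \<open>V\<^sub>L \<rightarrow> V\<^sub>E\<close> with dual \<open>\<psi> : E \<rightarrow> L\<close>.\<close>

definition has_dual ::
  "'a::rat_vector glie \<Rightarrow> 'b::rat_vector glie \<Rightarrow> 'b graded set
     \<Rightarrow> (nat \<Rightarrow> ('b word \<Rightarrow> rat) \<Rightarrow> ('a word \<Rightarrow> rat)) \<Rightarrow> (nat \<Rightarrow> 'a \<Rightarrow> 'b) \<Rightarrow> bool" where
  "has_dual E L \<I> \<phi> \<psi> \<longleftrightarrow>
     (\<forall>k. \<forall>v\<in>gens (quadratic_model L \<I>) (Suc k). \<forall>x\<in>lcomp E k.
        \<phi> (Suc k) v [(k, x)] = v [(k, \<psi> k x)])"

definition quadratic_model_map ::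
  "'a::rat_vector glie \<Rightarrow> 'a graded set \<Rightarrow> 'b::rat_vector glie \<Rightarrow> 'b graded set
     \<Rightarrow> (nat \<Rightarrow> 'a \<Rightarrow> 'b) \<Rightarrow> nat \<Rightarrow> ('b word \<Rightarrow> rat) \<Rightarrow> ('a word \<Rightarrow> rat)" where
  "quadratic_model_map E \<J> L \<I> \<psi> =
     (THE \<phi>. \<phi> \<in> sullivan_hom (quadratic_model L \<I>) (quadratic_model E \<J>) \<and> has_dual E L \<I> \<phi> \<psi>)"

text \<open>\<open>(L, \<I>)\<close> is a complete enriched Lie algebra with underlying graded vector space
  \<open>s\<^sup>-\<^sup>1V\<^sup>\<or>\<close>, \<open>V = gens A\<close>, whose quadratic model is \<open>A\<close> under the identification of \<open>v \<in> V\<close> with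
  evaluation at \<open>v\<close>.\<close>

definition is_inverse_object ::
  "'v::rat_vector gcdga \<Rightarrow> ('v \<Rightarrow> rat) glie \<Rightarrow> ('v \<Rightarrow> rat) graded set \<Rightarrow> bool" where
  "is_inverse_object A L \<I> \<longleftrightarrow>
     complete_enriched_lie L \<I> \<and>
     (\<forall>k. lcomp L k = dual_space (gens A (Suc k))) \<and>
     (\<exists>\<phi>\<in>sullivan_iso A (quadratic_model L \<I>).
        \<forall>k. \<forall>v\<in>gens A (Suc k). \<forall>f\<in>lcomp L k. \<phi> (Suc k) v [(k, f)] = f v)"

end

theory Submission
  imports Defs
begin

text \<open>The quadratic model only depends on the spaces \<open>V\<^sub>\<alpha>\<close> dual to the finite-dimensional quotients of \<open>L\<close>, and finite-dimensional
  spaces are reflexive. This gives the correspondence on underlying spaces: \<open>V = \<Union> V\<^sub>\<alpha>\<close>, a functional on \<open>V\<close> is a compatible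
  family of functionals on the \<open>V\<^sub>\<alpha>\<close>, that is, of elements of the \<open>L / I\<^sub>\<alpha>\<close>, and completeness of \<open>L\<close> says that such families are
  the elements of \<open>L\<close> (\<open>complete_realizes\<close>). The bracket and the quadratic differential are transposes of each other,
  \<open>(dv)(sx \<and> sy) = \<plusminus> v(s[x, y])\<close>, and under this correspondence the Jacobi identity is \<open>d\<^sup>2 = 0\<close> (\<open>bdry_form_bdry_form\<close>,
  \<open>dual_bracket_Jacobi\<close>), nilpotence of the quotients is the exhaustion of \<open>V\<close> by the Sullivan filtration
  (\<open>sullivan_filtration_lower_central\<close>, \<open>lower_central_kills\<close>), and continuity of a Lie morphism says that its transpose maps \<open>V\<^sub>L\<close> to \<open>V\<^sub>E\<close>
  (\<open>one_forms_image_common_ideal\<close>).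

  Cochains are functions on words. Contraction with a letter is a derivation of their product up to sign
  (\<open>contract_mul\<close>), so that the identities between product, differential and bracket follow by induction on words.
  That the model is free on \<open>V\<close> rests on the Euler identity: in a dual basis \<open>(e, v)\<close> of \<open>L / I\<close> the sum of
  the \<open>v \<and> \<iota>\<^sub>e f\<close> is \<open>p f\<close> for a form \<open>f\<close> in \<open>p\<close> letters (\<open>euler_identity\<close>). It shows that products of linear forms
  span (\<open>sym_form_generated\<close>), and its analogue for words of linear forms reconstructs a word, up to the relations of a graded
  commutative algebra, from the product of its letters (\<open>form_prod_free\<close>).

  A morphism of models is determined by its restriction \<open>V\<^sub>L \<rightarrow> V\<^sub>E\<close>, whose transpose is the Lie morphism.
  Conversely, a quadratic Sullivan algebra \<open>\<And>V\<close> defines a bracket on \<open>s\<^sup>-\<^sup>1V\<^sup>\<or>\<close>, with the annihilators of the finite-dimensional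
  subspaces \<open>U \<subseteq> V\<close> such that \<open>dU \<subseteq> \<And>\<^sup>2U\<close> as ideals (\<open>dual_lie_complete\<close>). By the universal property of free algebras
  (\<open>free_extension\<close>) the evaluation of \<open>V\<close> on \<open>V\<^sup>\<or>\<close> extends to an isomorphism from \<open>\<And>V\<close> to the model (\<open>evaluation_sullivan_iso\<close>).\<close>

section \<open>Linear algebra over the rationals\<close>

lemma scaleQ_rat [simp]: "c *\<^sub>Q (x::rat) = c * x"
  by (simp add: scaleQ_rat_def)

lemma scaleQ_fun_apply [simp]: "(c *\<^sub>Q f) x = c *\<^sub>Q f x"
  by (simp add: scaleQ_fun_def)

lemma sum_apply: "(\<Sum>i\<in>A. f i) x = (\<Sum>i\<in>A. f i x)"
  by (induction A rule: infinite_finite_induct) simp_all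

lemma sum_list_apply: "(\<Sum>i\<leftarrow>xs. f i) x = (\<Sum>i\<leftarrow>xs. f i x)"
  by (induction xs) simp_all

lemma linear_map_onI:
  assumes "\<And>x y. x \<in> S \<Longrightarrow> y \<in> S \<Longrightarrow> f (x + y) = f x + f y"
    and "\<And>c x. x \<in> S \<Longrightarrow> f (c *\<^sub>Q x) = c *\<^sub>Q f x"
  shows "linear_map_on S f"
  using assms by (auto simp: linear_map_on_def)

lemma linear_map_on_add: "linear_map_on S f \<Longrightarrow> x \<in> S \<Longrightarrow> y \<in> S \<Longrightarrow> f (x + y) = f x + f y"
  and linear_map_on_scale: "linear_map_on S f \<Longrightarrow> x \<in> S \<Longrightarrow> f (c *\<^sub>Q x) = c *\<^sub>Q f x"
  by (auto simp: linear_map_on_def)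

lemma linear_map_on_subset: "linear_map_on S f \<Longrightarrow> T \<subseteq> S \<Longrightarrow> linear_map_on T f"
  unfolding linear_map_on_def by blast

lemma linear_map_on_cong:
  "(\<And>x. x \<in> S \<Longrightarrow> f x = g x) \<Longrightarrow> ratvec.subspace S \<Longrightarrow> linear_map_on S f = linear_map_on S g"
  by (auto simp: linear_map_on_def ratvec.subspace_def)

lemma linear_map_on_zero: "linear_map_on S f \<Longrightarrow> ratvec.subspace S \<Longrightarrow> f 0 = 0"
  using linear_map_on_scale[of S f 0 0] by (simp add: ratvec.subspace_0)

lemma linear_map_on_minus: "linear_map_on S f \<Longrightarrow> x \<in> S \<Longrightarrow> f (- x) = - f x"
  using linear_map_on_scale[of S f x "-1"] by simp

lemma linear_map_on_diff:
  "linear_map_on S f \<Longrightarrow> ratvec.subspace S \<Longrightarrow> x \<in> S \<Longrightarrow> y \<in> S \<Longrightarrow> f (x - y) = f x - f y"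
  using linear_map_on_add[of S f x "- y"] by (simp add: linear_map_on_minus ratvec.subspace_neg)

lemma linear_map_on_sum_list:
  assumes "linear_map_on S f" "ratvec.subspace S" "\<And>i. i \<in> set xs \<Longrightarrow> g i \<in> S"
  shows "f (\<Sum>i\<leftarrow>xs. g i) = (\<Sum>i\<leftarrow>xs. f (g i))"
    and "(\<Sum>i\<leftarrow>xs. g i) \<in> S"
proof -
  have "f (\<Sum>i\<leftarrow>xs. g i) = (\<Sum>i\<leftarrow>xs. f (g i)) \<and> (\<Sum>i\<leftarrow>xs. g i) \<in> S"
    using assms(3)
    by (induction xs) (simp_all add: linear_map_on_zero[OF assms(1,2)] linear_map_on_add[OF assms(1)]
        ratvec.subspace_0[OF assms(2)] ratvec.subspace_add[OF assms(2)])
  then show "f (\<Sum>i\<leftarrow>xs. g i) = (\<Sum>i\<leftarrow>xs. f (g i))" and "(\<Sum>i\<leftarrow>xs. g i) \<in> S" by auto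
qed

lemma subspace_sum_list:
  "ratvec.subspace S \<Longrightarrow> (\<And>i. i \<in> set xs \<Longrightarrow> g i \<in> S) \<Longrightarrow> (\<Sum>i\<leftarrow>xs. g i) \<in> S"
  by (induction xs) (simp_all add: ratvec.subspace_0 ratvec.subspace_add)

lemma linear_map_on_sum:
  assumes "linear_map_on S f" "ratvec.subspace S" "\<And>i. i \<in> A \<Longrightarrow> g i \<in> S"
  shows "f (\<Sum>i\<in>A. g i) = (\<Sum>i\<in>A. f (g i))"
  using assms(3)
  by (induction A rule: infinite_finite_induct)
    (simp_all add: linear_map_on_zero[OF assms(1,2)] linear_map_on_add[OF assms(1)]
      ratvec.subspace_sum[OF assms(2)])

lemma linear_map_on_compose:
  "linear_map_on S f \<Longrightarrow> linear_map_on T g \<Longrightarrow> (\<And>x. x \<in> S \<Longrightarrow> f x \<in> T) \<Longrightarrow> linear_map_on S (\<lambda>x. g (f x))"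
  by (simp add: linear_map_on_def)

lemma linear_map_on_plus:
  "linear_map_on S f \<Longrightarrow> linear_map_on S g \<Longrightarrow> linear_map_on S (\<lambda>x. f x + g x)"
  by (simp add: linear_map_on_def scaleQ_add_right)

lemma linear_map_on_scaled:
  "linear_map_on S f \<Longrightarrow> linear_map_on S (\<lambda>x. c *\<^sub>Q f x)"
  by (simp add: linear_map_on_def scaleQ_add_right mult.commute)

lemma linear_map_on_mult:
  "linear_map_on S f \<Longrightarrow> linear_map_on S (\<lambda>x. c * f x :: rat)"
  using linear_map_on_scaled[of S f c] by simp

lemma linear_map_on_const0: "linear_map_on S (\<lambda>x. 0)"
  by (simp add: linear_map_on_def)

lemma bilinear_map_on_left: "bilinear_map_on S T f \<Longrightarrow> y \<in> T \<Longrightarrow> linear_map_on S (\<lambda>x. f x y)"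
  and bilinear_map_on_right: "bilinear_map_on S T f \<Longrightarrow> x \<in> S \<Longrightarrow> linear_map_on T (f x)"
  by (auto simp: bilinear_map_on_def)

lemma subspace_dual_space: "ratvec.subspace (dual_space S)"
  by (auto simp: ratvec.subspace_def dual_space_def linear_map_on_def algebra_simps)

lemma dual_space_eqI:
  "f \<in> dual_space S \<Longrightarrow> g \<in> dual_space S \<Longrightarrow> (\<And>x. x \<in> S \<Longrightarrow> f x = g x) \<Longrightarrow> f = g"
  unfolding dual_space_def by (rule ext) (metis (mono_tags, lifting) mem_Collect_eq)

lemma linear_map_on_span_eq:
  assumes "linear_map_on S f" "linear_map_on S g" "ratvec.subspace S" "B \<subseteq> S"
    and "\<And>b. b \<in> B \<Longrightarrow> f b = g b" "x \<in> ratvec.span B"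
  shows "f x = g x"
proof -
  have "x \<in> S \<and> f x = g x"
    using assms(6)
  proof (induction rule: ratvec.span_induct_alt)
    case base
    then show ?case
      using assms(1-3) by (simp add: linear_map_on_zero ratvec.subspace_0)
  next
    case (step c b y)
    then have "b \<in> S" "c *\<^sub>Q b \<in> S" using assms(3,4) by (auto simp: ratvec.subspace_scale)
    with step show ?case
      using assms(1-3,5)
      by (simp add: linear_map_on_add linear_map_on_scale ratvec.subspace_add)
  qed
  then show ?thesis ..
qed

lemma linear_map_on_span_in:
  assumes "linear_map_on S f" "ratvec.subspace S" "ratvec.subspace T" "B \<subseteq> S"
    and "\<And>b. b \<in> B \<Longrightarrow> f b \<in> T" "x \<in> ratvec.span B"
  shows "f x \<in> T"
proof -
  have "x \<in> S \<and> f x \<in> T"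
    using assms(6)
  proof (induction rule: ratvec.span_induct_alt)
    case base
    then show ?case
      using assms(1-3) by (simp add: linear_map_on_zero ratvec.subspace_0)
  next
    case (step c b y)
    then have "b \<in> S" "c *\<^sub>Q b \<in> S" using assms(2,4) by (auto simp: ratvec.subspace_scale)
    with step show ?case
      using assms(1-3,5)
      by (simp add: linear_map_on_add linear_map_on_scale ratvec.subspace_add ratvec.subspace_scale)
  qed
  then show ?thesis ..
qed

lemma separating_functional:
  fixes x :: "'a::rat_vector"
  assumes "x \<notin> ratvec.span S"
  obtains v :: "'a \<Rightarrow> rat" where "linear_map_on UNIV v" "\<And>y. y \<in> ratvec.span S \<Longrightarrow> v y = 0" "v x = 1"
proof -
  interpret vp: vector_space_pair "scaleQ :: rat \<Rightarrow> 'a \<Rightarrow> 'a" "scaleQ :: rat \<Rightarrow> rat \<Rightarrow> rat"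
    by unfold_locales
  obtain B where B: "B \<subseteq> S" "ratvec.independent B" "S \<subseteq> ratvec.span B"
    by (rule ratvec.basis_exists[of S])
  have span: "ratvec.span B = ratvec.span S"
    using ratvec.span_mono[OF B(1)] ratvec.span_minimal[OF B(3) ratvec.subspace_span] by blast
  then have ind: "ratvec.independent (insert x B)"
    using B assms by (simp add: ratvec.independent_insertI)
  obtain v where v: "Vector_Spaces.linear scaleQ scaleQ v" "\<forall>b\<in>insert x B. v b = (if b = x then 1 else 0::rat)"
    using vp.linear_independent_extend[OF ind, of "\<lambda>b. if b = x then 1 else 0"] by blast
  interpret v: Vector_Spaces.linear "scaleQ :: rat \<Rightarrow> 'a \<Rightarrow> 'a" "scaleQ :: rat \<Rightarrow> rat \<Rightarrow> rat" v
    by (rule v(1))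
  have lin: "linear_map_on UNIV v"
    by (rule linear_map_onI) (simp_all only: v.add v.scale)
  have "x \<notin> B" using span assms ratvec.span_base by blast
  then have "v b = 0" if "b \<in> B" for b using v(2) that by auto
  then have "v y = 0" if "y \<in> ratvec.span S" for y
    using linear_map_on_span_eq[OF lin linear_map_on_const0, of B y] that span by simp
  moreover have "v x = 1" using v(2) by simp
  ultimately show thesis using lin that by blast
qed

text \<open>The spanning vectors are added one at a time. A vector \<open>b\<close> outside the span so far contributes a functional \<open>w\<close> with
  \<open>w b = 1\<close> that vanishes on this span; replacing each earlier functional \<open>v\<close> by \<open>v - v(b) w\<close> makes it vanish on \<open>b\<close>
  and does not change it on the span.\<close>

lemma finite_codim_dual_basis:
  fixes I :: "'a::rat_vector set"
  assumes "finite B" "B \<subseteq> S" "ratvec.subspace I"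
  obtains D :: "('a \<times> ('a \<Rightarrow> rat)) list"
  where "\<And>e v. (e, v) \<in> set D \<Longrightarrow> e \<in> S \<and> linear_map_on UNIV v \<and> (\<forall>x\<in>I. v x = 0)"
    and "\<And>x. x \<in> ratvec.span (B \<union> I) \<Longrightarrow> x - (\<Sum>(e, v)\<leftarrow>D. v x *\<^sub>Q e) \<in> I"
proof -
  have "\<exists>D :: ('a \<times> ('a \<Rightarrow> rat)) list. (\<forall>(e, v)\<in>set D. e \<in> S \<and> linear_map_on UNIV v \<and> (\<forall>x\<in>I. v x = 0)) \<and>
     (\<forall>x\<in>ratvec.span (B \<union> I). x - (\<Sum>(e, v)\<leftarrow>D. v x *\<^sub>Q e) \<in> I)"
    using assms(1,2)
  proof (induction B rule: finite_induct)
    case empty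
    have "x \<in> I" if "x \<in> ratvec.span I" for x
      using that assms(3) ratvec.span_eq_iff[of I] by blast
    then show ?case by (intro exI[of _ "[]"]) simp
  next
    case (insert b B)
    then obtain D :: "('a \<times> ('a \<Rightarrow> rat)) list"
      where D: "\<forall>(e, v)\<in>set D. e \<in> S \<and> linear_map_on UNIV v \<and> (\<forall>x\<in>I. v x = 0)"
        "\<forall>x\<in>ratvec.span (B \<union> I). x - (\<Sum>(e, v)\<leftarrow>D. v x *\<^sub>Q e) \<in> I"
      by auto
    show ?case
    proof (cases "b \<in> ratvec.span (B \<union> I)")
      case True
      then have "ratvec.span (insert b B \<union> I) = ratvec.span (B \<union> I)"
        using ratvec.span_redundant[of b "B \<union> I"] by simp
      then show ?thesis using D by (intro exI[of _ D]) auto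
    next
      case False
      then obtain w :: "'a \<Rightarrow> rat" where w: "linear_map_on UNIV w"
        "\<And>y. y \<in> ratvec.span (B \<union> I) \<Longrightarrow> w y = 0" "w b = 1"
        using separating_functional by blast
      define D' where "D' = (b, w) # map (\<lambda>(e, v). (e, \<lambda>x. v x - v b * w x)) D"
      have lin': "linear_map_on UNIV (\<lambda>x. v x - v b * w x)" if "linear_map_on UNIV v" for v
        using that w(1) by (simp add: linear_map_on_def algebra_simps)
      have "\<forall>(e, v)\<in>set D'. e \<in> S \<and> linear_map_on UNIV v \<and> (\<forall>x\<in>I. v x = 0)"
        using D(1) w lin' insert.prems ratvec.span_base[of _ "B \<union> I"] by (auto simp: D'_def)
      moreover have "x - (\<Sum>(e, v)\<leftarrow>D'. v x *\<^sub>Q e) \<in> I" if xin: "x \<in> ratvec.span (insert b B \<union> I)" for x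
      proof -
        obtain c where c: "x - c *\<^sub>Q b \<in> ratvec.span (B \<union> I)"
          using xin ratvec.span_breakdown_eq[of x b "B \<union> I"] by auto
        define y where "y = x - c *\<^sub>Q b"
        have x: "x = y + c *\<^sub>Q b" by (simp add: y_def)
        have wx: "w x = c" using w c by (simp add: x linear_map_on_add[OF w(1)] linear_map_on_scale[OF w(1)] y_def[symmetric])
        have "v x - v b * w x = v y" if "(e, v) \<in> set D" for e v
          using D(1) that wx by (auto simp: x linear_map_on_def)
        then have "(\<Sum>(e, v)\<leftarrow>map (\<lambda>(e, v). (e, \<lambda>x. v x - v b * w x)) D. v x *\<^sub>Q e) = (\<Sum>(e, v)\<leftarrow>D. v y *\<^sub>Q e)"
          by (auto simp: o_def intro!: arg_cong[of _ _ sum_list] map_cong)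
        then have "x - (\<Sum>(e, v)\<leftarrow>D'. v x *\<^sub>Q e) = y - (\<Sum>(e, v)\<leftarrow>D. v y *\<^sub>Q e)"
          by (simp add: D'_def wx y_def)
        moreover have "y - (\<Sum>(e, v)\<leftarrow>D. v y *\<^sub>Q e) \<in> I" using D(2) c unfolding y_def by blast
        ultimately show ?thesis by (simp only:)
      qed
      ultimately show ?thesis by blast
    qed
  qed
  then obtain D where D: "\<forall>(e, v)\<in>set D. e \<in> S \<and> linear_map_on UNIV v \<and> (\<forall>x\<in>I. v x = 0)"
     "\<forall>x\<in>ratvec.span (B \<union> I). x - (\<Sum>(e, v)\<leftarrow>D. v x *\<^sub>Q e) \<in> I"
    by blast
  show thesis by (rule that[of D]) (use D in auto)
qed

section \<open>The product of cochains\<close>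

text \<open>The transpose of \<open>c \<mapsto> sx \<and> c\<close>, the contraction \<open>\<iota>\<^sub>x\<close>.\<close>

definition contract :: "nat \<Rightarrow> 'a \<Rightarrow> ('a word \<Rightarrow> rat) \<Rightarrow> 'a word \<Rightarrow> rat" where
  "contract k x f = (\<lambda>ws. f ((k, x) # ws))"

text \<open>The sign of moving something of degree \<open>m\<close> past \<open>f\<close>, as an operator on all functions, over which inductions on
  words can then quantify.\<close>

definition twist :: "nat \<Rightarrow> ('a word \<Rightarrow> rat) \<Rightarrow> 'a word \<Rightarrow> rat" where
  "twist m f = (\<lambda>ws. (-1) ^ (m * sdeg ws) * f ws)"

lemma sdeg_simps [simp]: "sdeg [] = 0" "sdeg ((k, x) # ws) = Suc k + sdeg ws"
    "sdeg (us @ vs) = sdeg us + sdeg vs"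
  by (simp_all add: sdeg_def)

lemma wdeg_simps [simp]: "wdeg [] = 0" "wdeg ((k, x) # ws) = k + wdeg ws"
    "wdeg (us @ vs) = wdeg us + wdeg vs"
  by (simp_all add: wdeg_def)

lemma words_simps [simp]: "[] \<in> words W" "(k, x) # ws \<in> words W \<longleftrightarrow> x \<in> W k \<and> ws \<in> words W"
    "us @ vs \<in> words W \<longleftrightarrow> us \<in> words W \<and> vs \<in> words W"
  by (auto simp: words_def)

lemma cochain_mul_Nil [simp]: "cochain_mul f g [] = f [] * g []"
  by (simp add: cochain_mul_def)

lemma cochain_mul_Cons [simp]:
  "cochain_mul f g ((k, x) # ws)
     = cochain_mul (contract k x f) g ws + cochain_mul (twist (Suc k) f) (contract k x g) ws"
proof -
  have "(\<Sum>(c, us, vs)\<leftarrow>concat (map (\<lambda>(c, us, vs).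
     [(c, (k, x) # us, vs), (c * (-1) ^ (Suc k * sdeg us), us, (k, x) # vs)]) xs). c * f us * g vs)
    = (\<Sum>(c, us, vs)\<leftarrow>xs. c * contract k x f us * g vs)
    + (\<Sum>(c, us, vs)\<leftarrow>xs. c * twist (Suc k) f us * contract k x g vs)" for xs
    by (induction xs) (auto simp: contract_def twist_def algebra_simps)
  then show ?thesis by (simp add: cochain_mul_def)
qed

text \<open>Contractions are derivations up to sign. Since a function on words is determined by its contractions and its value
  at the empty word, identities between products can be proved by induction on the word, for all factors at once.\<close>

lemma contract_mul:
  "contract k x (cochain_mul f g)
     = cochain_mul (contract k x f) g + cochain_mul (twist (Suc k) f) (contract k x g)"
  by (rule ext) (simp add: contract_def[of k x "cochain_mul f g"])

lemma contract_apply: "contract k x f ws = f ((k, x) # ws)"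
  by (simp add: contract_def)

lemma contract_simps [simp]:
  "contract k x (f + g) = contract k x f + contract k x g"
  "contract k x (c *\<^sub>Q f) = c *\<^sub>Q contract k x f"
  "contract k x (f - g) = contract k x f - contract k x g"
  "contract k x (- f) = - contract k x f"
  "contract k x 0 = 0"
  "contract k x (\<lambda>ws. 0) = (\<lambda>ws. 0)"
  by (auto simp: contract_def fun_eq_iff)

lemma twist_simps [simp]:
  "twist m (f + g) = twist m f + twist m g"
  "twist m (c *\<^sub>Q f) = c *\<^sub>Q twist m f"
  "twist m (f - g) = twist m f - twist m g"
  "twist m (- f) = - twist m f"
  "twist m 0 = 0"
  "twist m (\<lambda>ws. 0) = (\<lambda>ws. 0)"
  by (auto simp: twist_def fun_eq_iff algebra_simps)

lemma twist_apply: "twist m f ws = (-1) ^ (m * sdeg ws) * f ws"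
  by (simp add: twist_def)

lemma contract_twist: "contract k x (twist m f) = (-1) ^ (m * Suc k) *\<^sub>Q twist m (contract k x f)"
  by (auto simp: contract_def twist_def fun_eq_iff power_add algebra_simps)

lemma twist_twist: "twist a (twist b f) = twist b (twist a f)"
  by (auto simp: twist_def fun_eq_iff algebra_simps)

lemma cochain_mul_add_left: "cochain_mul (f + g) h = cochain_mul f h + cochain_mul g h"
proof (rule ext)
  show "cochain_mul (f + g) h ws = (cochain_mul f h + cochain_mul g h) ws" for ws
    by (induction ws arbitrary: f g h) (auto simp: algebra_simps)
qed

lemma cochain_mul_add_right: "cochain_mul h (f + g) = cochain_mul h f + cochain_mul h g"
proof (rule ext)
  show "cochain_mul h (f + g) ws = (cochain_mul h f + cochain_mul h g) ws" for ws
    by (induction ws arbitrary: f g h) (auto simp: algebra_simps)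
qed

lemma cochain_mul_scale_left: "cochain_mul (c *\<^sub>Q f) h = c *\<^sub>Q cochain_mul f h"
proof (rule ext)
  show "cochain_mul (c *\<^sub>Q f) h ws = (c *\<^sub>Q cochain_mul f h) ws" for ws
    by (induction ws arbitrary: f h) (auto simp: algebra_simps)
qed

lemma cochain_mul_scale_right: "cochain_mul h (c *\<^sub>Q f) = c *\<^sub>Q cochain_mul h f"
proof (rule ext)
  show "cochain_mul h (c *\<^sub>Q f) ws = (c *\<^sub>Q cochain_mul h f) ws" for ws
    by (induction ws arbitrary: f h) (auto simp: algebra_simps)
qed

lemma cochain_mul_zero [simp]: "cochain_mul 0 f = 0" "cochain_mul f 0 = 0"
  using cochain_mul_scale_left[of 0 0 f] cochain_mul_scale_right[of f 0 0] by auto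

lemma cochain_mul_minus: "cochain_mul (- f) g = - cochain_mul f g" "cochain_mul f (- g) = - cochain_mul f g"
  using cochain_mul_scale_left[of "-1" f g] cochain_mul_scale_right[of f "-1" g] by simp_all

lemma cochain_mul_diff: "cochain_mul (f - g) h = cochain_mul f h - cochain_mul g h"
    "cochain_mul h (f - g) = cochain_mul h f - cochain_mul h g"
  using cochain_mul_add_left[of f "- g" h] cochain_mul_add_right[of h f "- g"]
  by (simp_all add: cochain_mul_minus)

lemmas cochain_mul_linear = cochain_mul_minus cochain_mul_diff
  cochain_mul_add_left cochain_mul_add_right cochain_mul_scale_left cochain_mul_scale_right

lemma twist_mul: "twist m (cochain_mul f g) = cochain_mul (twist m f) (twist m g)"
proof (rule ext)
  show "twist m (cochain_mul f g) ws = cochain_mul (twist m f) (twist m g) ws" for ws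
  proof (induction ws arbitrary: f g)
    case Nil
    then show ?case by (simp add: twist_def)
  next
    case (Cons a ws)
    obtain k x where a: "a = (k, x)" by fastforce
    have "twist m (cochain_mul f g) (a # ws)
      = (-1) ^ (m * Suc k) * (twist m (cochain_mul (contract k x f) g) ws
          + twist m (cochain_mul (twist (Suc k) f) (contract k x g)) ws)"
      by (simp add: a twist_def power_add algebra_simps)
    also have "\<dots> = cochain_mul (twist m f) (twist m g) (a # ws)"
      by (simp add: a Cons.IH contract_twist cochain_mul_linear twist_twist[of "Suc k" m] algebra_simps)
    finally show ?case .
  qed
qed

lemma cochain_mul_assoc: "cochain_mul (cochain_mul f g) h = cochain_mul f (cochain_mul g h)"
proof (rule ext)
  show "cochain_mul (cochain_mul f g) h ws = cochain_mul f (cochain_mul g h) ws" for ws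
    by (induction ws arbitrary: f g h) (auto simp: contract_mul cochain_mul_linear twist_mul algebra_simps)
qed

lemma contract_single_Nil [simp]: "contract k x (single []) = 0"
  by (auto simp: contract_def single_def fun_eq_iff)

lemma twist_single_Nil [simp]: "twist m (single []) = single []"
  by (auto simp: twist_def single_def fun_eq_iff)

lemma cochain_mul_one [simp]: "cochain_mul (single []) f = f" "cochain_mul f (single []) = f"
proof -
  have 1: "single [] [] = 1" by (simp add: single_def)
  have "cochain_mul (single []) f ws = f ws" for ws
    by (induction ws arbitrary: f) (auto simp: 1 contract_apply)
  then show "cochain_mul (single []) f = f" by auto
  have "cochain_mul f (single []) ws = f ws" for ws
    by (induction ws arbitrary: f) (auto simp: 1 contract_apply)
  then show "cochain_mul f (single []) = f" by auto
qed

text \<open>Signs depend on degrees only modulo \<open>2\<close>, and there the effect of a contraction on the degree is an addition.\<close>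

definition has_parity :: "nat \<Rightarrow> ('a word \<Rightarrow> rat) \<Rightarrow> bool" where
  "has_parity n f \<longleftrightarrow> (\<forall>ws. f ws \<noteq> 0 \<longrightarrow> even (sdeg ws + n))"

lemma has_parity_contract: "has_parity n f \<Longrightarrow> has_parity (n + Suc k) (contract k x f)"
  unfolding has_parity_def contract_def by (metis add.assoc add.commute sdeg_simps(2))

lemma twist_parity:
  assumes "has_parity n f" shows "twist m f = (-1) ^ (m * n) *\<^sub>Q f"
proof (rule ext)
  show "twist m f ws = ((-1) ^ (m * n) *\<^sub>Q f) ws" for ws
    using assms unfolding has_parity_def twist_def
    by (cases "f ws = 0") (auto simp: minus_one_power_iff)
qed

lemma cochain_mul_commute:
  assumes "has_parity i f" "has_parity j g"
  shows "cochain_mul f g = (-1) ^ (i * j) *\<^sub>Q cochain_mul g f"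
proof (rule ext)
  show "cochain_mul f g ws = ((-1) ^ (i * j) *\<^sub>Q cochain_mul g f) ws" for ws
    using assms
  proof (induction ws arbitrary: f g i j)
    case Nil
    then show ?case by (auto simp: has_parity_def minus_one_power_iff)
  next
    case (Cons a ws)
    obtain k x where a: "a = (k, x)" by fastforce
    have 1: "cochain_mul (contract k x f) g ws = (-1) ^ ((i + Suc k) * j) * cochain_mul g (contract k x f) ws"
      using Cons.IH[OF has_parity_contract[OF Cons.prems(1)] Cons.prems(2)] by simp
    have 2: "cochain_mul f (contract k x g) ws = (-1) ^ (i * (j + Suc k)) * cochain_mul (contract k x g) f ws"
      using Cons.IH[OF Cons.prems(1) has_parity_contract[OF Cons.prems(2)]] by simp
    show ?case
      by (simp add: a twist_parity[OF Cons.prems(1)] twist_parity[OF Cons.prems(2)] cochain_mul_linear 1 2)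
        (simp add: minus_one_power_iff)
  qed
qed

lemma coprod_split:
  "(c, us, vs) \<in> set (coprod ws) \<Longrightarrow>
     sdeg us + sdeg vs = sdeg ws \<and> length us + length vs = length ws \<and> set us \<union> set vs = set ws"
  by (induction ws arbitrary: c us vs rule: coprod.induct) (fastforce simp: Un_insert_left)+

text \<open>Each term of the product evaluates its factors at complementary subwords, so degrees and lengths add up.\<close>

lemma cochain_mul_eq_0I:
  assumes "\<And>us vs. sdeg us + sdeg vs = sdeg ws \<Longrightarrow> length us + length vs = length ws \<Longrightarrow>
      set us \<union> set vs = set ws \<Longrightarrow> f us = 0 \<or> g vs = 0"
  shows "cochain_mul f g ws = 0"
proof -
  have "c * f us * g vs = 0" if "(c, us, vs) \<in> set (coprod ws)" for c us vs
    using assms coprod_split[OF that] by auto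
  then have "map (\<lambda>(c, us, vs). c * f us * g vs) (coprod ws) = map (\<lambda>_. 0) (coprod ws)"
    by (intro map_cong) auto
  then show ?thesis unfolding cochain_mul_def by (simp only: sum_list_0)
qed

lemma cochain_mul_cong:
  assumes "ws \<in> words W" "\<And>us. us \<in> words W \<Longrightarrow> f us = f' us" "\<And>us. us \<in> words W \<Longrightarrow> g us = g' us"
  shows "cochain_mul f g ws = cochain_mul f' g' ws"
proof -
  have "us \<in> words W \<and> vs \<in> words W" if "(c, us, vs) \<in> set (coprod ws)" for c us vs
    using assms(1) coprod_split[OF that] by (fastforce simp: words_def)
  then show ?thesis
    unfolding cochain_mul_def using assms(2,3)
    by (intro arg_cong[of _ _ sum_list] map_cong) fastforce+
qed

section \<open>Graded symmetric forms\<close>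

text \<open>The functionals on \<open>\<And>sW\<close>, without a condition on the degree.\<close>

definition sym_form :: "'a::rat_vector graded \<Rightarrow> ('a word \<Rightarrow> rat) \<Rightarrow> bool" where
  "sym_form W f \<longleftrightarrow>
     (\<forall>ws. ws \<notin> words W \<longrightarrow> f ws = 0) \<and>
     (\<forall>us\<in>words W. \<forall>ws\<in>words W. \<forall>k. linear_map_on (W k) (\<lambda>x. f (us @ (k, x) # ws))) \<and>
     (\<forall>us\<in>words W. \<forall>ws\<in>words W. \<forall>i j. \<forall>x\<in>W i. \<forall>y\<in>W j.
        f (us @ (i, x) # (j, y) # ws) = (-1) ^ (Suc i * Suc j) * f (us @ (j, y) # (i, x) # ws))"

lemma cochains_alt: "f \<in> cochains L n \<longleftrightarrow> sym_form (lcomp L) f \<and> (\<forall>ws. sdeg ws \<noteq> n \<longrightarrow> f ws = 0)"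
  unfolding cochains_def sym_form_def by blast

lemma sym_form_outside: "sym_form W f \<Longrightarrow> ws \<notin> words W \<Longrightarrow> f ws = 0"
  and sym_form_linear: "sym_form W f \<Longrightarrow> us \<in> words W \<Longrightarrow> ws \<in> words W \<Longrightarrow>
     linear_map_on (W k) (\<lambda>x. f (us @ (k, x) # ws))"
  and sym_form_swap: "sym_form W f \<Longrightarrow> us \<in> words W \<Longrightarrow> ws \<in> words W \<Longrightarrow> x \<in> W i \<Longrightarrow> y \<in> W j \<Longrightarrow>
     f (us @ (i, x) # (j, y) # ws) = (-1) ^ (Suc i * Suc j) * f (us @ (j, y) # (i, x) # ws)"
  unfolding sym_form_def by blast+

lemma sym_form_contract:
  assumes "sym_form W f" "x \<in> W k" shows "sym_form W (contract k x f)"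
  unfolding sym_form_def
proof (intro conjI ballI allI impI)
  show "contract k x f ws = 0" if "ws \<notin> words W" for ws
    using that sym_form_outside[OF assms(1), of "(k, x) # ws"] by (simp add: contract_def)
  show "linear_map_on (W l) (\<lambda>z. contract k x f (us @ (l, z) # ws))"
    if "us \<in> words W" "ws \<in> words W" for us ws l
    using that assms sym_form_linear[OF assms(1), of "(k, x) # us" ws l] by (simp add: contract_def)
  show "contract k x f (us @ (i, y) # (j, z) # ws)
      = (-1) ^ (Suc i * Suc j) * contract k x f (us @ (j, z) # (i, y) # ws)"
    if "us \<in> words W" "ws \<in> words W" "y \<in> W i" "z \<in> W j" for us ws i j y z
    using that assms sym_form_swap[OF assms(1), of "(k, x) # us" ws y i z j] by (simp add: contract_def)
qed

lemma sym_form_linear_front: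
  "sym_form W f \<Longrightarrow> ws \<in> words W \<Longrightarrow> linear_map_on (W k) (\<lambda>x. f ((k, x) # ws))"
  using sym_form_linear[of W f "[]" ws k] by simp

lemma contract_linear:
  assumes "sym_form W f" "graded_space W"
  shows "linear_map_on (W k) (\<lambda>x. contract k x f)"
proof (rule linear_map_onI)
  have W: "ratvec.subspace (W k)" using assms(2) by (simp add: graded_space_def)
  fix x y c assume x: "x \<in> W k"
  { assume y: "y \<in> W k"
    have "f ((k, x + y) # ws) = f ((k, x) # ws) + f ((k, y) # ws)" for ws
      using linear_map_on_add[OF sym_form_linear_front[OF assms(1)] x y, of ws]
        sym_form_outside[OF assms(1)] by (cases "ws \<in> words W") auto
    then show "contract k (x + y) f = contract k x f + contract k y f"
      by (auto simp: contract_def) }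
  have "f ((k, c *\<^sub>Q x) # ws) = c * f ((k, x) # ws)" for ws
    using linear_map_on_scale[OF sym_form_linear_front[OF assms(1)] x, of ws c]
      sym_form_outside[OF assms(1)] by (cases "ws \<in> words W") auto
  then show "contract k (c *\<^sub>Q x) f = c *\<^sub>Q contract k x f"
    by (auto simp: contract_def fun_eq_iff)
qed

lemma contract_contract:
  assumes "sym_form W f" "x \<in> W i" "y \<in> W j"
  shows "contract j y (contract i x f) = (-1) ^ (Suc i * Suc j) *\<^sub>Q contract i x (contract j y f)"
proof (rule ext)
  fix ws
  show "contract j y (contract i x f) ws = ((-1) ^ (Suc i * Suc j) *\<^sub>Q contract i x (contract j y f)) ws"
    using sym_form_swap[OF assms(1), of "[]" ws x i y j] sym_form_outside[OF assms(1)] assms(2,3)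
    by (cases "ws \<in> words W") (auto simp: contract_def)
qed

lemma sym_form_zero: "sym_form W 0"
  unfolding sym_form_def by (auto simp: linear_map_on_def)

lemma sym_form_add:
  assumes "sym_form W f" "sym_form W g" shows "sym_form W (f + g)"
  unfolding sym_form_def plus_fun_def
proof (intro conjI ballI allI impI)
  show "f (us @ (i, x) # (j, y) # ws) + g (us @ (i, x) # (j, y) # ws)
      = (-1) ^ (Suc i * Suc j) * (f (us @ (j, y) # (i, x) # ws) + g (us @ (j, y) # (i, x) # ws))"
    if "us \<in> words W" "ws \<in> words W" "x \<in> W i" "y \<in> W j" for us ws i j x y
    using sym_form_swap[OF assms(1) that] sym_form_swap[OF assms(2) that] by (simp only: distrib_left)
qed (use assms in \<open>auto intro: linear_map_on_plus sym_form_linear simp: sym_form_outside\<close>)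

lemma sym_form_twist:
  assumes "sym_form W f" shows "sym_form W (twist m f)"
  unfolding sym_form_def twist_def
proof (intro conjI ballI allI impI)
  show "(-1) ^ (m * sdeg (us @ (i, x) # (j, y) # ws)) * f (us @ (i, x) # (j, y) # ws)
      = (-1) ^ (Suc i * Suc j) * ((-1) ^ (m * sdeg (us @ (j, y) # (i, x) # ws)) * f (us @ (j, y) # (i, x) # ws))"
    if "us \<in> words W" "ws \<in> words W" "x \<in> W i" "y \<in> W j" for us ws i j x y
    using sym_form_swap[OF assms that] by (simp add: ac_simps)
  show "linear_map_on (W k) (\<lambda>x. (-1) ^ (m * sdeg (us @ (k, x) # ws)) * f (us @ (k, x) # ws))"
    if "us \<in> words W" "ws \<in> words W" for us ws k
    using linear_map_on_mult[OF sym_form_linear[OF assms that]] by simp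
qed (use assms in \<open>simp add: sym_form_outside\<close>)

lemma sym_form_scale:
  assumes "sym_form W f" shows "sym_form W (c *\<^sub>Q f)"
  unfolding sym_form_def
proof (intro conjI ballI allI impI)
  show "(c *\<^sub>Q f) (us @ (i, x) # (j, y) # ws)
      = (-1) ^ (Suc i * Suc j) * (c *\<^sub>Q f) (us @ (j, y) # (i, x) # ws)"
    if "us \<in> words W" "ws \<in> words W" "x \<in> W i" "y \<in> W j" for us ws i j x y
    using sym_form_swap[OF assms that] by (simp add: ac_simps)
  show "linear_map_on (W k) (\<lambda>x. (c *\<^sub>Q f) (us @ (k, x) # ws))"
    if "us \<in> words W" "ws \<in> words W" for us ws k
    using linear_map_on_mult[OF sym_form_linear[OF assms that]] by simp
qed (use assms in \<open>simp add: sym_form_outside\<close>)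

lemma sym_form_single_Nil: "sym_form W (single [])"
  unfolding sym_form_def single_def by (auto simp: linear_map_on_def)

text \<open>At the front of a word the claims are the linearity of contraction in the vector and \<open>contract_contract\<close>; the derivation
  property of contractions reduces the other positions to the front.\<close>

lemma sym_form_mul:
  assumes "sym_form W f" "sym_form W g" "graded_space W"
  shows "sym_form W (cochain_mul f g)"
  unfolding sym_form_def
proof (intro conjI ballI allI impI)
  fix ws assume "ws \<notin> words W"
  show "cochain_mul f g ws = 0"
  proof (rule cochain_mul_eq_0I)
    fix us vs assume "set us \<union> set vs = set ws"
    with \<open>ws \<notin> words W\<close> have "us \<notin> words W \<or> vs \<notin> words W"
      unfolding words_def by blast
    then show "f us = 0 \<or> g vs = 0" using assms(1,2) sym_form_outside by blast
  qed
next
  fix us ws k assume "us \<in> words W" and ws: "ws \<in> words W"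
  then show "linear_map_on (W k) (\<lambda>x. cochain_mul f g (us @ (k, x) # ws))"
    using assms(1,2)
  proof (induction us arbitrary: f g)
    case Nil
    have "linear_map_on (W k) (\<lambda>x. cochain_mul (contract k x f) g ws)"
      "linear_map_on (W k) (\<lambda>x. cochain_mul (twist (Suc k) f) (contract k x g) ws)"
      using contract_linear[OF Nil.prems(3) assms(3), of k] contract_linear[OF Nil.prems(4) assms(3), of k]
      by (auto simp: linear_map_on_def cochain_mul_linear)
    then show ?case by (simp add: linear_map_on_plus)
  next
    case (Cons a us)
    obtain l y where a: "a = (l, y)" by fastforce
    show ?case
      using Cons.prems Cons.IH[of "contract l y f" g] Cons.IH[of "twist (Suc l) f" "contract l y g"]
      by (simp add: a sym_form_contract sym_form_twist linear_map_on_plus)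
  qed
next
  fix us ws i j x y assume "us \<in> words W" and ws: "ws \<in> words W" and x: "x \<in> W i" and y: "y \<in> W j"
  then show "cochain_mul f g (us @ (i, x) # (j, y) # ws)
    = (-1) ^ (Suc i * Suc j) * cochain_mul f g (us @ (j, y) # (i, x) # ws)"
    using assms(1,2)
  proof (induction us arbitrary: f g)
    case Nil
    show ?case
      by (simp add: contract_twist cochain_mul_linear contract_contract[OF Nil.prems(5) x y]
          contract_contract[OF Nil.prems(6) x y] twist_twist[of "Suc j" "Suc i"])
        (cases "even i"; cases "even j"; simp add: minus_one_power_iff cochain_mul_linear)
  next
    case (Cons a us)
    obtain l z where a: "a = (l, z)" by fastforce
    show ?case
      using Cons.prems Cons.IH[of "contract l z f" g] Cons.IH[of "twist (Suc l) f" "contract l z g"]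
      by (simp add: a sym_form_contract sym_form_twist distrib_left)
  qed
qed

section \<open>The differential of cochains\<close>

text \<open>The transposes of \<open>bracket_into\<close> and \<open>boundary\<close>, defined on all functions on words. \<open>cochain_dif\<close> is \<open>bdry_form\<close>
  followed by restriction to the words in \<open>L\<close>, which would get in the way of the recursion over words.\<close>

definition bracket_form :: "'a glie \<Rightarrow> nat \<Rightarrow> 'a \<Rightarrow> ('a word \<Rightarrow> rat) \<Rightarrow> 'a word \<Rightarrow> rat" where
  "bracket_form L k x f = (\<lambda>ws. \<Sum>(c, us)\<leftarrow>bracket_into L k x ws. c * f us)"

definition bdry_form :: "'a glie \<Rightarrow> ('a word \<Rightarrow> rat) \<Rightarrow> 'a word \<Rightarrow> rat" where
  "bdry_form L f = (\<lambda>ws. \<Sum>(c, us)\<leftarrow>boundary L ws. c * f us)"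

lemma cochain_dif_alt: "cochain_dif L f = (\<lambda>ws. if ws \<in> words (lcomp L) then bdry_form L f ws else 0)"
  unfolding cochain_dif_def bdry_form_def by (rule refl)

lemma sum_list_scaled_terms:
  "(\<Sum>(c, us)\<leftarrow>map (\<lambda>(c, us). (c * r, (k, x) # us)) xs. c * f us)
    = (r::rat) * (\<Sum>(c, us)\<leftarrow>xs. c * contract k x f us)"
  by (induction xs) (auto simp: contract_def algebra_simps)

lemma bracket_form_simps [simp]:
  "bracket_form L k x f [] = 0"
  "bracket_form L k x f ((l, y) # ws) = (-1) ^ Suc k * f ((k + l, lbr L k l x y) # ws)
     + (-1) ^ (Suc k * Suc l + Suc l) * bracket_form L k x (contract l y f) ws"
  unfolding bracket_form_def by (simp_all add: sum_list_scaled_terms[simplified] del: power_Suc)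

lemma bdry_form_simps [simp]:
  "bdry_form L f [] = 0"
  "bdry_form L f ((k, x) # ws) = bracket_form L k x f ws + (-1) ^ Suc k * bdry_form L (contract k x f) ws"
  unfolding bdry_form_def bracket_form_def boundary.simps map_append sum_list.append sum_list_scaled_terms
  by simp_all

lemma bracket_form_linear [simp]:
  "bracket_form L k x (f + g) = bracket_form L k x f + bracket_form L k x g"
  "bracket_form L k x (c *\<^sub>Q f) = c *\<^sub>Q bracket_form L k x f"
  "bracket_form L k x (- f) = - bracket_form L k x f"
  "bracket_form L k x (f - g) = bracket_form L k x f - bracket_form L k x g"
  "bracket_form L k x 0 = 0"
proof -
  have "bracket_form L k x (f + g) ws = bracket_form L k x f ws + bracket_form L k x g ws" for ws f g
    by (induction ws arbitrary: f g) (auto simp: algebra_simps)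
  then have add: "bracket_form L k x (f + g) = bracket_form L k x f + bracket_form L k x g" for f g by auto
  then show "bracket_form L k x (f + g) = bracket_form L k x f + bracket_form L k x g" .
  have "bracket_form L k x (c *\<^sub>Q f) ws = c * bracket_form L k x f ws" for ws and c and f
    by (induction ws arbitrary: f) (auto simp: algebra_simps)
  then have *: "bracket_form L k x (c *\<^sub>Q f) = c *\<^sub>Q bracket_form L k x f" for c f by auto
  then show "bracket_form L k x (c *\<^sub>Q f) = c *\<^sub>Q bracket_form L k x f" .
  show minus: "bracket_form L k x (- f) = - bracket_form L k x f" for f using *[of "-1"] by simp
  show "bracket_form L k x (f - g) = bracket_form L k x f - bracket_form L k x g"
    using add[of f "- g"] by (simp add: minus)
  show "bracket_form L k x 0 = 0" by (auto simp: bracket_form_def fun_eq_iff case_prod_unfold)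
qed

lemma bdry_form_linear [simp]:
  "bdry_form L (f + g) = bdry_form L f + bdry_form L g"
  "bdry_form L (c *\<^sub>Q f) = c *\<^sub>Q bdry_form L f"
  "bdry_form L (- f) = - bdry_form L f"
  "bdry_form L (f - g) = bdry_form L f - bdry_form L g"
  "bdry_form L 0 = 0"
proof -
  have "bdry_form L (f + g) ws = bdry_form L f ws + bdry_form L g ws" for ws f g
    by (induction ws arbitrary: f g) (auto simp: algebra_simps)
  then have add: "bdry_form L (f + g) = bdry_form L f + bdry_form L g" for f g by auto
  then show "bdry_form L (f + g) = bdry_form L f + bdry_form L g" .
  have "bdry_form L (c *\<^sub>Q f) ws = c * bdry_form L f ws" for ws and c and f
    by (induction ws arbitrary: f) (auto simp: algebra_simps)
  then have *: "bdry_form L (c *\<^sub>Q f) = c *\<^sub>Q bdry_form L f" for c f by auto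
  then show "bdry_form L (c *\<^sub>Q f) = c *\<^sub>Q bdry_form L f" .
  show minus: "bdry_form L (- f) = - bdry_form L f" for f using *[of "-1"] by simp
  show "bdry_form L (f - g) = bdry_form L f - bdry_form L g"
    using add[of f "- g"] by (simp add: minus)
  show "bdry_form L 0 = 0" by (auto simp: bdry_form_def fun_eq_iff case_prod_unfold)
qed

lemma contract_bracket_form:
  "contract l y (bracket_form L k x f) = (-1) ^ Suc k *\<^sub>Q contract (k + l) (lbr L k l x y) f
     + (-1) ^ (Suc k * Suc l + Suc l) *\<^sub>Q bracket_form L k x (contract l y f)"
  by (rule ext) (simp add: contract_apply)

lemma contract_bdry_form:
  "contract k x (bdry_form L f) = bracket_form L k x f + (-1) ^ Suc k *\<^sub>Q bdry_form L (contract k x f)"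
  by (rule ext) (simp add: contract_apply)

lemma twist_add: "twist a (twist b f) = twist (a + b) f"
  by (auto simp: twist_def fun_eq_iff power_add algebra_simps)

lemma twist_Suc_Suc [simp]: "twist (Suc (Suc a)) f = twist a f"
  by (auto simp: twist_def fun_eq_iff power_add minus_one_power_iff)

lemma bracket_into_word:
  "(c, us) \<in> set (bracket_into L k x ws) \<Longrightarrow> length us = length ws \<and> sdeg us = sdeg ws + k"
  by (induction L k x ws arbitrary: c us rule: bracket_into.induct) fastforce+

lemma boundary_word:
  "(c, us) \<in> set (boundary L ws) \<Longrightarrow> Suc (length us) = length ws \<and> Suc (sdeg us) = sdeg ws"
  by (induction L ws arbitrary: c us rule: boundary.induct) (fastforce dest: bracket_into_word)+

lemma sum_list_terms_cong_scaled:
  assumes "\<And>c us. (c, us) \<in> set xs \<Longrightarrow> g us = r * f us"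
  shows "(\<Sum>(c, us)\<leftarrow>xs. c * g us) = (r::rat) * (\<Sum>(c, us)\<leftarrow>xs. c * f us)"
  using assms
proof (induction xs)
  case (Cons a xs)
  obtain c us where a: "a = (c, us)" by fastforce
  have "g us = r * f us" using Cons.prems[of c us] a by simp
  moreover have "(\<Sum>(c, us)\<leftarrow>xs. c * g us) = r * (\<Sum>(c, us)\<leftarrow>xs. c * f us)"
    using Cons.prems by (intro Cons.IH) auto
  ultimately show ?case by (simp add: a algebra_simps)
qed simp

lemma bracket_form_twist: "bracket_form L k x (twist m f) = (-1) ^ (m * k) *\<^sub>Q twist m (bracket_form L k x f)"
proof (rule ext)
  fix ws
  have "twist m f us = (-1) ^ (m * (sdeg ws + k)) * f us" if "(c, us) \<in> set (bracket_into L k x ws)" for c us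
    using bracket_into_word[OF that] by (simp add: twist_apply)
  from sum_list_terms_cong_scaled[of "bracket_into L k x ws" "twist m f", OF this]
  show "bracket_form L k x (twist m f) ws = ((-1) ^ (m * k) *\<^sub>Q twist m (bracket_form L k x f)) ws"
    unfolding bracket_form_def by (simp add: twist_apply[of m "\<lambda>ws. sum_list (g ws)" for g] distrib_left power_add)
qed

lemma bdry_form_twist: "bdry_form L (twist m f) = (-1) ^ m *\<^sub>Q twist m (bdry_form L f)"
proof (rule ext)
  fix ws
  have "twist m f us = (-1) ^ (m * sdeg ws + m) * f us" if "(c, us) \<in> set (boundary L ws)" for c us
  proof -
    have "sdeg ws = Suc (sdeg us)" using boundary_word[OF that] by simp
    then show ?thesis by (simp add: twist_apply minus_one_power_iff)
  qed
  from sum_list_terms_cong_scaled[of "boundary L ws" "twist m f", OF this]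
  show "bdry_form L (twist m f) ws = ((-1) ^ m *\<^sub>Q twist m (bdry_form L f)) ws"
    unfolding bdry_form_def by (simp add: twist_apply[of m "\<lambda>ws. sum_list (g ws)" for g] power_add)
qed

text \<open>Every term of \<open>bracket_into\<close> changes a single letter, and this letter goes to one of the two factors of the
  coproduct. The Leibniz rules are therefore identities on words that hold for every binary operation \<open>lbr\<close>; in this form they
  apply to the bracket dual to a differential before it is known to be a Lie bracket.\<close>

lemma bracket_form_Leibniz:
  "bracket_form L k x (cochain_mul f g)
     = cochain_mul (bracket_form L k x f) g + cochain_mul (twist k f) (bracket_form L k x g)"
proof (rule ext)
  show "bracket_form L k x (cochain_mul f g) ws
     = (cochain_mul (bracket_form L k x f) g + cochain_mul (twist k f) (bracket_form L k x g)) ws" for ws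
  proof (induction ws arbitrary: f g)
    case (Cons a ws)
    obtain l y where a: "a = (l, y)" by fastforce
    show ?case
      by (simp add: a contract_mul Cons.IH contract_bracket_form contract_twist bracket_form_twist
            cochain_mul_linear twist_add)
        (cases "even k"; cases "even l"; simp add: minus_one_power_iff cochain_mul_linear cochain_mul_minus[unfolded fun_Compl_def] add.commute)
  qed simp
qed

lemma bdry_form_Leibniz:
  "bdry_form L (cochain_mul f g) = cochain_mul (bdry_form L f) g + cochain_mul (twist 1 f) (bdry_form L g)"
proof (rule ext)
  show "bdry_form L (cochain_mul f g) ws
     = (cochain_mul (bdry_form L f) g + cochain_mul (twist 1 f) (bdry_form L g)) ws" for ws
  proof (induction ws arbitrary: f g)
    case (Cons a ws)
    obtain l y where a: "a = (l, y)" by fastforce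
    show ?case
      by (simp add: a contract_mul Cons.IH contract_bdry_form contract_twist bdry_form_twist
            bracket_form_Leibniz cochain_mul_linear twist_add)
        (cases "even l"; simp add: minus_one_power_iff cochain_mul_linear cochain_mul_minus[unfolded fun_Compl_def] add.commute)
  qed simp
qed

subsection \<open>Words in the boundary\<close>

lemma bdry_form_eq_0I:
  assumes "\<And>us. Suc (length us) = length ws \<Longrightarrow> Suc (sdeg us) = sdeg ws \<Longrightarrow> f us = 0"
  shows "bdry_form L f ws = 0"
proof -
  have "map (\<lambda>(c, us). c * f us) (boundary L ws) = map (\<lambda>_. 0) (boundary L ws)"
    using assms boundary_word by (intro map_cong) fastforce+
  then show ?thesis unfolding bdry_form_def by (simp only: sum_list_0)
qed

definition bracket_closed :: "'a glie \<Rightarrow> bool" where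
  "bracket_closed L \<longleftrightarrow> (\<forall>i j. \<forall>x\<in>lcomp L i. \<forall>y\<in>lcomp L j. lbr L i j x y \<in> lcomp L (i + j))"

lemma bracket_form_cong:
  assumes "bracket_closed L" "ws \<in> words (lcomp L)" "x \<in> lcomp L k"
    and "\<And>us. us \<in> words (lcomp L) \<Longrightarrow> f us = g us"
  shows "bracket_form L k x f ws = bracket_form L k x g ws"
  using assms(2,4)
proof (induction ws arbitrary: f g)
  case (Cons a ws)
  obtain l y where a: "a = (l, y)" by fastforce
  have "lbr L k l x y \<in> lcomp L (k + l)"
    using assms(1,3) Cons.prems(1) by (simp add: a bracket_closed_def)
  moreover have "bracket_form L k x (contract l y f) ws = bracket_form L k x (contract l y g) ws"
    using Cons.prems by (intro Cons.IH) (simp_all add: a contract_apply)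
  ultimately show ?case using Cons.prems by (simp add: a)
qed simp

lemma bdry_form_cong:
  assumes "bracket_closed L" "ws \<in> words (lcomp L)"
    and "\<And>us. us \<in> words (lcomp L) \<Longrightarrow> f us = g us"
  shows "bdry_form L f ws = bdry_form L g ws"
  using assms(2,3)
proof (induction ws arbitrary: f g)
  case (Cons a ws)
  obtain l y where a: "a = (l, y)" by fastforce
  have "bracket_form L l y f ws = bracket_form L l y g ws"
    using Cons.prems by (intro bracket_form_cong[OF assms(1)]) (simp_all add: a)
  moreover have "bdry_form L (contract l y f) ws = bdry_form L (contract l y g) ws"
    using Cons.prems by (intro Cons.IH) (simp_all add: a contract_apply)
  ultimately show ?case by (simp add: a)
qed simp

subsection \<open>The square of the differential\<close>

lemma graded_lieD:
  assumes "graded_lie L"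
  shows "graded_space (lcomp L)" "bracket_closed L"
    "bilinear_map_on (lcomp L i) (lcomp L j) (lbr L i j)"
    "x \<in> lcomp L i \<Longrightarrow> y \<in> lcomp L j \<Longrightarrow> lbr L i j x y \<in> lcomp L (i + j)"
    "x \<in> lcomp L i \<Longrightarrow> y \<in> lcomp L j \<Longrightarrow> lbr L i j x y = - ((-1) ^ (i * j) *\<^sub>Q lbr L j i y x)"
    "x \<in> lcomp L i \<Longrightarrow> y \<in> lcomp L j \<Longrightarrow> z \<in> lcomp L k \<Longrightarrow>
        lbr L i (j + k) x (lbr L j k y z) =
          lbr L (i + j) k (lbr L i j x y) z
          + (-1) ^ (i * j) *\<^sub>Q lbr L j (i + k) y (lbr L i k x z)"
  using assms unfolding graded_lie_def bracket_closed_def by blast+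

lemma graded_space_subspace: "graded_space W \<Longrightarrow> ratvec.subspace (W k)"
  by (simp add: graded_space_def)

text \<open>Letter by letter this is the Jacobi identity: on a letter \<open>z\<close> the two sides are \<open>[[x, y], z]\<close> and
  \<open>[x, [y, z]] - [y, [x, z]]\<close> up to sign.\<close>

lemma bracket_form_bracket:
  assumes L: "graded_lie L" and x: "x \<in> lcomp L i" and y: "y \<in> lcomp L j"
    and "sym_form (lcomp L) f" "ws \<in> words (lcomp L)"
  shows "bracket_form L (i + j) (lbr L i j x y) f ws
    = (-1) ^ (i * j) * bracket_form L i x (bracket_form L j y f) ws
      - bracket_form L j y (bracket_form L i x f) ws"
  using assms(4,5)
proof (induction ws arbitrary: f)
  case (Cons a ws)
  obtain l z where a: "a = (l, z)" by fastforce
  have z: "z \<in> lcomp L l" and ws: "ws \<in> words (lcomp L)" using Cons.prems(2) by (auto simp: a)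
  note closed = graded_lieD(4)[OF L]
  have lin: "linear_map_on (lcomp L n) (\<lambda>x. f ((n, x) # ws))" for n
    by (rule sym_form_linear_front[OF Cons.prems(1) ws])
  have in1: "lbr L (i + j) l (lbr L i j x y) z \<in> lcomp L (i + j + l)"
    using closed[OF closed[OF x y] z] .
  have in2: "lbr L j (i + l) y (lbr L i l x z) \<in> lcomp L (i + j + l)"
    using closed[OF y closed[OF x z]] by (simp add: ac_simps)
  have "f ((i + j + l, lbr L i (j + l) x (lbr L j l y z)) # ws)
    = f ((i + j + l, lbr L (i + j) l (lbr L i j x y) z) # ws)
      + (-1) ^ (i * j) * f ((i + j + l, lbr L j (i + l) y (lbr L i l x z)) # ws)"
    using in1 in2 ratvec.subspace_scale[OF graded_space_subspace[OF graded_lieD(1)[OF L]] in2]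
    by (simp add: graded_lieD(6)[OF L x y z] linear_map_on_add[OF lin] linear_map_on_scale[OF lin])
  then have jac: "f ((i + (j + l), lbr L i (j + l) x (lbr L j l y z)) # ws)
    = f ((i + (j + l), lbr L (i + j) l (lbr L i j x y) z) # ws)
      + (-1) ^ (i * j) * f ((i + (j + l), lbr L j (i + l) y (lbr L i l x z)) # ws)"
    by (simp add: add.assoc)
  show ?case
    using jac
    by (simp add: a contract_bracket_form Cons.IH[OF sym_form_contract[OF Cons.prems(1) z] ws]
          add.left_commute[of j i l] add.assoc)
      (cases "even i"; cases "even j"; cases "even l"; simp add: minus_one_power_iff)
qed simp

text \<open>In the induction step the first letter \<open>z\<close> contributes bracketing by \<open>z\<close> to the differential. Its commutator with bracketing
  by \<open>x\<close> is bracketing by \<open>[x, z]\<close> (\<open>bracket_form_bracket\<close>), which cancels against the terms where \<open>x\<close> is bracketed with \<open>z\<close>.\<close>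

lemma bracket_form_bdry_form:
  assumes L: "graded_lie L" and x: "x \<in> lcomp L i"
    and "sym_form (lcomp L) f" "ws \<in> words (lcomp L)"
  shows "bracket_form L i x (bdry_form L f) ws = (-1) ^ i * bdry_form L (bracket_form L i x f) ws"
  using assms(3,4)
proof (induction ws arbitrary: f)
  case (Cons a ws)
  obtain l z where a: "a = (l, z)" by fastforce
  have z: "z \<in> lcomp L l" and ws: "ws \<in> words (lcomp L)" using Cons.prems(2) by (auto simp: a)
  show ?case
    by (simp add: a contract_bracket_form contract_bdry_form
          Cons.IH[OF sym_form_contract[OF Cons.prems(1) z] ws]
          bracket_form_bracket[OF L x z Cons.prems(1) ws])
      (cases "even i"; cases "even l"; simp add: minus_one_power_iff)
qed simp

text \<open>Splitting off the first letter \<open>z\<close> leaves \<open>d\<^sup>2\<close> on the rest of the word and the graded commutator of \<open>d\<close> with bracketing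
  by \<open>z\<close>, which vanishes by \<open>bracket_form_bdry_form\<close>.\<close>

lemma bdry_form_bdry_form:
  assumes L: "graded_lie L" and "sym_form (lcomp L) f" "ws \<in> words (lcomp L)"
  shows "bdry_form L (bdry_form L f) ws = 0"
  using assms(2,3)
proof (induction ws arbitrary: f)
  case (Cons a ws)
  obtain l z where a: "a = (l, z)" by fastforce
  have z: "z \<in> lcomp L l" and ws: "ws \<in> words (lcomp L)" using Cons.prems(2) by (auto simp: a)
  show ?case
    by (simp add: a contract_bdry_form Cons.IH[OF sym_form_contract[OF Cons.prems(1) z] ws]
          bracket_form_bdry_form[OF L z Cons.prems(1) ws])
qed simp

subsection \<open>The differential preserves graded symmetric forms\<close>

lemma bracket_form_linear_arg:
  assumes L: "graded_lie L" and "sym_form (lcomp L) f" "ws \<in> words (lcomp L)"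
  shows "linear_map_on (lcomp L k) (\<lambda>x. bracket_form L k x f ws)"
  using assms(2,3)
proof (induction ws arbitrary: f)
  case Nil
  then show ?case by (simp add: linear_map_on_const0)
next
  case (Cons a ws)
  obtain l z where a: "a = (l, z)" by fastforce
  have z: "z \<in> lcomp L l" and ws: "ws \<in> words (lcomp L)" using Cons.prems(2) by (auto simp: a)
  have "linear_map_on (lcomp L k) (\<lambda>x. f ((k + l, lbr L k l x z) # ws))"
    by (rule linear_map_on_compose[OF bilinear_map_on_left[OF graded_lieD(3)[OF L] z]
          sym_form_linear_front[OF Cons.prems(1) ws]])
      (rule graded_lieD(4)[OF L _ z])
  moreover have "linear_map_on (lcomp L k) (\<lambda>x. bracket_form L k x (contract l z f) ws)"
    by (rule Cons.IH[OF sym_form_contract[OF Cons.prems(1) z] ws])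
  ultimately show ?case by (simp add: a linear_map_on_plus linear_map_on_mult del: power_Suc)
qed

lemma bracket_form_linear_word:
  assumes L: "graded_lie L" and z: "z \<in> lcomp L k" and ws: "ws \<in> words (lcomp L)"
    and "sym_form (lcomp L) f" "us \<in> words (lcomp L)"
  shows "linear_map_on (lcomp L l) (\<lambda>x. bracket_form L k z f (us @ (l, x) # ws))"
  using assms(4,5)
proof (induction us arbitrary: f)
  case Nil
  have "linear_map_on (lcomp L l) (\<lambda>x. f ((k + l, lbr L k l z x) # ws))"
    by (rule linear_map_on_compose[OF bilinear_map_on_right[OF graded_lieD(3)[OF L] z]
          sym_form_linear_front[OF Nil.prems(1) ws]])
      (rule graded_lieD(4)[OF L z])
  moreover have "linear_map_on (lcomp L l) (\<lambda>x. bracket_form L k z (contract l x f) ws)"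
    using contract_linear[OF Nil.prems(1) graded_lieD(1)[OF L], of l]
    by (simp add: linear_map_on_def)
  ultimately show ?case by (simp add: linear_map_on_plus linear_map_on_mult del: power_Suc)
next
  case (Cons a us)
  obtain m u where a: "a = (m, u)" by fastforce
  have u: "u \<in> lcomp L m" and us: "us \<in> words (lcomp L)" using Cons.prems(2) by (auto simp: a)
  have "linear_map_on (lcomp L l) (\<lambda>x. f ((k + m, lbr L k m z u) # us @ (l, x) # ws))"
    using sym_form_linear[OF Cons.prems(1), of "(k + m, lbr L k m z u) # us" ws l] us ws
      graded_lieD(4)[OF L z u] by simp
  then show ?case
    using Cons.IH[OF sym_form_contract[OF Cons.prems(1) u] us]
    by (simp add: a linear_map_on_plus linear_map_on_mult del: power_Suc)
qed

lemma bracket_form_swap: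
  assumes L: "graded_lie L" and z: "z \<in> lcomp L k" and ws: "ws \<in> words (lcomp L)"
    and x: "x \<in> lcomp L i" and y: "y \<in> lcomp L j"
    and "sym_form (lcomp L) f" "us \<in> words (lcomp L)"
  shows "bracket_form L k z f (us @ (i, x) # (j, y) # ws)
     = (-1) ^ (Suc i * Suc j) * bracket_form L k z f (us @ (j, y) # (i, x) # ws)"
  using assms(6,7)
proof (induction us arbitrary: f)
  case Nil
  note swap = sym_form_swap[OF Nil.prems(1), of "[]" ws, simplified, OF ws]
  show ?case
    using swap[OF graded_lieD(4)[OF L z x] y] swap[OF graded_lieD(4)[OF L z y] x]
    by (simp add: contract_contract[OF Nil.prems(1) x y] contract_apply)
      (cases "even i"; cases "even j"; cases "even k"; simp add: minus_one_power_iff)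
next
  case (Cons a us)
  obtain m u where a: "a = (m, u)" by fastforce
  have u: "u \<in> lcomp L m" and us: "us \<in> words (lcomp L)" using Cons.prems(2) by (auto simp: a)
  have "f ((k + m, lbr L k m z u) # us @ (i, x) # (j, y) # ws)
    = (-1) ^ (Suc i * Suc j) * f ((k + m, lbr L k m z u) # us @ (j, y) # (i, x) # ws)"
    using sym_form_swap[OF Cons.prems(1), of "(k + m, lbr L k m z u) # us" ws x i y j] us ws x y
      graded_lieD(4)[OF L z u] by simp
  then show ?case
    using Cons.IH[OF sym_form_contract[OF Cons.prems(1) u] us]
    by (simp add: a algebra_simps)
qed

lemma bdry_form_linear_word:
  assumes L: "graded_lie L" and ws: "ws \<in> words (lcomp L)"
    and "sym_form (lcomp L) f" "us \<in> words (lcomp L)"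
  shows "linear_map_on (lcomp L l) (\<lambda>x. bdry_form L f (us @ (l, x) # ws))"
  using assms(3,4)
proof (induction us arbitrary: f)
  case Nil
  have "linear_map_on (lcomp L l) (\<lambda>x. bdry_form L (contract l x f) ws)"
    using contract_linear[OF Nil.prems(1) graded_lieD(1)[OF L], of l]
    by (simp add: linear_map_on_def)
  then show ?case
    using bracket_form_linear_arg[OF L Nil.prems(1) ws, of l]
    by (simp add: linear_map_on_plus linear_map_on_mult del: power_Suc)
next
  case (Cons a us)
  obtain m u where a: "a = (m, u)" by fastforce
  have u: "u \<in> lcomp L m" and us: "us \<in> words (lcomp L)" using Cons.prems(2) by (auto simp: a)
  show ?case
    using Cons.IH[OF sym_form_contract[OF Cons.prems(1) u] us]
      bracket_form_linear_word[OF L u ws Cons.prems(1) us, of l]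
    by (simp add: a linear_map_on_plus linear_map_on_mult del: power_Suc)
qed

text \<open>For two letters at the front, the term in which they are bracketed with each other is symmetric because the bracket is
  antisymmetric, and the terms in which one of them is bracketed into the rest of the word are interchanged.\<close>

lemma bdry_form_swap:
  assumes L: "graded_lie L" and ws: "ws \<in> words (lcomp L)"
    and x: "x \<in> lcomp L i" and y: "y \<in> lcomp L j"
    and "sym_form (lcomp L) f" "us \<in> words (lcomp L)"
  shows "bdry_form L f (us @ (i, x) # (j, y) # ws)
     = (-1) ^ (Suc i * Suc j) * bdry_form L f (us @ (j, y) # (i, x) # ws)"
  using assms(5,6)
proof (induction us arbitrary: f)
  case Nil
  have sub: "ratvec.subspace (lcomp L n)" for n
    by (rule graded_space_subspace[OF graded_lieD(1)[OF L]])
  have yx: "lbr L j i y x \<in> lcomp L (i + j)"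
    using graded_lieD(4)[OF L y x] by (simp add: add.commute)
  note lin = sym_form_linear_front[OF Nil.prems(1) ws, of "i + j"]
  have "f ((i + j, lbr L i j x y) # ws) = - ((-1) ^ (i * j) * f ((j + i, lbr L j i y x) # ws))"
    unfolding graded_lieD(5)[OF L x y]
    using yx ratvec.subspace_scale[OF sub yx]
    by (simp add: linear_map_on_minus[OF lin] linear_map_on_scale[OF lin] add.commute)
  then show ?case
    by (simp add: contract_contract[OF Nil.prems(1) x y] add.commute)
      (cases "even i"; cases "even j"; simp add: minus_one_power_iff)
next
  case (Cons a us)
  obtain m u where a: "a = (m, u)" by fastforce
  have u: "u \<in> lcomp L m" and us: "us \<in> words (lcomp L)" using Cons.prems(2) by (auto simp: a)
  show ?case
    using Cons.IH[OF sym_form_contract[OF Cons.prems(1) u] us]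
      bracket_form_swap[OF L u ws x y Cons.prems(1) us]
    by (simp add: a algebra_simps)
qed

lemma cochain_dif_sym_form:
  assumes L: "graded_lie L" and f: "sym_form (lcomp L) f"
  shows "sym_form (lcomp L) (cochain_dif L f)"
  unfolding sym_form_def
proof (intro conjI ballI allI impI)
  show "cochain_dif L f ws = 0" if "ws \<notin> words (lcomp L)" for ws
    using that by (simp add: cochain_dif_alt)
next
  fix us ws k assume "us \<in> words (lcomp L)" "ws \<in> words (lcomp L)"
  then show "linear_map_on (lcomp L k) (\<lambda>x. cochain_dif L f (us @ (k, x) # ws))"
    using bdry_form_linear_word[OF L _ f, of ws us k]
      linear_map_on_cong[of "lcomp L k" "\<lambda>x. cochain_dif L f (us @ (k, x) # ws)"
        "\<lambda>x. bdry_form L f (us @ (k, x) # ws)"]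
      graded_space_subspace[OF graded_lieD(1)[OF L], of k]
    by (simp add: cochain_dif_alt)
next
  fix us ws i j x y assume us: "us \<in> words (lcomp L)" and ws: "ws \<in> words (lcomp L)"
    and x: "x \<in> lcomp L i" and y: "y \<in> lcomp L j"
  then show "cochain_dif L f (us @ (i, x) # (j, y) # ws)
      = (-1) ^ (Suc i * Suc j) * cochain_dif L f (us @ (j, y) # (i, x) # ws)"
    using bdry_form_swap[OF L ws x y f us] by (simp add: cochain_dif_alt)
qed

lemma cochain_dif_linear:
  "cochain_dif L (f + g) = cochain_dif L f + cochain_dif L g"
  "cochain_dif L (c *\<^sub>Q f) = c *\<^sub>Q cochain_dif L f"
  by (auto simp: cochain_dif_alt fun_eq_iff)

lemma cochain_dif_Leibniz:
  assumes f: "\<And>ws. ws \<notin> words (lcomp L) \<Longrightarrow> f ws = 0" and g: "\<And>ws. ws \<notin> words (lcomp L) \<Longrightarrow> g ws = 0"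
  shows "cochain_dif L (cochain_mul f g)
    = cochain_mul (cochain_dif L f) g + cochain_mul (twist 1 f) (cochain_dif L g)"
proof (rule ext)
  fix ws
  show "cochain_dif L (cochain_mul f g) ws
    = (cochain_mul (cochain_dif L f) g + cochain_mul (twist 1 f) (cochain_dif L g)) ws"
  proof (cases "ws \<in> words (lcomp L)")
    case True
    have "cochain_mul (bdry_form L f) g ws = cochain_mul (cochain_dif L f) g ws"
      "cochain_mul (twist 1 f) (bdry_form L g) ws = cochain_mul (twist 1 f) (cochain_dif L g) ws"
      by (rule cochain_mul_cong[OF True]; simp add: cochain_dif_alt)+
    then show ?thesis using True by (simp add: cochain_dif_alt[of L "cochain_mul f g"] bdry_form_Leibniz)
  next
    case False
    have split: "us \<notin> words (lcomp L) \<or> vs \<notin> words (lcomp L)" if "set us \<union> set vs = set ws" for us vs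
      using False that unfolding words_def by blast
    have "cochain_mul (cochain_dif L f) g ws = 0"
      by (rule cochain_mul_eq_0I) (use split g in \<open>auto simp: cochain_dif_alt\<close>)
    moreover have "cochain_mul (twist 1 f) (cochain_dif L g) ws = 0"
      by (rule cochain_mul_eq_0I) (use split f in \<open>auto simp: cochain_dif_alt twist_def\<close>)
    ultimately show ?thesis using False by (simp add: cochain_dif_alt[of L "cochain_mul f g"])
  qed
qed

lemma cochain_dif_cochain_dif:
  assumes L: "graded_lie L" and f: "sym_form (lcomp L) f"
  shows "cochain_dif L (cochain_dif L f) = 0"
proof (rule ext)
  fix ws
  have "bdry_form L (cochain_dif L f) ws = bdry_form L (bdry_form L f) ws" if "ws \<in> words (lcomp L)"
    by (rule bdry_form_cong[OF graded_lieD(2)[OF L] that]) (simp add: cochain_dif_alt)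
  then show "cochain_dif L (cochain_dif L f) ws = 0 ws"
    using bdry_form_bdry_form[OF L f] by (simp add: cochain_dif_alt[of L "cochain_dif L f"])
qed

subsection \<open>Forms on a quotient\<close>

definition vanishes_on :: "'a graded \<Rightarrow> ('a word \<Rightarrow> rat) \<Rightarrow> bool" where
  "vanishes_on I f \<longleftrightarrow> (\<forall>ws. (\<exists>(k, x)\<in>set ws. x \<in> I k) \<longrightarrow> f ws = 0)"

lemma vanishes_onD: "vanishes_on I f \<Longrightarrow> (k, x) \<in> set ws \<Longrightarrow> x \<in> I k \<Longrightarrow> f ws = 0"
  by (auto simp: vanishes_on_def)

lemma vanishes_on_contract: "vanishes_on I f \<Longrightarrow> vanishes_on I (contract k x f)"
  by (auto simp: vanishes_on_def contract_apply)

lemma contract_vanishes: "vanishes_on I f \<Longrightarrow> x \<in> I k \<Longrightarrow> contract k x f = 0"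
  by (rule ext) (auto simp: contract_apply intro: vanishes_onD)

lemma vanishes_on_mul:
  assumes "vanishes_on I f" "vanishes_on I g" shows "vanishes_on I (cochain_mul f g)"
  unfolding vanishes_on_def
proof (intro allI impI)
  fix ws assume "\<exists>(k, x)\<in>set ws. x \<in> I k"
  then obtain k x where kx: "(k, x) \<in> set ws" "x \<in> I k" by blast
  show "cochain_mul f g ws = 0"
  proof (rule cochain_mul_eq_0I)
    fix us vs assume "set us \<union> set vs = set ws"
    with kx(1) have "(k, x) \<in> set us \<or> (k, x) \<in> set vs" by blast
    then show "f us = 0 \<or> g vs = 0"
      using vanishes_onD[OF assms(1) _ kx(2)] vanishes_onD[OF assms(2) _ kx(2)] by blast
  qed
qed

lemma graded_idealD:
  assumes "graded_ideal L I"
  shows "ratvec.subspace (I k)" "I k \<subseteq> lcomp L k"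
    "x \<in> lcomp L i \<Longrightarrow> y \<in> I j \<Longrightarrow> lbr L i j x y \<in> I (i + j)"
  using assms unfolding graded_ideal_def graded_space_def by blast+

lemma graded_ideal_left:
  assumes L: "graded_lie L" and I: "graded_ideal L I" and x: "x \<in> I i" and y: "y \<in> lcomp L j"
  shows "lbr L i j x y \<in> I (i + j)"
proof -
  have "lbr L j i y x \<in> I (i + j)"
    using graded_idealD(3)[OF I y x] by (simp add: add.commute)
  moreover have "x \<in> lcomp L i" using graded_idealD(2)[OF I] x by blast
  ultimately show ?thesis
    by (simp add: graded_lieD(5)[OF L _ y] ratvec.subspace_neg ratvec.subspace_scale graded_idealD(1)[OF I])
qed

lemma bracket_form_vanishes:
  assumes L: "graded_lie L" and I: "graded_ideal L I"
    and "vanishes_on I f" "ws \<in> words (lcomp L)" "x \<in> lcomp L k" "x \<in> I k \<or> (\<exists>(l, y)\<in>set ws. y \<in> I l)"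
  shows "bracket_form L k x f ws = 0"
  using assms(3-6)
proof (induction ws arbitrary: f)
  case (Cons a ws)
  obtain l y where a: "a = (l, y)" by fastforce
  have y: "y \<in> lcomp L l" and ws: "ws \<in> words (lcomp L)" using Cons.prems(2) by (auto simp: a)
  consider "x \<in> I k" | "y \<in> I l" | "\<exists>(l, y)\<in>set ws. y \<in> I l"
    using Cons.prems(4) by (auto simp: a)
  then have "f ((k + l, lbr L k l x y) # ws) = 0 \<and> bracket_form L k x (contract l y f) ws = 0"
  proof cases
    case 1
    have "lbr L k l x y \<in> I (k + l)" by (rule graded_ideal_left[OF L I 1 y])
    then have "f ((k + l, lbr L k l x y) # ws) = 0" by (intro vanishes_onD[OF Cons.prems(1)]) auto
    then show ?thesis
      using Cons.IH[OF vanishes_on_contract[OF Cons.prems(1)] ws Cons.prems(3)] 1 by blast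
  next
    case 2
    have "lbr L k l x y \<in> I (k + l)" by (rule graded_idealD(3)[OF I Cons.prems(3) 2])
    then have "f ((k + l, lbr L k l x y) # ws) = 0" by (intro vanishes_onD[OF Cons.prems(1)]) auto
    then show ?thesis using contract_vanishes[of I f y l] Cons.prems(1) 2 by simp
  next
    case 3
    then have "f ((k + l, lbr L k l x y) # ws) = 0"
      by (auto intro: vanishes_onD[OF Cons.prems(1)])
    then show ?thesis
      using Cons.IH[OF vanishes_on_contract[OF Cons.prems(1)] ws Cons.prems(3)] 3 by blast
  qed
  then show ?case by (simp add: a)
qed simp

lemma bdry_form_vanishes:
  assumes L: "graded_lie L" and I: "graded_ideal L I"
    and "vanishes_on I f" "ws \<in> words (lcomp L)" "\<exists>(l, y)\<in>set ws. y \<in> I l"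
  shows "bdry_form L f ws = 0"
  using assms(3-5)
proof (induction ws arbitrary: f)
  case (Cons a ws)
  obtain l y where a: "a = (l, y)" by fastforce
  have y: "y \<in> lcomp L l" and ws: "ws \<in> words (lcomp L)" using Cons.prems(2) by (auto simp: a)
  have "bracket_form L l y f ws = 0"
    by (rule bracket_form_vanishes[OF L I Cons.prems(1) ws y]) (use Cons.prems(3) in \<open>auto simp: a\<close>)
  moreover have "bdry_form L (contract l y f) ws = 0"
  proof (cases "y \<in> I l")
    case True
    then show ?thesis using contract_vanishes[of I f y l] Cons.prems(1) by simp
  next
    case False
    then show ?thesis
      using Cons.IH[OF vanishes_on_contract[OF Cons.prems(1)] ws] Cons.prems(3) by (auto simp: a)
  qed
  ultimately show ?case by (simp add: a)
qed simp

lemma cochain_dif_vanishes: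
  assumes "graded_lie L" "graded_ideal L I" "vanishes_on I f"
  shows "vanishes_on I (cochain_dif L f)"
  using bdry_form_vanishes[OF assms] by (auto simp: vanishes_on_def cochain_dif_alt)

section \<open>Forms on a quotient of finite dimension\<close>

definition homog :: "nat \<Rightarrow> ('a word \<Rightarrow> rat) \<Rightarrow> bool" where
  "homog n f \<longleftrightarrow> (\<forall>ws. sdeg ws \<noteq> n \<longrightarrow> f ws = 0)"

definition len_homog :: "nat \<Rightarrow> ('a word \<Rightarrow> rat) \<Rightarrow> bool" where
  "len_homog p f \<longleftrightarrow> (\<forall>ws. length ws \<noteq> p \<longrightarrow> f ws = 0)"

lemma cochains_iff: "f \<in> cochains L n \<longleftrightarrow> sym_form (lcomp L) f \<and> homog n f"
  by (auto simp: cochains_alt homog_def)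

lemma quotient_cochains_iff:
  "f \<in> quotient_cochains L I n \<longleftrightarrow> sym_form (lcomp L) f \<and> homog n f \<and> vanishes_on I f"
  by (auto simp: quotient_cochains_def cochains_iff vanishes_on_def)

lemma homog_parity: "homog n f \<Longrightarrow> has_parity n f"
  by (auto simp: homog_def has_parity_def)

lemma homog_mul: "homog i f \<Longrightarrow> homog j g \<Longrightarrow> homog (i + j) (cochain_mul f g)"
  unfolding homog_def by (intro allI impI cochain_mul_eq_0I) metis

lemma len_homog_mul: "len_homog i f \<Longrightarrow> len_homog j g \<Longrightarrow> len_homog (i + j) (cochain_mul f g)"
  unfolding len_homog_def by (intro allI impI cochain_mul_eq_0I) metis

lemma homog_dif: "homog n f \<Longrightarrow> homog (Suc n) (cochain_dif L f)"
  unfolding homog_def cochain_dif_alt by (auto intro: bdry_form_eq_0I)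

lemma len_homog_dif: "len_homog n f \<Longrightarrow> len_homog (Suc n) (cochain_dif L f)"
  unfolding len_homog_def cochain_dif_alt by (auto intro: bdry_form_eq_0I)

lemma homog_contract: "homog n f \<Longrightarrow> Suc k \<le> n \<Longrightarrow> homog (n - Suc k) (contract k x f)"
  by (auto simp: homog_def contract_apply)

lemma homog_contract_0: "homog n f \<Longrightarrow> \<not> Suc k \<le> n \<Longrightarrow> contract k x f = 0"
  by (rule ext) (auto simp: homog_def contract_apply)

lemma len_homog_contract: "len_homog (Suc p) f \<Longrightarrow> len_homog p (contract k x f)"
  by (auto simp: len_homog_def contract_apply)

lemma length_le_sdeg: "length ws \<le> sdeg ws"
  by (induction ws) (auto simp: sdeg_def)

subsection \<open>Dual bases\<close>

text \<open>Triples of a degree, a vector and a functional: dual bases of the quotients \<open>W k / I k\<close> for all degrees in one list.\<close>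

definition dual_basis :: "'a::rat_vector graded \<Rightarrow> 'a graded \<Rightarrow> (nat \<times> 'a \<times> ('a \<Rightarrow> rat)) list \<Rightarrow> bool" where
  "dual_basis W I D \<longleftrightarrow>
     (\<forall>(k, e, v)\<in>set D. e \<in> W k \<and> linear_map_on UNIV v \<and> (\<forall>x\<in>I k. v x = 0)) \<and>
     (\<forall>k. \<forall>x\<in>W k. x - (\<Sum>(l, e, v)\<leftarrow>D. if l = k then v x *\<^sub>Q e else 0) \<in> I k)"

lemma dual_basisD:
  assumes "dual_basis W I D"
  shows "(k, e, v) \<in> set D \<Longrightarrow> e \<in> W k" "(k, e, v) \<in> set D \<Longrightarrow> linear_map_on UNIV v"
    "(k, e, v) \<in> set D \<Longrightarrow> x \<in> I k \<Longrightarrow> v x = 0"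
    "x \<in> W k \<Longrightarrow> x - (\<Sum>(l, e, v)\<leftarrow>D. if l = k then v x *\<^sub>Q e else 0) \<in> I k"
  using assms unfolding dual_basis_def by blast+

text \<open>Only finitely many degrees of the quotient are nonzero, so that dual bases of these can be concatenated.\<close>

lemma dual_basis_exists:
  assumes fin: "finite_dim_quotient L I" and sub: "\<And>k. ratvec.subspace (I k)"
  obtains D where "dual_basis (lcomp L) I D"
proof -
  obtain N where N: "\<And>k. k > N \<Longrightarrow> lcomp L k \<subseteq> I k"
    using fin unfolding finite_dim_quotient_def by blast
  define P where "P k D \<longleftrightarrow> (\<forall>(e, v)\<in>set D. e \<in> lcomp L k \<and> linear_map_on UNIV v \<and> (\<forall>x\<in>I k. v x = (0::rat))) \<and>
     (\<forall>x\<in>lcomp L k. x - (\<Sum>(e, v)\<leftarrow>D. v x *\<^sub>Q e) \<in> I k)" for k D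
  have "\<exists>D. P k D" for k
  proof -
    obtain B where B: "finite B" "B \<subseteq> lcomp L k" "lcomp L k \<subseteq> ratvec.span (B \<union> I k)"
      using fin unfolding finite_dim_quotient_def by blast
    obtain D :: "('a \<times> ('a \<Rightarrow> rat)) list" where
      "\<And>e v. (e, v) \<in> set D \<Longrightarrow> e \<in> lcomp L k \<and> linear_map_on UNIV v \<and> (\<forall>x\<in>I k. v x = 0)"
      "\<And>x. x \<in> ratvec.span (B \<union> I k) \<Longrightarrow> x - (\<Sum>(e, v)\<leftarrow>D. v x *\<^sub>Q e) \<in> I k"
      using finite_codim_dual_basis[OF B(1,2) sub] by blast
    then have "P k D" using B(3) unfolding P_def by auto
    then show ?thesis ..
  qed
  then obtain D where "\<And>k. P k (D k)" by metis
  then have D: "\<forall>(e, v)\<in>set (D k). e \<in> lcomp L k \<and> linear_map_on UNIV v \<and> (\<forall>x\<in>I k. v x = (0::rat))"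
     "\<forall>x\<in>lcomp L k. x - (\<Sum>(e, v)\<leftarrow>D k. v x *\<^sub>Q e) \<in> I k" for k
    by (simp_all add: P_def)
  define T where "T = (\<lambda>ks. concat (map (\<lambda>k. map (\<lambda>(e, v). (k, e, v)) (D k)) ks))"
  have one: "(\<Sum>(l, e, v)\<leftarrow>map (\<lambda>(e, v). (j, e, v)) xs. if l = k then v x *\<^sub>Q e else 0)
      = (if j = k then (\<Sum>(e, v)\<leftarrow>xs. v x *\<^sub>Q e) else 0)" for j k x and xs :: "('a \<times> ('a \<Rightarrow> rat)) list"
    by (induction xs) auto
  have T: "(\<Sum>(l, e, v)\<leftarrow>T ks. if l = k then v x *\<^sub>Q e else 0)
      = (if k \<in> set ks then \<Sum>(e, v)\<leftarrow>D k. v x *\<^sub>Q e else 0)" if "distinct ks" for ks k x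
    using that
  proof (induction ks)
    case (Cons j ks)
    have "(\<Sum>(l, e, v)\<leftarrow>T (j # ks). if l = k then v x *\<^sub>Q e else 0)
      = (\<Sum>(l, e, v)\<leftarrow>map (\<lambda>(e, v). (j, e, v)) (D j). if l = k then v x *\<^sub>Q e else 0)
        + (\<Sum>(l, e, v)\<leftarrow>T ks. if l = k then v x *\<^sub>Q e else 0)"
      unfolding T_def by simp
    also have "\<dots> = (if j = k then (\<Sum>(e, v)\<leftarrow>D j. v x *\<^sub>Q e) else 0)
        + (if k \<in> set ks then \<Sum>(e, v)\<leftarrow>D k. v x *\<^sub>Q e else 0)"
      unfolding one using Cons by simp
    also have "\<dots> = (if k \<in> set (j # ks) then \<Sum>(e, v)\<leftarrow>D k. v x *\<^sub>Q e else 0)"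
      using Cons.prems by auto
    finally show ?case .
  qed (simp add: T_def)
  have "dual_basis (lcomp L) I (T [0..<Suc N])"
    unfolding dual_basis_def
  proof (intro conjI allI ballI)
    show "case t of (k, e, v) \<Rightarrow> e \<in> lcomp L k \<and> linear_map_on UNIV v \<and> (\<forall>x\<in>I k. v x = 0)"
      if "t \<in> set (T [0..<Suc N])" for t
      using that D(1) by (fastforce simp: T_def)
    fix k x assume x: "x \<in> lcomp L k"
    have "x - (if k \<in> set [0..<Suc N] then \<Sum>(e, v)\<leftarrow>D k. v x *\<^sub>Q e else 0) \<in> I k"
    proof (cases "k \<in> set [0..<Suc N]")
      case True
      then show ?thesis using D(2) x by simp
    next
      case False
      then have "k > N" by auto
      then show ?thesis using N x False by auto
    qed
    then show "x - (\<Sum>(l, e, v)\<leftarrow>T [0..<Suc N]. if l = k then v x *\<^sub>Q e else 0) \<in> I k"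
      by (subst T) (simp_all only: distinct_upt)
  qed
  then show thesis using that by blast
qed

subsection \<open>Linear forms\<close>

text \<open>The functional \<open>v\<close> on \<open>W k\<close> as a linear form on \<open>sW\<close>.\<close>

definition letter_form :: "'a graded \<Rightarrow> nat \<Rightarrow> ('a \<Rightarrow> rat) \<Rightarrow> 'a word \<Rightarrow> rat" where
  "letter_form W k v = (\<lambda>ws. case ws of [(l, x)] \<Rightarrow> if l = k \<and> x \<in> W k then v x else 0 | _ \<Rightarrow> 0)"

text \<open>The generators of degree \<open>n\<close> of the model of \<open>W / I\<close>.\<close>

definition one_forms :: "'a::rat_vector graded \<Rightarrow> 'a graded \<Rightarrow> nat \<Rightarrow> ('a word \<Rightarrow> rat) set" where
  "one_forms W I n = {f. sym_form W f \<and> homog n f \<and> vanishes_on I f \<and> len_homog 1 f}"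

lemma letter_form_apply:
  "letter_form W k v [(l, x)] = (if l = k \<and> x \<in> W k then v x else 0)"
  "length ws \<noteq> 1 \<Longrightarrow> letter_form W k v ws = 0"
  by (auto simp: letter_form_def split: list.splits)

lemma contract_letter_form:
  "contract l x (letter_form W k v) = (if l = k \<and> x \<in> W k then v x else 0) *\<^sub>Q single []"
proof (rule ext)
  show "contract l x (letter_form W k v) ws = ((if l = k \<and> x \<in> W k then v x else 0) *\<^sub>Q single []) ws" for ws
    by (cases ws) (auto simp: contract_apply letter_form_apply single_def)
qed

lemma length_Suc_0E:
  assumes "length ws = Suc 0" obtains k x where "ws = [(k, x)]"
  using assms by (cases ws) auto

lemma letter_form_in_one_forms:
  assumes W: "graded_space W" and v: "linear_map_on (W k) v" and I: "\<And>x. x \<in> W k \<Longrightarrow> x \<in> I k \<Longrightarrow> v x = 0"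
  shows "letter_form W k v \<in> one_forms W I (Suc k)"
proof -
  have outside: "letter_form W k v ws = 0" if "ws \<notin> words W" for ws
    using that by (cases "length ws = 1") (auto elim!: length_Suc_0E simp: letter_form_apply)
  have "sym_form W (letter_form W k v)"
    unfolding sym_form_def
  proof (intro conjI ballI allI impI)
    fix us ws l
    show "linear_map_on (W l) (\<lambda>x. letter_form W k v (us @ (l, x) # ws))"
    proof (cases "us = [] \<and> ws = [] \<and> l = k")
      case True
      then show ?thesis
        using v linear_map_on_cong[of "W k" "\<lambda>x. letter_form W k v [(k, x)]" v] graded_space_subspace[OF W]
        by (simp add: letter_form_apply)
    next
      case False
      then have "letter_form W k v (us @ (l, x) # ws) = 0" for x
        by (cases "us = [] \<and> ws = []") (auto simp: letter_form_apply)
      then show ?thesis by (simp add: linear_map_on_const0)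
    qed
  qed (simp_all add: outside letter_form_apply)
  moreover have "homog (Suc k) (letter_form W k v)"
    unfolding homog_def
  proof (intro allI impI)
    show "letter_form W k v ws = 0" if "sdeg ws \<noteq> Suc k" for ws
      using that by (cases "length ws = 1") (auto elim!: length_Suc_0E simp: letter_form_apply)
  qed
  moreover have "vanishes_on I (letter_form W k v)"
    unfolding vanishes_on_def
  proof (intro allI impI)
    show "letter_form W k v ws = 0" if "\<exists>(k, x)\<in>set ws. x \<in> I k" for ws
      using that I by (cases "length ws = 1") (auto elim!: length_Suc_0E simp: letter_form_apply)
  qed
  moreover have "len_homog 1 (letter_form W k v)"
    by (simp add: len_homog_def letter_form_apply)
  ultimately show ?thesis by (simp add: one_forms_def)
qed

lemma letter_form_dual_basis:
  assumes W: "graded_space W" and D: "dual_basis W I D" and t: "(k, e, v) \<in> set D"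
  shows "letter_form W k v \<in> one_forms W I (Suc k)"
  using linear_map_on_subset[OF dual_basisD(2)[OF D t], of "W k"] dual_basisD(3)[OF D t]
  by (intro letter_form_in_one_forms[OF W]) auto

lemma one_formsD:
  assumes "f \<in> one_forms W I n"
  shows "sym_form W f" "homog n f" "vanishes_on I f" "len_homog 1 f" "has_parity n f"
    "contract k x f = f [(k, x)] *\<^sub>Q single []"
    "Suc k \<noteq> n \<Longrightarrow> f [(k, x)] = 0"
proof -
  show "sym_form W f" "homog n f" "vanishes_on I f" and len: "len_homog 1 f"
    using assms by (auto simp: one_forms_def)
  then show "has_parity n f" "Suc k \<noteq> n \<Longrightarrow> f [(k, x)] = 0"
    by (auto simp: homog_parity homog_def)
  show "contract k x f = f [(k, x)] *\<^sub>Q single []"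
  proof (rule ext)
    show "contract k x f ws = (f [(k, x)] *\<^sub>Q single []) ws" for ws
      using len by (cases ws) (auto simp: len_homog_def contract_apply single_def)
  qed
qed

lemma one_forms_eqI:
  assumes "f \<in> one_forms W I n" "g \<in> one_forms W I' n"
    and "\<And>k x. n = Suc k \<Longrightarrow> x \<in> W k \<Longrightarrow> f [(k, x)] = g [(k, x)]"
  shows "f = g"
proof (rule ext)
  fix ws
  show "f ws = g ws"
  proof (cases "length ws = 1")
    case True
    then obtain k x where ws: "ws = [(k, x)]" by (auto elim: length_Suc_0E)
    show ?thesis
    proof (cases "n = Suc k \<and> x \<in> W k")
      case True
      then show ?thesis using assms(3) ws by simp
    next
      case False
      then have "f [(k, x)] = 0 \<and> g [(k, x)] = 0"
        using one_formsD(7)[OF assms(1), of k x] one_formsD(7)[OF assms(2), of k x]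
          sym_form_outside[OF one_formsD(1)[OF assms(1)], of ws] sym_form_outside[OF one_formsD(1)[OF assms(2)], of ws]
        by (cases "x \<in> W k") (auto simp: ws)
      then show ?thesis by (simp add: ws)
    qed
  next
    case False
    then show ?thesis using one_formsD(4)[OF assms(1)] one_formsD(4)[OF assms(2)] by (simp add: len_homog_def)
  qed
qed

lemma one_forms_linear:
  assumes "f \<in> one_forms W I (Suc k)"
  shows "linear_map_on (W k) (\<lambda>x. f [(k, x)])"
  using sym_form_linear_front[OF one_formsD(1)[OF assms], of "[]" k] by simp

lemma one_forms_zero_degree:
  assumes "f \<in> one_forms W I 0" shows "f = 0"
  by (rule one_forms_eqI[OF assms, of 0 I])
    (auto simp: one_forms_def sym_form_zero homog_def vanishes_on_def len_homog_def)

text \<open>The Euler identity for homogeneous polynomials: the forms \<open>v\<close> are coordinates and contraction with \<open>e\<close> is the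
  corresponding partial derivative. The product with \<open>v\<close> moves each letter of the word to the front in turn, at the cost of the sign
  that \<open>f\<close> gives back by symmetry, so each letter contributes the value of \<open>f\<close> once.\<close>

lemma euler_identity:
  assumes W: "graded_space W" and D: "dual_basis W I D"
    and "sym_form W f" "vanishes_on I f" "ws \<in> words W"
  shows "(\<Sum>(k, e, v)\<leftarrow>D. cochain_mul (letter_form W k v) (contract k e f) ws) = of_nat (length ws) * f ws"
  using assms(3-5)
proof (induction ws arbitrary: f)
  case Nil
  have "map (\<lambda>(k, e, v). cochain_mul (letter_form W k v) (contract k e f) []) D = map (\<lambda>_. 0) D"
    by (intro map_cong) (auto simp: letter_form_apply)
  then show ?case by (simp only: sum_list_0) simp
next
  case (Cons a ws)
  obtain l x where a: "a = (l, x)" by fastforce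
  have x: "x \<in> W l" and ws: "ws \<in> words W" using Cons.prems(3) by (auto simp: a)
  have lin: "linear_map_on (W l) (\<lambda>z. f ((l, z) # ws))"
    by (rule sym_form_linear_front[OF Cons.prems(1) ws])
  have sub: "ratvec.subspace (W l)" by (rule graded_space_subspace[OF W])
  define g where "g = (\<lambda>(k, e, v). if k = l then v x *\<^sub>Q e else (0::'a))"
  have g: "g t \<in> W l" if "t \<in> set D" for t
    using that dual_basisD(1)[OF D] sub
    by (auto simp: g_def ratvec.subspace_scale ratvec.subspace_0 split: prod.splits)
  have sum_in: "(\<Sum>t\<leftarrow>D. g t) \<in> W l" using subspace_sum_list[OF sub g] .
  have "f ((l, x - (\<Sum>t\<leftarrow>D. g t)) # ws) = 0"
    using dual_basisD(4)[OF D x] by (intro vanishes_onD[OF Cons.prems(2)]) (auto simp: g_def)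
  then have "f ((l, x) # ws) = f ((l, \<Sum>t\<leftarrow>D. g t) # ws)"
    by (simp add: linear_map_on_diff[OF lin sub x sum_in])
  also have "\<dots> = (\<Sum>t\<leftarrow>D. f ((l, g t) # ws))"
    using linear_map_on_sum_list(1)[OF lin sub g] .
  finally have first: "(\<Sum>t\<leftarrow>D. f ((l, g t) # ws)) = f ((l, x) # ws)" ..
  have zero: "f ((l, 0) # ws) = 0" using linear_map_on_zero[OF lin sub] by simp
  have "cochain_mul (letter_form W k v) (contract k e f) (a # ws)
      = f ((l, g (k, e, v)) # ws) + cochain_mul (letter_form W k v) (contract k e (contract l x f)) ws"
    if "(k, e, v) \<in> set D" for k e v
  proof -
    have e: "e \<in> W k" using dual_basisD(1)[OF D that] .
    have "letter_form W k v \<in> one_forms W I (Suc k)"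
      by (rule letter_form_dual_basis[OF W D that])
    then have tw: "twist (Suc l) (letter_form W k v) = (-1) ^ (Suc l * Suc k) *\<^sub>Q letter_form W k v"
      by (intro twist_parity one_formsD(5))
    have "(if l = k \<and> x \<in> W k then v x else 0) * contract k e f ws = f ((l, g (k, e, v)) # ws)"
      using x e linear_map_on_scale[OF lin, of e "v x"] zero by (auto simp: g_def contract_apply)
    moreover have "(-1) ^ (Suc k * Suc l) * (-1) ^ (Suc l * Suc k) = (1::rat)"
      by (cases "even k"; cases "even l"; simp add: minus_one_power_iff)
    ultimately show ?thesis
      by (simp add: a contract_letter_form tw cochain_mul_linear contract_contract[OF Cons.prems(1) e x]
          del: power_Suc mult_Suc mult_Suc_right)
  qed
  then have "(\<Sum>(k, e, v)\<leftarrow>D. cochain_mul (letter_form W k v) (contract k e f) (a # ws))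
      = (\<Sum>t\<leftarrow>D. f ((l, g t) # ws) + (case t of (k, e, v) \<Rightarrow>
           cochain_mul (letter_form W k v) (contract k e (contract l x f)) ws))"
    by (intro arg_cong[of _ _ sum_list] map_cong) auto
  also have "\<dots> = f ((l, x) # ws) + of_nat (length ws) * contract l x f ws"
    unfolding sum_list_addf first
    using Cons.IH[OF sym_form_contract[OF Cons.prems(1) x] vanishes_on_contract[OF Cons.prems(2)] ws]
    by simp
  also have "\<dots> = of_nat (length (a # ws)) * f (a # ws)"
    by (simp add: a contract_apply algebra_simps)
  finally show ?case .
qed

lemma euler_identity_len:
  assumes W: "graded_space W" and D: "dual_basis W I D"
    and f: "sym_form W f" "vanishes_on I f" "len_homog p f"
  shows "(\<Sum>(k, e, v)\<leftarrow>D. cochain_mul (letter_form W k v) (contract k e f)) = of_nat p *\<^sub>Q f"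
proof (rule ext)
  fix ws
  have *: "(\<Sum>(k, e, v)\<leftarrow>D. cochain_mul (letter_form W k v) (contract k e f)) ws
    = (\<Sum>(k, e, v)\<leftarrow>D. cochain_mul (letter_form W k v) (contract k e f) ws)"
    by (simp add: sum_list_apply case_prod_unfold)
  show "(\<Sum>(k, e, v)\<leftarrow>D. cochain_mul (letter_form W k v) (contract k e f)) ws = (of_nat p *\<^sub>Q f) ws"
  proof (cases "ws \<in> words W")
    case True
    then show ?thesis
      unfolding * using euler_identity[OF W D f(1,2) True] f(3) by (auto simp: len_homog_def)
  next
    case False
    have "cochain_mul (letter_form W k v) (contract k e f) ws = 0" if "(k, e, v) \<in> set D" for k e v
    proof -
      have "letter_form W k v \<in> one_forms W I (Suc k)"
        by (rule letter_form_dual_basis[OF W D that])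
      then show ?thesis
        using sym_form_mul[OF one_formsD(1) sym_form_contract[OF f(1) dual_basisD(1)[OF D that]] W]
          sym_form_outside False by blast
    qed
    then have "map (\<lambda>(k, e, v). cochain_mul (letter_form W k v) (contract k e f) ws) D = map (\<lambda>_. 0) D"
      by (intro map_cong) auto
    then show ?thesis
      unfolding * using sym_form_outside[OF f(1) False] by (simp only: sum_list_0) simp
  qed
qed

subsection \<open>Products of linear forms\<close>

fun form_prod :: "('a word \<Rightarrow> rat) word \<Rightarrow> 'a word \<Rightarrow> rat" where
  "form_prod [] = single []"
| "form_prod ((k, v) # ws) = cochain_mul v (form_prod ws)"

text \<open>By the Euler identity \<open>p f\<close> is a sum of products of linear forms with forms in one letter less; here the
  characteristic is used.\<close>

lemma sym_form_generated:
  assumes W: "graded_space W" and D: "dual_basis W I D"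
    and "sym_form W f" "vanishes_on I f" "len_homog p f" "homog n f"
  shows "f \<in> ratvec.span (form_prod ` {ws \<in> words (one_forms W I). length ws = p \<and> wdeg ws = n})"
  using assms(3-)
proof (induction p arbitrary: f n)
  case 0
  have f: "f = f [] *\<^sub>Q single []"
    using 0(3) by (auto simp: len_homog_def single_def fun_eq_iff)
  show ?case
  proof (cases "n = 0")
    case True
    have "form_prod [] \<in> form_prod ` {ws \<in> words (one_forms W I). length ws = 0 \<and> wdeg ws = n}"
      using True by (intro imageI) simp
    then show ?thesis
      by (subst f) (auto intro: ratvec.span_scale ratvec.span_base)
  next
    case False
    then have "f [] = 0" using 0(4) by (auto simp: homog_def)
    then have "f = 0" by (subst f) simp
    then show ?thesis using ratvec.span_zero by (simp only:)
  qed
next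
  case (Suc p)
  let ?S = "\<lambda>p n. form_prod ` {ws \<in> words (one_forms W I). length ws = p \<and> wdeg ws = n}"
  have "(case t of (k, e, v) \<Rightarrow> cochain_mul (letter_form W k v) (contract k e f)) \<in> ratvec.span (?S (Suc p) n)"
    if t: "t \<in> set D" for t
  proof -
    obtain k e v where t': "t = (k, e, v)" by (cases t)
    show ?thesis
    proof (cases "Suc k \<le> n")
      case False
      then show ?thesis using homog_contract_0[OF Suc.prems(4)] by (simp add: t' ratvec.span_zero)
    next
      case True
      have e: "e \<in> W k" using dual_basisD(1)[OF D t[unfolded t']] .
      have "contract k e f \<in> ratvec.span (?S p (n - Suc k))"
        by (intro Suc.IH sym_form_contract vanishes_on_contract len_homog_contract homog_contract Suc.prems e True)
      then have "cochain_mul (letter_form W k v) (contract k e f) \<in> ratvec.span (?S (Suc p) n)"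
      proof (rule linear_map_on_span_in[of UNIV, rotated -1])
        fix b assume "b \<in> ?S p (n - Suc k)"
        then obtain ws where ws: "ws \<in> words (one_forms W I)" "length ws = p" "wdeg ws = n - Suc k" "b = form_prod ws"
          by blast
        have "letter_form W k v \<in> one_forms W I (Suc k)"
          by (rule letter_form_dual_basis[OF W D t[unfolded t']])
        then have "form_prod ((Suc k, letter_form W k v) # ws) \<in> ?S (Suc p) n"
          using ws True by (intro imageI) auto
        then show "cochain_mul (letter_form W k v) b \<in> ratvec.span (?S (Suc p) n)"
          by (simp add: ws(4) ratvec.span_base)
      qed (auto simp: linear_map_on_def cochain_mul_linear)
      then show ?thesis by (simp add: t')
    qed
  qed
  then have "(\<Sum>t\<leftarrow>D. case t of (k, e, v) \<Rightarrow> cochain_mul (letter_form W k v) (contract k e f)) \<in> ratvec.span (?S (Suc p) n)"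
    by (rule subspace_sum_list[OF ratvec.subspace_span])
  then have "(1 / of_nat (Suc p)) *\<^sub>Q (of_nat (Suc p) *\<^sub>Q f) \<in> ratvec.span (?S (Suc p) n)"
    unfolding euler_identity_len[OF W D Suc.prems(1-3)] by (rule ratvec.span_scale)
  then show ?case by (simp del: scaleQ_fun_apply of_nat_Suc)
qed

definition len_part :: "nat \<Rightarrow> ('a word \<Rightarrow> rat) \<Rightarrow> 'a word \<Rightarrow> rat" where
  "len_part p f = (\<lambda>ws. if length ws = p then f ws else 0)"

lemma len_part_props:
  assumes "sym_form W f"
  shows "sym_form W (len_part p f)" "vanishes_on I f \<Longrightarrow> vanishes_on I (len_part p f)"
    "homog n f \<Longrightarrow> homog n (len_part p f)" "len_homog p (len_part p f)"
proof -
  show "sym_form W (len_part p f)"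
    unfolding sym_form_def
  proof (intro conjI ballI allI impI)
    show "linear_map_on (W k) (\<lambda>x. len_part p f (us @ (k, x) # ws))" if "us \<in> words W" "ws \<in> words W" for us ws k
      using sym_form_linear[OF assms that, of k]
      by (cases "length us + Suc (length ws) = p") (simp_all add: len_part_def linear_map_on_const0)
    show "len_part p f (us @ (i, x) # (j, y) # ws) = (-1) ^ (Suc i * Suc j) * len_part p f (us @ (j, y) # (i, x) # ws)"
      if "us \<in> words W" "ws \<in> words W" "x \<in> W i" "y \<in> W j" for us ws i j x y
      using sym_form_swap[OF assms that] by (simp add: len_part_def)
  qed (simp add: len_part_def sym_form_outside[OF assms])
qed (auto simp: len_part_def vanishes_on_def homog_def len_homog_def)

text \<open>Letters of \<open>sW\<close> have positive degree, so a word of degree \<open>n\<close> has at most \<open>n\<close> letters.\<close>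

lemma sum_len_part:
  assumes "homog n f" shows "(\<Sum>p\<le>n. len_part p f) = f"
proof (rule ext)
  fix ws
  have "(\<Sum>p\<le>n. len_part p f) ws = (if length ws \<le> n then f ws else 0)"
    by (simp add: sum_apply len_part_def)
  then show "(\<Sum>p\<le>n. len_part p f) ws = f ws"
    using assms length_le_sdeg[of ws] by (auto simp: homog_def)
qed

lemma sym_form_generated_all:
  assumes W: "graded_space W" and D: "dual_basis W I D"
    and f: "sym_form W f" "vanishes_on I f" "homog n f"
  shows "f \<in> ratvec.span (form_prod ` {ws \<in> words (one_forms W I). wdeg ws = n})"
proof -
  have "len_part p f \<in> ratvec.span (form_prod ` {ws \<in> words (one_forms W I). wdeg ws = n})" for p
    using sym_form_generated[OF W D len_part_props(1)[OF f(1)] len_part_props(2)[OF f(1,2)]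
        len_part_props(4)[OF f(1)] len_part_props(3)[OF f(1,3)], of p]
    by (rule subsetD[OF ratvec.span_mono, rotated]) auto
  then have "(\<Sum>p\<le>n. len_part p f) \<in> ratvec.span (form_prod ` {ws \<in> words (one_forms W I). wdeg ws = n})"
    by (intro ratvec.span_sum)
  then show ?thesis by (simp only: sum_len_part[OF f(3)])
qed

section \<open>Formal linear combinations of words\<close>

text \<open>Functions on words that factor through the quotient by \<open>free_relations V\<close> when extended linearly.\<close>

definition respects_relations :: "'v::rat_vector graded \<Rightarrow> ('v word \<Rightarrow> 'b::rat_vector) \<Rightarrow> bool" where
  "respects_relations V h \<longleftrightarrow>
     (\<forall>us\<in>words V. \<forall>ws\<in>words V. \<forall>k. linear_map_on (V k) (\<lambda>x. h (us @ (k, x) # ws))) \<and>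
     (\<forall>us\<in>words V. \<forall>ws\<in>words V. \<forall>i j. \<forall>x\<in>V i. \<forall>y\<in>V j.
        h (us @ (i, x) # (j, y) # ws) = (-1) ^ (i * j) *\<^sub>Q h (us @ (j, y) # (i, x) # ws))"

lemma respects_relationsD:
  assumes "respects_relations V h" "us \<in> words V" "ws \<in> words V"
  shows "linear_map_on (V k) (\<lambda>x. h (us @ (k, x) # ws))"
    "x \<in> V i \<Longrightarrow> y \<in> V j \<Longrightarrow> h (us @ (i, x) # (j, y) # ws) = (-1) ^ (i * j) *\<^sub>Q h (us @ (j, y) # (i, x) # ws)"
  using assms unfolding respects_relations_def by blast+

lemma respects_relations_Cons:
  assumes "respects_relations V h" "x \<in> V k"
  shows "respects_relations V (\<lambda>ws. h ((k, x) # ws))"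
  unfolding respects_relations_def
proof (intro conjI ballI allI)
  fix us ws l assume "us \<in> words V" "ws \<in> words V"
  then show "linear_map_on (V l) (\<lambda>y. h ((k, x) # us @ (l, y) # ws))"
    using respects_relationsD(1)[OF assms(1), of "(k, x) # us" ws l] assms(2) by simp
next
  fix us ws i j y z assume "us \<in> words V" "ws \<in> words V" "y \<in> V i" "z \<in> V j"
  then show "h ((k, x) # us @ (i, y) # (j, z) # ws) = (-1) ^ (i * j) *\<^sub>Q h ((k, x) # us @ (j, z) # (i, y) # ws)"
    using respects_relationsD(2)[OF assms(1), of "(k, x) # us" ws y i z j] assms(2) by simp
qed

lemma respects_relations_mono:
  assumes "respects_relations V h" "\<And>k. U k \<subseteq> V k"
  shows "respects_relations U h"
proof -
  have "ws \<in> words V" if "ws \<in> words U" for ws using that assms(2) by (fastforce simp: words_def)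
  then show ?thesis
    using assms unfolding respects_relations_def by (meson linear_map_on_subset subsetD)
qed

definition lcomb :: "('v word \<Rightarrow> 'b::rat_vector) \<Rightarrow> ('v word \<Rightarrow> rat) \<Rightarrow> 'b" where
  "lcomb h p = (\<Sum>ws | p ws \<noteq> 0. p ws *\<^sub>Q h ws)"

abbreviation fin_supp :: "('v word \<Rightarrow> rat) \<Rightarrow> bool" where
  "fin_supp p \<equiv> finite {ws. p ws \<noteq> 0}"

lemma lcomb_superset:
  "finite S \<Longrightarrow> {ws. p ws \<noteq> 0} \<subseteq> S \<Longrightarrow> lcomb h p = (\<Sum>ws\<in>S. p ws *\<^sub>Q h ws)"
  unfolding lcomb_def by (intro sum.mono_neutral_left) auto

lemma fin_supp_add: "fin_supp p \<Longrightarrow> fin_supp q \<Longrightarrow> fin_supp (p + q)"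
  by (rule finite_subset[of _ "{ws. p ws \<noteq> 0} \<union> {ws. q ws \<noteq> 0}"]) auto

lemma fin_supp_scale: "fin_supp p \<Longrightarrow> fin_supp (c *\<^sub>Q p)"
  by (rule finite_subset[of _ "{ws. p ws \<noteq> 0}"]) auto

lemma fin_supp_single: "fin_supp (single ws)"
  by (rule finite_subset[of _ "{ws}"]) (auto simp: single_def)

lemma lcomb_add:
  assumes "fin_supp p" "fin_supp q" shows "lcomb h (p + q) = lcomb h p + lcomb h q"
proof -
  let ?S = "{ws. p ws \<noteq> 0} \<union> {ws. q ws \<noteq> 0}"
  have "finite ?S" using assms by simp
  then show ?thesis
    by (subst (1 2 3) lcomb_superset[of ?S]) (auto simp: sum.distrib scaleQ_add_left)
qed

lemma lcomb_scale:
  assumes "fin_supp p" shows "lcomb h (c *\<^sub>Q p) = c *\<^sub>Q lcomb h p"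
proof -
  let ?S = "{ws. p ws \<noteq> 0}"
  show ?thesis using assms
    by (subst (1 2) lcomb_superset[of ?S]) (auto simp: ratvec.scale_sum_right)
qed

lemma lcomb_single: "lcomb h (single ws) = h ws"
  by (subst lcomb_superset[of "{ws}"]) (auto simp: single_def)

lemma span_single_fin_supp:
  assumes "p \<in> ratvec.span (single ` S)" shows "fin_supp p \<and> {ws. p ws \<noteq> 0} \<subseteq> S"
  using assms
proof (induction rule: ratvec.span_induct_alt)
  case base
  then show ?case by simp
next
  case (step c b p)
  then obtain us where b: "b = single us" "us \<in> S" by blast
  have "fin_supp (c *\<^sub>Q b + p)"
    using step b by (intro fin_supp_add fin_supp_scale) (simp_all add: fin_supp_single)
  moreover have "{ws. (c *\<^sub>Q b + p) ws \<noteq> 0} \<subseteq> insert us {ws. p ws \<noteq> 0}"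
    by (auto simp: b single_def)
  ultimately show ?case using step b by blast
qed

lemma lcomb_linear: "linear_map_on (ratvec.span (single ` S)) (lcomb h)"
  using span_single_fin_supp by (intro linear_map_onI lcomb_add lcomb_scale) blast+

lemma fin_supp_expand:
  assumes "fin_supp p" shows "p = (\<Sum>ws | p ws \<noteq> 0. p ws *\<^sub>Q single ws)"
proof (rule ext)
  fix us
  have "(\<Sum>ws | p ws \<noteq> 0. p ws *\<^sub>Q single ws) us = (\<Sum>ws | p ws \<noteq> 0. if us = ws then p ws else 0)"
    by (simp add: sum_apply single_def if_distrib cong: if_cong)
  also have "\<dots> = p us" using assms by (simp add: sum.delta)
  finally show "p us = (\<Sum>ws | p ws \<noteq> 0. p ws *\<^sub>Q single ws) us" ..
qed

lemma fin_supp_in_span: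
  assumes "fin_supp p" "{ws. p ws \<noteq> 0} \<subseteq> S" shows "p \<in> ratvec.span (single ` S)"
proof -
  have "(\<Sum>ws | p ws \<noteq> 0. p ws *\<^sub>Q single ws) \<in> ratvec.span (single ` S)"
    using assms(2) by (intro ratvec.span_sum ratvec.span_scale ratvec.span_base) auto
  then show ?thesis by (subst fin_supp_expand[OF assms(1)])
qed

lemma lcomb_relations:
  assumes h: "respects_relations V h" and V: "graded_space V" and q: "q \<in> ratvec.span (free_relations V)"
  shows "lcomb h q = 0"
proof -
  have diff: "fin_supp (p - c *\<^sub>Q q) \<and> lcomb h (p - c *\<^sub>Q q) = lcomb h p - c *\<^sub>Q lcomb h q"
    if "fin_supp p" "fin_supp q" for p q c
  proof -
    have "p - c *\<^sub>Q q = p + (- c) *\<^sub>Q q" by simp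
    then show ?thesis using that
      by (simp only: lcomb_add lcomb_scale fin_supp_add fin_supp_scale) simp
  qed
  have rel: "fin_supp r \<and> lcomb h r = 0" if "r \<in> free_relations V" for r
    using that unfolding free_relations_def
  proof (elim UnE CollectE exE conjE)
    fix us ws k x y c
    assume r: "r = single (us @ (k, x + c *\<^sub>Q y) # ws) - single (us @ (k, x) # ws) - c *\<^sub>Q single (us @ (k, y) # ws)"
      and us: "us \<in> words V" and ws: "ws \<in> words V" and x: "x \<in> V k" and y: "y \<in> V k"
    note lin = respects_relationsD(1)[OF h us ws, of k]
    have "c *\<^sub>Q y \<in> V k" using y graded_space_subspace[OF V] by (simp add: ratvec.subspace_scale)
    then have "h (us @ (k, x + c *\<^sub>Q y) # ws) = h (us @ (k, x) # ws) + c *\<^sub>Q h (us @ (k, y) # ws)"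
      using linear_map_on_add[OF lin x] linear_map_on_scale[OF lin y] by simp
    moreover have "fin_supp (single (us @ (k, x + c *\<^sub>Q y) # ws) - single (us @ (k, x) # ws))
       \<and> lcomb h (single (us @ (k, x + c *\<^sub>Q y) # ws) - single (us @ (k, x) # ws))
          = h (us @ (k, x + c *\<^sub>Q y) # ws) - h (us @ (k, x) # ws)"
      using diff[OF fin_supp_single fin_supp_single, of _ 1] by (simp add: lcomb_single)
    ultimately show ?thesis using diff[OF _ fin_supp_single] by (simp add: r lcomb_single)
  next
    fix us ws i j x y
    assume r: "r = single (us @ (i, x) # (j, y) # ws) - (-1) ^ (i * j) *\<^sub>Q single (us @ (j, y) # (i, x) # ws)"
      and us: "us \<in> words V" and ws: "ws \<in> words V" and x: "x \<in> V i" and y: "y \<in> V j"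
    then show ?thesis
      using diff[OF fin_supp_single fin_supp_single] respects_relationsD(2)[OF h us ws x y]
      by (simp add: r lcomb_single)
  qed
  have "fin_supp q \<and> lcomb h q = 0"
    using q
  proof (induction rule: ratvec.span_induct_alt)
    case base
    then show ?case by (simp add: lcomb_def)
  next
    case (step c b y)
    then show ?case using rel[OF step(1)]
      by (simp add: lcomb_add lcomb_scale fin_supp_add fin_supp_scale del: scaleQ_fun_apply plus_fun_apply)
  qed
  then show ?thesis ..
qed

lemma functional_respects_relations:
  fixes l :: "('v::rat_vector word \<Rightarrow> rat) \<Rightarrow> rat"
  assumes l: "linear_map_on UNIV l" and "\<And>r. r \<in> free_relations V \<Longrightarrow> l r = 0" and V: "graded_space V"
  shows "respects_relations V (\<lambda>ws. l (single ws))"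
proof -
  have diff: "l (p - c *\<^sub>Q q) = l p - c * l q" for p q c
    using linear_map_on_diff[OF l ratvec.subspace_UNIV, of p "c *\<^sub>Q q"] linear_map_on_scale[OF l, of q c] by simp
  have diff1: "l (p - q) = l p - l q" for p q
    using linear_map_on_diff[OF l ratvec.subspace_UNIV, of p q] by simp
  show ?thesis
    unfolding respects_relations_def
  proof (intro conjI ballI allI)
    fix us ws k assume us: "us \<in> words V" and ws: "ws \<in> words V"
    have main: "l (single (us @ (k, x + c *\<^sub>Q y) # ws)) = l (single (us @ (k, x) # ws)) + c * l (single (us @ (k, y) # ws))"
      if "x \<in> V k" "y \<in> V k" for x y c
    proof -
      have "single (us @ (k, x + c *\<^sub>Q y) # ws) - single (us @ (k, x) # ws) - c *\<^sub>Q single (us @ (k, y) # ws) \<in> free_relations V"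
        unfolding free_relations_def using us ws that by blast
      from assms(2)[OF this] show ?thesis unfolding diff unfolding diff1 by simp
    qed
    have "0 \<in> V k" using graded_space_subspace[OF V] ratvec.subspace_0 by blast
    from main[OF this this, of 1] have zero: "l (single (us @ (k, 0) # ws)) = 0" by simp
    show "linear_map_on (V k) (\<lambda>x. l (single (us @ (k, x) # ws)))"
      using main[of _ _ 1] main[OF \<open>0 \<in> V k\<close>] by (intro linear_map_onI) (simp_all add: zero)
  next
    fix us ws i j x y assume "us \<in> words V" "ws \<in> words V" "x \<in> V i" "y \<in> V j"
    then have "single (us @ (i, x) # (j, y) # ws) - (-1) ^ (i * j) *\<^sub>Q single (us @ (j, y) # (i, x) # ws) \<in> free_relations V"
      unfolding free_relations_def by blast
    from assms(2)[OF this] show "l (single (us @ (i, x) # (j, y) # ws)) = (-1) ^ (i * j) *\<^sub>Q l (single (us @ (j, y) # (i, x) # ws))"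
      by (simp only: diff) simp
  qed
qed

section \<open>Freeness of the algebra of forms\<close>

lemma subspace_homog: "ratvec.subspace {f. homog n f}"
  and subspace_len_homog: "ratvec.subspace {f. len_homog n f}"
  by (auto simp: ratvec.subspace_def homog_def len_homog_def)

lemma subspace_vanishes_on: "ratvec.subspace {f. vanishes_on I f}"
  unfolding ratvec.subspace_def vanishes_on_def by force

lemma subspace_sym_form: "ratvec.subspace {f. sym_form W f}"
  unfolding ratvec.subspace_def using sym_form_zero sym_form_add sym_form_scale by blast

lemma subspace_one_forms: "ratvec.subspace (one_forms W I n)"
proof -
  have "one_forms W I n = {f. sym_form W f} \<inter> {f. homog n f} \<inter> {f. vanishes_on I f} \<inter> {f. len_homog 1 f}"
    by (auto simp: one_forms_def)
  then show ?thesis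
    by (simp only: ratvec.subspace_inter subspace_sym_form subspace_homog subspace_vanishes_on subspace_len_homog)
qed

text \<open>The terms of the contraction of a product of linear forms: one factor is evaluated at \<open>e\<close> and deleted.\<close>

fun deletions :: "nat \<Rightarrow> 'a \<Rightarrow> ('a word \<Rightarrow> rat) word \<Rightarrow> (rat \<times> ('a word \<Rightarrow> rat) word) list" where
  "deletions k e [] = []"
| "deletions k e ((m, v) # ws) =
     (v [(k, e)], ws) # map (\<lambda>(c, us). ((-1) ^ (Suc k * m) * c, (m, v) # us)) (deletions k e ws)"

lemma deletions_word:
  assumes "(c, us) \<in> set (deletions k e ws)" "ws \<in> words V"
  shows "us \<in> words V \<and> Suc (length us) = length ws"
  using assms by (induction k e ws arbitrary: c us rule: deletions.induct) fastforce+

lemma contract_form_prod: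
  assumes "ws \<in> words (one_forms W I)"
  shows "contract k e (form_prod ws) = (\<Sum>(c, us)\<leftarrow>deletions k e ws. c *\<^sub>Q form_prod us)"
  using assms
proof (induction ws)
  case (Cons a ws)
  obtain m v where a: "a = (m, v)" by fastforce
  have v: "v \<in> one_forms W I m" and ws: "ws \<in> words (one_forms W I)" using Cons.prems by (auto simp: a)
  have sums: "r *\<^sub>Q cochain_mul v (\<Sum>(c, us)\<leftarrow>xs. c *\<^sub>Q form_prod us)
     = (\<Sum>(c, us)\<leftarrow>map (\<lambda>(c, us). (r * c, (m, v) # us)) xs. c *\<^sub>Q form_prod us)" for r xs
    by (induction xs)
      (auto simp: cochain_mul_linear scaleQ_add_right simp del: scaleQ_fun_apply plus_fun_apply zero_fun_apply)
  show ?case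
    unfolding a form_prod.simps contract_mul one_formsD(6)[OF v] twist_parity[OF one_formsD(5)[OF v]]
      Cons.IH[OF ws] cochain_mul_linear cochain_mul_one sums deletions.simps list.map sum_list.Cons prod.case ..
qed simp

lemma one_forms_expand:
  assumes W: "graded_space W" and D: "dual_basis W I D" and w: "w \<in> one_forms W I m"
  shows "w = (\<Sum>(k, e, v)\<leftarrow>D. if Suc k = m then w [(k, e)] *\<^sub>Q letter_form W k v else 0)"
proof -
  have "map (\<lambda>(k, e, v). if Suc k = m then w [(k, e)] *\<^sub>Q letter_form W k v else 0) D
     = map (\<lambda>(k, e, v). cochain_mul (letter_form W k v) (contract k e w)) D"
  proof (intro map_cong refl)
    fix t assume t: "t \<in> set D"
    obtain k e v where t': "t = (k, e, v)" by (cases t)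
    show "(case t of (k, e, v) \<Rightarrow> if Suc k = m then w [(k, e)] *\<^sub>Q letter_form W k v else 0)
      = (case t of (k, e, v) \<Rightarrow> cochain_mul (letter_form W k v) (contract k e w))"
      using one_formsD(7)[OF w, of k e]
      by (simp add: t' one_formsD(6)[OF w] cochain_mul_linear del: scaleQ_fun_apply)
  qed
  then show ?thesis
    using euler_identity_len[OF W D one_formsD(1,3,4)[OF w]] by (simp only: of_nat_1 scaleQ_one)
qed

text \<open>The Euler identity for words of linear forms. Each letter is expanded in the dual basis, and moved to its place from the
  front, with the sign that its deletion carries.\<close>

lemma deletions_euler:
  fixes h :: "('a::rat_vector word \<Rightarrow> rat) word \<Rightarrow> rat"
  assumes W: "graded_space W" and D: "dual_basis W I D"
    and "respects_relations (one_forms W I) h" "ws \<in> words (one_forms W I)"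
  shows "(\<Sum>(k, e, v)\<leftarrow>D. \<Sum>(c, us)\<leftarrow>deletions k e ws. c * h ((Suc k, letter_form W k v) # us))
    = of_nat (length ws) * h ws"
  using assms(3,4)
proof (induction ws arbitrary: h)
  case Nil
  then show ?case by (simp add: case_prod_unfold)
next
  case (Cons a ws)
  obtain m w where a: "a = (m, w)" by fastforce
  have w: "w \<in> one_forms W I m" and ws: "ws \<in> words (one_forms W I)" using Cons.prems by (auto simp: a)
  have lin: "linear_map_on (one_forms W I m) (\<lambda>x. h ((m, x) # ws))"
    using respects_relationsD(1)[OF Cons.prems(1), of "[]" ws m] ws by simp
  define g where "g = (\<lambda>(k, e, v). if Suc k = m then w [(k, e)] *\<^sub>Q letter_form W k v else 0)"
  have letter: "letter_form W k v \<in> one_forms W I (Suc k)" if "(k, e, v) \<in> set D" for k e v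
    by (rule letter_form_dual_basis[OF W D that])
  have g: "g t \<in> one_forms W I m" if "t \<in> set D" for t
    using that subspace_one_forms[of W I m] letter
    by (auto simp: g_def ratvec.subspace_0 ratvec.subspace_scale split: prod.splits simp del: scaleQ_fun_apply)
  have "(\<Sum>t\<leftarrow>D. g t) = w"
    unfolding g_def by (rule one_forms_expand[OF W D w, symmetric])
  then have "h ((m, w) # ws) = (\<Sum>t\<leftarrow>D. h ((m, g t) # ws))"
    using linear_map_on_sum_list(1)[OF lin subspace_one_forms, of D g] g by simp
  moreover have "h ((m, g (k, e, v)) # ws) = w [(k, e)] * h ((Suc k, letter_form W k v) # ws)"
    if "(k, e, v) \<in> set D" for k e v
    using one_formsD(7)[OF w, of k e] linear_map_on_scale[OF lin, of "letter_form W k v" "w [(k, e)]"]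
      letter[OF that] linear_map_on_zero[OF lin subspace_one_forms] by (auto simp: g_def simp del: scaleQ_fun_apply)
  ultimately have first: "(\<Sum>(k, e, v)\<leftarrow>D. w [(k, e)] * h ((Suc k, letter_form W k v) # ws)) = h ((m, w) # ws)"
    by (auto intro!: arg_cong[of _ _ sum_list] map_cong)
  have swap: "(\<Sum>(c, us)\<leftarrow>map (\<lambda>(c, us). ((-1) ^ (Suc k * m) * c, (m, w) # us)) (deletions k e ws).
        c * h ((Suc k, letter_form W k v) # us))
    = (\<Sum>(c, us)\<leftarrow>deletions k e ws. c * h ((m, w) # (Suc k, letter_form W k v) # us))"
    if t: "(k, e, v) \<in> set D" for k e v
  proof -
    have "(-1) ^ (Suc k * m) * c * h ((Suc k, letter_form W k v) # (m, w) # us)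
      = c * h ((m, w) # (Suc k, letter_form W k v) # us)" if "(c, us) \<in> set (deletions k e ws)" for c us
    proof -
      have "us \<in> words (one_forms W I)" using deletions_word[OF that ws] by blast
      then have "h ((Suc k, letter_form W k v) # (m, w) # us)
         = (-1) ^ (Suc k * m) * h ((m, w) # (Suc k, letter_form W k v) # us)"
        using respects_relationsD(2)[OF Cons.prems(1) _ _ letter[OF t] w, of "[]" us] by simp
      then show ?thesis by (simp add: minus_one_power_iff)
    qed
    then show ?thesis
      by (auto intro!: arg_cong[of _ _ sum_list] map_cong)
  qed
  have "(\<Sum>(k, e, v)\<leftarrow>D. \<Sum>(c, us)\<leftarrow>deletions k e (a # ws). c * h ((Suc k, letter_form W k v) # us))
    = (\<Sum>t\<leftarrow>D. (case t of (k, e, v) \<Rightarrow> w [(k, e)] * h ((Suc k, letter_form W k v) # ws))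
        + (case t of (k, e, v) \<Rightarrow> \<Sum>(c, us)\<leftarrow>deletions k e ws. c * h ((m, w) # (Suc k, letter_form W k v) # us)))"
  proof (intro arg_cong[of _ _ sum_list] map_cong refl)
    fix t assume t: "t \<in> set D"
    obtain k e v where t': "t = (k, e, v)" by (cases t)
    show "(case t of (k, e, v) \<Rightarrow> \<Sum>(c, us)\<leftarrow>deletions k e (a # ws). c * h ((Suc k, letter_form W k v) # us))
      = (case t of (k, e, v) \<Rightarrow> w [(k, e)] * h ((Suc k, letter_form W k v) # ws))
        + (case t of (k, e, v) \<Rightarrow> \<Sum>(c, us)\<leftarrow>deletions k e ws. c * h ((m, w) # (Suc k, letter_form W k v) # us))"
      unfolding t' prod.case a deletions.simps list.map sum_list.Cons swap[OF t[unfolded t']] ..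
  qed
  also have "\<dots> = h ((m, w) # ws) + of_nat (length ws) * h ((m, w) # ws)"
    unfolding sum_list_addf first
    using Cons.IH[OF respects_relations_Cons[OF Cons.prems(1) w] ws] by simp
  also have "\<dots> = of_nat (length (a # ws)) * h (a # ws)"
    by (simp add: a algebra_simps)
  finally show ?case .
qed

text \<open>Iterated expansion by the Euler identity, with \<open>h\<close> applied to the words of coordinate forms that it produces. This is a
  function of the product alone that recovers the value of \<open>h\<close> at the word of its factors (\<open>theta_form_prod\<close>).\<close>

primrec theta :: "'a graded \<Rightarrow> (nat \<times> 'a \<times> ('a \<Rightarrow> rat)) list \<Rightarrow> nat \<Rightarrow>
    (('a word \<Rightarrow> rat) word \<Rightarrow> rat) \<Rightarrow> ('a word \<Rightarrow> rat) \<Rightarrow> rat" where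
  "theta W D 0 = (\<lambda>h f. f [] * h [])"
| "theta W D (Suc p) = (\<lambda>h f. (\<Sum>(k, e, v)\<leftarrow>D.
     theta W D p (\<lambda>ws. h ((Suc k, letter_form W k v) # ws)) (contract k e f)) / of_nat (Suc p))"

lemma theta_linear: "linear_map_on UNIV (theta W D p h)"
proof (induction p arbitrary: h)
  case 0
  then show ?case by (simp add: linear_map_on_def algebra_simps)
next
  case (Suc p)
  have add: "theta W D p h (contract k e (f + g)) = theta W D p h (contract k e f) + theta W D p h (contract k e g)"
    and scale: "theta W D p h (contract k e (c *\<^sub>Q f)) = c * theta W D p h (contract k e f)" for k e f g h c
    using linear_map_on_add[OF Suc, of "contract k e f" "contract k e g" h]
      linear_map_on_scale[OF Suc, of "contract k e f" h c] by (simp_all del: scaleQ_fun_apply plus_fun_apply)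
  show ?case
    by (intro linear_map_onI)
      (simp_all only: theta.simps add scale case_prod_unfold sum_list_addf sum_list_const_mult
        add_divide_distrib scaleQ_rat times_divide_eq_right)
qed

lemma theta_other_length:
  assumes "len_homog q f" "q \<noteq> p" shows "theta W D p h f = 0"
  using assms
proof (induction p arbitrary: h f q)
  case 0
  then show ?case by (simp add: len_homog_def)
next
  case (Suc p)
  have "theta W D p h (contract k e f) = 0" for h k e
  proof (cases q)
    case 0
    then have "len_homog (Suc p) (contract k e f)"
      using Suc.prems(1) by (auto simp: len_homog_def contract_apply)
    from Suc.IH[OF this] show ?thesis by simp
  next
    case (Suc q')
    then show ?thesis using Suc.IH[OF len_homog_contract, of q' f] Suc.prems by blast
  qed
  then show ?case by (simp add: case_prod_unfold)
qed

lemma len_homog_form_prod: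
  assumes "ws \<in> words (one_forms W I)" shows "len_homog (length ws) (form_prod ws)"
  using assms
proof (induction ws rule: form_prod.induct)
  case 1
  then show ?case by (auto simp: len_homog_def single_def)
next
  case (2 k v ws)
  then have "len_homog (1 + length ws) (cochain_mul v (form_prod ws))"
    by (intro len_homog_mul one_formsD(4)[of v W I k]) simp_all
  then show ?case by simp
qed

lemma theta_form_prod:
  assumes W: "graded_space W" and D: "dual_basis W I D"
    and "respects_relations (one_forms W I) h" "ws \<in> words (one_forms W I)"
  shows "theta W D (length ws) h (form_prod ws) = h ws"
  using assms(3-)
proof (induction "length ws" arbitrary: h ws)
  case 0
  then show ?case by (simp add: single_def)
next
  case (Suc p)
  have inner: "theta W D p (\<lambda>us. h ((Suc k, letter_form W k v) # us)) (contract k e (form_prod ws))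
     = (\<Sum>(c, us)\<leftarrow>deletions k e ws. c * h ((Suc k, letter_form W k v) # us))" if t: "(k, e, v) \<in> set D" for k e v
  proof -
    let ?h = "\<lambda>us. h ((Suc k, letter_form W k v) # us)"
    have h': "respects_relations (one_forms W I) ?h"
      by (rule respects_relations_Cons[OF Suc.prems(1) letter_form_dual_basis[OF W D t]])
    have "theta W D p ?h (contract k e (form_prod ws))
      = (\<Sum>x\<leftarrow>deletions k e ws. theta W D p ?h (case x of (c, us) \<Rightarrow> c *\<^sub>Q form_prod us))"
      unfolding contract_form_prod[OF Suc.prems(2)]
      by (rule linear_map_on_sum_list(1)[OF theta_linear ratvec.subspace_UNIV]) simp
    also have "\<dots> = (\<Sum>(c, us)\<leftarrow>deletions k e ws. c * ?h us)"
    proof (intro arg_cong[of _ _ sum_list] map_cong refl)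
      fix x assume x: "x \<in> set (deletions k e ws)"
      obtain c us where x': "x = (c, us)" by fastforce
      have us: "us \<in> words (one_forms W I)" "Suc (length us) = length ws"
        using deletions_word[OF x[unfolded x'] Suc.prems(2)] by auto
      then have "p = length us" using Suc.hyps(2) by simp
      then have "theta W D p ?h (form_prod us) = ?h us" using Suc.hyps(1)[OF _ h' us(1)] by simp
      then show "theta W D p ?h (case x of (c, us) \<Rightarrow> c *\<^sub>Q form_prod us) = (case x of (c, us) \<Rightarrow> c * ?h us)"
        using linear_map_on_scale[OF theta_linear, of "form_prod us" W D p ?h c] by (simp add: x')
    qed
    finally show ?thesis .
  qed
  have "theta W D (Suc p) h (form_prod ws) = (\<Sum>(k, e, v)\<leftarrow>D.
      \<Sum>(c, us)\<leftarrow>deletions k e ws. c * h ((Suc k, letter_form W k v) # us)) / of_nat (Suc p)"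
    unfolding theta.simps
    by (intro arg_cong[of _ _ "\<lambda>x. x / of_nat (Suc p)"] arg_cong[of _ _ sum_list] map_cong refl)
      (use inner in auto)
  also have "\<dots> = h ws"
    unfolding deletions_euler[OF W D Suc.prems] Suc.hyps(2)[symmetric] by simp
  finally show ?case by (simp only: Suc.hyps(2)[symmetric])
qed

text \<open>Otherwise a functional \<open>l\<close> kills the relations but not \<open>p\<close>. Its values on words respect the relations, so \<open>theta\<close>
  expresses \<open>l p\<close> by the sums of products, which vanish. The sums are given degree by degree; \<open>theta\<close> separates them by the
  number of factors.\<close>

lemma form_prod_free:
  assumes W: "graded_space W" and D: "dual_basis W I D"
    and V: "graded_space V" "\<And>n. one_forms W I n \<subseteq> V n"
    and p: "fin_supp p" "{ws. p ws \<noteq> 0} \<subseteq> words (one_forms W I)"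
    and zero: "\<And>n. (\<Sum>ws | p ws \<noteq> 0 \<and> wdeg ws = n. p ws *\<^sub>Q form_prod ws) = 0"
  shows "p \<in> ratvec.span (free_relations V)"
proof (rule ccontr)
  assume "p \<notin> ratvec.span (free_relations V)"
  then obtain l :: "(('a word \<Rightarrow> rat) word \<Rightarrow> rat) \<Rightarrow> rat" where l: "linear_map_on UNIV l"
    "\<And>r. r \<in> ratvec.span (free_relations V) \<Longrightarrow> l r = 0" "l p = 1"
    using separating_functional by blast
  define h where "h = (\<lambda>ws. l (single ws))"
  have "respects_relations V h"
    unfolding h_def using l(2) by (intro functional_respects_relations[OF l(1) _ V(1)]) (auto intro: ratvec.span_base)
  then have h: "respects_relations (one_forms W I) h" using V(2) by (rule respects_relations_mono)
  define S where "S = {ws. p ws \<noteq> 0}"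
  define N where "N = Max (insert 0 (length ` S))"
  have S: "finite S" using p(1) by (simp add: S_def)
  have len: "length ws \<le> N" if "ws \<in> S" for ws
    unfolding N_def using S that by (intro Max_ge) auto
  have th: "theta W D q h (form_prod ws) = (if q = length ws then h ws else 0)" if "ws \<in> S" for q ws
  proof -
    have "ws \<in> words (one_forms W I)" using that p(2) by (auto simp: S_def)
    then show ?thesis
      using theta_form_prod[OF W D h] theta_other_length[OF len_homog_form_prod, of ws W I q W D h]
      by (cases "q = length ws") simp_all
  qed
  have "l p = lcomb h p"
    unfolding h_def
    by (rule linear_map_on_span_eq[OF linear_map_on_subset[OF l(1)] lcomb_linear[of UNIV] ratvec.subspace_span
          ratvec.span_superset])
      (use fin_supp_in_span[OF p(1), of UNIV] in \<open>auto simp: lcomb_single\<close>)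
  also have "\<dots> = (\<Sum>ws\<in>S. p ws * h ws)" by (simp add: lcomb_def S_def)
  also have "\<dots> = (\<Sum>ws\<in>S. \<Sum>q\<le>N. p ws * theta W D q h (form_prod ws))"
  proof (rule sum.cong[OF refl])
    fix ws assume ws: "ws \<in> S"
    have "(\<Sum>q\<le>N. p ws * theta W D q h (form_prod ws)) = (\<Sum>q\<le>N. if q = length ws then p ws * h ws else 0)"
      using th[OF ws] by (intro sum.cong) auto
    then show "p ws * h ws = (\<Sum>q\<le>N. p ws * theta W D q h (form_prod ws))"
      using len[OF ws] by simp
  qed
  also have "\<dots> = (\<Sum>q\<le>N. \<Sum>ws\<in>S. p ws * theta W D q h (form_prod ws))"
    by (rule sum.swap)
  also have "\<dots> = 0"
  proof (rule sum.neutral, rule ballI)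
    fix q
    have "(\<Sum>ws\<in>S. p ws * theta W D q h (form_prod ws))
      = (\<Sum>n\<in>wdeg ` S. \<Sum>ws\<in>{ws \<in> S. wdeg ws = n}. p ws * theta W D q h (form_prod ws))"
      by (rule sum.image_gen[OF S])
    also have "\<dots> = 0"
    proof (rule sum.neutral, rule ballI)
      fix n
      have "(\<Sum>ws\<in>{ws \<in> S. wdeg ws = n}. p ws * theta W D q h (form_prod ws))
        = theta W D q h (\<Sum>ws\<in>{ws \<in> S. wdeg ws = n}. p ws *\<^sub>Q form_prod ws)"
        using linear_map_on_sum[OF theta_linear[of W D q h] ratvec.subspace_UNIV,
            of "{ws \<in> S. wdeg ws = n}" "\<lambda>ws. p ws *\<^sub>Q form_prod ws"]
        by (simp add: linear_map_on_scale[OF theta_linear] del: scaleQ_fun_apply)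
      also have "(\<Sum>ws\<in>{ws \<in> S. wdeg ws = n}. p ws *\<^sub>Q form_prod ws) = 0"
        using zero[of n] by (simp add: S_def)
      finally show "(\<Sum>ws\<in>{ws \<in> S. wdeg ws = n}. p ws * theta W D q h (form_prod ws)) = 0"
        by (simp only: linear_map_on_zero[OF theta_linear ratvec.subspace_UNIV])
    qed
    finally show "(\<Sum>ws\<in>S. p ws * theta W D q h (form_prod ws)) = 0" .
  qed
  finally show False using l(3) by simp
qed

section \<open>Graded commutative algebras\<close>

text \<open>The conditions of \<open>cdga\<close> on the product and on the differential are separated: the algebra of all cochains on \<open>V\<^sup>\<or>\<close>
  and its derivation are needed before the square of the derivation is known to vanish.\<close>

definition graded_algebra :: "'v::rat_vector gcdga \<Rightarrow> bool" where
  "graded_algebra A \<longleftrightarrow>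
     graded_space (acomp A) \<and>
     (\<forall>i j. \<forall>x\<in>acomp A i. \<forall>y\<in>acomp A j. amul A i j x y \<in> acomp A (i + j)) \<and>
     (\<forall>i j. bilinear_map_on (acomp A i) (acomp A j) (amul A i j)) \<and>
     aone A \<in> acomp A 0 \<and>
     (\<forall>i. \<forall>x\<in>acomp A i. amul A 0 i (aone A) x = x \<and> amul A i 0 x (aone A) = x) \<and>
     (\<forall>i j k. \<forall>x\<in>acomp A i. \<forall>y\<in>acomp A j. \<forall>z\<in>acomp A k.
        amul A (i + j) k (amul A i j x y) z = amul A i (j + k) x (amul A j k y z)) \<and>
     (\<forall>i j. \<forall>x\<in>acomp A i. \<forall>y\<in>acomp A j. amul A i j x y = (-1) ^ (i * j) *\<^sub>Q amul A j i y x)"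

definition is_derivation :: "'v::rat_vector gcdga \<Rightarrow> bool" where
  "is_derivation A \<longleftrightarrow>
     (\<forall>i. linear_map_on (acomp A i) (adif A i)) \<and> adif A 0 (aone A) = 0 \<and>
     (\<forall>i j. \<forall>x\<in>acomp A i. \<forall>y\<in>acomp A j.
        adif A (i + j) (amul A i j x y) =
          amul A (Suc i) j (adif A i x) y + (-1) ^ i *\<^sub>Q amul A i (Suc j) x (adif A j y))"

lemma graded_algebraD:
  assumes "graded_algebra A"
  shows "ratvec.subspace (acomp A i)"
    "x \<in> acomp A i \<Longrightarrow> y \<in> acomp A j \<Longrightarrow> amul A i j x y \<in> acomp A (i + j)"
    "bilinear_map_on (acomp A i) (acomp A j) (amul A i j)"
    "aone A \<in> acomp A 0"
    "x \<in> acomp A i \<Longrightarrow> amul A 0 i (aone A) x = x"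
    "x \<in> acomp A i \<Longrightarrow> amul A i 0 x (aone A) = x"
    "x \<in> acomp A i \<Longrightarrow> y \<in> acomp A j \<Longrightarrow> z \<in> acomp A k \<Longrightarrow>
       amul A (i + j) k (amul A i j x y) z = amul A i (j + k) x (amul A j k y z)"
    "x \<in> acomp A i \<Longrightarrow> y \<in> acomp A j \<Longrightarrow> amul A i j x y = (-1) ^ (i * j) *\<^sub>Q amul A j i y x"
  using assms unfolding graded_algebra_def graded_space_def by blast+

lemma cdga_graded_algebra: "cdga A \<Longrightarrow> graded_algebra A"
  unfolding cdga_def graded_algebra_def by (elim conjE, intro conjI)

lemma cdgaD:
  assumes "cdga A"
  shows "x \<in> acomp A i \<Longrightarrow> adif A i x \<in> acomp A (Suc i)"
    "linear_map_on (acomp A i) (adif A i)"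
    "x \<in> acomp A i \<Longrightarrow> adif A (Suc i) (adif A i x) = 0"
    "x \<in> acomp A i \<Longrightarrow> y \<in> acomp A j \<Longrightarrow> adif A (i + j) (amul A i j x y) =
          amul A (Suc i) j (adif A i x) y + (-1) ^ i *\<^sub>Q amul A i (Suc j) x (adif A j y)"
  using assms unfolding cdga_def by blast+

lemma cdga_is_derivation:
  assumes A: "cdga A" shows "is_derivation A"
proof -
  note alg = cdga_graded_algebra[OF A]
  have one: "aone A \<in> acomp A 0" and d1: "adif A 0 (aone A) \<in> acomp A (Suc 0)"
    using graded_algebraD(4)[OF alg] cdgaD(1)[OF A] by auto
  have "adif A 0 (aone A) = adif A 0 (aone A) + adif A 0 (aone A)"
    using cdgaD(4)[OF A one one] graded_algebraD(5,6)[OF alg d1] graded_algebraD(5)[OF alg one] by simp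
  then have "adif A 0 (aone A) = 0" by simp
  then show ?thesis using cdgaD[OF A] unfolding is_derivation_def by blast
qed

lemma amul_linear_left: "graded_algebra A \<Longrightarrow> y \<in> acomp A j \<Longrightarrow> linear_map_on (acomp A i) (\<lambda>x. amul A i j x y)"
  and amul_linear_right: "graded_algebra A \<Longrightarrow> x \<in> acomp A i \<Longrightarrow> linear_map_on (acomp A j) (amul A i j x)"
  using graded_algebraD(3) bilinear_map_on_left bilinear_map_on_right by blast+

lemma wprod_in:
  "graded_algebra A \<Longrightarrow> ws \<in> words (acomp A) \<Longrightarrow> wprod A ws \<in> acomp A (wdeg ws)"
  by (induction A ws rule: wprod.induct) (auto intro: graded_algebraD)

lemma wprod_append:
  assumes A: "graded_algebra A" and "us \<in> words (acomp A)" "vs \<in> words (acomp A)"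
  shows "wprod A (us @ vs) = amul A (wdeg us) (wdeg vs) (wprod A us) (wprod A vs)"
  using assms(2)
proof (induction us)
  case Nil
  then show ?case using graded_algebraD(5)[OF A wprod_in[OF A assms(3)]] by simp
next
  case (Cons a us)
  obtain k x where a: "a = (k, x)" by fastforce
  have x: "x \<in> acomp A k" and us: "us \<in> words (acomp A)" using Cons.prems by (auto simp: a)
  show ?case
    using Cons.IH[OF us] graded_algebraD(7)[OF A x wprod_in[OF A us] wprod_in[OF A assms(3)]]
    by (simp add: a)
qed

lemma wprod_respects_relations:
  assumes A: "graded_algebra A"
  shows "respects_relations (acomp A) (wprod A)"
  unfolding respects_relations_def
proof (intro conjI ballI allI)
  fix us ws k assume "us \<in> words (acomp A)" and ws: "ws \<in> words (acomp A)"
  then show "linear_map_on (acomp A k) (\<lambda>x. wprod A (us @ (k, x) # ws))"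
  proof (induction us)
    case Nil
    then show ?case using amul_linear_left[OF A wprod_in[OF A ws]] by simp
  next
    case (Cons a us)
    obtain l y where a: "a = (l, y)" by fastforce
    have y: "y \<in> acomp A l" and us: "us \<in> words (acomp A)" using Cons.prems by (auto simp: a)
    have "wprod A (us @ (k, x) # ws) \<in> acomp A (wdeg us + (k + wdeg ws))" if "x \<in> acomp A k" for x
      using wprod_in[OF A, of "us @ (k, x) # ws"] us ws that by simp
    then show ?case
      using linear_map_on_compose[OF Cons.IH[OF us ws] amul_linear_right[OF A y]] by (simp add: a)
  qed
next
  fix us ws i j x y assume "us \<in> words (acomp A)" and ws: "ws \<in> words (acomp A)"
    and x: "x \<in> acomp A i" and y: "y \<in> acomp A j"
  then show "wprod A (us @ (i, x) # (j, y) # ws) = (-1) ^ (i * j) *\<^sub>Q wprod A (us @ (j, y) # (i, x) # ws)"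
  proof (induction us)
    case Nil
    note w = wprod_in[OF A ws]
    have yx: "amul A j i y x \<in> acomp A (i + j)" using graded_algebraD(2)[OF A y x] by (simp add: add.commute)
    have "amul A i (j + wdeg ws) x (amul A j (wdeg ws) y (wprod A ws))
      = amul A (i + j) (wdeg ws) (amul A i j x y) (wprod A ws)"
      using graded_algebraD(7)[OF A x y w] by simp
    also have "\<dots> = (-1) ^ (i * j) *\<^sub>Q amul A (i + j) (wdeg ws) (amul A j i y x) (wprod A ws)"
      unfolding graded_algebraD(8)[OF A x y] using linear_map_on_scale[OF amul_linear_left[OF A w] yx] .
    also have "amul A (i + j) (wdeg ws) (amul A j i y x) (wprod A ws)
      = amul A j (i + wdeg ws) y (amul A i (wdeg ws) x (wprod A ws))"
      using graded_algebraD(7)[OF A y x w] by (simp add: add.commute)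
    finally show ?case by simp
  next
    case (Cons a us)
    obtain l z where a: "a = (l, z)" by fastforce
    have z: "z \<in> acomp A l" and us: "us \<in> words (acomp A)" using Cons.prems by (auto simp: a)
    have "wprod A (us @ (j, y) # (i, x) # ws) \<in> acomp A (wdeg us + (j + (i + wdeg ws)))"
      using wprod_in[OF A, of "us @ (j, y) # (i, x) # ws"] us ws x y by simp
    from linear_map_on_scale[OF amul_linear_right[OF A z] this]
    show ?case using Cons.IH[OF us ws x y] by (simp add: a add.left_commute)
  qed
qed

definition map_word :: "(nat \<Rightarrow> 'v \<Rightarrow> 'w) \<Rightarrow> 'v word \<Rightarrow> 'w word" where
  "map_word g = map (\<lambda>(k, x). (k, g k x))"

lemma map_word_simps [simp]: "map_word g [] = []" "map_word g ((k, x) # ws) = (k, g k x) # map_word g ws"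
    "map_word g (us @ vs) = map_word g us @ map_word g vs" "wdeg (map_word g ws) = wdeg ws"
    "sdeg (map_word g ws) = sdeg ws" "length (map_word g ws) = length ws"
  by (auto simp: map_word_def wdeg_def sdeg_def o_def case_prod_unfold)

lemma map_word_in: "ws \<in> words V \<Longrightarrow> (\<And>k x. x \<in> V k \<Longrightarrow> g k x \<in> U k) \<Longrightarrow> map_word g ws \<in> words U"
  by (auto simp: words_def map_word_def)

lemma respects_relations_map_word:
  assumes h: "respects_relations U h" and "\<And>k. linear_map_on (V k) (g k)" and g: "\<And>k x. x \<in> V k \<Longrightarrow> g k x \<in> U k"
  shows "respects_relations V (\<lambda>ws. h (map_word g ws))"
  unfolding respects_relations_def
proof (intro conjI ballI allI)
  fix us ws k assume "us \<in> words V" "ws \<in> words V"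
  then have "map_word g us \<in> words U" "map_word g ws \<in> words U" using map_word_in g by blast+
  from linear_map_on_compose[OF assms(2) respects_relationsD(1)[OF h this] g]
  show "linear_map_on (V k) (\<lambda>x. h (map_word g (us @ (k, x) # ws)))" by simp
next
  fix us ws i j x y assume "us \<in> words V" "ws \<in> words V" and xy: "x \<in> V i" "y \<in> V j"
  then have "map_word g us \<in> words U" "map_word g ws \<in> words U" using map_word_in g by blast+
  from respects_relationsD(2)[OF h this g[OF xy(1)] g[OF xy(2)]]
  show "h (map_word g (us @ (i, x) # (j, y) # ws)) = (-1) ^ (i * j) *\<^sub>Q h (map_word g (us @ (j, y) # (i, x) # ws))"
    by simp
qed

subsection \<open>Homomorphisms\<close>

definition algebra_hom :: "'v::rat_vector gcdga \<Rightarrow> 'w::rat_vector gcdga \<Rightarrow> (nat \<Rightarrow> 'v \<Rightarrow> 'w) \<Rightarrow> bool" where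
  "algebra_hom A B \<phi> \<longleftrightarrow>
     (\<forall>k. \<forall>x\<in>acomp A k. \<phi> k x \<in> acomp B k) \<and> (\<forall>k. linear_map_on (acomp A k) (\<phi> k)) \<and>
     \<phi> 0 (aone A) = aone B \<and>
     (\<forall>i j. \<forall>x\<in>acomp A i. \<forall>y\<in>acomp A j. \<phi> (i + j) (amul A i j x y) = amul B i j (\<phi> i x) (\<phi> j y))"

lemma algebra_homD:
  assumes "algebra_hom A B \<phi>"
  shows "x \<in> acomp A k \<Longrightarrow> \<phi> k x \<in> acomp B k" "linear_map_on (acomp A k) (\<phi> k)" "\<phi> 0 (aone A) = aone B"
    "x \<in> acomp A i \<Longrightarrow> y \<in> acomp A j \<Longrightarrow> \<phi> (i + j) (amul A i j x y) = amul B i j (\<phi> i x) (\<phi> j y)"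
  using assms unfolding algebra_hom_def by blast+

lemma algebra_hom_wprod:
  assumes A: "graded_algebra A" and \<phi>: "algebra_hom A B \<phi>" and "ws \<in> words (acomp A)"
  shows "\<phi> (wdeg ws) (wprod A ws) = wprod B (map_word \<phi> ws)"
  using assms(3)
proof (induction ws)
  case Nil
  then show ?case by (simp add: algebra_homD(3)[OF \<phi>])
next
  case (Cons a ws)
  obtain k x where a: "a = (k, x)" by fastforce
  then show ?case using Cons algebra_homD(4)[OF \<phi> _ wprod_in[OF A]] by simp
qed

lemma free_on_gensD:
  assumes "free_on_gens A"
  shows "graded_space (gens A)" "gens A k \<subseteq> acomp A k"
    "acomp A n = ratvec.span (wprod A ` {ws \<in> words (gens A). wdeg ws = n})"
    "p \<in> ratvec.span (single ` words (gens A)) \<Longrightarrow>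
        (\<And>n. (\<Sum>ws | p ws \<noteq> 0 \<and> wdeg ws = n. p ws *\<^sub>Q wprod A ws) = 0) \<Longrightarrow>
        p \<in> ratvec.span (free_relations (gens A))"
  using assms unfolding free_on_gens_def by blast+

lemma words_gens: "free_on_gens A \<Longrightarrow> ws \<in> words (gens A) \<Longrightarrow> ws \<in> words (acomp A)"
  using free_on_gensD(2) by (fastforce simp: words_def)

lemma wprod_gens_subset:
  assumes "graded_algebra A" "free_on_gens A"
  shows "wprod A ` {ws \<in> words (gens A). wdeg ws = n} \<subseteq> acomp A n"
  using wprod_in[OF assms(1) words_gens[OF assms(2)]] by blast

lemma linear_eq_on_generated:
  assumes A: "graded_algebra A" "free_on_gens A"
    and "linear_map_on (acomp A n) f" "linear_map_on (acomp A n) g"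
    and "\<And>ws. ws \<in> words (gens A) \<Longrightarrow> wdeg ws = n \<Longrightarrow> f (wprod A ws) = g (wprod A ws)"
    and "x \<in> acomp A n"
  shows "f x = g x"
proof (rule linear_map_on_span_eq[OF assms(3,4) graded_algebraD(1)[OF A(1)] wprod_gens_subset[OF A]])
  show "x \<in> ratvec.span (wprod A ` {ws \<in> words (gens A). wdeg ws = n})"
    using assms(6) unfolding free_on_gensD(3)[OF A(2), of n] .
qed (use assms(5) in blast)

lemma algebra_hom_eq:
  assumes A: "graded_algebra A" "free_on_gens A"
    and \<phi>: "algebra_hom A B \<phi>" and \<chi>: "algebra_hom A B \<chi>"
    and "\<And>k v. v \<in> gens A k \<Longrightarrow> \<phi> k v = \<chi> k v" and "x \<in> acomp A n"
  shows "\<phi> n x = \<chi> n x"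
proof (rule linear_eq_on_generated[OF A algebra_homD(2)[OF \<phi>] algebra_homD(2)[OF \<chi>] _ assms(6)])
  fix ws assume ws: "ws \<in> words (gens A)" "wdeg ws = n"
  have "map_word \<phi> ws = map_word \<chi> ws"
    using ws(1) assms(5) by (auto simp: map_word_def words_def)
  then show "\<phi> n (wprod A ws) = \<chi> n (wprod A ws)"
    using algebra_hom_wprod[OF A(1) \<phi> words_gens[OF A(2) ws(1)]]
      algebra_hom_wprod[OF A(1) \<chi> words_gens[OF A(2) ws(1)]] ws(2) by simp
qed

text \<open>Both composites of \<open>\<phi>\<close> with the differentials obey the Leibniz rule along \<open>\<phi>\<close>, so they agree if they agree on generators.\<close>

lemma algebra_hom_commutes_dif:
  assumes A: "cdga A" "free_on_gens A" and B: "graded_algebra B" "is_derivation B"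
    and \<phi>: "algebra_hom A B \<phi>"
    and gens: "\<And>k v. v \<in> gens A k \<Longrightarrow> \<phi> (Suc k) (adif A k v) = adif B k (\<phi> k v)"
    and x: "x \<in> acomp A n"
  shows "\<phi> (Suc n) (adif A n x) = adif B n (\<phi> n x)"
proof -
  note alg = cdga_graded_algebra[OF A(1)]
  have word: "\<phi> (Suc (wdeg ws)) (adif A (wdeg ws) (wprod A ws)) = adif B (wdeg ws) (\<phi> (wdeg ws) (wprod A ws))"
    if "ws \<in> words (gens A)" for ws
    using that
  proof (induction ws)
    case Nil
    have "adif A 0 (aone A) = 0" "adif B 0 (aone B) = 0"
      using cdga_is_derivation[OF A(1)] B(2) unfolding is_derivation_def by blast+
    then show ?case
      using linear_map_on_zero[OF algebra_homD(2)[OF \<phi>] graded_algebraD(1)[OF alg]]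
      by (simp add: algebra_homD(3)[OF \<phi>])
  next
    case (Cons a ws)
    obtain k v where a: "a = (k, v)" by fastforce
    have v: "v \<in> gens A k" and ws: "ws \<in> words (gens A)" using Cons.prems by (auto simp: a)
    have v': "v \<in> acomp A k" using v free_on_gensD(2)[OF A(2)] by blast
    have w: "wprod A ws \<in> acomp A (wdeg ws)" using wprod_in[OF alg words_gens[OF A(2) ws]] .
    have dv: "adif A k v \<in> acomp A (Suc k)" and dw: "adif A (wdeg ws) (wprod A ws) \<in> acomp A (Suc (wdeg ws))"
      using cdgaD(1)[OF A(1)] v' w by auto
    have p1: "amul A (Suc k) (wdeg ws) (adif A k v) (wprod A ws) \<in> acomp A (Suc (k + wdeg ws))"
      using graded_algebraD(2)[OF alg dv w] by simp
    have p2: "amul A k (Suc (wdeg ws)) v (adif A (wdeg ws) (wprod A ws)) \<in> acomp A (Suc (k + wdeg ws))"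
      using graded_algebraD(2)[OF alg v' dw] by simp
    have "adif B (k + wdeg ws) (amul B k (wdeg ws) (\<phi> k v) (\<phi> (wdeg ws) (wprod A ws)))
       = amul B (Suc k) (wdeg ws) (adif B k (\<phi> k v)) (\<phi> (wdeg ws) (wprod A ws))
        + (-1) ^ k *\<^sub>Q amul B k (Suc (wdeg ws)) (\<phi> k v) (adif B (wdeg ws) (\<phi> (wdeg ws) (wprod A ws)))"
      using B(2) algebra_homD(1)[OF \<phi> v'] algebra_homD(1)[OF \<phi> w] unfolding is_derivation_def by blast
    then show ?case
      using algebra_homD(4)[OF \<phi> dv w] algebra_homD(4)[OF \<phi> v' dw] algebra_homD(4)[OF \<phi> v' w]
        Cons.IH[OF ws] gens[OF v] p1 p2 ratvec.subspace_scale[OF graded_algebraD(1)[OF alg] p2]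
      by (simp add: a cdgaD(4)[OF A(1) v' w] linear_map_on_add[OF algebra_homD(2)[OF \<phi>]]
          linear_map_on_scale[OF algebra_homD(2)[OF \<phi>]])
  qed
  show ?thesis
  proof (rule linear_eq_on_generated[OF alg A(2) _ _ _ x])
    show "linear_map_on (acomp A n) (\<lambda>x. \<phi> (Suc n) (adif A n x))"
      using cdgaD(1,2)[OF A(1)] by (intro linear_map_on_compose[OF _ algebra_homD(2)[OF \<phi>]]) auto
    show "linear_map_on (acomp A n) (\<lambda>x. adif B n (\<phi> n x))"
      using B(2) algebra_homD(1)[OF \<phi>] unfolding is_derivation_def
      by (intro linear_map_on_compose[OF algebra_homD(2)[OF \<phi>]]) auto
  qed (use word in auto)
qed

text \<open>The universal property: an element is written as a combination of words in the generators, and two such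
  combinations differ by relations that hold in every graded commutative algebra.\<close>

lemma free_extension:
  assumes A: "graded_algebra A" "free_on_gens A" and B: "graded_algebra B"
    and g: "\<And>k. linear_map_on (gens A k) (g k)" "\<And>k x. x \<in> gens A k \<Longrightarrow> g k x \<in> acomp B k"
  obtains \<phi> where "algebra_hom A B \<phi>" "\<And>k x. x \<in> gens A k \<Longrightarrow> \<phi> k x = g k x"
proof -
  define h where "h = (\<lambda>ws. wprod B (map_word g ws))"
  define P where "P = (\<lambda>n. ratvec.span (single ` {ws \<in> words (gens A). wdeg ws = n}))"
  let ?e = "lcomb (wprod A)"
  have V: "graded_space (gens A)" by (rule free_on_gensD(1)[OF A(2)])
  have respects: "respects_relations (gens A) h"
    unfolding h_def by (rule respects_relations_map_word[OF wprod_respects_relations[OF B] g])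
  have h_in: "h ws \<in> acomp B (wdeg ws)" if "ws \<in> words (gens A)" for ws
    using wprod_in[OF B map_word_in[OF that g(2)]] by (simp add: h_def)
  have linP: "linear_map_on (P n) (lcomb f)" for n and f :: "'a word \<Rightarrow> 'c::rat_vector"
    unfolding P_def by (rule lcomb_linear)
  have subP: "ratvec.subspace (P n)" for n by (simp add: P_def)
  have single_P: "single ws \<in> P n" if "ws \<in> words (gens A)" "wdeg ws = n" for ws n
    using that by (auto simp: P_def intro: ratvec.span_base)
  have kernel: "lcomb h p = 0" if p: "p \<in> P n" and zero: "?e p = 0" for p n
  proof -
    have supp: "fin_supp p" "{ws. p ws \<noteq> 0} \<subseteq> {ws \<in> words (gens A). wdeg ws = n}"
      using span_single_fin_supp p unfolding P_def by blast+
    have "p \<in> ratvec.span (free_relations (gens A))"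
    proof (rule free_on_gensD(4)[OF A(2)])
      show "p \<in> ratvec.span (single ` words (gens A))"
        using supp by (intro fin_supp_in_span) auto
      \<comment> \<open>all words in \<open>p\<close> have degree \<open>n\<close>\<close>
      show "(\<Sum>ws | p ws \<noteq> 0 \<and> wdeg ws = m. p ws *\<^sub>Q wprod A ws) = 0" for m
      proof (cases "m = n")
        case True
        then have "{ws. p ws \<noteq> 0 \<and> wdeg ws = m} = {ws. p ws \<noteq> 0}" using supp(2) by auto
        then show ?thesis using zero by (simp add: lcomb_def)
      next
        case False
        then have "{ws. p ws \<noteq> 0 \<and> wdeg ws = m} = {}" using supp(2) by auto
        then show ?thesis by (simp only: sum.empty)
      qed
    qed
    then show ?thesis by (rule lcomb_relations[OF respects V])
  qed
  have surj: "\<exists>p\<in>P n. ?e p = a" if "a \<in> acomp A n" for a n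
    using that unfolding free_on_gensD(3)[OF A(2), of n]
  proof (induction rule: ratvec.span_induct_alt)
    case base
    show ?case using linear_map_on_zero[OF linP subP] ratvec.subspace_0[OF subP] by blast
  next
    case (step c b y)
    then obtain ws q where ws: "ws \<in> words (gens A)" "wdeg ws = n" "b = wprod A ws" and q: "q \<in> P n" "?e q = y" by blast
    note s = single_P[OF ws(1,2)]
    have cs: "c *\<^sub>Q single ws \<in> P n" using s by (rule ratvec.subspace_scale[OF subP])
    have "?e (c *\<^sub>Q single ws + q) = c *\<^sub>Q b + y"
      using linear_map_on_add[OF linP[of n "wprod A"] cs q(1)] linear_map_on_scale[OF linP[of n "wprod A"] s] ws q
      by (simp add: lcomb_single)
    then show ?case using ratvec.subspace_add[OF subP cs q(1)] by blast
  qed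
  define \<phi> where "\<phi> = (\<lambda>n a. lcomb h (SOME p. p \<in> P n \<and> ?e p = a))"
  have \<phi>: "\<phi> n (?e p) = lcomb h p" if p: "p \<in> P n" for p n
  proof -
    define q where "q = (SOME q. q \<in> P n \<and> ?e q = ?e p)"
    have q: "q \<in> P n" "?e q = ?e p"
      using someI_ex[of "\<lambda>q. q \<in> P n \<and> ?e q = ?e p"] p unfolding q_def by blast+
    have "lcomb h (q - p) = 0"
      using q p by (intro kernel[of _ n])
        (simp_all add: ratvec.subspace_diff[OF subP] linear_map_on_diff[OF linP subP])
    then show ?thesis
      using linear_map_on_diff[OF linP subP q(1) p, of h] by (simp add: \<phi>_def q_def)
  qed
  have \<phi>_word: "\<phi> n (wprod A ws) = h ws" if "ws \<in> words (gens A)" "wdeg ws = n" for ws n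
    using \<phi>[OF single_P[OF that]] by (simp add: lcomb_single)
  have lin: "linear_map_on (acomp A n) (\<phi> n)" for n
  proof (rule linear_map_onI)
    fix x y c assume x: "x \<in> acomp A n"
    obtain p where p: "p \<in> P n" "?e p = x" using surj[OF x] by blast
    show "\<phi> n (c *\<^sub>Q x) = c *\<^sub>Q \<phi> n x"
      using \<phi>[OF ratvec.subspace_scale[OF subP p(1)], of c] \<phi>[OF p(1)]
        linear_map_on_scale[OF linP[of n "wprod A"] p(1), of c] linear_map_on_scale[OF linP[of n h] p(1), of c] p(2)
      by (simp del: scaleQ_fun_apply)
    assume y: "y \<in> acomp A n"
    obtain q where q: "q \<in> P n" "?e q = y" using surj[OF y] by blast
    show "\<phi> n (x + y) = \<phi> n x + \<phi> n y"
      using \<phi>[OF ratvec.subspace_add[OF subP p(1) q(1)]] \<phi>[OF p(1)] \<phi>[OF q(1)]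
        linear_map_on_add[OF linP[of n "wprod A"] p(1) q(1)] linear_map_on_add[OF linP[of n h] p(1) q(1)] p(2) q(2)
      by simp
  qed
  have into: "\<phi> n x \<in> acomp B n" if "x \<in> acomp A n" for n x
  proof (rule linear_map_on_span_in[OF lin graded_algebraD(1)[OF A(1)] graded_algebraD(1)[OF B] wprod_gens_subset[OF A]])
    show "x \<in> ratvec.span (wprod A ` {ws \<in> words (gens A). wdeg ws = n})"
      using that unfolding free_on_gensD(3)[OF A(2), of n] .
  qed (use \<phi>_word h_in in auto)
  have mul_words: "\<phi> (wdeg us + wdeg vs) (amul A (wdeg us) (wdeg vs) (wprod A us) (wprod A vs))
      = amul B (wdeg us) (wdeg vs) (h us) (h vs)" if us: "us \<in> words (gens A)" and vs: "vs \<in> words (gens A)" for us vs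
  proof -
    have "\<phi> (wdeg us + wdeg vs) (wprod A (us @ vs)) = h (us @ vs)"
      using us vs by (intro \<phi>_word) auto
    then show ?thesis
      unfolding wprod_append[OF A(1) words_gens[OF A(2) us] words_gens[OF A(2) vs]]
      using wprod_append[OF B map_word_in[OF us g(2)] map_word_in[OF vs g(2)]] by (simp add: h_def)
  qed
  have hom: "algebra_hom A B \<phi>"
    unfolding algebra_hom_def
  proof (intro conjI allI ballI)
    show "\<phi> 0 (aone A) = aone B" using \<phi>_word[of "[]" 0] by (simp add: h_def)
    fix i j x y assume x: "x \<in> acomp A i" and y: "y \<in> acomp A j"
    show "\<phi> (i + j) (amul A i j x y) = amul B i j (\<phi> i x) (\<phi> j y)"
    proof (rule linear_eq_on_generated[OF A _ _ _ x])
      show "linear_map_on (acomp A i) (\<lambda>x. \<phi> (i + j) (amul A i j x y))"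
        using graded_algebraD(2)[OF A(1)] y by (intro linear_map_on_compose[OF amul_linear_left[OF A(1) y] lin]) auto
      show "linear_map_on (acomp A i) (\<lambda>x. amul B i j (\<phi> i x) (\<phi> j y))"
        using linear_map_on_compose[OF lin amul_linear_left[OF B into[OF y]] into] by blast
      fix us assume us: "us \<in> words (gens A)" "wdeg us = i"
      have u: "wprod A us \<in> acomp A i" using wprod_in[OF A(1) words_gens[OF A(2) us(1)]] us(2) by simp
      show "\<phi> (i + j) (amul A i j (wprod A us) y) = amul B i j (\<phi> i (wprod A us)) (\<phi> j y)"
      proof (rule linear_eq_on_generated[OF A _ _ _ y])
        show "linear_map_on (acomp A j) (\<lambda>y. \<phi> (i + j) (amul A i j (wprod A us) y))"
          using graded_algebraD(2)[OF A(1) u] by (intro linear_map_on_compose[OF amul_linear_right[OF A(1) u] lin]) auto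
        show "linear_map_on (acomp A j) (\<lambda>y. amul B i j (\<phi> i (wprod A us)) (\<phi> j y))"
          using linear_map_on_compose[OF lin amul_linear_right[OF B into[OF u]] into] by blast
        fix vs assume vs: "vs \<in> words (gens A)" "wdeg vs = j"
        show "\<phi> (i + j) (amul A i j (wprod A us) (wprod A vs)) = amul B i j (\<phi> i (wprod A us)) (\<phi> j (wprod A vs))"
          using mul_words[OF us(1) vs(1)] us vs by (simp add: \<phi>_word)
      qed
    qed
  qed (use into lin in auto)
  have "\<phi> k x = g k x" if x: "x \<in> gens A k" for k x
  proof -
    have "x \<in> acomp A k" using x free_on_gensD(2)[OF A(2)] by blast
    then show ?thesis
      using \<phi>_word[of "[(k, x)]" k] x graded_algebraD(6)[OF A(1)] graded_algebraD(6)[OF B g(2)[OF x]]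
      by (simp add: h_def)
  qed
  with hom show thesis using that by blast
qed

subsection \<open>Morphisms of quadratic Sullivan algebras\<close>

lemma sullivan_homD:
  assumes "\<phi> \<in> sullivan_hom A B"
  shows "algebra_hom A B \<phi>" "\<phi> k \<in> extensional (acomp A k)"
    "x \<in> acomp A k \<Longrightarrow> \<phi> (Suc k) (adif A k x) = adif B k (\<phi> k x)"
    "v \<in> gens A k \<Longrightarrow> \<phi> k v \<in> gens B k"
proof -
  have "\<phi> k \<in> acomp A k \<rightarrow>\<^sub>E acomp B k" for k using assms unfolding sullivan_hom_def by blast
  then have "\<phi> k \<in> extensional (acomp A k)" "\<forall>x\<in>acomp A k. \<phi> k x \<in> acomp B k" for k
    by (auto simp: PiE_iff)
  moreover have "(\<forall>k. linear_map_on (acomp A k) (\<phi> k)) \<and> \<phi> 0 (aone A) = aone B \<and>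
     (\<forall>i j. \<forall>x\<in>acomp A i. \<forall>y\<in>acomp A j. \<phi> (i + j) (amul A i j x y) = amul B i j (\<phi> i x) (\<phi> j y))"
    using assms unfolding sullivan_hom_def by blast
  ultimately show "algebra_hom A B \<phi>" "\<phi> k \<in> extensional (acomp A k)" unfolding algebra_hom_def by blast+
  show "x \<in> acomp A k \<Longrightarrow> \<phi> (Suc k) (adif A k x) = adif B k (\<phi> k x)" "v \<in> gens A k \<Longrightarrow> \<phi> k v \<in> gens B k"
    using assms unfolding sullivan_hom_def by blast+
qed

lemma sullivan_homI:
  assumes "algebra_hom A B \<phi>" "\<And>k. \<phi> k \<in> extensional (acomp A k)"
    "\<And>k x. x \<in> acomp A k \<Longrightarrow> \<phi> (Suc k) (adif A k x) = adif B k (\<phi> k x)"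
    "\<And>k v. v \<in> gens A k \<Longrightarrow> \<phi> k v \<in> gens B k"
  shows "\<phi> \<in> sullivan_hom A B"
  using assms unfolding sullivan_hom_def algebra_hom_def by (auto simp: PiE_iff)

lemma sullivan_hom_restrict:
  assumes A: "cdga A" "free_on_gens A" and \<phi>: "algebra_hom A B \<phi>"
    and dif: "\<And>k x. x \<in> acomp A k \<Longrightarrow> \<phi> (Suc k) (adif A k x) = adif B k (\<phi> k x)"
    and gens: "\<And>k v. v \<in> gens A k \<Longrightarrow> \<phi> k v \<in> gens B k"
  shows "(\<lambda>k. restrict (\<phi> k) (acomp A k)) \<in> sullivan_hom A B"
proof (rule sullivan_homI)
  note alg = cdga_graded_algebra[OF A(1)]
  have "linear_map_on (acomp A k) (restrict (\<phi> k) (acomp A k))" for k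
    using linear_map_on_cong[of "acomp A k" "restrict (\<phi> k) (acomp A k)" "\<phi> k"]
      graded_algebraD(1)[OF alg] algebra_homD(2)[OF \<phi>] by simp
  then show "algebra_hom A B (\<lambda>k. restrict (\<phi> k) (acomp A k))"
    using algebra_homD[OF \<phi>] graded_algebraD(2,4)[OF alg] by (simp add: algebra_hom_def)
  show "restrict (\<phi> (Suc k)) (acomp A (Suc k)) (adif A k x) = adif B k (restrict (\<phi> k) (acomp A k) x)"
    if "x \<in> acomp A k" for k x
    using that cdgaD(1)[OF A(1) that] dif by simp
  show "restrict (\<phi> k) (acomp A k) v \<in> gens B k" if "v \<in> gens A k" for k v
    using that gens free_on_gensD(2)[OF A(2), of k] by auto
qed simp

lemma sullivan_hom_eqI:
  assumes A: "graded_algebra A" "free_on_gens A"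
    and \<phi>: "\<phi> \<in> sullivan_hom A B" and \<chi>: "\<chi> \<in> sullivan_hom A B"
    and "\<And>k v. v \<in> gens A k \<Longrightarrow> \<phi> k v = \<chi> k v"
  shows "\<phi> = \<chi>"
proof (rule ext)
  show "\<phi> k = \<chi> k" for k
    using sullivan_homD(2)[OF \<phi>] sullivan_homD(2)[OF \<chi>]
      algebra_hom_eq[OF A sullivan_homD(1)[OF \<phi>] sullivan_homD(1)[OF \<chi>] assms(5)]
    by (intro extensionalityI[of _ "acomp A k"]) blast+
qed

lemma graded_comp_apply: "x \<in> V k \<Longrightarrow> graded_comp V g f k x = g k (f k x)"
  by (simp add: graded_comp_def compose_def)

lemma graded_id_apply: "x \<in> V k \<Longrightarrow> graded_id V k x = x"
  by (simp add: graded_id_def)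

lemma sullivan_hom_comp:
  assumes A: "cdga A" "free_on_gens A" and \<phi>: "\<phi> \<in> sullivan_hom A B" and \<chi>: "\<chi> \<in> sullivan_hom B C"
  shows "graded_comp (acomp A) \<chi> \<phi> \<in> sullivan_hom A C"
proof -
  note f = algebra_homD[OF sullivan_homD(1)[OF \<phi>]] and g = algebra_homD[OF sullivan_homD(1)[OF \<chi>]]
  have "algebra_hom A C (\<lambda>k x. \<chi> k (\<phi> k x))"
    unfolding algebra_hom_def
    using f g linear_map_on_compose[OF f(2) g(2) f(1)] by simp
  then have "(\<lambda>k. restrict (\<lambda>x. \<chi> k (\<phi> k x)) (acomp A k)) \<in> sullivan_hom A C"
    using sullivan_homD(3,4)[OF \<phi>] sullivan_homD(3,4)[OF \<chi>] f(1)
    by (intro sullivan_hom_restrict[OF A]) auto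
  then show ?thesis by (simp add: graded_comp_def compose_def)
qed

lemma sullivan_hom_id:
  assumes A: "cdga A" "free_on_gens A"
  shows "graded_id (acomp A) \<in> sullivan_hom A A"
proof -
  have "algebra_hom A A (\<lambda>k x. x)" by (simp add: algebra_hom_def linear_map_on_def)
  then have "(\<lambda>k. restrict (\<lambda>x. x) (acomp A k)) \<in> sullivan_hom A A"
    by (intro sullivan_hom_restrict[OF A]) auto
  then show ?thesis by (simp add: graded_id_def id_def)
qed

section \<open>The quadratic model is a quadratic Sullivan algebra\<close>

definition directed_family :: "'a graded set \<Rightarrow> bool" where
  "directed_family \<I> \<longleftrightarrow> \<I> \<noteq> {} \<and> (\<forall>I\<in>\<I>. \<forall>J\<in>\<I>. \<exists>K\<in>\<I>. \<forall>k. K k \<subseteq> I k \<inter> J k)"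

lemma model_simps [simp]:
  "acomp (quadratic_model L \<I>) n = (\<Union>I\<in>\<I>. quotient_cochains L I n)"
  "amul (quadratic_model L \<I>) i j = cochain_mul"
  "aone (quadratic_model L \<I>) = single []"
  "adif (quadratic_model L \<I>) n = cochain_dif L"
  by (simp_all add: quadratic_model_def)

lemma gens_model: "gens (quadratic_model L \<I>) n = (\<Union>I\<in>\<I>. one_forms (lcomp L) I n)"
  by (auto simp: quadratic_model_def one_forms_def quotient_cochains_iff len_homog_def)

lemma wprod_model: "wprod (quadratic_model L \<I>) ws = form_prod ws"
  by (induction ws rule: form_prod.induct) simp_all

lemma vanishes_on_mono: "vanishes_on I f \<Longrightarrow> (\<And>k. J k \<subseteq> I k) \<Longrightarrow> vanishes_on J f"
  unfolding vanishes_on_def by blast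

lemma one_forms_mono: "f \<in> one_forms W I n \<Longrightarrow> (\<And>k. J k \<subseteq> I k) \<Longrightarrow> f \<in> one_forms W J n"
  unfolding one_forms_def using vanishes_on_mono by blast

lemma quotient_cochains_mono: "f \<in> quotient_cochains L I n \<Longrightarrow> (\<And>k. J k \<subseteq> I k) \<Longrightarrow> f \<in> quotient_cochains L J n"
  unfolding quotient_cochains_iff using vanishes_on_mono by blast

lemma subspace_quotient_cochains: "ratvec.subspace (quotient_cochains L I n)"
proof -
  have "quotient_cochains L I n = {f. sym_form (lcomp L) f} \<inter> {f. homog n f} \<inter> {f. vanishes_on I f}"
    by (auto simp: quotient_cochains_iff)
  then show ?thesis
    by (simp only: ratvec.subspace_inter subspace_sym_form subspace_homog subspace_vanishes_on)
qed

lemma subspace_directed_Union: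
  assumes "\<I> \<noteq> {}" "\<And>I. I \<in> \<I> \<Longrightarrow> ratvec.subspace (S I)"
    and "\<And>I J. I \<in> \<I> \<Longrightarrow> J \<in> \<I> \<Longrightarrow> \<exists>K\<in>\<I>. S I \<union> S J \<subseteq> S K"
  shows "ratvec.subspace (\<Union>I\<in>\<I>. S I)"
  unfolding ratvec.subspace_def
proof (intro conjI ballI allI)
  show "0 \<in> (\<Union>I\<in>\<I>. S I)" using assms(1,2) ratvec.subspace_0 by blast
  show "c *\<^sub>Q x \<in> (\<Union>I\<in>\<I>. S I)" if "x \<in> (\<Union>I\<in>\<I>. S I)" for c x
    using that assms(2) ratvec.subspace_scale by blast
  fix x y assume "x \<in> (\<Union>I\<in>\<I>. S I)" "y \<in> (\<Union>I\<in>\<I>. S I)"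
  then obtain I J where "I \<in> \<I>" "J \<in> \<I>" "x \<in> S I" "y \<in> S J" by blast
  with assms(3)[of I J] obtain K where "K \<in> \<I>" "x \<in> S K" "y \<in> S K" by blast
  then show "x + y \<in> (\<Union>I\<in>\<I>. S I)" using assms(2) ratvec.subspace_add by blast
qed

lemma directed_family_common:
  assumes "directed_family \<I>" "I \<in> \<I>" "J \<in> \<I>"
  obtains K where "K \<in> \<I>" "\<And>k. K k \<subseteq> I k" "\<And>k. K k \<subseteq> J k"
  using assms unfolding directed_family_def by (meson le_inf_iff)

lemma quotient_cochains_directed:
  assumes "directed_family \<I>" "I \<in> \<I>" "J \<in> \<I>"
  shows "\<exists>K\<in>\<I>. \<forall>n. quotient_cochains L I n \<union> quotient_cochains L J n \<subseteq> quotient_cochains L K n"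
proof -
  obtain K where K: "K \<in> \<I>" "\<And>k. K k \<subseteq> I k" "\<And>k. K k \<subseteq> J k"
    using directed_family_common[OF assms] by blast
  show ?thesis
    using quotient_cochains_mono[of _ L I _ K] quotient_cochains_mono[of _ L J _ K] K by blast
qed

lemma one_forms_directed:
  assumes "directed_family \<I>" "I \<in> \<I>" "J \<in> \<I>"
  shows "\<exists>K\<in>\<I>. \<forall>n. one_forms W I n \<union> one_forms W J n \<subseteq> one_forms W K n"
proof -
  obtain K where K: "K \<in> \<I>" "\<And>k. K k \<subseteq> I k" "\<And>k. K k \<subseteq> J k"
    using directed_family_common[OF assms] by blast
  show ?thesis
    using one_forms_mono[of _ W I _ K] one_forms_mono[of _ W J _ K] K by blast
qed

lemma quotient_cochains_mul:
  assumes "graded_space (lcomp L)" "f \<in> quotient_cochains L I i" "g \<in> quotient_cochains L I j"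
  shows "cochain_mul f g \<in> quotient_cochains L I (i + j)"
  using assms by (simp add: quotient_cochains_iff sym_form_mul homog_mul vanishes_on_mul)

lemma single_Nil_quotient_cochains: "single [] \<in> quotient_cochains L I 0"
  unfolding quotient_cochains_iff
  by (intro conjI sym_form_single_Nil) (auto simp: homog_def vanishes_on_def single_def)

text \<open>Forms on \<open>L / I\<close> and on \<open>L / J\<close> are forms on \<open>L / K\<close> for \<open>K \<subseteq> I \<inter> J\<close>, where their sums and products can be taken.\<close>

lemma model_graded_algebra:
  assumes W: "graded_space (lcomp L)" and dir: "directed_family \<I>"
  shows "graded_algebra (quadratic_model L \<I>)"
proof -
  have ne: "\<I> \<noteq> {}" using dir by (simp add: directed_family_def)
  have sub: "ratvec.subspace (\<Union>I\<in>\<I>. quotient_cochains L I n)" for n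
    using quotient_cochains_directed[OF dir]
    by (intro subspace_directed_Union ne subspace_quotient_cochains) blast
  have closed: "cochain_mul f g \<in> (\<Union>I\<in>\<I>. quotient_cochains L I (i + j))"
    if f: "f \<in> (\<Union>I\<in>\<I>. quotient_cochains L I i)" and g: "g \<in> (\<Union>I\<in>\<I>. quotient_cochains L I j)" for f g i j
  proof -
    obtain I J where "I \<in> \<I>" "J \<in> \<I>" "f \<in> quotient_cochains L I i" "g \<in> quotient_cochains L J j" using f g by blast
    with quotient_cochains_directed[OF dir, of I J L] obtain K where
      "K \<in> \<I>" "f \<in> quotient_cochains L K i" "g \<in> quotient_cochains L K j" by blast
    then show ?thesis using quotient_cochains_mul[OF W] by blast
  qed
  have comm: "cochain_mul f g = (-1) ^ (i * j) *\<^sub>Q cochain_mul g f"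
    if "f \<in> (\<Union>I\<in>\<I>. quotient_cochains L I i)" "g \<in> (\<Union>I\<in>\<I>. quotient_cochains L I j)" for f g i j
    using that by (intro cochain_mul_commute homog_parity) (auto simp: quotient_cochains_iff)
  have one: "single [] \<in> (\<Union>I\<in>\<I>. quotient_cochains L I 0)"
    using ne single_Nil_quotient_cochains by blast
  have bil: "bilinear_map_on S T cochain_mul" for S T :: "('a word \<Rightarrow> rat) set"
    by (simp add: bilinear_map_on_def linear_map_on_def cochain_mul_linear)
  show ?thesis
    unfolding graded_algebra_def graded_space_def model_simps
    by (intro conjI allI ballI;
        (rule sub bil one cochain_mul_one cochain_mul_assoc | (rule closed; assumption) | (rule comm; assumption)))
qed

lemma model_is_derivation: "is_derivation (quadratic_model L \<I>)"
proof -
  \<comment> \<open>\<open>d 1 = d(1 \<and> 1) = d 1 + d 1\<close>\<close>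
  have "bdry_form L (single []) = bdry_form L (single []) + bdry_form L (single [])"
    using bdry_form_Leibniz[of L "single []" "single []"] by simp
  then have "bdry_form L (single []) = 0" by simp
  then have "cochain_dif L (single []) = 0" by (auto simp: cochain_dif_alt fun_eq_iff)
  moreover have "cochain_dif L (cochain_mul f g)
      = cochain_mul (cochain_dif L f) g + (-1) ^ i *\<^sub>Q cochain_mul f (cochain_dif L g)"
    if "f \<in> (\<Union>I\<in>\<I>. quotient_cochains L I i)" "g \<in> (\<Union>I\<in>\<I>. quotient_cochains L I j)" for f g i j
  proof -
    have f: "sym_form (lcomp L) f" "homog i f" and g: "sym_form (lcomp L) g"
      using that by (auto simp: quotient_cochains_iff)
    show ?thesis
      using cochain_dif_Leibniz[of L f g] sym_form_outside[OF f(1)] sym_form_outside[OF g]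
        twist_parity[OF homog_parity[OF f(2)], of 1]
      by (simp add: cochain_mul_linear)
  qed
  moreover have "linear_map_on S (cochain_dif L)" for S
    by (simp add: linear_map_on_def cochain_dif_linear)
  ultimately show ?thesis unfolding is_derivation_def model_simps by blast
qed

lemma cochain_dif_pair:
  assumes "x \<in> lcomp L i" "y \<in> lcomp L j"
  shows "cochain_dif L f [(i, x), (j, y)] = (-1) ^ Suc i * f [(i + j, lbr L i j x y)]"
  using assms by (simp add: cochain_dif_alt)

subsection \<open>Enriched Lie algebras\<close>

lemma enriched_lieD:
  assumes "enriched_lie L \<I>"
  shows "graded_lie L" "graded_space (lcomp L)" "directed_family \<I>"
    "I \<in> \<I> \<Longrightarrow> graded_ideal L I" "I \<in> \<I> \<Longrightarrow> finite_dim_quotient L I" "I \<in> \<I> \<Longrightarrow> nilpotent_quotient L I"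
    "(\<Inter>I\<in>\<I>. I k) = {0}"
  using assms graded_lieD(1)[of L] unfolding enriched_lie_def directed_family_def by simp_all

lemma enriched_dual_basis:
  assumes "enriched_lie L \<I>" "I \<in> \<I>"
  obtains D where "dual_basis (lcomp L) I D"
  using dual_basis_exists[OF enriched_lieD(5)[OF assms]] graded_idealD(1)[OF enriched_lieD(4)[OF assms]] by blast

lemma cdgaI:
  assumes "graded_algebra A" "is_derivation A"
    and "\<And>i x. x \<in> acomp A i \<Longrightarrow> adif A i x \<in> acomp A (Suc i)"
    and "\<And>i x. x \<in> acomp A i \<Longrightarrow> adif A (Suc i) (adif A i x) = 0"
  shows "cdga A"
  unfolding cdga_def
  by (insert assms(1)[unfolded graded_algebra_def] assms(2)[unfolded is_derivation_def], elim conjE, intro conjI;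
      (assumption | (intro allI ballI, erule assms(3)) | (intro allI ballI, erule assms(4))))

lemma model_cdga:
  assumes "enriched_lie L \<I>" shows "cdga (quadratic_model L \<I>)"
proof -
  note L = enriched_lieD[OF assms]
  have closed: "cochain_dif L f \<in> (\<Union>I\<in>\<I>. quotient_cochains L I (Suc i))"
    if "f \<in> (\<Union>I\<in>\<I>. quotient_cochains L I i)" for f i
    using that L(1,4) by (fastforce simp: quotient_cochains_iff intro: cochain_dif_sym_form homog_dif cochain_dif_vanishes)
  have square: "cochain_dif L (cochain_dif L f) = 0"
    if "f \<in> (\<Union>I\<in>\<I>. quotient_cochains L I i)" for f i
    using that cochain_dif_cochain_dif[OF L(1)] by (auto simp: quotient_cochains_iff)
  show ?thesis
    using closed square by (intro cdgaI model_graded_algebra[OF L(2,3)] model_is_derivation) simp_all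
qed

lemma gens_common_ideal:
  assumes dir: "directed_family \<I>" and "finite F" "\<And>k v. (k, v) \<in> F \<Longrightarrow> v \<in> (\<Union>I\<in>\<I>. one_forms W I k)"
  shows "\<exists>I\<in>\<I>. \<forall>(k, v)\<in>F. v \<in> one_forms W I k"
  using assms(2,3)
proof (induction F rule: finite_induct)
  case empty
  then show ?case using dir by (auto simp: directed_family_def)
next
  case (insert a F)
  obtain k v where a: "a = (k, v)" by fastforce
  obtain I where I: "I \<in> \<I>" "\<forall>(k, v)\<in>F. v \<in> one_forms W I k" using insert by auto
  obtain J where J: "J \<in> \<I>" "v \<in> one_forms W J k" using insert.prems[of k v] a by blast
  obtain K where "K \<in> \<I>" "\<forall>n. one_forms W I n \<union> one_forms W J n \<subseteq> one_forms W K n"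
    using one_forms_directed[OF dir I(1) J(1)] by blast
  moreover from this have "w \<in> one_forms W K l" if "(l, w) \<in> F" for l w using I(2) that by blast
  moreover have "v \<in> one_forms W K k" using calculation(2) J(2) by blast
  ultimately show ?case by (intro bexI[of _ K]) (auto simp: a)
qed

lemma model_gens_graded_space:
  assumes "directed_family \<I>" shows "graded_space (gens (quadratic_model L \<I>))"
  unfolding graded_space_def gens_model
proof (intro allI subspace_directed_Union subspace_one_forms)
  show "\<I> \<noteq> {}" using assms by (simp add: directed_family_def)
  show "\<exists>K\<in>\<I>. one_forms (lcomp L) I k \<union> one_forms (lcomp L) J k \<subseteq> one_forms (lcomp L) K k"
    if "I \<in> \<I>" "J \<in> \<I>" for k I J
    using one_forms_directed[OF assms that] by blast
qed

text \<open>Finitely many forms live on one quotient \<open>L / I\<close> of finite dimension, where \<open>sym_form_generated_all\<close> and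
  \<open>form_prod_free\<close> apply.\<close>

lemma model_free_on_gens:
  assumes "enriched_lie L \<I>" shows "free_on_gens (quadratic_model L \<I>)"
proof -
  note L = enriched_lieD[OF assms]
  let ?M = "quadratic_model L \<I>"
  have alg: "graded_algebra ?M" by (rule model_graded_algebra[OF L(2,3)])
  have gens: "graded_space (gens ?M)" by (rule model_gens_graded_space[OF L(3)])
  have sub: "gens ?M k \<subseteq> acomp ?M k" for k
    by (auto simp: gens_model one_forms_def quotient_cochains_iff)
  have "acomp ?M n = ratvec.span (wprod ?M ` {ws \<in> words (gens ?M). wdeg ws = n})" for n
  proof
    show "acomp ?M n \<subseteq> ratvec.span (wprod ?M ` {ws \<in> words (gens ?M). wdeg ws = n})"
    proof
      fix f assume "f \<in> acomp ?M n"
      then obtain I where I: "I \<in> \<I>" "f \<in> quotient_cochains L I n" by auto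
      obtain D where "dual_basis (lcomp L) I D" using enriched_dual_basis[OF assms I(1)] .
      then have "f \<in> ratvec.span (form_prod ` {ws \<in> words (one_forms (lcomp L) I). wdeg ws = n})"
        using I(2) by (intro sym_form_generated_all[OF L(2)]) (auto simp: quotient_cochains_iff)
      moreover have "words (one_forms (lcomp L) I) \<subseteq> words (gens ?M)"
        using I(1) by (auto simp: words_def gens_model)
      then have "form_prod ` {ws \<in> words (one_forms (lcomp L) I). wdeg ws = n}
        \<subseteq> form_prod ` {ws \<in> words (gens ?M). wdeg ws = n}" by blast
      ultimately show "f \<in> ratvec.span (wprod ?M ` {ws \<in> words (gens ?M). wdeg ws = n})"
        unfolding wprod_model using ratvec.span_mono by blast
    qed
    have "words (gens ?M) \<subseteq> words (acomp ?M)" using sub by (fastforce simp: words_def)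
    then show "ratvec.span (wprod ?M ` {ws \<in> words (gens ?M). wdeg ws = n}) \<subseteq> acomp ?M n"
      using wprod_in[OF alg] by (intro ratvec.span_minimal graded_algebraD(1)[OF alg]) blast
  qed
  moreover have "p \<in> ratvec.span (free_relations (gens ?M))"
    if p: "p \<in> ratvec.span (single ` words (gens ?M))"
      and zero: "\<And>n. (\<Sum>ws | p ws \<noteq> 0 \<and> wdeg ws = n. p ws *\<^sub>Q wprod ?M ws) = 0" for p
  proof -
    have supp: "fin_supp p" "{ws. p ws \<noteq> 0} \<subseteq> words (gens ?M)"
      using span_single_fin_supp[OF p] by auto
    have "\<exists>I\<in>\<I>. \<forall>(k, v)\<in>(\<Union>ws\<in>{ws. p ws \<noteq> 0}. set ws). v \<in> one_forms (lcomp L) I k"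
      using supp by (intro gens_common_ideal[OF L(3)]) (auto simp: words_def gens_model)
    then obtain I where I: "I \<in> \<I>" "{ws. p ws \<noteq> 0} \<subseteq> words (one_forms (lcomp L) I)"
      unfolding words_def by blast
    obtain D where D: "dual_basis (lcomp L) I D" using enriched_dual_basis[OF assms I(1)] .
    show ?thesis
      using zero I(1)
      by (intro form_prod_free[OF L(2) D gens _ supp(1) I(2)]) (auto simp: gens_model wprod_model)
  qed
  ultimately show ?thesis unfolding free_on_gens_def using gens sub by blast
qed

text \<open>Used with an ideal \<open>I\<close> of the family as \<open>J\<close>, and with the sum of \<open>I\<close> and a term of the lower central series in order to
  place a differential in \<open>\<And>\<^sup>2V\<^sub>n\<close>.\<close>

lemma quadratic_in_wedge2:
  assumes W: "graded_space (lcomp L)" and D: "dual_basis (lcomp L) J D"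
    and f: "sym_form (lcomp L) f" "vanishes_on J f" "len_homog 2 f" "homog n f"
    and U: "\<And>k. one_forms (lcomp L) J k \<subseteq> U k"
  shows "f \<in> wedge2 (quadratic_model L \<I>) U n"
proof -
  have "form_prod ` {ws \<in> words (one_forms (lcomp L) J). length ws = 2 \<and> wdeg ws = n}
     \<subseteq> {amul (quadratic_model L \<I>) i j x y | i j x y. i + j = n \<and> x \<in> U i \<and> y \<in> U j}"
  proof
    fix g assume "g \<in> form_prod ` {ws \<in> words (one_forms (lcomp L) J). length ws = 2 \<and> wdeg ws = n}"
    then obtain ws where ws: "ws \<in> words (one_forms (lcomp L) J)" "length ws = 2" "wdeg ws = n" "g = form_prod ws"
      by blast
    then obtain i x j y where "ws = [(i, x), (j, y)]"
      by (cases ws; cases "tl ws") (auto simp: numeral_2_eq_2)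
    moreover from this have "x \<in> U i" "y \<in> U j" "i + j = n" using ws U by auto
    ultimately have "g = amul (quadratic_model L \<I>) i j x y" "x \<in> U i" "y \<in> U j" "i + j = n"
      using ws by simp_all
    then show "g \<in> {amul (quadratic_model L \<I>) i j x y | i j x y. i + j = n \<and> x \<in> U i \<and> y \<in> U j}"
      by blast
  qed
  then show ?thesis
    unfolding wedge2_def using sym_form_generated[OF W D f] ratvec.span_mono by blast
qed

lemma lower_central_subset:
  assumes "graded_lie L" shows "lower_central L n k \<subseteq> lcomp L k"
proof (induction n arbitrary: k)
  case (Suc n)
  show ?case
    unfolding lower_central.simps
  proof (rule ratvec.span_minimal)
    show "{lbr L i j x y | i j x y. i + j = k \<and> x \<in> lcomp L i \<and> y \<in> lower_central L n j} \<subseteq> lcomp L k"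
      using graded_lieD(4)[OF assms] Suc by blast
    show "ratvec.subspace (lcomp L k)" using graded_space_subspace[OF graded_lieD(1)[OF assms]] .
  qed
qed simp

lemma lower_central_bracket:
  "x \<in> lcomp L i \<Longrightarrow> y \<in> lower_central L n j \<Longrightarrow> lbr L i j x y \<in> lower_central L (Suc n) (i + j)"
  unfolding lower_central.simps by (rule ratvec.span_base) blast

lemma len_2E:
  assumes "length ws = 2" obtains i x j y where "ws = [(i, x), (j, y)]"
  using assms by (cases ws; cases "tl ws") (auto simp: numeral_2_eq_2)

text \<open>In the induction step, if \<open>v\<close> vanishes on the term of index \<open>n + 2\<close> of the lower central series, then \<open>dv\<close>, which evaluates \<open>v\<close> at brackets,
  vanishes as soon as one argument lies in the term of index \<open>n + 1\<close>. So \<open>dv\<close> is a quadratic expression in forms that vanish there,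
  which are in \<open>V\<^sub>n\<close> by induction.\<close>

lemma sullivan_filtration_lower_central:
  assumes E: "enriched_lie L \<I>" and I: "I \<in> \<I>"
    and "v \<in> one_forms (lcomp L) I m" "\<And>j x. x \<in> lower_central L (Suc n) j \<Longrightarrow> v [(j, x)] = 0"
  shows "v \<in> sullivan_filtration (quadratic_model L \<I>) n m"
  using assms(3,4)
proof (induction n arbitrary: v m)
  case 0
  note L = enriched_lieD[OF E]
  have "cochain_dif L v = 0"
  proof (rule ext)
    fix ws
    have two: "len_homog 2 (cochain_dif L v)"
      using len_homog_dif[OF one_formsD(4)[OF 0(1)], of L] by (simp add: numeral_2_eq_2)
    show "cochain_dif L v ws = 0 ws"
    proof (cases "ws \<in> words (lcomp L) \<and> length ws = 2")
      case True
      then obtain i x j y where ws: "ws = [(i, x), (j, y)]" by (auto elim: len_2E)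
      then have xy: "x \<in> lcomp L i" "y \<in> lcomp L j" using True by auto
      have "v [(i + j, lbr L i j x y)] = 0"
        using xy lower_central_bracket[of x L i y 0 j] by (intro 0(2)) simp
      then show ?thesis unfolding ws cochain_dif_pair[OF xy] by simp
    next
      case False
      then show ?thesis using two by (auto simp: len_homog_def cochain_dif_alt)
    qed
  qed
  then show ?case using 0(1) I by (auto simp: gens_model)
next
  case (Suc n)
  note L = enriched_lieD[OF E]
  note ideal = L(4)[OF I]
  have subW: "ratvec.subspace (lcomp L k)" for k by (rule graded_space_subspace[OF L(2)])
  \<comment> \<open>\<open>dv\<close> is a form on the quotient by \<open>J\<close>, and the linear forms on this quotient are in \<open>V\<^sub>n\<close>\<close>
  define J where "J = (\<lambda>k. ratvec.span (I k \<union> lower_central L (Suc n) k))"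
  have gen: "I k \<union> lower_central L (Suc n) k \<subseteq> lcomp L k" for k
    using graded_idealD(2)[OF ideal] lower_central_subset[OF L(1)] by blast
  have JW: "J k \<subseteq> lcomp L k" for k unfolding J_def by (rule ratvec.span_minimal[OF gen subW])
  have IJ: "I k \<subseteq> J k" for k unfolding J_def using ratvec.span_superset by blast
  have "finite_dim_quotient L J"
    unfolding finite_dim_quotient_def
  proof (intro conjI allI)
    show "\<exists>N. \<forall>k>N. lcomp L k \<subseteq> J k"
      using L(5)[OF I] IJ unfolding finite_dim_quotient_def by (meson subset_trans)
    fix k
    obtain B where "finite B" "B \<subseteq> lcomp L k" "lcomp L k \<subseteq> ratvec.span (B \<union> I k)"
      using L(5)[OF I] unfolding finite_dim_quotient_def by blast
    then show "\<exists>B. finite B \<and> B \<subseteq> lcomp L k \<and> lcomp L k \<subseteq> ratvec.span (B \<union> J k)"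
      using ratvec.span_mono[of "B \<union> I k" "B \<union> J k"] IJ[of k] by (intro exI[of _ B]) blast
  qed
  then obtain D where D: "dual_basis (lcomp L) J D"
    by (rule dual_basis_exists) (auto simp: J_def)
  have right: "v [(i + j, lbr L i j a b)] = 0" if a: "a \<in> lcomp L i" and b: "b \<in> J j" for i j a b
  proof (cases "m = Suc (i + j)")
    case True
    have v: "linear_map_on (lcomp L (i + j)) (\<lambda>x. v [(i + j, x)])"
      using one_forms_linear[of v "lcomp L" I "i + j"] Suc.prems(1) True by simp
    have lin: "linear_map_on (lcomp L j) (\<lambda>b. v [(i + j, lbr L i j a b)])"
      by (rule linear_map_on_compose[OF bilinear_map_on_right[OF graded_lieD(3)[OF L(1)] a] v])
        (rule graded_lieD(4)[OF L(1) a])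
    have "v [(i + j, lbr L i j a b)] = 0" if "b \<in> I j \<union> lower_central L (Suc n) j" for b
      using that
    proof
      assume "b \<in> I j"
      then have "lbr L i j a b \<in> I (i + j)" by (rule graded_idealD(3)[OF ideal a])
      then show ?thesis by (intro vanishes_onD[OF one_formsD(3)[OF Suc.prems(1)]]) auto
    next
      assume "b \<in> lower_central L (Suc n) j"
      then show ?thesis by (intro Suc.prems(2) lower_central_bracket[OF a])
    qed
    then show ?thesis
      using linear_map_on_span_eq[OF lin linear_map_on_const0 subW gen] b unfolding J_def by blast
  next
    case False
    then show ?thesis using one_formsD(7)[OF Suc.prems(1)] by simp
  qed
  have left: "v [(i + j, lbr L i j a b)] = 0" if a: "a \<in> J i" and b: "b \<in> lcomp L j" for i j a b
  proof (cases "m = Suc (i + j)")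
    case True
    have v: "linear_map_on (lcomp L (i + j)) (\<lambda>x. v [(i + j, x)])"
      using one_forms_linear[of v "lcomp L" I "i + j"] Suc.prems(1) True by simp
    have a': "a \<in> lcomp L i" using a JW by blast
    have ba: "lbr L j i b a \<in> lcomp L (i + j)" using graded_lieD(4)[OF L(1) b a'] by (simp add: add.commute)
    show ?thesis
      unfolding graded_lieD(5)[OF L(1) a' b]
      using right[OF b a] ratvec.subspace_scale[OF subW ba]
      by (simp add: linear_map_on_minus[OF v] linear_map_on_scale[OF v ba] add.commute)
  next
    case False
    then show ?thesis using one_formsD(7)[OF Suc.prems(1)] by simp
  qed
  have two: "len_homog 2 (cochain_dif L v)"
    using len_homog_dif[OF one_formsD(4)[OF Suc.prems(1)], of L] by (simp add: numeral_2_eq_2)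
  have sym: "sym_form (lcomp L) (cochain_dif L v)"
    by (rule cochain_dif_sym_form[OF L(1) one_formsD(1)[OF Suc.prems(1)]])
  have "vanishes_on J (cochain_dif L v)"
    unfolding vanishes_on_def
  proof (intro allI impI)
    fix ws assume ex: "\<exists>(k, x)\<in>set ws. x \<in> J k"
    show "cochain_dif L v ws = 0"
    proof (cases "ws \<in> words (lcomp L) \<and> length ws = 2")
      case True
      then obtain i x j y where ws: "ws = [(i, x), (j, y)]" by (auto elim: len_2E)
      then have xy: "x \<in> lcomp L i" "y \<in> lcomp L j" using True by auto
      have "v [(i + j, lbr L i j x y)] = 0" using ex left right xy by (auto simp: ws)
      then show ?thesis unfolding ws cochain_dif_pair[OF xy] by simp
    next
      case False
      then show ?thesis using two by (auto simp: len_homog_def cochain_dif_alt)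
    qed
  qed
  moreover have "one_forms (lcomp L) J k \<subseteq> sullivan_filtration (quadratic_model L \<I>) n k" for k
  proof
    fix u assume u: "u \<in> one_forms (lcomp L) J k"
    have "u [(j, x)] = 0" if "x \<in> lower_central L (Suc n) j" for j x
    proof -
      have "x \<in> J j" unfolding J_def using that by (intro ratvec.span_base) blast
      then show ?thesis by (intro vanishes_onD[OF one_formsD(3)[OF u]]) auto
    qed
    then show "u \<in> sullivan_filtration (quadratic_model L \<I>) n k"
      using one_forms_mono[OF u IJ] by (intro Suc.IH)
  qed
  ultimately have "cochain_dif L v \<in> wedge2 (quadratic_model L \<I>) (sullivan_filtration (quadratic_model L \<I>) n) (Suc m)"
    by (intro quadratic_in_wedge2[OF L(2) D sym _ two homog_dif[OF one_formsD(2)[OF Suc.prems(1)]]])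
  then show ?case using Suc.prems(1) I by (auto simp: gens_model)
qed

lemma model_quadratic_sullivan:
  assumes E: "enriched_lie L \<I>" shows "quadratic_sullivan (quadratic_model L \<I>)"
proof -
  note L = enriched_lieD[OF E]
  let ?M = "quadratic_model L \<I>"
  have "gens ?M 0 = {0}"
  proof
    show "gens ?M 0 \<subseteq> {0}" using one_forms_zero_degree unfolding gens_model by blast
    show "{0} \<subseteq> gens ?M 0"
      using ratvec.subspace_0[OF graded_space_subspace[OF model_gens_graded_space[OF L(3)]]] by blast
  qed
  moreover have "cochain_dif L v \<in> wedge2 ?M (gens ?M) (Suc k)" if v: "v \<in> gens ?M k" for k v
  proof -
    obtain I where I: "I \<in> \<I>" "v \<in> one_forms (lcomp L) I k" using v by (auto simp: gens_model)
    obtain D where D: "dual_basis (lcomp L) I D" using enriched_dual_basis[OF E I(1)] .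
    have two: "len_homog 2 (cochain_dif L v)"
      using len_homog_dif[OF one_formsD(4)[OF I(2)], of L] by (simp add: numeral_2_eq_2)
    show ?thesis
      using I(1) by (intro quadratic_in_wedge2[OF L(2) D cochain_dif_sym_form[OF L(1) one_formsD(1)[OF I(2)]]
          cochain_dif_vanishes[OF L(1) L(4)[OF I(1)] one_formsD(3)[OF I(2)]] two homog_dif[OF one_formsD(2)[OF I(2)]]])
        (auto simp: gens_model)
  qed
  moreover have "gens ?M k = (\<Union>n. sullivan_filtration ?M n k)" for k
  proof
    show "gens ?M k \<subseteq> (\<Union>n. sullivan_filtration ?M n k)"
    proof
      fix v assume "v \<in> gens ?M k"
      then obtain I where I: "I \<in> \<I>" "v \<in> one_forms (lcomp L) I k" by (auto simp: gens_model)
      note ideal = L(4)[OF I(1)]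
      obtain n where n: "\<And>k. lower_central L n k \<subseteq> I k"
        using L(6)[OF I(1)] unfolding nilpotent_quotient_def by blast
      have "lower_central L (Suc n) j \<subseteq> I j" for j
        unfolding lower_central.simps
        using n graded_idealD(3)[OF ideal] by (intro ratvec.span_minimal graded_idealD(1)[OF ideal]) blast
      then have "v [(j, x)] = 0" if "x \<in> lower_central L (Suc n) j" for j x
        using that by (intro vanishes_onD[OF one_formsD(3)[OF I(2)]]) auto
      then have "v \<in> sullivan_filtration ?M n k"
        by (rule sullivan_filtration_lower_central[OF E I])
      then show "v \<in> (\<Union>n. sullivan_filtration ?M n k)" by blast
    qed
    have "sullivan_filtration ?M n k \<subseteq> gens ?M k" for n
      by (cases n) (simp_all only: sullivan_filtration.simps Collect_restrict)
    then show "(\<Union>n. sullivan_filtration ?M n k) \<subseteq> gens ?M k" by blast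
  qed
  ultimately show ?thesis
    unfolding quadratic_sullivan_def using model_cdga[OF E] model_free_on_gens[OF E] by simp
qed

section \<open>Duality between a complete enriched Lie algebra and its generators\<close>

lemma one_forms_separate:
  assumes W: "graded_space W" and I: "ratvec.subspace (I k)" and x: "x \<in> W k"
    and zero: "\<And>v. v \<in> one_forms W I (Suc k) \<Longrightarrow> v [(k, x)] = 0"
  shows "x \<in> I k"
proof (rule ccontr)
  assume "x \<notin> I k"
  then have "x \<notin> ratvec.span (I k)" using I ratvec.span_eq_iff by blast
  then obtain v :: "'a \<Rightarrow> rat" where v: "linear_map_on UNIV v" "\<And>y. y \<in> ratvec.span (I k) \<Longrightarrow> v y = 0" "v x = 1"
    using separating_functional by blast
  have "letter_form W k v \<in> one_forms W I (Suc k)"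
    using linear_map_on_subset[OF v(1)] v(2) ratvec.span_base[of _ "I k"] by (intro letter_form_in_one_forms[OF W]) auto
  then show False using zero[of "letter_form W k v"] v(3) x by (simp add: letter_form_apply)
qed

lemma gens_separate:
  assumes E: "enriched_lie L \<I>" and x: "x \<in> lcomp L k" and y: "y \<in> lcomp L k"
    and eq: "\<And>v. v \<in> gens (quadratic_model L \<I>) (Suc k) \<Longrightarrow> v [(k, x)] = v [(k, y)]"
  shows "x = y"
proof -
  note L = enriched_lieD[OF E]
  have sub: "ratvec.subspace (lcomp L k)" by (rule graded_space_subspace[OF L(2)])
  have "x - y \<in> I k" if I: "I \<in> \<I>" for I
  proof (rule one_forms_separate[OF L(2) graded_idealD(1)[OF L(4)[OF I]] ratvec.subspace_diff[OF sub x y]])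
    fix v assume v: "v \<in> one_forms (lcomp L) I (Suc k)"
    then show "v [(k, x - y)] = 0"
      using eq[of v] I linear_map_on_diff[OF one_forms_linear[OF v] sub x y] by (auto simp: gens_model)
  qed
  then have "x - y \<in> (\<Inter>I\<in>\<I>. I k)" by blast
  then show ?thesis unfolding L(7) by simp
qed

text \<open>Reflexivity of finite-dimensional spaces: \<open>x = \<Sum> F(v) e\<close> over a dual basis.\<close>

lemma dual_basis_realizes:
  assumes W: "graded_space W" and D: "dual_basis W I D" and F: "linear_map_on (one_forms W I (Suc k)) F"
  shows "\<exists>x\<in>W k. \<forall>v\<in>one_forms W I (Suc k). v [(k, x)] = F v"
proof -
  have sub: "ratvec.subspace (W k)" by (rule graded_space_subspace[OF W])
  define g where "g = (\<lambda>(l::nat, e::'a, u). if l = k then F (letter_form W k u) *\<^sub>Q e else 0)"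
  have g: "g t \<in> W k" if "t \<in> set D" for t
    using that dual_basisD(1)[OF D] ratvec.subspace_0[OF sub] ratvec.subspace_scale[OF sub]
    by (auto simp: g_def split: prod.splits)
  have "v [(k, \<Sum>t\<leftarrow>D. g t)] = F v" if v: "v \<in> one_forms W I (Suc k)" for v
  proof -
    note lin = one_forms_linear[OF v]
    define f where "f = (\<lambda>(l, e, u). if Suc l = Suc k then v [(l, e)] *\<^sub>Q letter_form W l u else 0)"
    have f: "f t \<in> one_forms W I (Suc k)" if "t \<in> set D" for t
      using that letter_form_dual_basis[OF W D] ratvec.subspace_0[OF subspace_one_forms[of W I "Suc k"]]
        ratvec.subspace_scale[OF subspace_one_forms[of W I "Suc k"]]
      by (auto simp: f_def split: prod.splits simp del: scaleQ_fun_apply zero_fun_apply)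
    have "F v = F (\<Sum>t\<leftarrow>D. f t)" unfolding f_def by (rule arg_cong[OF one_forms_expand[OF W D v]])
    also have "\<dots> = (\<Sum>t\<leftarrow>D. F (f t))" by (rule linear_map_on_sum_list(1)[OF F subspace_one_forms f])
    also have "\<dots> = (\<Sum>t\<leftarrow>D. v [(k, g t)])"
    proof (intro arg_cong[of _ _ sum_list] map_cong refl)
      fix t assume t: "t \<in> set D"
      obtain l e u where t': "t = (l, e, u)" by (cases t)
      show "F (f t) = v [(k, g t)]"
      proof (cases "l = k")
        case True
        then show ?thesis
          using linear_map_on_scale[OF F, of "letter_form W k u" "v [(k, e)]"]
            linear_map_on_scale[OF lin, of e "F (letter_form W k u)"]
            letter_form_dual_basis[OF W D t[unfolded t']] dual_basisD(1)[OF D t[unfolded t']]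
          by (simp add: f_def g_def t' del: scaleQ_fun_apply)
      next
        case False
        then show ?thesis
          using linear_map_on_zero[OF F subspace_one_forms] linear_map_on_zero[OF lin sub]
          by (simp add: f_def g_def t' del: zero_fun_apply)
      qed
    qed
    also have "\<dots> = v [(k, \<Sum>t\<leftarrow>D. g t)]" using linear_map_on_sum_list(1)[OF lin sub, of D g] g by simp
    finally show ?thesis ..
  qed
  then show ?thesis by (intro bexI[of _ "\<Sum>t\<leftarrow>D. g t"] ballI subspace_sum_list[OF sub g])
qed

text \<open>On the forms on each \<open>L / I\<close> the functional \<open>F\<close> is evaluation at some \<open>x I\<close>. These are compatible, since forms separate the
  elements of \<open>L / I\<close>, so they come from one element of \<open>L\<close>.\<close>

lemma complete_realizes:
  assumes C: "complete_enriched_lie L \<I>" and F: "linear_map_on (gens (quadratic_model L \<I>) (Suc k)) F"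
  shows "\<exists>x\<in>lcomp L k. \<forall>v\<in>gens (quadratic_model L \<I>) (Suc k). v [(k, x)] = F v"
proof -
  have E: "enriched_lie L \<I>" using C by (simp add: complete_enriched_lie_def)
  note L = enriched_lieD[OF E]
  have sub: "ratvec.subspace (lcomp L k)" by (rule graded_space_subspace[OF L(2)])
  have "\<exists>x\<in>lcomp L k. \<forall>v\<in>one_forms (lcomp L) I (Suc k). v [(k, x)] = F v" if I: "I \<in> \<I>" for I
  proof -
    obtain D where "dual_basis (lcomp L) I D" using enriched_dual_basis[OF E I] .
    moreover have "linear_map_on (one_forms (lcomp L) I (Suc k)) F"
      using I by (intro linear_map_on_subset[OF F]) (auto simp: gens_model)
    ultimately show ?thesis by (rule dual_basis_realizes[OF L(2)])
  qed
  then obtain x where x: "\<And>I. I \<in> \<I> \<Longrightarrow> x I \<in> lcomp L k"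
    "\<And>I v. I \<in> \<I> \<Longrightarrow> v \<in> one_forms (lcomp L) I (Suc k) \<Longrightarrow> v [(k, x I)] = F v"
    by metis
  have "x J - x I \<in> I k" if I: "I \<in> \<I>" and J: "J \<in> \<I>" and "J \<le> I" for I J
  proof (rule one_forms_separate[OF L(2) graded_idealD(1)[OF L(4)[OF I]] ratvec.subspace_diff[OF sub x(1)[OF J] x(1)[OF I]]])
    fix v assume v: "v \<in> one_forms (lcomp L) I (Suc k)"
    then have "v \<in> one_forms (lcomp L) J (Suc k)"
      using \<open>J \<le> I\<close> by (intro one_forms_mono[OF v]) (simp add: le_fun_def)
    then show "v [(k, x J - x I)] = 0"
      using linear_map_on_diff[OF one_forms_linear[OF v] sub x(1)[OF J] x(1)[OF I]] x(2)[OF J] x(2)[OF I v] by simp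
  qed
  then obtain y where y: "y \<in> lcomp L k" "\<And>I. I \<in> \<I> \<Longrightarrow> y - x I \<in> I k"
    using C x(1) unfolding complete_enriched_lie_def by metis
  have "v [(k, y)] = F v" if v: "v \<in> gens (quadratic_model L \<I>) (Suc k)" for v
  proof -
    obtain I where I: "I \<in> \<I>" "v \<in> one_forms (lcomp L) I (Suc k)" using v by (auto simp: gens_model)
    have "v [(k, y - x I)] = 0"
      using y(2)[OF I(1)] by (intro vanishes_onD[OF one_formsD(3)[OF I(2)]]) auto
    then show ?thesis
      using linear_map_on_diff[OF one_forms_linear[OF I(2)] sub y(1) x(1)[OF I(1)]] x(2)[OF I] by simp
  qed
  then show ?thesis using y(1) by blast
qed

lemma suspension_eval_bij:
  assumes C: "complete_enriched_lie L \<I>"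
  shows "bij_betw (suspension_eval L \<I> k) (lcomp L k) (dual_space (gens (quadratic_model L \<I>) (Suc k)))"
proof -
  have E: "enriched_lie L \<I>" using C by (simp add: complete_enriched_lie_def)
  note L = enriched_lieD[OF E]
  let ?G = "gens (quadratic_model L \<I>) (Suc k)"
  have sub: "ratvec.subspace ?G" by (rule graded_space_subspace[OF model_gens_graded_space[OF L(3)]])
  have ev: "suspension_eval L \<I> k x v = v [(k, x)]" if "v \<in> ?G" for x v
    using that by (simp add: suspension_eval_def)
  show ?thesis
    unfolding bij_betw_def
  proof (intro conjI equalityI subsetI)
    show "inj_on (suspension_eval L \<I> k) (lcomp L k)"
    proof (rule inj_onI)
      fix x y assume xy: "x \<in> lcomp L k" "y \<in> lcomp L k" "suspension_eval L \<I> k x = suspension_eval L \<I> k y"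
      then show "x = y" using ev by (intro gens_separate[OF E xy(1,2)]) metis
    qed
    fix F assume "F \<in> suspension_eval L \<I> k ` lcomp L k"
    then obtain x where F: "F = suspension_eval L \<I> k x" by blast
    have "linear_map_on ?G F"
      unfolding F by (intro linear_map_onI)
        (simp_all add: ev ratvec.subspace_add[OF sub] ratvec.subspace_scale[OF sub])
    then show "F \<in> dual_space ?G" by (simp add: dual_space_def F suspension_eval_def)
  next
    fix F assume F: "F \<in> dual_space ?G"
    then have "linear_map_on ?G F" by (simp add: dual_space_def)
    then obtain x where x: "x \<in> lcomp L k" "\<forall>v\<in>?G. v [(k, x)] = F v" using complete_realizes[OF C] by blast
    have "suspension_eval L \<I> k x = F"
      using x(2) F by (auto simp: fun_eq_iff suspension_eval_def dual_space_def)
    then show "F \<in> suspension_eval L \<I> k ` lcomp L k" using x(1) by blast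
  qed
qed

text \<open>The linear forms on a quotient of finite dimension are spanned by finitely many of them, so a linear map takes them to forms
  on a single quotient.\<close>

lemma one_forms_image_common_ideal:
  assumes W: "graded_space W" and D: "dual_basis W I D" and dir: "directed_family \<J>"
    and g: "\<And>m. linear_map_on (one_forms W I m) (g m)"
      "\<And>m v. v \<in> one_forms W I m \<Longrightarrow> g m v \<in> (\<Union>J\<in>\<J>. one_forms W' J m)"
  shows "\<exists>J\<in>\<J>. \<forall>m. \<forall>v\<in>one_forms W I m. g m v \<in> one_forms W' J m"
proof -
  define F where "F = set (map (\<lambda>(k, e, u). (Suc k, g (Suc k) (letter_form W k u))) D)"
  have "\<exists>J\<in>\<J>. \<forall>(k, v)\<in>F. v \<in> one_forms W' J k"
  proof (rule gens_common_ideal[OF dir])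
    show "finite F" by (simp add: F_def)
    fix k v assume "(k, v) \<in> F"
    then obtain l e u where "(l, e, u) \<in> set D" "k = Suc l" "v = g (Suc l) (letter_form W l u)"
      by (auto simp: F_def)
    then show "v \<in> (\<Union>J\<in>\<J>. one_forms W' J k)" using g(2)[OF letter_form_dual_basis[OF W D]] by blast
  qed
  then obtain J where J: "J \<in> \<J>" "\<forall>(k, v)\<in>F. v \<in> one_forms W' J k" by blast
  have "g m v \<in> one_forms W' J m" if v: "v \<in> one_forms W I m" for m v
  proof -
    define f where "f = (\<lambda>(k, e, u). if Suc k = m then v [(k, e)] *\<^sub>Q letter_form W k u else 0)"
    have f: "f t \<in> one_forms W I m \<and> g m (f t) \<in> one_forms W' J m" if t: "t \<in> set D" for t
    proof -
      obtain k e u where t': "t = (k, e, u)" by (cases t)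
      show ?thesis
      proof (cases "Suc k = m")
        case True
        have 1: "letter_form W k u \<in> one_forms W I m"
          using letter_form_dual_basis[OF W D t[unfolded t']] True by simp
        have "(m, g m (letter_form W k u)) \<in> F"
          using t True unfolding F_def t' by force
        then have "g m (letter_form W k u) \<in> one_forms W' J m" using J(2) by blast
        then show ?thesis
          using 1 True by (simp add: f_def t' linear_map_on_scale[OF g(1)] ratvec.subspace_scale[OF subspace_one_forms]
              del: scaleQ_fun_apply)
      next
        case False
        then show ?thesis
          using linear_map_on_zero[OF g(1) subspace_one_forms, of m]
            ratvec.subspace_0[OF subspace_one_forms[of W I m]] ratvec.subspace_0[OF subspace_one_forms[of W' J m]]
          by (simp add: f_def t' del: zero_fun_apply)
      qed
    qed
    have "g m v = g m (\<Sum>t\<leftarrow>D. f t)" unfolding f_def by (rule arg_cong[OF one_forms_expand[OF W D v]])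
    also have "\<dots> = (\<Sum>t\<leftarrow>D. g m (f t))" using f by (intro linear_map_on_sum_list(1)[OF g(1) subspace_one_forms]) blast
    also have "\<dots> \<in> one_forms W' J m" using f by (intro subspace_sum_list subspace_one_forms) blast
    finally show ?thesis .
  qed
  then show ?thesis using J(1) by blast
qed

section \<open>Morphisms\<close>

text \<open>The algebra morphism that extends the transpose of \<open>\<psi>\<close>; like cochains, a pullback vanishes outside the words in \<open>W\<close>.\<close>

definition pull :: "'a graded \<Rightarrow> (nat \<Rightarrow> 'a \<Rightarrow> 'b) \<Rightarrow> ('b word \<Rightarrow> rat) \<Rightarrow> 'a word \<Rightarrow> rat" where
  "pull W \<psi> f = (\<lambda>ws. if ws \<in> words W then f (map_word \<psi> ws) else 0)"

lemma pull_linear: "pull W \<psi> (f + g) = pull W \<psi> f + pull W \<psi> g" "pull W \<psi> (c *\<^sub>Q f) = c *\<^sub>Q pull W \<psi> f"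
  by (auto simp: pull_def fun_eq_iff)

lemma pull_single_Nil: "pull W \<psi> (single []) = single []"
  by (auto simp: pull_def single_def fun_eq_iff map_word_def)

lemma contract_pull: "x \<in> W k \<Longrightarrow> contract k x (pull W \<psi> f) = pull W \<psi> (contract k (\<psi> k x) f)"
  by (auto simp: pull_def contract_def fun_eq_iff)

lemma twist_pull: "twist m (pull W \<psi> f) = pull W \<psi> (twist m f)"
  by (auto simp: pull_def twist_def fun_eq_iff)

lemma pull_mul: "pull W \<psi> (cochain_mul f g) = cochain_mul (pull W \<psi> f) (pull W \<psi> g)"
proof (rule ext)
  fix ws
  show "pull W \<psi> (cochain_mul f g) ws = cochain_mul (pull W \<psi> f) (pull W \<psi> g) ws"
  proof (cases "ws \<in> words W")
    case True
    then show ?thesis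
    proof (induction ws arbitrary: f g)
      case Nil
      then show ?case by (simp add: pull_def)
    next
      case (Cons a ws)
      obtain k x where a: "a = (k, x)" by fastforce
      have x: "x \<in> W k" and ws: "ws \<in> words W" using Cons.prems by (auto simp: a)
      have "pull W \<psi> (cochain_mul f g) (a # ws)
        = pull W \<psi> (cochain_mul (contract k (\<psi> k x) f) g) ws
          + pull W \<psi> (cochain_mul (twist (Suc k) f) (contract k (\<psi> k x) g)) ws"
        using x ws by (simp add: a pull_def)
      then show ?case
        unfolding Cons.IH[OF ws] by (simp add: a contract_pull[of x W k] x twist_pull)
    qed
  next
    case False
    have "cochain_mul (pull W \<psi> f) (pull W \<psi> g) ws = 0"
    proof (rule cochain_mul_eq_0I)
      fix us vs assume "set us \<union> set vs = set ws"
      with False have "us \<notin> words W \<or> vs \<notin> words W" unfolding words_def by blast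
      then show "pull W \<psi> f us = 0 \<or> pull W \<psi> g vs = 0" by (auto simp: pull_def)
    qed
    then show ?thesis using False by (simp add: pull_def)
  qed
qed

lemma pull_sym_form:
  assumes f: "sym_form U f" and W: "graded_space W"
    and \<psi>: "\<And>k. linear_map_on (W k) (\<psi> k)" "\<And>k x. x \<in> W k \<Longrightarrow> \<psi> k x \<in> U k"
  shows "sym_form W (pull W \<psi> f)"
  unfolding sym_form_def
proof (intro conjI ballI allI impI)
  fix us ws k assume us: "us \<in> words W" and ws: "ws \<in> words W"
  have "map_word \<psi> us \<in> words U" "map_word \<psi> ws \<in> words U" using map_word_in us ws \<psi>(2) by blast+
  from linear_map_on_compose[OF \<psi>(1) sym_form_linear[OF f this] \<psi>(2)]
  have lin: "linear_map_on (W k) (\<lambda>x. f (map_word \<psi> (us @ (k, x) # ws)))" by simp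
  have "linear_map_on (W k) (\<lambda>x. pull W \<psi> f (us @ (k, x) # ws))
    = linear_map_on (W k) (\<lambda>x. f (map_word \<psi> (us @ (k, x) # ws)))"
    using us ws by (intro linear_map_on_cong graded_space_subspace[OF W]) (simp add: pull_def)
  then show "linear_map_on (W k) (\<lambda>x. pull W \<psi> f (us @ (k, x) # ws))" using lin by blast
next
  fix us ws i j x y assume us: "us \<in> words W" and ws: "ws \<in> words W" and xy: "x \<in> W i" "y \<in> W j"
  have "map_word \<psi> us \<in> words U" "map_word \<psi> ws \<in> words U" using map_word_in us ws \<psi>(2) by blast+
  from sym_form_swap[OF f this \<psi>(2)[OF xy(1)] \<psi>(2)[OF xy(2)]]
  show "pull W \<psi> f (us @ (i, x) # (j, y) # ws) = (-1) ^ (Suc i * Suc j) * pull W \<psi> f (us @ (j, y) # (i, x) # ws)"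
    using us ws xy by (simp add: pull_def)
qed (simp add: pull_def)

lemma pull_homog: "homog n f \<Longrightarrow> homog n (pull W \<psi> f)" "len_homog n f \<Longrightarrow> len_homog n (pull W \<psi> f)"
  by (auto simp: homog_def len_homog_def pull_def)

lemma pull_vanishes_on:
  assumes "vanishes_on I f" "\<And>k x. x \<in> J k \<Longrightarrow> \<psi> k x \<in> I k"
  shows "vanishes_on J (pull W \<psi> f)"
  unfolding vanishes_on_def
proof (intro allI impI)
  fix ws assume "\<exists>(k, x)\<in>set ws. x \<in> J k"
  then obtain k x where "(k, x) \<in> set ws" "x \<in> J k" by blast
  then have "(k, \<psi> k x) \<in> set (map_word \<psi> ws)" "\<psi> k x \<in> I k"
    using assms(2) by (force simp: map_word_def)+
  then show "pull W \<psi> f ws = 0" using vanishes_onD[OF assms(1)] by (simp add: pull_def)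
qed

text \<open>All cochains of \<open>L\<close>, obtained as the model for the family whose only member is empty in every degree: every form vanishes on it.\<close>

abbreviation all_cochains :: "'a::rat_vector glie \<Rightarrow> ('a word \<Rightarrow> rat) gcdga" where
  "all_cochains L \<equiv> quadratic_model L {\<lambda>_. {}}"

lemma all_cochains_acomp: "f \<in> acomp (all_cochains L) n \<longleftrightarrow> sym_form (lcomp L) f \<and> homog n f"
  by (simp add: quotient_cochains_iff vanishes_on_def)

lemma all_cochains_algebra: "graded_space (lcomp L) \<Longrightarrow> graded_algebra (all_cochains L)"
  by (rule model_graded_algebra) (simp_all add: directed_family_def)

lemma pull_algebra_hom:
  assumes W: "graded_space (lcomp E)"
    and \<psi>: "\<And>k. linear_map_on (lcomp E k) (\<psi> k)" "\<And>k x. x \<in> lcomp E k \<Longrightarrow> \<psi> k x \<in> lcomp L k"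
  shows "algebra_hom (quadratic_model L \<I>) (all_cochains E) (\<lambda>_. pull (lcomp E) \<psi>)"
  unfolding algebra_hom_def
proof (intro conjI allI ballI)
  show "pull (lcomp E) \<psi> f \<in> acomp (all_cochains E) k" if "f \<in> acomp (quadratic_model L \<I>) k" for k f
    using that unfolding all_cochains_acomp
    by (auto simp: quotient_cochains_iff intro: pull_sym_form[OF _ W \<psi>] pull_homog)
qed (simp_all add: linear_map_on_def pull_linear pull_single_Nil pull_mul)

lemma model_hom_all_cochains:
  assumes "algebra_hom A (quadratic_model E \<J>) \<phi>"
  shows "algebra_hom A (all_cochains E) \<phi>"
proof -
  have "acomp (quadratic_model E \<J>) k \<subseteq> acomp (all_cochains E) k" for k
    by (auto simp: quotient_cochains_iff vanishes_on_def)
  then show ?thesis using assms unfolding algebra_hom_def by (simp del: model_simps(1)) blast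
qed

lemma has_dualD:
  "has_dual E L \<I> \<phi> \<psi> \<Longrightarrow> v \<in> gens (quadratic_model L \<I>) (Suc k) \<Longrightarrow> x \<in> lcomp E k \<Longrightarrow>
     \<phi> (Suc k) v [(k, x)] = v [(k, \<psi> k x)]"
  unfolding has_dual_def by blast

lemma gens_model_eqI:
  assumes "v \<in> gens (quadratic_model L \<I>) n" "w \<in> gens (quadratic_model L \<I>') n"
    and "\<And>k x. n = Suc k \<Longrightarrow> x \<in> lcomp L k \<Longrightarrow> v [(k, x)] = w [(k, x)]"
  shows "v = w"
proof -
  obtain I I' where "v \<in> one_forms (lcomp L) I n" "w \<in> one_forms (lcomp L) I' n"
    using assms(1,2) unfolding gens_model by blast
  then show ?thesis using assms(3) by (rule one_forms_eqI)
qed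

lemma has_dual_unique:
  assumes L: "enriched_lie L \<I>"
    and \<phi>: "\<phi> \<in> sullivan_hom (quadratic_model L \<I>) (quadratic_model E \<J>)" "has_dual E L \<I> \<phi> \<psi>"
    and \<phi>': "\<phi>' \<in> sullivan_hom (quadratic_model L \<I>) (quadratic_model E \<J>)" "has_dual E L \<I> \<phi>' \<psi>"
  shows "\<phi> = \<phi>'"
proof (rule sullivan_hom_eqI[OF cdga_graded_algebra[OF model_cdga[OF L]] model_free_on_gens[OF L] \<phi>(1) \<phi>'(1)])
  fix m v assume v: "v \<in> gens (quadratic_model L \<I>) m"
  show "\<phi> m v = \<phi>' m v"
  proof (rule gens_model_eqI[OF sullivan_homD(4)[OF \<phi>(1) v] sullivan_homD(4)[OF \<phi>'(1) v]])
    fix k x assume "m = Suc k" "x \<in> lcomp E k"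
    then show "\<phi> m v [(k, x)] = \<phi>' m v [(k, x)]"
      using has_dualD[OF \<phi>(2)] has_dualD[OF \<phi>'(2)] v by simp
  qed
qed

lemma quadratic_model_map_eq:
  assumes L: "enriched_lie L \<I>"
    and \<phi>: "\<phi> \<in> sullivan_hom (quadratic_model L \<I>) (quadratic_model E \<J>)" "has_dual E L \<I> \<phi> \<psi>"
  shows "quadratic_model_map E \<J> L \<I> \<psi> = \<phi>"
  unfolding quadratic_model_map_def
  by (rule the_equality) (use \<phi> has_dual_unique[OF L] in blast)+

text \<open>Both are algebra morphisms to the algebra of all cochains with the same values on generators.\<close>

lemma has_dual_pull:
  assumes L: "enriched_lie L \<I>" and W: "graded_space (lcomp E)"
    and \<phi>: "\<phi> \<in> sullivan_hom (quadratic_model L \<I>) (quadratic_model E \<J>)" "has_dual E L \<I> \<phi> \<psi>"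
    and \<psi>: "\<And>k. linear_map_on (lcomp E k) (\<psi> k)" "\<And>k x. x \<in> lcomp E k \<Longrightarrow> \<psi> k x \<in> lcomp L k"
    and f: "f \<in> acomp (quadratic_model L \<I>) n" and ws: "ws \<in> words (lcomp E)"
  shows "\<phi> n f ws = f (map_word \<psi> ws)"
proof -
  have "\<phi> n f = pull (lcomp E) \<psi> f"
  proof (rule algebra_hom_eq[OF cdga_graded_algebra[OF model_cdga[OF L]] model_free_on_gens[OF L]
        model_hom_all_cochains[OF sullivan_homD(1)[OF \<phi>(1)]] pull_algebra_hom[OF W \<psi>] _ f])
    fix m v assume v: "v \<in> gens (quadratic_model L \<I>) m"
    then obtain I where I: "v \<in> one_forms (lcomp L) I m" by (auto simp: gens_model)
    have "pull (lcomp E) \<psi> v \<in> one_forms (lcomp E) (\<lambda>_. {}) m"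
      using pull_sym_form[OF one_formsD(1)[OF I] W \<psi>] pull_homog(1)[OF one_formsD(2)[OF I], of "lcomp E" \<psi>]
        pull_homog(2)[OF one_formsD(4)[OF I], of "lcomp E" \<psi>]
      unfolding one_forms_def by (simp add: vanishes_on_def)
    moreover obtain J where "\<phi> m v \<in> one_forms (lcomp E) J m"
      using sullivan_homD(4)[OF \<phi>(1) v] unfolding gens_model by blast
    ultimately show "\<phi> m v = pull (lcomp E) \<psi> v"
      using has_dualD[OF \<phi>(2)] v by (intro one_forms_eqI) (auto simp: pull_def)
  qed
  then show ?thesis using ws by (simp add: pull_def)
qed

lemma lie_homD:
  assumes "\<psi> \<in> lie_hom E \<J> L \<I>"
  shows "\<psi> k \<in> extensional (lcomp E k)" "x \<in> lcomp E k \<Longrightarrow> \<psi> k x \<in> lcomp L k"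
    "linear_map_on (lcomp E k) (\<psi> k)"
    "x \<in> lcomp E i \<Longrightarrow> y \<in> lcomp E j \<Longrightarrow> \<psi> (i + j) (lbr E i j x y) = lbr L i j (\<psi> i x) (\<psi> j y)"
    "I \<in> \<I> \<Longrightarrow> \<exists>J\<in>\<J>. \<forall>k. J k \<subseteq> {x \<in> lcomp E k. \<psi> k x \<in> I k}"
proof -
  have "\<psi> k \<in> lcomp E k \<rightarrow>\<^sub>E lcomp L k" for k using assms unfolding lie_hom_def by blast
  then show "\<psi> k \<in> extensional (lcomp E k)" "x \<in> lcomp E k \<Longrightarrow> \<psi> k x \<in> lcomp L k"
    by (auto simp: PiE_iff)
  show "linear_map_on (lcomp E k) (\<psi> k)"
    "x \<in> lcomp E i \<Longrightarrow> y \<in> lcomp E j \<Longrightarrow> \<psi> (i + j) (lbr E i j x y) = lbr L i j (\<psi> i x) (\<psi> j y)"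
    "I \<in> \<I> \<Longrightarrow> \<exists>J\<in>\<J>. \<forall>k. J k \<subseteq> {x \<in> lcomp E k. \<psi> k x \<in> I k}"
    using assms unfolding lie_hom_def by blast+
qed

lemma lie_homI:
  assumes "\<And>k. \<psi> k \<in> extensional (lcomp E k)" "\<And>k x. x \<in> lcomp E k \<Longrightarrow> \<psi> k x \<in> lcomp L k"
    "\<And>k. linear_map_on (lcomp E k) (\<psi> k)"
    "\<And>i j x y. x \<in> lcomp E i \<Longrightarrow> y \<in> lcomp E j \<Longrightarrow> \<psi> (i + j) (lbr E i j x y) = lbr L i j (\<psi> i x) (\<psi> j y)"
    "\<And>I. I \<in> \<I> \<Longrightarrow> \<exists>J\<in>\<J>. \<forall>k. J k \<subseteq> {x \<in> lcomp E k. \<psi> k x \<in> I k}"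
  shows "\<psi> \<in> lie_hom E \<J> L \<I>"
  using assms unfolding lie_hom_def by (auto simp: PiE_iff)

text \<open>The morphism is the pullback. On a generator \<open>v\<close>, compatibility with the differentials is the equation
  \<open>v(\<psi>[x, y]) = v([\<psi> x, \<psi> y])\<close>; continuity of \<open>\<psi>\<close> ensures that a pullback vanishes on one of the ideals of \<open>E\<close>.\<close>

lemma lie_hom_induces_model_hom:
  assumes E: "enriched_lie E \<J>" and L: "enriched_lie L \<I>" and \<psi>: "\<psi> \<in> lie_hom E \<J> L \<I>"
  shows "\<exists>\<phi>\<in>sullivan_hom (quadratic_model L \<I>) (quadratic_model E \<J>). has_dual E L \<I> \<phi> \<psi>"
proof -
  let ?QL = "quadratic_model L \<I>" and ?QE = "quadratic_model E \<J>"
  note e = enriched_lieD[OF E] and l = enriched_lieD[OF L] and p = lie_homD[OF \<psi>]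
  define \<phi> where "\<phi> = pull (lcomp E) \<psi>"
  have cont: "\<exists>J\<in>\<J>. vanishes_on J (\<phi> f)" if I: "I \<in> \<I>" and f: "vanishes_on I f" for I f
  proof -
    obtain J where "J \<in> \<J>" "\<forall>k. J k \<subseteq> {x \<in> lcomp E k. \<psi> k x \<in> I k}" using p(5)[OF I] by blast
    then show ?thesis using pull_vanishes_on[OF f] unfolding \<phi>_def by blast
  qed
  have sym: "sym_form (lcomp E) (\<phi> f)" if "sym_form (lcomp L) f" for f
    unfolding \<phi>_def using pull_sym_form[OF that e(2) p(3) p(2)] by blast
  have into: "\<phi> f \<in> acomp ?QE k" if "f \<in> acomp ?QL k" for f k
  proof -
    obtain I where I: "I \<in> \<I>" "f \<in> quotient_cochains L I k" using \<open>f \<in> acomp ?QL k\<close> by auto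
    then obtain J where "J \<in> \<J>" "vanishes_on J (\<phi> f)" using cont[of I f] by (auto simp: quotient_cochains_iff)
    then show ?thesis
      using I(2) sym[of f] pull_homog(1)[of k f] by (auto simp: quotient_cochains_iff \<phi>_def)
  qed
  have gens: "\<phi> v \<in> gens ?QE k" if "v \<in> gens ?QL k" for v k
  proof -
    obtain I where I: "I \<in> \<I>" "v \<in> one_forms (lcomp L) I k" using \<open>v \<in> gens ?QL k\<close> by (auto simp: gens_model)
    obtain J where "J \<in> \<J>" "vanishes_on J (\<phi> v)" using cont[OF I(1) one_formsD(3)[OF I(2)]] by blast
    then show ?thesis
      using sym[OF one_formsD(1)[OF I(2)]] pull_homog(1)[OF one_formsD(2)[OF I(2)]] pull_homog(2)[OF one_formsD(4)[OF I(2)]]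
      by (auto simp: gens_model one_forms_def \<phi>_def)
  qed
  have hom: "algebra_hom ?QL ?QE (\<lambda>_. \<phi>)"
    unfolding algebra_hom_def
  proof (intro conjI allI ballI)
    show "\<phi> f \<in> acomp ?QE k" if "f \<in> acomp ?QL k" for f k by (rule into[OF that])
  qed (simp_all add: \<phi>_def linear_map_on_def pull_linear pull_single_Nil pull_mul)
  have dif: "\<phi> (adif ?QL k v) = adif ?QE k (\<phi> v)" if v: "v \<in> gens ?QL k" for k v
  proof -
    obtain I where I: "v \<in> one_forms (lcomp L) I k" using v by (auto simp: gens_model)
    have two: "len_homog 2 (\<phi> (cochain_dif L v))" "len_homog 2 (cochain_dif E (\<phi> v))"
      using pull_homog(2)[OF len_homog_dif[OF one_formsD(4)[OF I], of L], of "lcomp E" \<psi>]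
        len_homog_dif[OF pull_homog(2)[OF one_formsD(4)[OF I], of "lcomp E" \<psi>], of E]
      by (simp_all add: \<phi>_def numeral_2_eq_2)
    have "\<phi> (cochain_dif L v) ws = cochain_dif E (\<phi> v) ws" for ws
    proof (cases "ws \<in> words (lcomp E) \<and> length ws = 2")
      case True
      then obtain i x j y where ws: "ws = [(i, x), (j, y)]" by (auto elim: len_2E)
      then have xy: "x \<in> lcomp E i" "y \<in> lcomp E j" using True by auto
      have "\<phi> (cochain_dif L v) ws = cochain_dif L v [(i, \<psi> i x), (j, \<psi> j y)]"
        using xy by (simp add: ws \<phi>_def pull_def)
      then show ?thesis
        unfolding ws cochain_dif_pair[OF xy] cochain_dif_pair[OF p(2)[OF xy(1)] p(2)[OF xy(2)]]
        using graded_lieD(4)[OF e(1) xy] p(4)[OF xy] by (simp add: \<phi>_def pull_def)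
    next
      case False
      then show ?thesis
      proof (cases "ws \<in> words (lcomp E)")
        case True
        then show ?thesis using two False by (simp add: len_homog_def)
      next
        case False
        then show ?thesis by (simp add: cochain_dif_alt[of E] \<phi>_def pull_def)
      qed
    qed
    then show ?thesis by auto
  qed
  have dif': "\<phi> (adif ?QL k f) = adif ?QE k (\<phi> f)" if "f \<in> acomp ?QL k" for k f
    using algebra_hom_commutes_dif[OF model_cdga[OF L] model_free_on_gens[OF L] model_graded_algebra[OF e(2,3)]
        model_is_derivation hom dif that] .
  have "(\<lambda>k. restrict \<phi> (acomp ?QL k)) \<in> sullivan_hom ?QL ?QE"
    by (rule sullivan_hom_restrict[OF model_cdga[OF L] model_free_on_gens[OF L] hom], erule dif', erule gens)
  moreover have "has_dual E L \<I> (\<lambda>k. restrict \<phi> (acomp ?QL k)) \<psi>"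
    unfolding has_dual_def
  proof (intro allI ballI)
    fix k v x assume v: "v \<in> gens ?QL (Suc k)" and x: "x \<in> lcomp E k"
    have "v \<in> acomp ?QL (Suc k)" using v free_on_gensD(2)[OF model_free_on_gens[OF L]] by blast
    then show "restrict \<phi> (acomp ?QL (Suc k)) v [(k, x)] = v [(k, \<psi> k x)]"
      using x by (simp add: \<phi>_def pull_def del: model_simps)
  qed
  ultimately show ?thesis by blast
qed

text \<open>For \<open>x\<close> in \<open>E\<close> the functional \<open>v \<mapsto> (\<phi> v)(sx)\<close> is evaluation at one element of \<open>L\<close>, which is \<open>\<psi> x\<close>. Brackets are
  compared by evaluating \<open>d \<phi> v = \<phi> dv\<close> on two letters. For the continuity, \<open>\<phi>\<close> takes the forms on \<open>L / I\<close> to forms on a single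
  \<open>E / J\<close>, and \<open>I\<close> is the common kernel of the former.\<close>

lemma model_hom_has_dual:
  assumes E: "enriched_lie E \<J>" and C: "complete_enriched_lie L \<I>"
    and \<phi>: "\<phi> \<in> sullivan_hom (quadratic_model L \<I>) (quadratic_model E \<J>)"
  shows "\<exists>\<psi>\<in>lie_hom E \<J> L \<I>. has_dual E L \<I> \<phi> \<psi>"
proof -
  have L: "enriched_lie L \<I>" using C by (simp add: complete_enriched_lie_def)
  let ?QL = "quadratic_model L \<I>" and ?QE = "quadratic_model E \<J>"
  note e = enriched_lieD[OF E] and l = enriched_lieD[OF L]
  note hom = algebra_homD[OF sullivan_homD(1)[OF \<phi>]]
  have sub: "ratvec.subspace (lcomp E k)" "ratvec.subspace (lcomp L k)" for k
    using graded_space_subspace e(2) l(2) by blast+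
  have gens_sub: "gens ?QL k \<subseteq> acomp ?QL k" for k by (rule free_on_gensD(2)[OF model_free_on_gens[OF L]])
  have lin_gens: "linear_map_on (gens ?QL k) (\<phi> k)" for k by (rule linear_map_on_subset[OF hom(2) gens_sub])
  have "\<exists>y\<in>lcomp L k. \<forall>v\<in>gens ?QL (Suc k). v [(k, y)] = \<phi> (Suc k) v [(k, x)]" for k x
    using lin_gens[of "Suc k"] by (intro complete_realizes[OF C]) (simp add: linear_map_on_def)
  then obtain \<psi>0 where \<psi>0: "\<And>k x. \<psi>0 k x \<in> lcomp L k"
    "\<And>k x v. v \<in> gens ?QL (Suc k) \<Longrightarrow> v [(k, \<psi>0 k x)] = \<phi> (Suc k) v [(k, x)]"
    by metis
  define \<psi> where "\<psi> = (\<lambda>k. restrict (\<psi>0 k) (lcomp E k))"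
  have into: "\<psi> k x \<in> lcomp L k" if "x \<in> lcomp E k" for k x using that \<psi>0(1) by (simp add: \<psi>_def)
  have dual: "v [(k, \<psi> k x)] = \<phi> (Suc k) v [(k, x)]" if "x \<in> lcomp E k" "v \<in> gens ?QL (Suc k)" for k x v
    using that \<psi>0(2) by (simp add: \<psi>_def)
  have v_lin: "linear_map_on (lcomp L k) (\<lambda>y. v [(k, y)])" if "v \<in> gens ?QL (Suc k)" for k v
    using that one_forms_linear unfolding gens_model by blast
  have \<phi>v_lin: "linear_map_on (lcomp E k) (\<lambda>x. \<phi> (Suc k) v [(k, x)])" if "v \<in> gens ?QL (Suc k)" for k v
    using sullivan_homD(4)[OF \<phi> that] one_forms_linear unfolding gens_model by blast
  have lin: "linear_map_on (lcomp E k) (\<psi> k)" for k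
  proof (rule linear_map_onI)
    fix x y c assume x: "x \<in> lcomp E k"
    note ix = into[OF x] and cx = ratvec.subspace_scale[OF sub(1) x, of c]
    show "\<psi> k (c *\<^sub>Q x) = c *\<^sub>Q \<psi> k x"
    proof (rule gens_separate[OF L into[OF cx] ratvec.subspace_scale[OF sub(2) ix]])
      fix v assume v: "v \<in> gens ?QL (Suc k)"
      show "v [(k, \<psi> k (c *\<^sub>Q x))] = v [(k, c *\<^sub>Q \<psi> k x)]"
        using linear_map_on_scale[OF v_lin[OF v] ix] linear_map_on_scale[OF \<phi>v_lin[OF v] x] dual[OF cx v] dual[OF x v]
        by simp
    qed
    assume y: "y \<in> lcomp E k"
    note iy = into[OF y] and xy = ratvec.subspace_add[OF sub(1) x y]
    show "\<psi> k (x + y) = \<psi> k x + \<psi> k y"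
    proof (rule gens_separate[OF L into[OF xy] ratvec.subspace_add[OF sub(2) ix iy]])
      fix v assume v: "v \<in> gens ?QL (Suc k)"
      show "v [(k, \<psi> k (x + y))] = v [(k, \<psi> k x + \<psi> k y)]"
        using linear_map_on_add[OF v_lin[OF v] ix iy] linear_map_on_add[OF \<phi>v_lin[OF v] x y]
          dual[OF xy v] dual[OF x v] dual[OF y v] by simp
    qed
  qed
  have has: "has_dual E L \<I> \<phi> \<psi>" unfolding has_dual_def using dual by simp
  have "\<psi> \<in> lie_hom E \<J> L \<I>"
  proof (rule lie_homI)
    show "\<psi> k \<in> extensional (lcomp E k)" for k by (simp add: \<psi>_def)
  next
    fix i j x y assume x: "x \<in> lcomp E i" and y: "y \<in> lcomp E j"
    note xy = graded_lieD(4)[OF e(1) x y]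
    show "\<psi> (i + j) (lbr E i j x y) = lbr L i j (\<psi> i x) (\<psi> j y)"
    proof (rule gens_separate[OF L into[OF xy] graded_lieD(4)[OF l(1) into[OF x] into[OF y]]])
      fix v assume v: "v \<in> gens ?QL (Suc (i + j))"
      have va: "v \<in> acomp ?QL (Suc (i + j))" using v gens_sub by blast
      have dv: "adif ?QL (Suc (i + j)) v \<in> acomp ?QL (Suc (Suc (i + j)))" by (rule cdgaD(1)[OF model_cdga[OF L] va])
      have "cochain_dif E (\<phi> (Suc (i + j)) v) [(i, x), (j, y)]
         = \<phi> (Suc (Suc (i + j))) (cochain_dif L v) [(i, x), (j, y)]"
        using sullivan_homD(3)[OF \<phi> va] by simp
      also have "\<dots> = cochain_dif L v [(i, \<psi> i x), (j, \<psi> j y)]"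
        using has_dual_pull[OF L e(2) \<phi> has lin into dv, of "[(i, x), (j, y)]"] x y by simp
      finally have "\<phi> (Suc (i + j)) v [(i + j, lbr E i j x y)] = v [(i + j, lbr L i j (\<psi> i x) (\<psi> j y))]"
        unfolding cochain_dif_pair[OF x y] cochain_dif_pair[OF into[OF x] into[OF y]] by simp
      then show "v [(i + j, \<psi> (i + j) (lbr E i j x y))] = v [(i + j, lbr L i j (\<psi> i x) (\<psi> j y))]"
        using dual[OF xy v] by simp
    qed
  next
    fix I assume I: "I \<in> \<I>"
    obtain D where D: "dual_basis (lcomp L) I D" using enriched_dual_basis[OF L I] .
    have sub_gens: "one_forms (lcomp L) I m \<subseteq> gens ?QL m" for m using I by (auto simp: gens_model)
    have "\<exists>J\<in>\<J>. \<forall>m. \<forall>v\<in>one_forms (lcomp L) I m. \<phi> m v \<in> one_forms (lcomp E) J m"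
    proof (rule one_forms_image_common_ideal[OF l(2) D e(3)])
      show "linear_map_on (one_forms (lcomp L) I m) (\<phi> m)" for m
        by (rule linear_map_on_subset[OF lin_gens sub_gens])
      show "\<phi> m v \<in> (\<Union>J\<in>\<J>. one_forms (lcomp E) J m)" if "v \<in> one_forms (lcomp L) I m" for m v
        using sullivan_homD(4)[OF \<phi>, of v m] sub_gens that unfolding gens_model by blast
    qed
    then obtain J where J: "J \<in> \<J>" "\<And>m v. v \<in> one_forms (lcomp L) I m \<Longrightarrow> \<phi> m v \<in> one_forms (lcomp E) J m"
      by blast
    have "\<psi> k x \<in> I k" if x: "x \<in> J k" for k x
    proof -
      have x': "x \<in> lcomp E k" using x graded_idealD(2)[OF e(4)[OF J(1)]] by blast
      show ?thesis
      proof (rule one_forms_separate[OF l(2) graded_idealD(1)[OF l(4)[OF I]] into[OF x']])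
        fix v assume v: "v \<in> one_forms (lcomp L) I (Suc k)"
        have "\<phi> (Suc k) v [(k, x)] = 0"
          using x by (intro vanishes_onD[OF one_formsD(3)[OF J(2)[OF v]]]) auto
        then show "v [(k, \<psi> k x)] = 0" using dual[OF x', of v] sub_gens[of "Suc k"] v by auto
      qed
    qed
    then show "\<exists>J\<in>\<J>. \<forall>k. J k \<subseteq> {x \<in> lcomp E k. \<psi> k x \<in> I k}"
      using J(1) graded_idealD(2)[OF e(4)[OF J(1)]] by (intro bexI[of _ J]) blast+
  qed (use into lin in auto)
  with has show ?thesis by blast
qed

lemma quadratic_model_map_props:
  assumes E: "enriched_lie E \<J>" and L: "enriched_lie L \<I>" and \<psi>: "\<psi> \<in> lie_hom E \<J> L \<I>"
  shows "quadratic_model_map E \<J> L \<I> \<psi> \<in> sullivan_hom (quadratic_model L \<I>) (quadratic_model E \<J>)"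
    "has_dual E L \<I> (quadratic_model_map E \<J> L \<I> \<psi>) \<psi>"
proof -
  obtain \<phi> where \<phi>: "\<phi> \<in> sullivan_hom (quadratic_model L \<I>) (quadratic_model E \<J>)" "has_dual E L \<I> \<phi> \<psi>"
    using lie_hom_induces_model_hom[OF assms] by blast
  from quadratic_model_map_eq[OF L this] \<phi>
  show "quadratic_model_map E \<J> L \<I> \<psi> \<in> sullivan_hom (quadratic_model L \<I>) (quadratic_model E \<J>)"
    "has_dual E L \<I> (quadratic_model_map E \<J> L \<I> \<psi>) \<psi>" by simp_all
qed

lemma quadratic_model_map_bij:
  assumes E: "enriched_lie E \<J>" and C: "complete_enriched_lie L \<I>"
  shows "bij_betw (quadratic_model_map E \<J> L \<I>) (lie_hom E \<J> L \<I>)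
     (sullivan_hom (quadratic_model L \<I>) (quadratic_model E \<J>))"
proof -
  have L: "enriched_lie L \<I>" using C by (simp add: complete_enriched_lie_def)
  note props = quadratic_model_map_props[OF E L]
  show ?thesis
    unfolding bij_betw_def
  proof (intro conjI inj_onI equalityI subsetI)
    fix \<psi> \<psi>' assume p: "\<psi> \<in> lie_hom E \<J> L \<I>" and p': "\<psi>' \<in> lie_hom E \<J> L \<I>"
      and eq: "quadratic_model_map E \<J> L \<I> \<psi> = quadratic_model_map E \<J> L \<I> \<psi>'"
    show "\<psi> = \<psi>'"
    proof (rule ext, rule extensionalityI[OF lie_homD(1)[OF p] lie_homD(1)[OF p']])
      fix k x assume x: "x \<in> lcomp E k"
      show "\<psi> k x = \<psi>' k x"
      proof (rule gens_separate[OF L lie_homD(2)[OF p x] lie_homD(2)[OF p' x]])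
        fix v assume v: "v \<in> gens (quadratic_model L \<I>) (Suc k)"
        show "v [(k, \<psi> k x)] = v [(k, \<psi>' k x)]"
          using has_dualD[OF props(2)[OF p] v x] has_dualD[OF props(2)[OF p'] v x] eq by simp
      qed
    qed
  next
    fix \<phi> assume "\<phi> \<in> quadratic_model_map E \<J> L \<I> ` lie_hom E \<J> L \<I>"
    then show "\<phi> \<in> sullivan_hom (quadratic_model L \<I>) (quadratic_model E \<J>)" using props(1) by blast
  next
    fix \<phi> assume \<phi>: "\<phi> \<in> sullivan_hom (quadratic_model L \<I>) (quadratic_model E \<J>)"
    then obtain \<psi> where "\<psi> \<in> lie_hom E \<J> L \<I>" "has_dual E L \<I> \<phi> \<psi>" using model_hom_has_dual[OF E C] by blast
    then show "\<phi> \<in> quadratic_model_map E \<J> L \<I> ` lie_hom E \<J> L \<I>"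
      using quadratic_model_map_eq[OF L \<phi>] by blast
  qed
qed

lemma quadratic_model_map_id:
  assumes L: "enriched_lie L \<I>"
  shows "quadratic_model_map L \<I> L \<I> (graded_id (lcomp L)) = graded_id (acomp (quadratic_model L \<I>))"
proof (rule quadratic_model_map_eq[OF L sullivan_hom_id[OF model_cdga[OF L] model_free_on_gens[OF L]]])
  show "has_dual L L \<I> (graded_id (acomp (quadratic_model L \<I>))) (graded_id (lcomp L))"
    unfolding has_dual_def using free_on_gensD(2)[OF model_free_on_gens[OF L]]
    by (auto simp: graded_id_apply subset_iff simp del: model_simps)
qed

lemma quadratic_model_map_comp:
  assumes E: "enriched_lie E \<J>" and F: "enriched_lie F \<K>" and L: "enriched_lie L \<I>"
    and \<psi>: "\<psi> \<in> lie_hom E \<J> F \<K>" and \<chi>: "\<chi> \<in> lie_hom F \<K> L \<I>"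
  shows "quadratic_model_map E \<J> L \<I> (graded_comp (lcomp E) \<chi> \<psi>) =
     graded_comp (acomp (quadratic_model L \<I>)) (quadratic_model_map E \<J> F \<K> \<psi>) (quadratic_model_map F \<K> L \<I> \<chi>)"
proof (rule quadratic_model_map_eq[OF L])
  note p = quadratic_model_map_props[OF E F \<psi>] and c = quadratic_model_map_props[OF F L \<chi>]
  let ?\<phi> = "graded_comp (acomp (quadratic_model L \<I>)) (quadratic_model_map E \<J> F \<K> \<psi>) (quadratic_model_map F \<K> L \<I> \<chi>)"
  show "?\<phi> \<in> sullivan_hom (quadratic_model L \<I>) (quadratic_model E \<J>)"
    by (rule sullivan_hom_comp[OF model_cdga[OF L] model_free_on_gens[OF L] c(1) p(1)])
  show "has_dual E L \<I> ?\<phi> (graded_comp (lcomp E) \<chi> \<psi>)"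
    unfolding has_dual_def
  proof (intro allI ballI)
    fix k v x assume v: "v \<in> gens (quadratic_model L \<I>) (Suc k)" and x: "x \<in> lcomp E k"
    have "v \<in> acomp (quadratic_model L \<I>) (Suc k)" using v free_on_gensD(2)[OF model_free_on_gens[OF L]] by blast
    then show "?\<phi> (Suc k) v [(k, x)] = v [(k, graded_comp (lcomp E) \<chi> \<psi> k x)]"
      using has_dualD[OF p(2) sullivan_homD(4)[OF c(1) v] x] has_dualD[OF c(2) v lie_homD(2)[OF \<psi> x]] x
      by (simp add: graded_comp_apply del: model_simps)
  qed
qed

section \<open>The model determines the enriched Lie algebra\<close>

text \<open>The forms on \<open>L / I\<close>, of which \<open>I\<close> is the common kernel, are forms on a single \<open>L / J\<close>.\<close>

lemma gens_subset_refines: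
  assumes L: "enriched_lie L \<I>" and L': "enriched_lie L' \<I>'" and W: "lcomp L = lcomp L'"
    and gens: "\<And>k. gens (quadratic_model L \<I>) k \<subseteq> gens (quadratic_model L' \<I>') k" and I: "I \<in> \<I>"
  shows "\<exists>J\<in>\<I>'. \<forall>k. J k \<subseteq> I k"
proof -
  note l = enriched_lieD[OF L] and l' = enriched_lieD[OF L']
  obtain D where D: "dual_basis (lcomp L) I D" using enriched_dual_basis[OF L I] .
  have "\<exists>J\<in>\<I>'. \<forall>m. \<forall>v\<in>one_forms (lcomp L) I m. v \<in> one_forms (lcomp L) J m"
    using gens I by (intro one_forms_image_common_ideal[OF l(2) D l'(3), of "\<lambda>_ v. v"])
      (auto simp: linear_map_on_def gens_model W subset_iff)
  then obtain J where J: "J \<in> \<I>'" "\<And>m v. v \<in> one_forms (lcomp L) I m \<Longrightarrow> v \<in> one_forms (lcomp L) J m" by blast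
  have "x \<in> I k" if x: "x \<in> J k" for k x
  proof -
    have "x \<in> lcomp L k" using x graded_idealD(2)[OF l'(4)[OF J(1)]] W by auto
    then show ?thesis
    proof (rule one_forms_separate[OF l(2) graded_idealD(1)[OF l(4)[OF I]]])
      show "v [(k, x)] = 0" if "v \<in> one_forms (lcomp L) I (Suc k)" for v
        using x by (intro vanishes_onD[OF one_formsD(3)[OF J(2)[OF that]]]) auto
    qed
  qed
  then show ?thesis using J(1) by blast
qed

lemma graded_id_lie_homI:
  assumes L: "enriched_lie L \<I>" and ref: "\<And>I. I \<in> \<I>' \<Longrightarrow> \<exists>J\<in>\<I>. \<forall>k. J k \<subseteq> I k"
  shows "graded_id (lcomp L) \<in> lie_hom L \<I> L \<I>'"
proof (rule lie_homI)
  note l = enriched_lieD[OF L]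
  show "graded_id (lcomp L) k \<in> extensional (lcomp L k)" for k by (simp add: graded_id_def)
  show "graded_id (lcomp L) k x \<in> lcomp L k" if "x \<in> lcomp L k" for k x
    using that by (simp add: graded_id_apply)
  show "linear_map_on (lcomp L k) (graded_id (lcomp L) k)" for k
    using graded_space_subspace[OF l(2), of k]
    by (intro linear_map_onI) (simp_all add: graded_id_apply ratvec.subspace_add ratvec.subspace_scale)
  show "graded_id (lcomp L) (i + j) (lbr L i j x y) = lbr L i j (graded_id (lcomp L) i x) (graded_id (lcomp L) j y)"
    if "x \<in> lcomp L i" "y \<in> lcomp L j" for i j x y
    using that graded_lieD(4)[OF l(1) that] by (simp add: graded_id_apply)
  fix I assume "I \<in> \<I>'"
  then obtain J where J: "J \<in> \<I>" "\<forall>k. J k \<subseteq> I k" using ref by blast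
  have "J k \<subseteq> {x \<in> lcomp L k. graded_id (lcomp L) k x \<in> I k}" for k
  proof
    fix x assume "x \<in> J k"
    then have "x \<in> lcomp L k" "x \<in> I k" using J(2) graded_idealD(2)[OF l(4)[OF J(1)]] by blast+
    then show "x \<in> {x \<in> lcomp L k. graded_id (lcomp L) k x \<in> I k}" by (simp add: graded_id_apply)
  qed
  then show "\<exists>J\<in>\<I>. \<forall>k. J k \<subseteq> {x \<in> lcomp L k. graded_id (lcomp L) k x \<in> I k}" using J(1) by blast
qed

lemma graded_id_lie_homD:
  assumes "graded_id (lcomp L) \<in> lie_hom L \<I> L \<I>'" "I \<in> \<I>'"
  shows "\<exists>J\<in>\<I>. \<forall>k. J k \<subseteq> I k"
proof -
  obtain J where J: "J \<in> \<I>" "\<forall>k. J k \<subseteq> {x \<in> lcomp L k. graded_id (lcomp L) k x \<in> I k}"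
    using lie_homD(5)[OF assms] by blast
  have "J k \<subseteq> I k" for k
  proof
    fix x assume "x \<in> J k"
    then have "x \<in> lcomp L k" "graded_id (lcomp L) k x \<in> I k" using J(2) by auto
    then show "x \<in> I k" by (simp add: graded_id_apply)
  qed
  then show ?thesis using J(1) by blast
qed

lemma same_enrichedI:
  assumes L: "enriched_lie L \<I>" and L': "enriched_lie L' \<I>'" and W: "lcomp L = lcomp L'"
    and br: "\<And>i j x y. x \<in> lcomp L i \<Longrightarrow> y \<in> lcomp L j \<Longrightarrow> lbr L i j x y = lbr L' i j x y"
    and gens: "\<And>k. gens (quadratic_model L \<I>) k = gens (quadratic_model L' \<I>') k"
  shows "same_enriched L \<I> L' \<I>'"
proof -
  have "\<exists>J\<in>\<I>. \<forall>k. J k \<subseteq> I k" if "I \<in> \<I>'" for I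
    using gens_subset_refines[OF L' L W[symmetric] _ that] gens by simp
  then have 1: "graded_id (lcomp L) \<in> lie_hom L \<I> L \<I>'" by (rule graded_id_lie_homI[OF L])
  have "\<exists>J\<in>\<I>'. \<forall>k. J k \<subseteq> I k" if "I \<in> \<I>" for I
    using gens_subset_refines[OF L L' W _ that] gens by simp
  then have "graded_id (lcomp L') \<in> lie_hom L' \<I>' L' \<I>" by (rule graded_id_lie_homI[OF L'])
  moreover have "lie_hom L' \<I>' L' \<I> = lie_hom L \<I>' L \<I>"
  proof -
    have "\<psi> \<in> lie_hom L \<I>' L \<I>" if p: "\<psi> \<in> lie_hom L' \<I>' L' \<I>" for \<psi>
      using lie_homD[OF p] br W by (intro lie_homI) simp_all
    moreover have "\<psi> \<in> lie_hom L' \<I>' L' \<I>" if p: "\<psi> \<in> lie_hom L \<I>' L \<I>" for \<psi>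
      using lie_homD[OF p] br W by (intro lie_homI) simp_all
    ultimately show ?thesis by blast
  qed
  ultimately show ?thesis using 1 W br by (simp add: same_enriched_def equiv_families_def)
qed

lemma bracket_form_same:
  assumes "\<And>i j x y. x \<in> lcomp L i \<Longrightarrow> y \<in> lcomp L j \<Longrightarrow> lbr L i j x y = lbr L' i j x y"
    and "x \<in> lcomp L k" "ws \<in> words (lcomp L)"
  shows "bracket_form L k x f ws = bracket_form L' k x f ws"
  using assms(3)
proof (induction ws arbitrary: f)
  case (Cons a ws)
  then show ?case using assms(1)[OF assms(2)] by (cases a) simp
qed simp

lemma bdry_form_same:
  assumes "\<And>i j x y. x \<in> lcomp L i \<Longrightarrow> y \<in> lcomp L j \<Longrightarrow> lbr L i j x y = lbr L' i j x y"
    and "ws \<in> words (lcomp L)"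
  shows "bdry_form L f ws = bdry_form L' f ws"
  using assms(2)
proof (induction ws arbitrary: f)
  case (Cons a ws)
  obtain l y where a: "a = (l, y)" by fastforce
  have "bracket_form L l y f ws = bracket_form L' l y f ws"
    using Cons.prems by (intro bracket_form_same[OF assms(1)]) (simp_all add: a)
  then show ?case using Cons by (simp add: a)
qed simp

lemma same_enriched_model_eq:
  assumes L: "enriched_lie L \<I>" and L': "enriched_lie L' \<I>'" and same: "same_enriched L \<I> L' \<I>'"
  shows "quadratic_model L \<I> = quadratic_model L' \<I>'"
proof -
  have W: "lcomp L = lcomp L'" using same by (simp add: same_enriched_def)
  have br: "lbr L i j x y = lbr L' i j x y" if "x \<in> lcomp L i" "y \<in> lcomp L j" for i j x y
    using same that unfolding same_enriched_def by blast
  have ids: "graded_id (lcomp L) \<in> lie_hom L \<I> L \<I>'" "graded_id (lcomp L) \<in> lie_hom L \<I>' L \<I>"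
    using same unfolding same_enriched_def equiv_families_def by blast+
  have quot: "quotient_cochains L I n = quotient_cochains L' I n" for I n
    by (auto simp: quotient_cochains_iff W)
  have "(\<Union>I\<in>\<I>. quotient_cochains L I n) = (\<Union>I\<in>\<I>'. quotient_cochains L' I n)" for n
  proof (intro equalityI subsetI)
    fix f assume "f \<in> (\<Union>I\<in>\<I>. quotient_cochains L I n)"
    then obtain I where I: "I \<in> \<I>" "f \<in> quotient_cochains L I n" by blast
    obtain J where "J \<in> \<I>'" "\<forall>k. J k \<subseteq> I k" using graded_id_lie_homD[OF ids(2) I(1)] by blast
    then show "f \<in> (\<Union>I\<in>\<I>'. quotient_cochains L' I n)"
      using quotient_cochains_mono[OF I(2)] unfolding quot by blast
  next
    fix f assume "f \<in> (\<Union>I\<in>\<I>'. quotient_cochains L' I n)"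
    then obtain I where I: "I \<in> \<I>'" "f \<in> quotient_cochains L I n" unfolding quot by blast
    obtain J where "J \<in> \<I>" "\<forall>k. J k \<subseteq> I k" using graded_id_lie_homD[OF ids(1) I(1)] by blast
    then show "f \<in> (\<Union>I\<in>\<I>. quotient_cochains L I n)"
      using quotient_cochains_mono[OF I(2)] by blast
  qed
  moreover have "cochain_dif L = cochain_dif L'"
  proof (intro ext)
    show "cochain_dif L f ws = cochain_dif L' f ws" for f ws
      using bdry_form_same[of L L' ws f] br W by (simp add: cochain_dif_alt)
  qed
  ultimately show ?thesis unfolding quadratic_model_def by simp
qed

text \<open>The model remembers \<open>L\<close> because it consists of functions on words in \<open>L\<close>: a nonzero \<open>x\<close> is in \<open>L\<close> iff some generator does not
  vanish at \<open>sx\<close>, and the differential of generators determines the bracket.\<close>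

lemma model_eq_same_enriched:
  assumes L: "enriched_lie L \<I>" and L': "enriched_lie L' \<I>'"
    and eq: "quadratic_model L \<I> = quadratic_model L' \<I>'"
  shows "same_enriched L \<I> L' \<I>'"
proof -
  let ?M = "quadratic_model L \<I>"
  have comp: "lcomp K k = {x. x = 0 \<or> (\<exists>v\<in>gens (quadratic_model K \<K>) (Suc k). v [(k, x)] \<noteq> 0)}"
    if K: "enriched_lie K \<K>" for K :: "'a glie" and \<K> k
  proof (intro equalityI subsetI CollectI)
    have sub: "ratvec.subspace (lcomp K k)" by (rule graded_space_subspace[OF enriched_lieD(2)[OF K]])
    have v0: "v [(k, 0)] = 0" if v: "v \<in> gens (quadratic_model K \<K>) (Suc k)" for v
    proof -
      obtain I where "v \<in> one_forms (lcomp K) I (Suc k)" using v unfolding gens_model by blast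
      from linear_map_on_zero[OF one_forms_linear[OF this] sub] show ?thesis .
    qed
    show "x = 0 \<or> (\<exists>v\<in>gens (quadratic_model K \<K>) (Suc k). v [(k, x)] \<noteq> 0)" if "x \<in> lcomp K k" for x
      using gens_separate[OF K that ratvec.subspace_0[OF sub]] v0 by metis
    show "x \<in> lcomp K k" if xin: "x \<in> {x. x = 0 \<or> (\<exists>v\<in>gens (quadratic_model K \<K>) (Suc k). v [(k, x)] \<noteq> 0)}" for x
    proof (cases "x = 0")
      case True
      then show ?thesis using ratvec.subspace_0[OF sub] by simp
    next
      case False
      then obtain I v where "v \<in> one_forms (lcomp K) I (Suc k)" "v [(k, x)] \<noteq> 0"
        using xin unfolding gens_model by blast
      then show ?thesis using sym_form_outside[OF one_formsD(1), of v "lcomp K" I "Suc k" "[(k, x)]"] by auto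
    qed
  qed
  have W: "lcomp L = lcomp L'" by (rule ext) (simp only: comp[OF L] comp[OF L'] eq)
  have dif: "cochain_dif L = cochain_dif L'"
    using arg_cong[OF eq, of "\<lambda>M. adif M 0"] by simp
  show ?thesis
  proof (rule same_enrichedI[OF L L' W])
    show "gens ?M k = gens (quadratic_model L' \<I>') k" for k by (simp only: eq)
    fix i j x y assume x: "x \<in> lcomp L i" and y: "y \<in> lcomp L j"
    have x': "x \<in> lcomp L' i" and y': "y \<in> lcomp L' j" using x y W by simp_all
    have in1: "lbr L i j x y \<in> lcomp L (i + j)" and in2: "lbr L' i j x y \<in> lcomp L (i + j)"
      using graded_lieD(4)[OF enriched_lieD(1)[OF L] x y] graded_lieD(4)[OF enriched_lieD(1)[OF L'] x' y'] W by simp_all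
    show "lbr L i j x y = lbr L' i j x y"
    proof (rule gens_separate[OF L in1 in2])
      fix v
      have "cochain_dif L v [(i, x), (j, y)] = cochain_dif L' v [(i, x), (j, y)]" by (simp only: dif)
      then show "v [(i + j, lbr L i j x y)] = v [(i + j, lbr L' i j x y)]"
        unfolding cochain_dif_pair[OF x y] cochain_dif_pair[OF x' y'] by simp
    qed
  qed
qed

section \<open>The Lie algebra dual to a quadratic Sullivan algebra\<close>

definition dual_comp :: "'v::rat_vector gcdga \<Rightarrow> ('v \<Rightarrow> rat) graded" where
  "dual_comp A = (\<lambda>k. dual_space (gens A (Suc k)))"

text \<open>In degree \<open>0\<close> there are no generators and no letters, and the form is set to \<open>0\<close>.\<close>

definition evaluation_form :: "'v::rat_vector gcdga \<Rightarrow> nat \<Rightarrow> 'v \<Rightarrow> ('v \<Rightarrow> rat) word \<Rightarrow> rat" where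
  "evaluation_form A m v = (case m of 0 \<Rightarrow> 0 | Suc k \<Rightarrow> letter_form (dual_comp A) k (\<lambda>f. f v))"

text \<open>As an algebra, the cochains do not involve the bracket, which is yet to be defined; the zero bracket stands in for it.\<close>

definition cochains_of_dual :: "'v::rat_vector gcdga \<Rightarrow> (('v \<Rightarrow> rat) word \<Rightarrow> rat) gcdga" where
  "cochains_of_dual A = all_cochains \<lparr>lcomp = dual_comp A, lbr = (\<lambda>_ _ _ _. 0)\<rparr>"

text \<open>The extension of the evaluation \<open>v \<mapsto> (sf \<mapsto> f v)\<close> to an algebra morphism, which exists by freeness.\<close>

definition evaluation :: "'v::rat_vector gcdga \<Rightarrow> nat \<Rightarrow> 'v \<Rightarrow> ('v \<Rightarrow> rat) word \<Rightarrow> rat" where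
  "evaluation A = (SOME \<phi>. algebra_hom A (cochains_of_dual A) \<phi> \<and>
     (\<forall>k. \<forall>v\<in>gens A k. \<phi> k v = evaluation_form A k v))"

text \<open>The bracket with \<open>(dv)(sf \<and> sg) = (-1)\<^bsup>deg f + 1\<^esup> [f, g](v)\<close>, for which evaluation commutes with the differentials.\<close>

definition dual_bracket :: "'v::rat_vector gcdga \<Rightarrow> nat \<Rightarrow> nat \<Rightarrow> ('v \<Rightarrow> rat) \<Rightarrow> ('v \<Rightarrow> rat) \<Rightarrow> 'v \<Rightarrow> rat" where
  "dual_bracket A i j f g = (\<lambda>v. if v \<in> gens A (Suc (i + j))
     then (-1) ^ Suc i * evaluation A (Suc (Suc (i + j))) (adif A (Suc (i + j)) v) [(i, f), (j, g)] else 0)"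

definition dual_lie :: "'v::rat_vector gcdga \<Rightarrow> ('v \<Rightarrow> rat) glie" where
  "dual_lie A = \<lparr>lcomp = dual_comp A, lbr = dual_bracket A\<rparr>"

lemma dual_lie_simps [simp]: "lcomp (dual_lie A) = dual_comp A" "lbr (dual_lie A) = dual_bracket A"
  by (simp_all add: dual_lie_def)

lemma dual_comp_graded_space: "graded_space (dual_comp A)"
  by (simp add: graded_space_def dual_comp_def subspace_dual_space)

lemma dual_compD:
  assumes "f \<in> dual_comp A k"
  shows "linear_map_on (gens A (Suc k)) f" "v \<notin> gens A (Suc k) \<Longrightarrow> f v = 0"
  using assms by (auto simp: dual_comp_def dual_space_def)

lemma dual_comp_eqI:
  "f \<in> dual_comp A k \<Longrightarrow> g \<in> dual_comp A k \<Longrightarrow> (\<And>v. v \<in> gens A (Suc k) \<Longrightarrow> f v = g v) \<Longrightarrow> f = g"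
  unfolding dual_comp_def by (rule dual_space_eqI)

lemma quadratic_sullivanD:
  assumes "quadratic_sullivan A"
  shows "cdga A" "free_on_gens A" "graded_algebra A" "gens A 0 = {0}"
    "v \<in> gens A k \<Longrightarrow> adif A k v \<in> wedge2 A (gens A) (Suc k)"
    "gens A k = (\<Union>n. sullivan_filtration A n k)" "ratvec.subspace (gens A k)" "gens A k \<subseteq> acomp A k"
proof -
  show "cdga A" and free: "free_on_gens A" using assms unfolding quadratic_sullivan_def by blast+
  then show "graded_algebra A" "ratvec.subspace (gens A k)" "gens A k \<subseteq> acomp A k"
    using cdga_graded_algebra graded_space_subspace[OF free_on_gensD(1)[OF free]] free_on_gensD(2)[OF free] by blast+
  show "gens A 0 = {0}" "v \<in> gens A k \<Longrightarrow> adif A k v \<in> wedge2 A (gens A) (Suc k)"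
    using assms unfolding quadratic_sullivan_def by blast+
  have "\<forall>k. gens A k = (\<Union>n. sullivan_filtration A n k)"
    using assms unfolding quadratic_sullivan_def by (elim conjE)
  then show "gens A k = (\<Union>n. sullivan_filtration A n k)" by (rule spec)
qed

lemma evaluation_form_one_form:
  assumes v: "v \<in> gens A m" and I: "\<And>k f. m = Suc k \<Longrightarrow> f \<in> I k \<Longrightarrow> f v = 0"
  shows "evaluation_form A m v \<in> one_forms (dual_comp A) I m"
proof (cases m)
  case 0
  then show ?thesis using ratvec.subspace_0[OF subspace_one_forms] by (simp add: evaluation_form_def)
next
  case (Suc k)
  then show ?thesis
    using I unfolding evaluation_form_def
    by (auto intro!: letter_form_in_one_forms dual_comp_graded_space simp: linear_map_on_def)
qed

lemma evaluation_form_apply: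
  "f \<in> dual_comp A k \<Longrightarrow> evaluation_form A (Suc k) v [(k, f)] = f v"
  by (simp add: evaluation_form_def letter_form_apply)

lemma evaluation_form_linear:
  assumes A: "quadratic_sullivan A" shows "linear_map_on (gens A m) (evaluation_form A m)"
proof (cases m)
  case 0
  then show ?thesis by (simp add: evaluation_form_def linear_map_on_def)
next
  case (Suc k)
  have sub: "ratvec.subspace (gens A m)" by (rule quadratic_sullivanD(7)[OF A])
  have one: "evaluation_form A m v \<in> one_forms (dual_comp A) (\<lambda>_. {}) m" if "v \<in> gens A m" for v
    using that by (intro evaluation_form_one_form) auto
  show ?thesis
  proof (rule linear_map_onI)
    fix x y c assume x: "x \<in> gens A m"
    note cx = ratvec.subspace_scale[OF sub x, of c]
    show "evaluation_form A m (c *\<^sub>Q x) = c *\<^sub>Q evaluation_form A m x"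
    proof (rule one_forms_eqI[OF one[OF cx] ratvec.subspace_scale[OF subspace_one_forms one[OF x]]])
      fix l f assume l: "m = Suc l" "f \<in> dual_comp A l"
      then show "evaluation_form A m (c *\<^sub>Q x) [(l, f)] = (c *\<^sub>Q evaluation_form A m x) [(l, f)]"
        using linear_map_on_scale[OF dual_compD(1)[OF l(2)], of x c] x by (simp add: evaluation_form_apply)
    qed
    assume y: "y \<in> gens A m"
    show "evaluation_form A m (x + y) = evaluation_form A m x + evaluation_form A m y"
    proof (rule one_forms_eqI[OF one[OF ratvec.subspace_add[OF sub x y]] ratvec.subspace_add[OF subspace_one_forms one[OF x] one[OF y]]])
      fix l f assume l: "m = Suc l" "f \<in> dual_comp A l"
      then show "evaluation_form A m (x + y) [(l, f)] = (evaluation_form A m x + evaluation_form A m y) [(l, f)]"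
        using linear_map_on_add[OF dual_compD(1)[OF l(2)], of x y] x y by (simp add: evaluation_form_apply)
    qed
  qed
qed

lemma all_cochains_same:
  assumes "lcomp L = lcomp L'"
  shows "acomp (all_cochains L) = acomp (all_cochains L')"
    "algebra_hom A (all_cochains L) \<phi> \<longleftrightarrow> algebra_hom A (all_cochains L') \<phi>"
    "graded_algebra (all_cochains L) \<longleftrightarrow> graded_algebra (all_cochains L')"
proof -
  show eq: "acomp (all_cochains L) = acomp (all_cochains L')"
    using assms by (intro ext set_eqI) (simp only: all_cochains_acomp)
  show "algebra_hom A (all_cochains L) \<phi> \<longleftrightarrow> algebra_hom A (all_cochains L') \<phi>"
    unfolding algebra_hom_def eq by simp
  show "graded_algebra (all_cochains L) \<longleftrightarrow> graded_algebra (all_cochains L')"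
    unfolding graded_algebra_def eq by simp
qed

lemma one_forms_all_cochains:
  assumes "f \<in> one_forms (lcomp L) I n" shows "f \<in> acomp (all_cochains L) n"
  unfolding all_cochains_acomp using one_formsD(1,2)[OF assms] by blast

lemma evaluation_props:
  assumes A: "quadratic_sullivan A"
  shows "algebra_hom A (all_cochains (dual_lie A)) (evaluation A)"
    "v \<in> gens A k \<Longrightarrow> evaluation A k v = evaluation_form A k v"
proof -
  note q = quadratic_sullivanD[OF A]
  let ?L = "\<lparr>lcomp = dual_comp A, lbr = (\<lambda>_ _ _ _. 0)\<rparr> :: ('a \<Rightarrow> rat) glie"
  have same: "lcomp ?L = lcomp (dual_lie A)" by simp
  have B: "graded_algebra (cochains_of_dual A)"
    unfolding cochains_of_dual_def by (rule all_cochains_algebra) (simp add: dual_comp_graded_space)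
  have "evaluation_form A k v \<in> acomp (cochains_of_dual A) k" if "v \<in> gens A k" for k v
    unfolding cochains_of_dual_def using evaluation_form_one_form[OF that, of "\<lambda>_. {}"]
    by (intro one_forms_all_cochains) simp
  then obtain \<phi> where "algebra_hom A (cochains_of_dual A) \<phi>" "\<And>k v. v \<in> gens A k \<Longrightarrow> \<phi> k v = evaluation_form A k v"
    using free_extension[OF q(3,2) B evaluation_form_linear[OF A]] by blast
  then have "algebra_hom A (cochains_of_dual A) (evaluation A) \<and>
     (\<forall>k. \<forall>v\<in>gens A k. evaluation A k v = evaluation_form A k v)"
    unfolding evaluation_def by (intro someI_ex[where P = "\<lambda>\<phi>. algebra_hom A (cochains_of_dual A) \<phi> \<and>
     (\<forall>k. \<forall>v\<in>gens A k. \<phi> k v = evaluation_form A k v)"]) blast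
  then show "algebra_hom A (all_cochains (dual_lie A)) (evaluation A)"
    "v \<in> gens A k \<Longrightarrow> evaluation A k v = evaluation_form A k v"
    using all_cochains_same(2)[OF same] unfolding cochains_of_dual_def by blast+
qed

lemma evaluation_acomp:
  assumes "quadratic_sullivan A" "x \<in> acomp A n"
  shows "sym_form (dual_comp A) (evaluation A n x)" "homog n (evaluation A n x)"
  using algebra_homD(1)[OF evaluation_props(1)[OF assms(1)] assms(2)] unfolding all_cochains_acomp by simp_all

lemma wedge2_mono: "(\<And>k. U k \<subseteq> V k) \<Longrightarrow> wedge2 A U n \<subseteq> wedge2 A V n"
  unfolding wedge2_def by (rule ratvec.span_mono) blast

lemma evaluation_one_form:
  assumes "quadratic_sullivan A" "v \<in> gens A k"
  shows "evaluation A k v \<in> one_forms (dual_comp A) (\<lambda>_. {}) k"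
  unfolding evaluation_props(2)[OF assms] using assms(2) by (intro evaluation_form_one_form) auto

text \<open>Linear conditions on the evaluation of a quadratic expression can be checked on products of two generators.\<close>

lemma wedge2_linear_property:
  assumes A: "quadratic_sullivan A" and U: "\<And>k. U k \<subseteq> gens A k" and T: "ratvec.subspace T"
    and prod: "\<And>i j x y. i + j = n \<Longrightarrow> x \<in> U i \<Longrightarrow> y \<in> U j \<Longrightarrow>
        cochain_mul (evaluation A i x) (evaluation A j y) \<in> T"
    and x: "x \<in> wedge2 A U n"
  shows "evaluation A n x \<in> T"
proof (rule linear_map_on_span_in[OF algebra_homD(2)[OF evaluation_props(1)[OF A]]
      graded_algebraD(1)[OF quadratic_sullivanD(3)[OF A]] T _ _ x[unfolded wedge2_def]])
  note q = quadratic_sullivanD[OF A]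
  show "{amul A i j x y |i j x y. i + j = n \<and> x \<in> U i \<and> y \<in> U j} \<subseteq> acomp A n"
    using graded_algebraD(2)[OF q(3)] U q(8) by blast
  fix b assume "b \<in> {amul A i j x y |i j x y. i + j = n \<and> x \<in> U i \<and> y \<in> U j}"
  then obtain i j x y where b: "b = amul A i j x y" "i + j = n" "x \<in> U i" "y \<in> U j" by blast
  then have "x \<in> acomp A i" "y \<in> acomp A j" using U q(8) by blast+
  then have "evaluation A n b = cochain_mul (evaluation A i x) (evaluation A j y)"
    using algebra_homD(4)[OF evaluation_props(1)[OF A], of x i y j] b(1,2) by simp
  then show "evaluation A n b \<in> T" using prod b by simp
qed

lemma evaluation_dif_len_homog:
  assumes A: "quadratic_sullivan A" and v: "v \<in> gens A k"
  shows "len_homog 2 (evaluation A (Suc k) (adif A k v))"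
proof -
  have "evaluation A (Suc k) (adif A k v) \<in> {f. len_homog 2 f}"
  proof (rule wedge2_linear_property[OF A _ subspace_len_homog _ quadratic_sullivanD(5)[OF A v]])
    fix i j x y assume "x \<in> gens A i" "y \<in> gens A j"
    then have "len_homog (1 + 1) (cochain_mul (evaluation A i x) (evaluation A j y))"
      by (intro len_homog_mul one_formsD(4)[OF evaluation_one_form[OF A]])
    then show "cochain_mul (evaluation A i x) (evaluation A j y) \<in> {f. len_homog 2 f}" by (simp add: numeral_2_eq_2)
  qed simp
  then show ?thesis by simp
qed

lemma dual_bracket_apply:
  assumes "v \<in> gens A (Suc (i + j))"
  shows "dual_bracket A i j f g v
    = (-1) ^ Suc i * evaluation A (Suc (Suc (i + j))) (adif A (Suc (i + j)) v) [(i, f), (j, g)]"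
  using assms by (simp add: dual_bracket_def)

lemma dual_bracket_in:
  assumes A: "quadratic_sullivan A"
  shows "dual_bracket A i j f g \<in> dual_comp A (i + j)"
proof -
  note q = quadratic_sullivanD[OF A]
  let ?m = "Suc (i + j)"
  let ?e = "\<lambda>v. evaluation A (Suc ?m) (adif A ?m v)"
  have "linear_map_on (acomp A ?m) ?e"
    using cdgaD(1)[OF q(1)]
    by (intro linear_map_on_compose[OF cdgaD(2)[OF q(1)] algebra_homD(2)[OF evaluation_props(1)[OF A]]]) auto
  then have e: "linear_map_on (gens A ?m) ?e" by (rule linear_map_on_subset[OF _ q(8)])
  have "linear_map_on (gens A ?m) (dual_bracket A i j f g)"
    by (intro linear_map_onI)
      (simp_all add: dual_bracket_apply ratvec.subspace_add[OF q(7)] ratvec.subspace_scale[OF q(7)]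
        linear_map_on_add[OF e] linear_map_on_scale[OF e] algebra_simps)
  then show ?thesis by (simp add: dual_comp_def dual_space_def dual_bracket_def)
qed

lemma evaluation_dif:
  assumes A: "quadratic_sullivan A" and x: "x \<in> acomp A n"
  shows "evaluation A (Suc n) (adif A n x) = cochain_dif (dual_lie A) (evaluation A n x)"
proof -
  note q = quadratic_sullivanD[OF A]
  have alg: "graded_algebra (all_cochains (dual_lie A))"
    by (rule all_cochains_algebra) (simp add: dual_comp_graded_space)
  have gens: "evaluation A (Suc k) (adif A k v) = adif (all_cochains (dual_lie A)) k (evaluation A k v)"
    if v: "v \<in> gens A k" for k v
  proof -
    have va: "v \<in> acomp A k" using v q(8) by blast
    note dv = evaluation_acomp[OF A cdgaD(1)[OF q(1) va]]
    note ev = evaluation_one_form[OF A v]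
    have two: "len_homog 2 (evaluation A (Suc k) (adif A k v))" "len_homog 2 (cochain_dif (dual_lie A) (evaluation A k v))"
      using evaluation_dif_len_homog[OF A v] len_homog_dif[OF one_formsD(4)[OF ev], of "dual_lie A"]
      by (simp_all add: numeral_2_eq_2)
    have homog: "homog (Suc k) (cochain_dif (dual_lie A) (evaluation A k v))"
      by (rule homog_dif[OF one_formsD(2)[OF ev]])
    have "evaluation A (Suc k) (adif A k v) ws = cochain_dif (dual_lie A) (evaluation A k v) ws" for ws
    proof (cases "ws \<in> words (dual_comp A) \<and> length ws = 2 \<and> sdeg ws = Suc k")
      case True
      then obtain i f j g where ws: "ws = [(i, f), (j, g)]" by (auto elim: len_2E)
      then have fg: "f \<in> lcomp (dual_lie A) i" "g \<in> lcomp (dual_lie A) j" and k: "k = Suc (i + j)" using True by auto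
      have "cochain_dif (dual_lie A) (evaluation A k v) ws = (-1) ^ Suc i * dual_bracket A i j f g v"
        unfolding ws cochain_dif_pair[OF fg]
        using evaluation_props(2)[OF A v] evaluation_form_apply[OF dual_bracket_in[OF A]] by (simp add: k)
      also have "\<dots> = evaluation A (Suc k) (adif A k v) ws"
        using v by (simp add: dual_bracket_apply k ws minus_one_power_iff)
      finally show ?thesis ..
    next
      case False
      then consider "ws \<notin> words (dual_comp A)" | "length ws \<noteq> 2" | "sdeg ws \<noteq> Suc k" by blast
      then show ?thesis
      proof cases
        case 1
        then show ?thesis using sym_form_outside[OF dv(1)] by (simp add: cochain_dif_alt)
      next
        case 2
        then show ?thesis using two by (simp add: len_homog_def)
      next
        case 3
        then show ?thesis using dv(2) homog by (simp add: homog_def)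
      qed
    qed
    then show ?thesis by auto
  qed
  show ?thesis
    using algebra_hom_commutes_dif[OF q(1,2) alg model_is_derivation evaluation_props(1)[OF A] gens x] by simp
qed

text \<open>The Jacobi identity is the equation \<open>d\<^sup>2 = 0\<close> on generators, evaluated on three elements.\<close>

lemma dual_bracket_Jacobi:
  assumes A: "quadratic_sullivan A" and x: "x \<in> dual_comp A i" and y: "y \<in> dual_comp A j" and z: "z \<in> dual_comp A k"
  shows "dual_bracket A i (j + k) x (dual_bracket A j k y z) =
     dual_bracket A (i + j) k (dual_bracket A i j x y) z
     + (-1) ^ (i * j) *\<^sub>Q dual_bracket A j (i + k) y (dual_bracket A i k x z)"
proof -
  note q = quadratic_sullivanD[OF A]
  let ?L = "dual_lie A" and ?m = "i + j + k"
  have sub: "ratvec.subspace (dual_comp A n)" for n by (rule graded_space_subspace[OF dual_comp_graded_space])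
  have in1: "dual_bracket A i (j + k) x (dual_bracket A j k y z) \<in> dual_comp A ?m"
    and in2: "dual_bracket A (i + j) k (dual_bracket A i j x y) z \<in> dual_comp A ?m"
    and in3: "dual_bracket A j (i + k) y (dual_bracket A i k x z) \<in> dual_comp A ?m"
    using dual_bracket_in[OF A, of i "j + k"] dual_bracket_in[OF A, of "i + j" k] dual_bracket_in[OF A, of j "i + k"]
    by (simp_all add: ac_simps)
  show ?thesis
  proof (rule dual_comp_eqI[OF in1 ratvec.subspace_add[OF sub in2 ratvec.subspace_scale[OF sub in3]]])
    fix v assume v: "v \<in> gens A (Suc ?m)"
    have va: "v \<in> acomp A (Suc ?m)" using v q(8) by blast
    define e where "e = evaluation A (Suc ?m) v"
    have e: "e [(n, f)] = f v" if "n = ?m" "f \<in> dual_comp A n" for n f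
      using that evaluation_props(2)[OF A v] evaluation_form_apply by (simp add: e_def)
    have "cochain_dif ?L (cochain_dif ?L e) = evaluation A (Suc (Suc (Suc ?m))) (adif A (Suc (Suc ?m)) (adif A (Suc ?m) v))"
      unfolding e_def evaluation_dif[OF A va, symmetric] by (rule evaluation_dif[OF A cdgaD(1)[OF q(1) va], symmetric])
    also have "\<dots> = 0"
      unfolding cdgaD(3)[OF q(1) va]
      by (rule linear_map_on_zero[OF algebra_homD(2)[OF evaluation_props(1)[OF A]] graded_algebraD(1)[OF q(3)]])
    finally have "cochain_dif ?L (cochain_dif ?L e) [(i, x), (j, y), (k, z)] = 0" by simp
    moreover define h where "h = cochain_dif ?L e"
    ultimately have "cochain_dif ?L h [(i, x), (j, y), (k, z)] = 0" by simp
    \<comment> \<open>one term for each of the three pairs of letters\<close>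
    then have zero: "(-1) ^ Suc i * h [(i + j, dual_bracket A i j x y), (k, z)]
       + (-1) ^ (Suc i * Suc j + Suc j) * ((-1) ^ Suc i * h [(j, y), (i + k, dual_bracket A i k x z)])
       + (-1) ^ Suc i * ((-1) ^ Suc j * h [(i, x), (j + k, dual_bracket A j k y z)]) = 0"
      using x y z by (simp add: cochain_dif_alt[of ?L h] contract_apply)
    have pair: "h [(a, f), (b, g)] = (-1) ^ Suc a * dual_bracket A a b f g v"
      if "a + b = ?m" "f \<in> dual_comp A a" "g \<in> dual_comp A b" for a b f g
      unfolding h_def using that cochain_dif_pair[of f ?L a g b e] e[OF that(1) dual_bracket_in[OF A]] by simp
    have h1: "h [(i + j, dual_bracket A i j x y), (k, z)]
        = (-1) ^ Suc (i + j) * dual_bracket A (i + j) k (dual_bracket A i j x y) z v"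
      by (rule pair) (simp_all add: z dual_bracket_in[OF A])
    have h2: "h [(j, y), (i + k, dual_bracket A i k x z)]
        = (-1) ^ Suc j * dual_bracket A j (i + k) y (dual_bracket A i k x z) v"
      by (rule pair) (simp_all add: y dual_bracket_in[OF A])
    have h3: "h [(i, x), (j + k, dual_bracket A j k y z)]
        = (-1) ^ Suc i * dual_bracket A i (j + k) x (dual_bracket A j k y z) v"
      by (rule pair) (simp_all add: x dual_bracket_in[OF A])
    show "dual_bracket A i (j + k) x (dual_bracket A j k y z) v =
      (dual_bracket A (i + j) k (dual_bracket A i j x y) z
       + (-1) ^ (i * j) *\<^sub>Q dual_bracket A j (i + k) y (dual_bracket A i k x z)) v"
      using zero unfolding h1 h2 h3
      by (cases "even i"; cases "even j") (simp_all add: minus_one_power_iff)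
  qed
qed

lemma dual_lie_graded_lie:
  assumes A: "quadratic_sullivan A" shows "graded_lie (dual_lie A)"
proof -
  note q = quadratic_sullivanD[OF A]
  have sub: "ratvec.subspace (dual_comp A n)" for n by (rule graded_space_subspace[OF dual_comp_graded_space])
  have sym: "sym_form (dual_comp A) (evaluation A (Suc (Suc (i + j))) (adif A (Suc (i + j)) v))"
    if "v \<in> gens A (Suc (i + j))" for i j v
    using that q(8) cdgaD(1)[OF q(1)] by (intro evaluation_acomp(1)[OF A]) blast
  have left: "linear_map_on (dual_comp A i) (\<lambda>x. dual_bracket A i j x y)" if y: "y \<in> dual_comp A j" for i j y
  proof -
    have lin: "linear_map_on (dual_comp A i) (\<lambda>x. dual_bracket A i j x y v)" for v
    proof (cases "v \<in> gens A (Suc (i + j))")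
      case True
      then show ?thesis
        using sym_form_linear[OF sym[OF True], of "[]" "[(j, y)]" i] y
        by (simp add: dual_bracket_apply linear_map_on_mult del: power_Suc)
    qed (simp add: dual_bracket_def linear_map_on_const0)
    then show ?thesis unfolding linear_map_on_def by (simp add: fun_eq_iff)
  qed
  have right: "linear_map_on (dual_comp A j) (dual_bracket A i j x)" if x: "x \<in> dual_comp A i" for i j x
  proof -
    have lin: "linear_map_on (dual_comp A j) (\<lambda>y. dual_bracket A i j x y v)" for v
    proof (cases "v \<in> gens A (Suc (i + j))")
      case True
      then show ?thesis
        using sym_form_linear[OF sym[OF True], of "[(i, x)]" "[]" j] x
        by (simp add: dual_bracket_apply linear_map_on_mult del: power_Suc)
    qed (simp add: dual_bracket_def linear_map_on_const0)
    then show ?thesis unfolding linear_map_on_def by (simp add: fun_eq_iff)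
  qed
  have anti: "dual_bracket A i j x y = - ((-1) ^ (i * j) *\<^sub>Q dual_bracket A j i y x)"
    if x: "x \<in> dual_comp A i" and y: "y \<in> dual_comp A j" for i j x y
  proof -
    have yx: "dual_bracket A j i y x \<in> dual_comp A (i + j)"
      using dual_bracket_in[OF A, of j i] by (simp add: add.commute)
    show ?thesis
    proof (rule dual_comp_eqI[OF dual_bracket_in[OF A] ratvec.subspace_neg[OF sub ratvec.subspace_scale[OF sub yx]]])
      fix v assume v: "v \<in> gens A (Suc (i + j))"
      have "dual_bracket A j i y x v
          = (-1) ^ Suc j * evaluation A (Suc (Suc (i + j))) (adif A (Suc (i + j)) v) [(j, y), (i, x)]"
        using dual_bracket_apply[of v A j i y x] v by (simp add: add.commute)
      then show "dual_bracket A i j x y v = (- ((-1) ^ (i * j) *\<^sub>Q dual_bracket A j i y x)) v"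
        using sym_form_swap[OF sym[OF v], of "[]" "[]" x i y j] x y
        by (simp add: dual_bracket_apply[OF v]) (simp add: minus_one_power_iff)
    qed
  qed
  show ?thesis
    unfolding graded_lie_def dual_lie_simps
    by (intro conjI allI ballI; (rule dual_comp_graded_space dual_bracket_in[OF A]
        | (rule anti; assumption) | (rule dual_bracket_Jacobi[OF A]; assumption)
        | (simp add: bilinear_map_on_def left right; fail)))
qed

section \<open>The ideals of the dual Lie algebra\<close>

text \<open>A stable set is a finite spanning set of a graded subspace \<open>U\<close> of the generators with \<open>dU \<subseteq> \<And>\<^sup>2U\<close>. The annihilators of these
  subspaces are the ideals of the dual Lie algebra.\<close>

definition stable_set :: "'v::rat_vector gcdga \<Rightarrow> (nat \<times> 'v) set \<Rightarrow> bool" where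
  "stable_set A F \<longleftrightarrow> finite F \<and>
     (\<forall>(k, v)\<in>F. v \<in> gens A k \<and> adif A k v \<in> wedge2 A (\<lambda>k. {w. (k, w) \<in> F}) (Suc k))"

definition annihilator :: "'v::rat_vector gcdga \<Rightarrow> (nat \<times> 'v) set \<Rightarrow> ('v \<Rightarrow> rat) graded" where
  "annihilator A F = (\<lambda>k. {f \<in> dual_comp A k. \<forall>v. (Suc k, v) \<in> F \<longrightarrow> f v = 0})"

definition dual_family :: "'v::rat_vector gcdga \<Rightarrow> ('v \<Rightarrow> rat) graded set" where
  "dual_family A = annihilator A ` Collect (stable_set A)"

lemma stable_setD:
  assumes "stable_set A F"
  shows "finite F" "(k, v) \<in> F \<Longrightarrow> v \<in> gens A k"
    "(k, v) \<in> F \<Longrightarrow> adif A k v \<in> wedge2 A (\<lambda>k. {w. (k, w) \<in> F}) (Suc k)"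
  using assms unfolding stable_set_def by auto

lemma stable_set_empty: "stable_set A {}"
  by (simp add: stable_set_def)

lemma stable_set_Un:
  assumes "stable_set A F" "stable_set A G" shows "stable_set A (F \<union> G)"
proof -
  have "adif A k v \<in> wedge2 A (\<lambda>k. {w. (k, w) \<in> F \<union> G}) (Suc k)" if "(k, v) \<in> F \<union> G" for k v
    using that stable_setD(3)[OF assms(1), of k v] stable_setD(3)[OF assms(2), of k v]
      wedge2_mono[of "\<lambda>k. {w. (k, w) \<in> F}" "\<lambda>k. {w. (k, w) \<in> F \<union> G}" A "Suc k"]
      wedge2_mono[of "\<lambda>k. {w. (k, w) \<in> G}" "\<lambda>k. {w. (k, w) \<in> F \<union> G}" A "Suc k"] by blast
  then show ?thesis
    using stable_setD(1,2)[OF assms(1)] stable_setD(1,2)[OF assms(2)] unfolding stable_set_def by blast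
qed

lemma sullivan_filtration_gens: "sullivan_filtration A n k \<subseteq> gens A k"
  by (cases n) (simp_all only: sullivan_filtration.simps Collect_restrict)

lemma sullivan_filtration_Suc: "sullivan_filtration A n k \<subseteq> sullivan_filtration A (Suc n) k"
proof (induction n arbitrary: k)
  case 0
  have "0 \<in> wedge2 A U m" for U m unfolding wedge2_def by (rule ratvec.span_zero)
  then show ?case by auto
next
  case (Suc n)
  have "wedge2 A (sullivan_filtration A n) (Suc k) \<subseteq> wedge2 A (sullivan_filtration A (Suc n)) (Suc k)"
    by (rule wedge2_mono[OF Suc])
  then show ?case unfolding sullivan_filtration.simps(2)[of A "Suc n"] sullivan_filtration.simps(2)[of A n] by blast
qed

lemma sullivan_filtration_mono: "m \<le> n \<Longrightarrow> sullivan_filtration A m k \<subseteq> sullivan_filtration A n k"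
  using lift_Suc_mono_le[of "\<lambda>n. sullivan_filtration A n k"] sullivan_filtration_Suc by blast

text \<open>By induction on the filtration, the factors in an expression for \<open>dv\<close> lie in stable sets; their union together with \<open>v\<close> is stable.\<close>

lemma stable_set_exists:
  assumes "v \<in> sullivan_filtration A n k"
  shows "\<exists>F. stable_set A F \<and> (k, v) \<in> F"
  using assms
proof (induction n arbitrary: k v)
  case 0
  then have "stable_set A {(k, v)}"
    by (auto simp: stable_set_def wedge2_def ratvec.span_zero)
  then show ?case by blast
next
  case (Suc n)
  have "\<exists>F. stable_set A F \<and> y \<in> wedge2 A (\<lambda>k. {w. (k, w) \<in> F}) m"
    if "y \<in> wedge2 A (sullivan_filtration A n) m" for y m
    using that unfolding wedge2_def
  proof (induction rule: ratvec.span_induct_alt)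
    case base
    show ?case using stable_set_empty ratvec.span_zero by blast
  next
    case (step c b y)
    then obtain F i j a a' where F: "stable_set A F" "y \<in> wedge2 A (\<lambda>k. {w. (k, w) \<in> F}) m"
      and b: "b = amul A i j a a'" "i + j = m" "a \<in> sullivan_filtration A n i" "a' \<in> sullivan_filtration A n j"
      unfolding wedge2_def by blast
    obtain G G' where G: "stable_set A G" "(i, a) \<in> G" "stable_set A G'" "(j, a') \<in> G'"
      using Suc.IH[OF b(3)] Suc.IH[OF b(4)] by blast
    let ?H = "F \<union> (G \<union> G')"
    have "b \<in> {amul A i j x y |i j x y. i + j = m \<and> x \<in> {w. (i, w) \<in> ?H} \<and> y \<in> {w. (j, w) \<in> ?H}}"
      using b G by blast
    then have "b \<in> wedge2 A (\<lambda>k. {w. (k, w) \<in> ?H}) m" unfolding wedge2_def by (rule ratvec.span_base)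
    moreover have "y \<in> wedge2 A (\<lambda>k. {w. (k, w) \<in> ?H}) m"
      using F(2) wedge2_mono[of "\<lambda>k. {w. (k, w) \<in> F}" "\<lambda>k. {w. (k, w) \<in> ?H}" A m] by blast
    ultimately have "c *\<^sub>Q b + y \<in> wedge2 A (\<lambda>k. {w. (k, w) \<in> ?H}) m"
      unfolding wedge2_def by (intro ratvec.span_add ratvec.span_scale)
    moreover have "stable_set A ?H" by (intro stable_set_Un F(1) G(1,3))
    ultimately show ?case unfolding wedge2_def by blast
  qed
  from this[of "adif A k v" "Suc k"] Suc.prems obtain F where F: "stable_set A F"
    "adif A k v \<in> wedge2 A (\<lambda>k. {w. (k, w) \<in> F}) (Suc k)" by auto
  let ?G = "insert (k, v) F"
  have mono: "wedge2 A (\<lambda>k. {w. (k, w) \<in> F}) m \<subseteq> wedge2 A (\<lambda>k. {w. (k, w) \<in> ?G}) m" for m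
    by (rule wedge2_mono) blast
  have "v \<in> gens A k" using Suc.prems by simp
  then have "stable_set A ?G"
    unfolding stable_set_def using stable_setD[OF F(1)] F(2) mono by blast
  then show ?case by blast
qed

lemma gens_stable_set:
  assumes "quadratic_sullivan A" "v \<in> gens A k"
  obtains F where "stable_set A F" "(k, v) \<in> F"
proof -
  obtain n where "v \<in> sullivan_filtration A n k" using assms(2) quadratic_sullivanD(6)[OF assms(1), of k] by blast
  from stable_set_exists[OF this] show thesis using that by blast
qed

lemma cochain_mul_pair:
  assumes f: "len_homog 1 f" and g: "len_homog 1 g"
  shows "cochain_mul f g [(i, x), (j, y)]
    = f [(i, x)] * g [(j, y)] + (-1) ^ (Suc i * Suc j) * f [(j, y)] * g [(i, x)]"
proof -
  have z: "f [] = 0" "g [] = 0" "f [(a, u), (b, w)] = 0" "g [(a, u), (b, w)] = 0" for a b u w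
    using f g by (simp_all add: len_homog_def)
  show ?thesis by (simp add: contract_apply twist_apply z)
qed

text \<open>The value \<open>[f, g](v)\<close> is a sum of terms \<open>f(a) g(b)\<close> over the products \<open>a \<and> b\<close> that make up \<open>dv\<close>. This gives both that
  annihilators of stable sets are ideals and that the lower central series kills the Sullivan filtration.\<close>

lemma dual_bracket_vanishes:
  assumes A: "quadratic_sullivan A" and g: "g \<in> dual_comp A j" and f: "f \<in> dual_comp A i"
    and U: "\<And>k. U k \<subseteq> gens A k" and dv: "adif A (Suc (i + j)) v \<in> wedge2 A U (Suc (Suc (i + j)))"
    and zero: "\<And>u. u \<in> U (Suc j) \<Longrightarrow> g u = 0"
  shows "dual_bracket A i j f g v = 0"
proof -
  let ?T = "{h :: ('a \<Rightarrow> rat) word \<Rightarrow> rat. h [(i, f), (j, g)] = 0}"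
  have T: "ratvec.subspace ?T" by (simp add: ratvec.subspace_def)
  have kill: "evaluation A p a [(j, g)] = 0" if a: "a \<in> U p" for p a
  proof (cases "p = Suc j")
    case True
    then have "a \<in> gens A (Suc j)" "g a = 0" using U a zero by blast+
    then show ?thesis
      using evaluation_props(2)[OF A, of a "Suc j"] evaluation_form_apply[OF g, of a] True by simp
  next
    case False
    have "a \<in> gens A p" using U a by blast
    from one_formsD(7)[OF evaluation_one_form[OF A this], of j g] False show ?thesis by simp
  qed
  have "evaluation A (Suc (Suc (i + j))) (adif A (Suc (i + j)) v) \<in> ?T"
  proof (rule wedge2_linear_property[OF A U T _ dv])
    fix p q a b assume a: "a \<in> U p" and b: "b \<in> U q"
    then have "a \<in> gens A p" "b \<in> gens A q" using U by blast+
    then have "len_homog 1 (evaluation A p a)" "len_homog 1 (evaluation A q b)"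
      using one_formsD(4)[OF evaluation_one_form[OF A]] by blast+
    then show "cochain_mul (evaluation A p a) (evaluation A q b) \<in> ?T"
      by (simp only: cochain_mul_pair kill[OF a] kill[OF b] mult_zero_left mult_zero_right add_0_left mem_Collect_eq)
  qed
  then show ?thesis by (simp add: dual_bracket_def)
qed

lemma annihilator_subspace: "ratvec.subspace (annihilator A F k)"
  using graded_space_subspace[OF dual_comp_graded_space, of A k]
  by (auto simp: annihilator_def ratvec.subspace_def)

lemma annihilator_ideal:
  assumes A: "quadratic_sullivan A" and F: "stable_set A F"
  shows "graded_ideal (dual_lie A) (annihilator A F)"
proof -
  have "dual_bracket A i j f g \<in> annihilator A F (i + j)"
    if f: "f \<in> dual_comp A i" and g: "g \<in> annihilator A F j" for i j f g
  proof -
    have "dual_bracket A i j f g v = 0" if v: "(Suc (i + j), v) \<in> F" for v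
      using g stable_setD(2)[OF F]
      by (intro dual_bracket_vanishes[OF A _ f _ stable_setD(3)[OF F v]]) (auto simp: annihilator_def)
    then show ?thesis by (simp add: annihilator_def dual_bracket_in[OF A])
  qed
  then show ?thesis
    unfolding graded_ideal_def graded_space_def dual_lie_simps
    using annihilator_subspace by (auto simp: annihilator_def)
qed

text \<open>The functionals are added one at a time. If the new one does not vanish on the common kernel \<open>K\<close> of the others, it has the
  value \<open>1\<close> at some \<open>b\<close> in \<open>K\<close>, and \<open>x \<mapsto> x - l(x) b\<close> maps \<open>K\<close> to the new common kernel.\<close>

lemma finitely_many_functionals:
  fixes l :: "'i \<Rightarrow> 'a::rat_vector \<Rightarrow> rat"
  assumes S: "ratvec.subspace S" and "finite T" and l: "\<And>t. t \<in> T \<Longrightarrow> linear_map_on S (l t)"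
  shows "\<exists>B. finite B \<and> B \<subseteq> S \<and> S \<subseteq> ratvec.span (B \<union> {x \<in> S. \<forall>t\<in>T. l t x = 0})"
    "\<And>w :: 'a \<Rightarrow> rat. linear_map_on S w \<Longrightarrow> (\<And>x. x \<in> S \<Longrightarrow> (\<forall>t\<in>T. l t x = 0) \<Longrightarrow> w x = 0) \<Longrightarrow>
       \<exists>c. \<forall>x\<in>S. w x = (\<Sum>t\<in>T. c t * l t x)"
proof -
  have "(\<exists>B. finite B \<and> B \<subseteq> S \<and> S \<subseteq> ratvec.span (B \<union> {x \<in> S. \<forall>t\<in>T. l t x = 0})) \<and>
    (\<forall>w :: 'a \<Rightarrow> rat. linear_map_on S w \<longrightarrow> (\<forall>x\<in>S. (\<forall>t\<in>T. l t x = 0) \<longrightarrow> w x = 0) \<longrightarrow>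
       (\<exists>c. \<forall>x\<in>S. w x = (\<Sum>t\<in>T. c t * l t x)))"
    using \<open>finite T\<close> l
  proof (induction T rule: finite_induct)
    case empty
    show ?case by (intro conjI exI[of _ "{}"]) (auto intro: ratvec.span_base)
  next
    case (insert t T)
    let ?K = "\<lambda>T. {x \<in> S. \<forall>t\<in>T. l t x = 0}"
    have lt: "linear_map_on S (l t)" using insert.prems by simp
    obtain B where B: "finite B" "B \<subseteq> S" "S \<subseteq> ratvec.span (B \<union> ?K T)"
      using insert.IH insert.prems by blast
    have IH: "\<exists>c. \<forall>x\<in>S. w x = (\<Sum>t\<in>T. c t * l t x)"
      if "linear_map_on S w" "\<And>x. x \<in> ?K T \<Longrightarrow> w x = 0" for w :: "'a \<Rightarrow> rat"
      using insert.IH insert.prems that by blast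
    show ?case
    proof (cases "\<exists>b0\<in>?K T. l t b0 \<noteq> 0")
      case False
      then have K: "?K (insert t T) = ?K T" by auto
      show ?thesis
      proof (intro conjI allI impI)
        show "\<exists>B. finite B \<and> B \<subseteq> S \<and> S \<subseteq> ratvec.span (B \<union> ?K (insert t T))"
          unfolding K using B by blast
        fix w :: "'a \<Rightarrow> rat" assume "linear_map_on S w" "\<forall>x\<in>S. (\<forall>t\<in>insert t T. l t x = 0) \<longrightarrow> w x = 0"
        with K obtain c where c: "\<forall>x\<in>S. w x = (\<Sum>t\<in>T. c t * l t x)" using IH[of w] by blast
        have "(\<Sum>u\<in>insert t T. (c(t := 0)) u * l u x) = (\<Sum>u\<in>T. c u * l u x)" for x
          using insert.hyps by (simp add: sum.insert) (rule sum.cong, auto)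
        then show "\<exists>c. \<forall>x\<in>S. w x = (\<Sum>t\<in>insert t T. c t * l t x)"
          using c by (intro exI[of _ "c(t := 0)"]) simp
      qed
    next
      case True
      then obtain b0 where b0: "b0 \<in> ?K T" "l t b0 \<noteq> 0" by blast
      define b where "b = (1 / l t b0) *\<^sub>Q b0"
      have bS: "b \<in> S" using b0 S by (simp add: b_def ratvec.subspace_scale)
      have lb: "l t b = 1" using linear_map_on_scale[OF lt, of b0] b0 by (simp add: b_def)
      have bK: "l u b = 0" if "u \<in> T" for u
        using linear_map_on_scale[of S "l u" b0] insert.prems[of u] that b0 by (simp add: b_def)
      have sub: "x - c *\<^sub>Q b \<in> S" if "x \<in> S" for x c
        using that bS S by (simp add: ratvec.subspace_diff ratvec.subspace_scale)
      have corr: "x - l t x *\<^sub>Q b \<in> ?K (insert t T)" if x: "x \<in> ?K T" for x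
      proof -
        have "l u (x - l t x *\<^sub>Q b) = l u x - l t x * l u b" if "u \<in> insert t T" for u
          using linear_map_on_diff[OF insert.prems[OF that] S, of x "l t x *\<^sub>Q b"]
            linear_map_on_scale[OF insert.prems[OF that] bS, of "l t x"] x bS S
          by (simp add: ratvec.subspace_scale)
        then show ?thesis using x sub lb bK by auto
      qed
      show ?thesis
      proof (intro conjI allI impI)
        have "?K T \<subseteq> ratvec.span (insert b B \<union> ?K (insert t T))"
        proof
          fix x assume x: "x \<in> ?K T"
          have "(x - l t x *\<^sub>Q b) + l t x *\<^sub>Q b \<in> ratvec.span (insert b B \<union> ?K (insert t T))"
            using corr[OF x] by (intro ratvec.span_add ratvec.span_scale ratvec.span_base) blast+
          then show "x \<in> ratvec.span (insert b B \<union> ?K (insert t T))" by simp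
        qed
        moreover have "B \<subseteq> ratvec.span (insert b B \<union> ?K (insert t T))" by (auto intro: ratvec.span_base)
        ultimately have "S \<subseteq> ratvec.span (insert b B \<union> ?K (insert t T))"
          using B(3) ratvec.span_minimal[OF _ ratvec.subspace_span, of "B \<union> ?K T"] by blast
        then show "\<exists>B. finite B \<and> B \<subseteq> S \<and> S \<subseteq> ratvec.span (B \<union> ?K (insert t T))"
          using B(1,2) bS by (intro exI[of _ "insert b B"]) simp
        fix w :: "'a \<Rightarrow> rat" assume w: "linear_map_on S w" "\<forall>x\<in>S. (\<forall>t\<in>insert t T. l t x = 0) \<longrightarrow> w x = 0"
        have w': "linear_map_on S (\<lambda>x. w x - w b * l t x)"
          using w(1) lt by (simp add: linear_map_on_def algebra_simps)
        have "w x - w b * l t x = 0" if x: "x \<in> ?K T" for x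
        proof -
          have "w (x - l t x *\<^sub>Q b) = 0" using w(2) corr[OF x] by blast
          then show ?thesis
            using linear_map_on_diff[OF w(1) S, of x "l t x *\<^sub>Q b"] linear_map_on_scale[OF w(1) bS, of "l t x"] x bS S
            by (simp add: ratvec.subspace_scale mult.commute)
        qed
        then obtain c where c: "\<forall>x\<in>S. w x - w b * l t x = (\<Sum>t\<in>T. c t * l t x)" using IH[OF w'] by blast
        have "(\<Sum>u\<in>insert t T. (c(t := w b)) u * l u x) = w b * l t x + (\<Sum>u\<in>T. c u * l u x)" for x
          using insert.hyps by (simp add: sum.insert) (rule sum.cong, auto)
        then show "\<exists>c. \<forall>x\<in>S. w x = (\<Sum>t\<in>insert t T. c t * l t x)"
          using c by (intro exI[of _ "c(t := w b)"]) (simp add: algebra_simps)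
      qed
    qed
  qed
  then show "\<exists>B. finite B \<and> B \<subseteq> S \<and> S \<subseteq> ratvec.span (B \<union> {x \<in> S. \<forall>t\<in>T. l t x = 0})"
    "\<And>w :: 'a \<Rightarrow> rat. linear_map_on S w \<Longrightarrow> (\<And>x. x \<in> S \<Longrightarrow> (\<forall>t\<in>T. l t x = 0) \<Longrightarrow> w x = 0) \<Longrightarrow>
       \<exists>c. \<forall>x\<in>S. w x = (\<Sum>t\<in>T. c t * l t x)"
    by blast+
qed

lemma stable_set_functionals:
  assumes F: "stable_set A F"
  shows "finite {v. (Suc k, v) \<in> F}" "ratvec.subspace (dual_comp A k)"
    "v \<in> {v. (Suc k, v) \<in> F} \<Longrightarrow> linear_map_on (dual_comp A k) (\<lambda>f. f v)"
    "annihilator A F k = {f \<in> dual_comp A k. \<forall>v\<in>{v. (Suc k, v) \<in> F}. f v = 0}"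
proof -
  have "{v. (Suc k, v) \<in> F} \<subseteq> snd ` F" by force
  then show "finite {v. (Suc k, v) \<in> F}" using stable_setD(1)[OF F] finite_surj by blast
  show "ratvec.subspace (dual_comp A k)" by (rule graded_space_subspace[OF dual_comp_graded_space])
  show "linear_map_on (dual_comp A k) (\<lambda>f. f v)" by (simp add: linear_map_on_def)
  show "annihilator A F k = {f \<in> dual_comp A k. \<forall>v\<in>{v. (Suc k, v) \<in> F}. f v = 0}" by (simp add: annihilator_def)
qed

lemma annihilator_finite_dim:
  assumes F: "stable_set A F"
  shows "finite_dim_quotient (dual_lie A) (annihilator A F)"
  unfolding finite_dim_quotient_def dual_lie_simps
proof (intro conjI allI)
  define N where "N = Max (insert 0 (fst ` F))"
  have "k \<le> N" if "(k, v) \<in> F" for k v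
    unfolding N_def using stable_setD(1)[OF F] that by (intro Max_ge) force+
  then have "dual_comp A k \<subseteq> annihilator A F k" if "k > N" for k
    using that by (force simp: annihilator_def)
  then show "\<exists>N. \<forall>k>N. dual_comp A k \<subseteq> annihilator A F k" by blast
  show "\<exists>B. finite B \<and> B \<subseteq> dual_comp A k \<and> dual_comp A k \<subseteq> ratvec.span (B \<union> annihilator A F k)" for k
    unfolding stable_set_functionals(4)[OF F]
    by (rule finitely_many_functionals(1)[OF stable_set_functionals(2)[OF F] stable_set_functionals(1)[OF F]
        stable_set_functionals(3)[OF F]])
qed

lemma span_apply_zero:
  assumes "f \<in> ratvec.span B" "\<And>b. b \<in> B \<Longrightarrow> b v = (0::rat)" shows "f v = 0"
  using linear_map_on_span_eq[of UNIV "\<lambda>f. f v" "\<lambda>_. 0" B f] assms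
  by (simp add: linear_map_on_def)

lemma lower_central_kills:
  assumes A: "quadratic_sullivan A"
    and "v \<in> sullivan_filtration A n (Suc k)" "f \<in> lower_central (dual_lie A) (Suc n) k"
  shows "f v = 0"
  using assms(2,3)
proof (induction n arbitrary: v k f)
  case 0
  have "dual_bracket A i j x y v = 0" if "i + j = k" "x \<in> dual_comp A i" for i j x y
    using 0(1) that linear_map_on_zero[OF algebra_homD(2)[OF evaluation_props(1)[OF A]]
        graded_algebraD(1)[OF quadratic_sullivanD(3)[OF A]]]
    by (auto simp: dual_bracket_def)
  then have gen: "b v = 0" if "b \<in> {lbr (dual_lie A) i j x y |i j x y. i + j = k \<and> x \<in> lcomp (dual_lie A) i
      \<and> y \<in> lower_central (dual_lie A) 0 j}" for b
    using that by auto
  show ?case by (rule span_apply_zero[OF 0(2)[unfolded lower_central.simps(2)] gen])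
next
  case (Suc n)
  let ?L = "dual_lie A"
  have "dual_bracket A i j x y v = 0"
    if ij: "i + j = k" and x: "x \<in> dual_comp A i" and y: "y \<in> lower_central ?L (Suc n) j" for i j x y
  proof (rule dual_bracket_vanishes[OF A _ x sullivan_filtration_gens])
    show "y \<in> dual_comp A j" using lower_central_subset[OF dual_lie_graded_lie[OF A], of "Suc n" j] y
      by (auto simp del: lower_central.simps)
    show "adif A (Suc (i + j)) v \<in> wedge2 A (sullivan_filtration A n) (Suc (Suc (i + j)))"
      using Suc.prems(1) ij by simp
    show "y u = 0" if "u \<in> sullivan_filtration A n (Suc j)" for u by (rule Suc.IH[OF that y])
  qed
  then have gen: "b v = 0" if "b \<in> {lbr ?L i j x y |i j x y. i + j = k \<and> x \<in> lcomp ?L i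
      \<and> y \<in> lower_central ?L (Suc n) j}" for b
    using that unfolding dual_lie_simps by blast
  show ?case by (rule span_apply_zero[OF Suc.prems(2)[unfolded lower_central.simps(2)[of ?L "Suc n"]] gen])
qed

lemma annihilator_nilpotent:
  assumes A: "quadratic_sullivan A" and F: "stable_set A F"
  shows "nilpotent_quotient (dual_lie A) (annihilator A F)"
proof -
  have "\<exists>n. \<forall>(k, v)\<in>G. v \<in> sullivan_filtration A n k" if "finite G" "\<And>k v. (k, v) \<in> G \<Longrightarrow> v \<in> gens A k" for G
    using that
  proof (induction G rule: finite_induct)
    case (insert a G)
    obtain k v where a: "a = (k, v)" by fastforce
    obtain n where n: "\<forall>(k, v)\<in>G. v \<in> sullivan_filtration A n k" using insert by auto
    have "v \<in> gens A k" using insert.prems[of k v] a by simp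
    then obtain m where m: "v \<in> sullivan_filtration A m k" using quadratic_sullivanD(6)[OF A, of k] by blast
    have "v \<in> sullivan_filtration A (max m n) k"
      using m sullivan_filtration_mono[of m "max m n" A k] by auto
    moreover have "w \<in> sullivan_filtration A (max m n) l" if "(l, w) \<in> G" for l w
      using n that sullivan_filtration_mono[of n "max m n" A l] by auto
    ultimately show ?case by (intro exI[of _ "max m n"]) (auto simp: a)
  qed simp
  from this[OF stable_setD(1,2)[OF F]]
  obtain n where n: "\<And>k v. (k, v) \<in> F \<Longrightarrow> v \<in> sullivan_filtration A n k" by blast
  have "lower_central (dual_lie A) (Suc n) k \<subseteq> annihilator A F k" for k
    using lower_central_subset[OF dual_lie_graded_lie[OF A], of "Suc n" k] lower_central_kills[OF A n]
    by (auto simp: annihilator_def simp del: lower_central.simps)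
  then show ?thesis unfolding nilpotent_quotient_def by blast
qed

lemma annihilator_Un: "annihilator A (F \<union> G) k \<subseteq> annihilator A F k \<inter> annihilator A G k"
  by (auto simp: annihilator_def)

text \<open>Every generator lies in some stable set.\<close>

lemma dual_family_separates:
  assumes A: "quadratic_sullivan A" and f: "f \<in> dual_comp A k"
    and "\<And>F. stable_set A F \<Longrightarrow> f \<in> annihilator A F k"
  shows "f = 0"
proof (rule dual_comp_eqI[OF f ratvec.subspace_0[OF graded_space_subspace[OF dual_comp_graded_space]]])
  fix v assume "v \<in> gens A (Suc k)"
  then obtain F where F: "stable_set A F" "(Suc k, v) \<in> F" using gens_stable_set[OF A] by blast
  then show "f v = 0 v" using assms(3)[OF F(1)] by (simp add: annihilator_def)
qed

lemma dual_lie_enriched: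
  assumes A: "quadratic_sullivan A" shows "enriched_lie (dual_lie A) (dual_family A)"
  unfolding enriched_lie_def
proof (intro conjI ballI allI)
  show "graded_lie (dual_lie A)" by (rule dual_lie_graded_lie[OF A])
  show "dual_family A \<noteq> {}" using stable_set_empty by (auto simp: dual_family_def)
  show "graded_ideal (dual_lie A) I" "finite_dim_quotient (dual_lie A) I" "nilpotent_quotient (dual_lie A) I"
    if "I \<in> dual_family A" for I
    using that annihilator_ideal[OF A] annihilator_finite_dim annihilator_nilpotent[OF A]
    by (auto simp: dual_family_def)
  show "\<exists>K\<in>dual_family A. \<forall>k. K k \<subseteq> I k \<inter> J k" if IJ: "I \<in> dual_family A" "J \<in> dual_family A" for I J
  proof -
    obtain F G where FG: "stable_set A F" "I = annihilator A F" "stable_set A G" "J = annihilator A G"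
      using IJ by (auto simp: dual_family_def)
    have "annihilator A (F \<union> G) \<in> dual_family A" using stable_set_Un[OF FG(1,3)] by (simp add: dual_family_def)
    then show ?thesis using annihilator_Un FG(2,4) by blast
  qed
  show "(\<Inter>I\<in>dual_family A. I k) = {0}" for k
  proof (intro equalityI subsetI)
    fix f assume "f \<in> (\<Inter>I\<in>dual_family A. I k)"
    then have all: "f \<in> annihilator A F k" if "stable_set A F" for F using that by (auto simp: dual_family_def)
    have "f \<in> dual_comp A k" using all[OF stable_set_empty] by (simp add: annihilator_def)
    then show "f \<in> {0}" using dual_family_separates[OF A _ all] by simp
  next
    fix f :: "'a \<Rightarrow> rat" assume "f \<in> {0}"
    then show "f \<in> (\<Inter>I\<in>dual_family A. I k)" using ratvec.subspace_0[OF annihilator_subspace] by (auto simp: dual_family_def)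
  qed
qed

text \<open>The class of \<open>x I\<close> modulo the annihilator \<open>I\<close> of \<open>F\<close> is the restriction of this functional to \<open>F\<close>. Compatible restrictions
  glue to a functional on all generators, since any finite number of generators lies in a common stable set.\<close>

lemma dual_lie_complete:
  assumes A: "quadratic_sullivan A" shows "complete_enriched_lie (dual_lie A) (dual_family A)"
  unfolding complete_enriched_lie_def dual_lie_simps
proof (intro conjI allI impI)
  show "enriched_lie (dual_lie A) (dual_family A)" by (rule dual_lie_enriched[OF A])
  fix k and x :: "('a \<Rightarrow> rat) graded \<Rightarrow> 'a \<Rightarrow> rat"
  assume "(\<forall>I\<in>dual_family A. x I \<in> dual_comp A k) \<and>
    (\<forall>I\<in>dual_family A. \<forall>J\<in>dual_family A. J \<le> I \<longrightarrow> x J - x I \<in> I k)"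
  then have x: "\<And>F. stable_set A F \<Longrightarrow> x (annihilator A F) \<in> dual_comp A k"
    and compat: "\<And>F G. stable_set A F \<Longrightarrow> stable_set A G \<Longrightarrow> annihilator A G \<le> annihilator A F \<Longrightarrow>
      x (annihilator A G) - x (annihilator A F) \<in> annihilator A F k"
    by (auto simp: dual_family_def)
  have agree: "x (annihilator A G) v = x (annihilator A F) v"
    if F: "stable_set A F" and G: "stable_set A G" and v: "(Suc k, v) \<in> F" "(Suc k, v) \<in> G" for F G v
  proof -
    note H = stable_set_Un[OF F G]
    have "x (annihilator A (F \<union> G)) - x (annihilator A F) \<in> annihilator A F k"
      "x (annihilator A (F \<union> G)) - x (annihilator A G) \<in> annihilator A G k"
      using annihilator_Un[of A F G] by (intro compat F G H; auto simp: le_fun_def)+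
    then have "(x (annihilator A (F \<union> G)) - x (annihilator A F)) v = 0"
      "(x (annihilator A (F \<union> G)) - x (annihilator A G)) v = 0"
      using v unfolding annihilator_def by blast+
    then show ?thesis by simp
  qed
  have "\<forall>v. \<exists>F. v \<in> gens A (Suc k) \<longrightarrow> stable_set A F \<and> (Suc k, v) \<in> F"
    using gens_stable_set[OF A] by metis
  then obtain S where S: "\<And>v. v \<in> gens A (Suc k) \<Longrightarrow> stable_set A (S v)" "\<And>v. v \<in> gens A (Suc k) \<Longrightarrow> (Suc k, v) \<in> S v"
    by metis
  define y where "y = (\<lambda>v. if v \<in> gens A (Suc k) then x (annihilator A (S v)) v else 0)"
  have y: "y v = x (annihilator A F) v" if F: "stable_set A F" "(Suc k, v) \<in> F" for F v
  proof -
    have v: "v \<in> gens A (Suc k)" by (rule stable_setD(2)[OF F])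
    then show ?thesis using agree[OF F(1) S(1)[OF v] F(2) S(2)[OF v]] by (simp add: y_def)
  qed
  have sub: "ratvec.subspace (gens A (Suc k))" by (rule quadratic_sullivanD(7)[OF A])
  have "linear_map_on (gens A (Suc k)) y"
  proof (rule linear_map_onI)
    fix u v c assume u: "u \<in> gens A (Suc k)"
    note cu = ratvec.subspace_scale[OF sub u, of c]
    let ?F = "S u \<union> S (c *\<^sub>Q u)"
    have F: "stable_set A ?F" by (intro stable_set_Un S u cu)
    show "y (c *\<^sub>Q u) = c *\<^sub>Q y u"
      using y[OF F, of u] y[OF F, of "c *\<^sub>Q u"] S(2)[OF u] S(2)[OF cu]
        linear_map_on_scale[OF dual_compD(1)[OF x[OF F]] u, of c] by simp
    assume v: "v \<in> gens A (Suc k)"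
    note uv = ratvec.subspace_add[OF sub u v]
    let ?G = "S u \<union> (S v \<union> S (u + v))"
    have G: "stable_set A ?G" by (intro stable_set_Un S u v uv)
    show "y (u + v) = y u + y v"
      using y[OF G, of u] y[OF G, of v] y[OF G, of "u + v"] S(2)[OF u] S(2)[OF v] S(2)[OF uv]
        linear_map_on_add[OF dual_compD(1)[OF x[OF G]] u v] by simp
  qed
  then have yin: "y \<in> dual_comp A k" by (simp add: dual_comp_def dual_space_def y_def)
  have subW: "ratvec.subspace (dual_comp A k)" by (rule graded_space_subspace[OF dual_comp_graded_space])
  have yx: "y - x (annihilator A F) \<in> annihilator A F k" if F: "stable_set A F" for F
    using y[OF F] ratvec.subspace_diff[OF subW yin x[OF F]] by (simp add: annihilator_def)
  show "\<exists>!y. y \<in> dual_comp A k \<and> (\<forall>I\<in>dual_family A. y - x I \<in> I k)"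
  proof (intro ex1I[of _ y] conjI ballI)
    show "y \<in> dual_comp A k" by (rule yin)
    show "y - x I \<in> I k" if "I \<in> dual_family A" for I using that yx by (auto simp: dual_family_def)
    fix z assume z: "z \<in> dual_comp A k \<and> (\<forall>I\<in>dual_family A. z - x I \<in> I k)"
    have "z - y = 0"
    proof (rule dual_family_separates[OF A])
      show "z - y \<in> dual_comp A k" using z yin by (simp add: ratvec.subspace_diff[OF subW])
      fix F assume F: "stable_set A F"
      have "z - x (annihilator A F) \<in> annihilator A F k" using z F by (auto simp: dual_family_def)
      from ratvec.subspace_diff[OF annihilator_subspace this yx[OF F]]
      show "z - y \<in> annihilator A F k" by simp
    qed
    then show "z = y" by simp
  qed
qed

section \<open>Every quadratic Sullivan algebra is a quadratic model\<close>

lemma evaluation_gens_model: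
  assumes A: "quadratic_sullivan A" and v: "v \<in> gens A k"
  shows "evaluation A k v \<in> gens (quadratic_model (dual_lie A) (dual_family A)) k"
proof -
  obtain F where F: "stable_set A F" "(k, v) \<in> F" using gens_stable_set[OF A v] by blast
  have "evaluation_form A k v \<in> one_forms (dual_comp A) (annihilator A F) k"
    using F(2) by (intro evaluation_form_one_form[OF v]) (auto simp: annihilator_def)
  then show ?thesis
    using F(1) unfolding evaluation_props(2)[OF A v] gens_model by (auto simp: dual_family_def)
qed

lemma evaluation_model_hom:
  assumes A: "quadratic_sullivan A"
  shows "algebra_hom A (quadratic_model (dual_lie A) (dual_family A)) (evaluation A)"
proof -
  let ?M = "quadratic_model (dual_lie A) (dual_family A)"
  note q = quadratic_sullivanD[OF A] and hom = evaluation_props(1)[OF A]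
  note E = dual_lie_enriched[OF A]
  note alg = cdga_graded_algebra[OF model_cdga[OF E]]
  have "evaluation A n x \<in> acomp ?M n" if x: "x \<in> acomp A n" for n x
  proof (rule linear_map_on_span_in[OF algebra_homD(2)[OF hom] graded_algebraD(1)[OF q(3)] graded_algebraD(1)[OF alg]
        wprod_gens_subset[OF q(3,2)]])
    show "x \<in> ratvec.span (wprod A ` {ws \<in> words (gens A). wdeg ws = n})"
      using x unfolding free_on_gensD(3)[OF q(2), of n] .
    fix b assume "b \<in> wprod A ` {ws \<in> words (gens A). wdeg ws = n}"
    then obtain ws where ws: "ws \<in> words (gens A)" "wdeg ws = n" "b = wprod A ws" by blast
    have "evaluation A n b = wprod ?M (map_word (evaluation A) ws)"
      using algebra_hom_wprod[OF q(3) hom words_gens[OF q(2) ws(1)]] ws(2,3) by (simp add: wprod_model)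
    moreover have "map_word (evaluation A) ws \<in> words (acomp ?M)"
      using evaluation_gens_model[OF A]
      by (intro words_gens[OF model_free_on_gens[OF E]] map_word_in[OF ws(1)]) blast
    ultimately show "evaluation A n b \<in> acomp ?M n"
      using wprod_in[OF alg, of "map_word (evaluation A) ws"] ws(2) by (simp del: model_simps)
  qed
  then show ?thesis
    using algebra_homD(2-4)[OF hom] unfolding algebra_hom_def model_simps(2,3) by blast
qed

lemma evaluation_inj:
  assumes A: "quadratic_sullivan A" and v: "v \<in> gens A k" and w: "w \<in> gens A k"
    and eq: "evaluation A k v = evaluation A k w"
  shows "v = w"
proof (cases k)
  case 0
  then show ?thesis using v w quadratic_sullivanD(4)[OF A] by simp
next
  case (Suc l)
  show ?thesis
  proof (rule ccontr)
    assume "v \<noteq> w"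
    then have "v - w \<notin> ratvec.span {}" by simp
    then obtain u :: "'a \<Rightarrow> rat" where u: "linear_map_on UNIV u" "u (v - w) = 1"
      using separating_functional by blast
    \<comment> \<open>functionals in the dual are extended by \<open>0\<close>\<close>
    define f where "f = (\<lambda>x. if x \<in> gens A k then u x else 0)"
    have sub: "ratvec.subspace (gens A k)" by (rule quadratic_sullivanD(7)[OF A])
    have "linear_map_on (gens A k) f \<longleftrightarrow> linear_map_on (gens A k) u"
      by (rule linear_map_on_cong[OF _ sub]) (simp add: f_def)
    then have f: "f \<in> dual_comp A l"
      using linear_map_on_subset[OF u(1)] by (simp add: dual_comp_def dual_space_def Suc[symmetric]) (simp add: f_def)
    have "evaluation A k u [(l, f)] = f u" if "u \<in> gens A k" for u
      using evaluation_form_apply[OF f, of u] evaluation_props(2)[OF A that] by (simp add: Suc)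
    from this[OF v] this[OF w] have "f v = f w" by (simp only: eq)
    then show False
      using linear_map_on_diff[OF u(1) ratvec.subspace_UNIV, of v w] u(2) v w by (simp add: f_def)
  qed
qed

text \<open>A form on the quotient by the annihilator of \<open>F\<close> is a functional on \<open>V\<^sup>\<or>\<close> that vanishes where the evaluations at elements of \<open>F\<close>
  vanish. So it is a linear combination of these, which is evaluation at the same combination of elements of \<open>F\<close>.\<close>

lemma evaluation_surj:
  assumes A: "quadratic_sullivan A" and w: "w \<in> gens (quadratic_model (dual_lie A) (dual_family A)) m"
  shows "\<exists>v\<in>gens A m. evaluation A m v = w"
proof (cases m)
  case 0
  then have "w = 0" using w one_forms_zero_degree by (auto simp: gens_model)
  moreover have "evaluation A m 0 = 0" "0 \<in> gens A m"
    using evaluation_props(2)[OF A, of 0 0] quadratic_sullivanD(4)[OF A] 0 by (simp_all add: evaluation_form_def)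
  ultimately show ?thesis by blast
next
  case (Suc k)
  obtain F where F: "stable_set A F" and wF: "w \<in> one_forms (dual_comp A) (annihilator A F) (Suc k)"
    using w Suc by (auto simp: gens_model dual_family_def)
  note l = stable_set_functionals[OF F, where k = k]
  let ?T = "{v. (Suc k, v) \<in> F}"
  have "w [(k, f)] = 0" if "f \<in> dual_comp A k" "\<forall>v\<in>?T. f v = 0" for f
    using that by (intro vanishes_onD[OF one_formsD(3)[OF wF]]) (auto simp: l(4))
  then obtain c where c: "\<And>f. f \<in> dual_comp A k \<Longrightarrow> w [(k, f)] = (\<Sum>v\<in>?T. c v * f v)"
    using finitely_many_functionals(2)[OF l(2) l(1), of "\<lambda>v f. f v", OF l(3) one_forms_linear[OF wF]] by blast
  define v where "v = (\<Sum>v\<in>?T. c v *\<^sub>Q v)"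
  have sub: "ratvec.subspace (gens A (Suc k))" by (rule quadratic_sullivanD(7)[OF A])
  have T: "c u *\<^sub>Q u \<in> gens A (Suc k) \<and> u \<in> gens A (Suc k)" if "u \<in> ?T" for u
    using that stable_setD(2)[OF F] ratvec.subspace_scale[OF sub] by blast
  have v: "v \<in> gens A (Suc k)" unfolding v_def using T by (intro ratvec.subspace_sum[OF sub]) blast
  have "evaluation A (Suc k) v = w"
  proof (rule one_forms_eqI[OF evaluation_one_form[OF A v] wF])
    fix l f assume "Suc k = Suc l" and f: "f \<in> dual_comp A l"
    then have lk: "l = k" by simp
    note lin = dual_compD(1)[OF f[unfolded lk]]
    have "f v = (\<Sum>u\<in>?T. f (c u *\<^sub>Q u))" unfolding v_def using T by (intro linear_map_on_sum[OF lin sub]) blast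
    also have "\<dots> = w [(l, f)]" using T f linear_map_on_scale[OF lin] by (simp add: c lk)
    finally show "evaluation A (Suc k) v [(l, f)] = w [(l, f)]"
      using evaluation_props(2)[OF A v] evaluation_form_apply[OF f, of v] by (simp add: lk)
  qed
  then show ?thesis using v Suc by blast
qed

text \<open>Both algebras are free and evaluation is bijective on generators; the inverse extends to an algebra morphism, and the two
  composites are identities because they are so on generators.\<close>

lemma evaluation_sullivan_iso:
  assumes A: "quadratic_sullivan A"
  shows "(\<lambda>k. restrict (evaluation A k) (acomp A k)) \<in> sullivan_iso A (quadratic_model (dual_lie A) (dual_family A))"
proof -
  let ?M = "quadratic_model (dual_lie A) (dual_family A)"
  note q = quadratic_sullivanD[OF A] and hom = evaluation_model_hom[OF A]
  note E = dual_lie_enriched[OF A]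
  note m = model_cdga[OF E] and free = model_free_on_gens[OF E]
  note alg = cdga_graded_algebra[OF m]
  define g where "g = (\<lambda>k w. SOME v. v \<in> gens A k \<and> evaluation A k v = w)"
  have g: "g k w \<in> gens A k" "evaluation A k (g k w) = w" if "w \<in> gens ?M k" for k w
  proof -
    have "\<exists>v. v \<in> gens A k \<and> evaluation A k v = w" using evaluation_surj[OF A that] by blast
    from someI_ex[OF this] show "g k w \<in> gens A k" "evaluation A k (g k w) = w" by (simp_all add: g_def)
  qed
  have lin: "linear_map_on (gens A k) (evaluation A k)" for k
    by (rule linear_map_on_subset[OF algebra_homD(2)[OF hom] q(8)])
  have subM: "ratvec.subspace (gens ?M k)" for k by (rule graded_space_subspace[OF free_on_gensD(1)[OF free]])
  have g_lin: "linear_map_on (gens ?M k) (g k)" for k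
  proof (rule linear_map_onI)
    fix x y c assume x: "x \<in> gens ?M k"
    note cx = ratvec.subspace_scale[OF subM x, of c]
    show "g k (c *\<^sub>Q x) = c *\<^sub>Q g k x"
      using linear_map_on_scale[OF lin g(1)[OF x], of c] g(2)[OF x] g(2)[OF cx]
      by (intro evaluation_inj[OF A g(1)[OF cx] ratvec.subspace_scale[OF q(7) g(1)[OF x]]]) simp
    assume y: "y \<in> gens ?M k"
    note xy = ratvec.subspace_add[OF subM x y]
    show "g k (x + y) = g k x + g k y"
      using linear_map_on_add[OF lin g(1)[OF x] g(1)[OF y]] g(2)[OF x] g(2)[OF y] g(2)[OF xy]
      by (intro evaluation_inj[OF A g(1)[OF xy] ratvec.subspace_add[OF q(7) g(1)[OF x] g(1)[OF y]]]) simp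
  qed
  have g_in: "g k w \<in> acomp A k" if "w \<in> gens ?M k" for k w using g(1)[OF that] q(8) by blast
  obtain \<chi> where \<chi>: "algebra_hom ?M A \<chi>" "\<And>k w. w \<in> gens ?M k \<Longrightarrow> \<chi> k w = g k w"
    using free_extension[OF alg free q(3) g_lin g_in] by blast
  have comp1: "\<chi> k (evaluation A k x) = x" if x: "x \<in> acomp A k" for k x
  proof (rule algebra_hom_eq[OF q(3,2), where \<phi> = "\<lambda>k x. \<chi> k (evaluation A k x)" and \<chi> = "\<lambda>k x. x", OF _ _ _ x])
    show "algebra_hom A A (\<lambda>k x. \<chi> k (evaluation A k x))"
      using algebra_homD[OF hom] algebra_homD[OF \<chi>(1)]
        linear_map_on_compose[OF algebra_homD(2)[OF hom] algebra_homD(2)[OF \<chi>(1)] algebra_homD(1)[OF hom]]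
      unfolding algebra_hom_def by (simp del: model_simps)
    show "algebra_hom A A (\<lambda>k x. x)" by (simp add: algebra_hom_def linear_map_on_def)
    fix k v assume v: "v \<in> gens A k"
    note ev = evaluation_gens_model[OF A v]
    show "\<chi> k (evaluation A k v) = v"
      using \<chi>(2)[OF ev] evaluation_inj[OF A g(1)[OF ev] v g(2)[OF ev]] by simp
  qed
  have comp2: "evaluation A k (\<chi> k y) = y" if y: "y \<in> acomp ?M k" for k y
  proof (rule algebra_hom_eq[OF alg free, where \<phi> = "\<lambda>k y. evaluation A k (\<chi> k y)" and \<chi> = "\<lambda>k y. y", OF _ _ _ y])
    show "algebra_hom ?M ?M (\<lambda>k y. evaluation A k (\<chi> k y))"
      using algebra_homD[OF hom] algebra_homD[OF \<chi>(1)]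
        linear_map_on_compose[OF algebra_homD(2)[OF \<chi>(1)] algebra_homD(2)[OF hom] algebra_homD(1)[OF \<chi>(1)]]
      unfolding algebra_hom_def by (simp del: model_simps)
    show "algebra_hom ?M ?M (\<lambda>k y. y)" by (simp add: algebra_hom_def linear_map_on_def)
    show "evaluation A k (\<chi> k w) = w" if "w \<in> gens ?M k" for k w using \<chi>(2)[OF that] g(2)[OF that] by simp
  qed
  have dif: "evaluation A (Suc k) (adif A k x) = adif ?M k (evaluation A k x)" if "x \<in> acomp A k" for k x
    using evaluation_dif[OF A that] by simp
  have \<chi>_dif: "\<chi> (Suc k) (adif ?M k y) = adif A k (\<chi> k y)" if y: "y \<in> acomp ?M k" for k y
  proof -
    have x: "\<chi> k y \<in> acomp A k" by (rule algebra_homD(1)[OF \<chi>(1) y])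
    have "adif ?M k y = evaluation A (Suc k) (adif A k (\<chi> k y))" using dif[OF x] comp2[OF y] by simp
    then show ?thesis using comp1[OF cdgaD(1)[OF q(1) x]] by simp
  qed
  let ?\<phi> = "\<lambda>k. restrict (evaluation A k) (acomp A k)" and ?\<chi> = "\<lambda>k. restrict (\<chi> k) (acomp ?M k)"
  have \<phi>: "?\<phi> \<in> sullivan_hom A ?M"
    using evaluation_gens_model[OF A] by (intro sullivan_hom_restrict[OF q(1,2) hom dif])
  have "?\<chi> \<in> sullivan_hom ?M A"
    by (rule sullivan_hom_restrict[OF m free \<chi>(1)], erule \<chi>_dif) (simp add: g(1) \<chi>(2))
  moreover have "graded_comp (acomp A) ?\<chi> ?\<phi> = graded_id (acomp A)"
    using comp1 algebra_homD(1)[OF hom]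
    by (auto simp: graded_comp_def graded_id_def compose_def restrict_def fun_eq_iff simp del: model_simps)
  moreover have "graded_comp (acomp ?M) ?\<phi> ?\<chi> = graded_id (acomp ?M)"
    using comp2 algebra_homD(1)[OF \<chi>(1)]
    by (auto simp: graded_comp_def graded_id_def compose_def restrict_def fun_eq_iff simp del: model_simps)
  ultimately show ?thesis using \<phi> unfolding sullivan_iso_def by blast
qed

lemma is_inverse_object_exists:
  assumes A: "quadratic_sullivan A"
  shows "is_inverse_object A (dual_lie A) (dual_family A)"
  unfolding is_inverse_object_def
proof (intro conjI allI bexI[OF _ evaluation_sullivan_iso[OF A]] ballI)
  show "complete_enriched_lie (dual_lie A) (dual_family A)" by (rule dual_lie_complete[OF A])
  show "lcomp (dual_lie A) k = dual_space (gens A (Suc k))" for k by (simp add: dual_comp_def)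
  fix k v f assume v: "v \<in> gens A (Suc k)" and f: "f \<in> lcomp (dual_lie A) k"
  have "v \<in> acomp A (Suc k)" using v quadratic_sullivanD(8)[OF A] by blast
  then show "restrict (evaluation A (Suc k)) (acomp A (Suc k)) v [(k, f)] = f v"
    using f evaluation_props(2)[OF A v] evaluation_form_apply by simp
qed

lemma sullivan_iso_gens:
  assumes "\<phi> \<in> sullivan_iso A B" "free_on_gens B"
  shows "gens B k = \<phi> k ` gens A k"
proof -
  obtain \<chi> where \<phi>: "\<phi> \<in> sullivan_hom A B" and \<chi>: "\<chi> \<in> sullivan_hom B A"
    and id: "graded_comp (acomp B) \<phi> \<chi> = graded_id (acomp B)"
    using assms(1) unfolding sullivan_iso_def by blast
  have "w \<in> \<phi> k ` gens A k" if w: "w \<in> gens B k" for w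
  proof -
    have "w \<in> acomp B k" using w free_on_gensD(2)[OF assms(2)] by blast
    then have "\<phi> k (\<chi> k w) = w" using fun_cong[OF fun_cong[OF id, of k], of w]
      by (simp add: graded_comp_apply graded_id_apply)
    then show ?thesis using sullivan_homD(4)[OF \<chi> w] by (metis imageI)
  qed
  then show ?thesis using sullivan_homD(4)[OF \<phi>] by blast
qed

text \<open>The two isomorphisms agree on generators, hence everywhere; bracket and generators of the models can be read off from
  them and from the differential of \<open>A\<close>.\<close>

lemma is_inverse_object_unique:
  assumes A: "quadratic_sullivan A" and L: "is_inverse_object A L \<I>" and L': "is_inverse_object A L' \<I>'"
  shows "same_enriched L \<I> L' \<I>'"
proof -
  note q = quadratic_sullivanD[OF A]
  have E: "enriched_lie L \<I>" "enriched_lie L' \<I>'"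
    using L L' by (simp_all add: is_inverse_object_def complete_enriched_lie_def)
  have comp: "lcomp L k = dual_space (gens A (Suc k))" "lcomp L' k = dual_space (gens A (Suc k))" for k
    using L L' by (simp_all add: is_inverse_object_def)
  then have W: "lcomp L = lcomp L'" by auto
  obtain \<phi> where \<phi>: "\<phi> \<in> sullivan_iso A (quadratic_model L \<I>)"
    "\<And>k v f. v \<in> gens A (Suc k) \<Longrightarrow> f \<in> lcomp L k \<Longrightarrow> \<phi> (Suc k) v [(k, f)] = f v"
    using L unfolding is_inverse_object_def by blast
  obtain \<phi>' where \<phi>': "\<phi>' \<in> sullivan_iso A (quadratic_model L' \<I>')"
    "\<And>k v f. v \<in> gens A (Suc k) \<Longrightarrow> f \<in> lcomp L' k \<Longrightarrow> \<phi>' (Suc k) v [(k, f)] = f v"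
    using L' unfolding is_inverse_object_def by blast
  have h: "\<phi> \<in> sullivan_hom A (quadratic_model L \<I>)" and h': "\<phi>' \<in> sullivan_hom A (quadratic_model L' \<I>')"
    using \<phi>(1) \<phi>'(1) by (auto simp: sullivan_iso_def)
  have gens_eq: "\<phi> m v = \<phi>' m v" if v: "v \<in> gens A m" for m v
  proof -
    obtain I I' where "\<phi> m v \<in> one_forms (lcomp L) I m" "\<phi>' m v \<in> one_forms (lcomp L) I' m"
      using sullivan_homD(4)[OF h v] sullivan_homD(4)[OF h' v] unfolding gens_model W by blast
    then show ?thesis
      using \<phi>(2) \<phi>'(2) v W by (intro one_forms_eqI) auto
  qed
  have hom: "algebra_hom A (all_cochains L) \<phi>" "algebra_hom A (all_cochains L) \<phi>'"
    using model_hom_all_cochains[OF sullivan_homD(1)[OF h]] model_hom_all_cochains[OF sullivan_homD(1)[OF h']]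
      all_cochains_same(2)[OF W] by blast+
  have eq: "\<phi> n x = \<phi>' n x" if "x \<in> acomp A n" for n x
    by (rule algebra_hom_eq[OF q(3,2) hom gens_eq that])
  show ?thesis
  proof (rule same_enrichedI[OF E W])
    show "gens (quadratic_model L \<I>) k = gens (quadratic_model L' \<I>') k" for k
      unfolding sullivan_iso_gens[OF \<phi>(1) model_free_on_gens[OF E(1)]]
        sullivan_iso_gens[OF \<phi>'(1) model_free_on_gens[OF E(2)]]
      using gens_eq by (rule image_cong[OF refl])
    fix i j x y assume x: "x \<in> lcomp L i" and y: "y \<in> lcomp L j"
    have x': "x \<in> lcomp L' i" and y': "y \<in> lcomp L' j" using x y W by simp_all
    note b = graded_lieD(4)[OF enriched_lieD(1)[OF E(1)] x y] and b' = graded_lieD(4)[OF enriched_lieD(1)[OF E(2)] x' y']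
    show "lbr L i j x y = lbr L' i j x y"
    proof (rule dual_space_eqI)
      show "lbr L i j x y \<in> dual_space (gens A (Suc (i + j)))" "lbr L' i j x y \<in> dual_space (gens A (Suc (i + j)))"
        using b b' comp by simp_all
      fix v assume v: "v \<in> gens A (Suc (i + j))"
      have va: "v \<in> acomp A (Suc (i + j))" using v q(8) by blast
      have "cochain_dif L (\<phi> (Suc (i + j)) v) [(i, x), (j, y)] = cochain_dif L' (\<phi>' (Suc (i + j)) v) [(i, x), (j, y)]"
        using sullivan_homD(3)[OF h va] sullivan_homD(3)[OF h' va] eq[OF cdgaD(1)[OF q(1) va]] by simp
      then show "lbr L i j x y v = lbr L' i j x y v"
        unfolding cochain_dif_pair[OF x y] cochain_dif_pair[OF x' y'] \<phi>(2)[OF v b] \<phi>'(2)[OF v b'] by simp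
    qed
  qed
qed

theorem proposition5:
  shows
    \<comment> \<open>objects: the model is a quadratic Sullivan algebra, and its generators satisfy \<open>V\<^sup>\<or> = sL\<close>\<close>
    "(\<forall>(L :: 'a::rat_vector glie) \<I>. complete_enriched_lie L \<I> \<longrightarrow>
        quadratic_sullivan (quadratic_model L \<I>) \<and>
        (\<forall>k. bij_betw (suspension_eval L \<I> k) (lcomp L k)
               (dual_space (gens (quadratic_model L \<I>) (Suc k)))))
    \<comment> \<open>well defined and injective on objects\<close>
   \<and> (\<forall>(L :: 'a glie) \<I> L' \<I>'. complete_enriched_lie L \<I> \<and> complete_enriched_lie L' \<I>' \<longrightarrow>
        (same_enriched L \<I> L' \<I>' \<longleftrightarrow> quadratic_model L \<I> = quadratic_model L' \<I>'))
    \<comment> \<open>well defined and bijective on morphisms\<close>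
   \<and> (\<forall>(E :: 'a glie) \<J> (L :: 'b::rat_vector glie) \<I>.
        complete_enriched_lie E \<J> \<and> complete_enriched_lie L \<I> \<longrightarrow>
        (\<forall>\<psi>\<in>lie_hom E \<J> L \<I>.
           \<exists>!\<phi>. \<phi> \<in> sullivan_hom (quadratic_model L \<I>) (quadratic_model E \<J>) \<and> has_dual E L \<I> \<phi> \<psi>) \<and>
        bij_betw (quadratic_model_map E \<J> L \<I>)
          (lie_hom E \<J> L \<I>) (sullivan_hom (quadratic_model L \<I>) (quadratic_model E \<J>)))
    \<comment> \<open>contravariant functoriality\<close>
   \<and> (\<forall>(L :: 'a glie) \<I>. complete_enriched_lie L \<I> \<longrightarrow>
        quadratic_model_map L \<I> L \<I> (graded_id (lcomp L)) = graded_id (acomp (quadratic_model L \<I>)))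
   \<and> (\<forall>(E :: 'a glie) \<J> (F :: 'b glie) \<K> (L :: 'c::rat_vector glie) \<I>.
        complete_enriched_lie E \<J> \<and> complete_enriched_lie F \<K> \<and> complete_enriched_lie L \<I> \<longrightarrow>
        (\<forall>\<psi>\<in>lie_hom E \<J> F \<K>. \<forall>\<chi>\<in>lie_hom F \<K> L \<I>.
           quadratic_model_map E \<J> L \<I> (graded_comp (lcomp E) \<chi> \<psi>) =
             graded_comp (acomp (quadratic_model L \<I>))
               (quadratic_model_map E \<J> F \<K> \<psi>) (quadratic_model_map F \<K> L \<I> \<chi>)))
    \<comment> \<open>surjective on objects: every \<open>\<And>V\<close> is the model of exactly one structure on \<open>s\<^sup>-\<^sup>1V\<^sup>\<or>\<close>\<close>
   \<and> (\<forall>(A :: 'v::rat_vector gcdga). quadratic_sullivan A \<longrightarrow>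
        (\<exists>L \<I>. is_inverse_object A L \<I>) \<and>
        (\<forall>L \<I> L' \<I>'. is_inverse_object A L \<I> \<and> is_inverse_object A L' \<I>' \<longrightarrow>
           same_enriched L \<I> L' \<I>'))"
proof (intro conjI allI impI ballI)
  have enr: "enriched_lie L \<I>" if "complete_enriched_lie L \<I>" for L :: "'z::rat_vector glie" and \<I>
    using that by (simp add: complete_enriched_lie_def)
  show "quadratic_sullivan (quadratic_model L \<I>)" if "complete_enriched_lie L \<I>" for L :: "'a glie" and \<I>
    by (rule model_quadratic_sullivan[OF enr[OF that]])
  show "bij_betw (suspension_eval L \<I> k) (lcomp L k) (dual_space (gens (quadratic_model L \<I>) (Suc k)))"
    if "complete_enriched_lie L \<I>" for L :: "'a glie" and \<I> k
    by (rule suspension_eval_bij[OF that])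
  show "same_enriched L \<I> L' \<I>' \<longleftrightarrow> quadratic_model L \<I> = quadratic_model L' \<I>'"
    if "complete_enriched_lie L \<I> \<and> complete_enriched_lie L' \<I>'" for L L' :: "'a glie" and \<I> \<I>'
    using same_enriched_model_eq model_eq_same_enriched enr that by blast
  show "\<exists>!\<phi>. \<phi> \<in> sullivan_hom (quadratic_model L \<I>) (quadratic_model E \<J>) \<and> has_dual E L \<I> \<phi> \<psi>"
    if "complete_enriched_lie E \<J> \<and> complete_enriched_lie L \<I>" "\<psi> \<in> lie_hom E \<J> L \<I>"
    for E :: "'a glie" and \<J> and L :: "'b glie" and \<I> \<psi>
    using lie_hom_induces_model_hom[OF enr enr that(2)] has_dual_unique[OF enr] that(1) by blast
  show "bij_betw (quadratic_model_map E \<J> L \<I>)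
          (lie_hom E \<J> L \<I>) (sullivan_hom (quadratic_model L \<I>) (quadratic_model E \<J>))"
    if "complete_enriched_lie E \<J> \<and> complete_enriched_lie L \<I>" for E :: "'a glie" and \<J> and L :: "'b glie" and \<I>
    using quadratic_model_map_bij[OF enr] that by blast
  show "quadratic_model_map L \<I> L \<I> (graded_id (lcomp L)) = graded_id (acomp (quadratic_model L \<I>))"
    if "complete_enriched_lie L \<I>" for L :: "'a glie" and \<I>
    by (rule quadratic_model_map_id[OF enr[OF that]])
  show "quadratic_model_map E \<J> L \<I> (graded_comp (lcomp E) \<chi> \<psi>) =
      graded_comp (acomp (quadratic_model L \<I>)) (quadratic_model_map E \<J> F \<K> \<psi>) (quadratic_model_map F \<K> L \<I> \<chi>)"
    if "complete_enriched_lie E \<J> \<and> complete_enriched_lie F \<K> \<and> complete_enriched_lie L \<I>"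
      "\<psi> \<in> lie_hom E \<J> F \<K>" "\<chi> \<in> lie_hom F \<K> L \<I>"
    for E :: "'a glie" and \<J> and F :: "'b glie" and \<K> and L :: "'c glie" and \<I> \<psi> \<chi>
    using quadratic_model_map_comp[OF enr enr enr that(2,3)] that(1) by blast
  show "\<exists>L \<I>. is_inverse_object A L \<I>" if "quadratic_sullivan A" for A :: "'v gcdga"
    using is_inverse_object_exists[OF that] by blast
  show "same_enriched L \<I> L' \<I>'" if "quadratic_sullivan A" "is_inverse_object A L \<I> \<and> is_inverse_object A L' \<I>'"
    for A :: "'v gcdga" and L \<I> L' \<I>'
    using is_inverse_object_unique[OF that(1)] that(2) by blast
qed

end
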